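(* For any positive number $h<\frac72$ there is a positive number $\delta=\delta(h)$ such that $$\sum_{1\le n\le N}\Bigl|R_{5,3}(n)-\frac{\Gamma(\frac43)^5}{\Gamma(\frac53)}\mathfrak{S}_{5,3}(n)n^{2/3}\Bigr|^h\ll N^{2h/3+1-\delta}$$ for all large $N$. In addition, for each $\varepsilon>0$ one has $$\sum_{1\le n\le N}\Bigl|R_{5,3}(n)-\frac{\Gamma(\frac43)^5}{\Gamma(\frac53)}\mathfrak{S}_{5,3}(n)n^{2/3}\Bigr|^3\ll N^{35/12+\varepsilon}$$ for all sufficiently large $N$ (implied constant depending on $\varepsilon$).
   Context: $R_{5,3}(n)$ denotes the number of representations of the positive integer $n$ as a sum of five cubes of positive integers. With $e(z)=\exp(2\pi i z)$, $$\mathfrak{S}_{5,3}(n)=\sum_{q=1}^\infty\sum_{\substack{a=1\\(a,q)=1}}^q\Bigl(q^{-1}\sum_{r=1}^q e(ar^3/q)\Bigr)^5 e(-an/q).$$ *)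

theory Defs
  imports "HOL-Analysis.Analysis" "HOL-Library.Landau_Symbols"
begin

definition e :: "complex \<Rightarrow> complex" where
  "e z = exp (2 * of_real pi * \<i> * z)"

(* Ordered representations: (x_1, ..., x_s) is encoded as a list of length s. *)
definition waring_count :: "nat \<Rightarrow> nat \<Rightarrow> nat \<Rightarrow> nat" where
  "waring_count s k n =
     card {xs :: nat list. length xs = s \<and> (\<forall>x\<in>set xs. x > 0) \<and> (\<Sum>x\<leftarrow>xs. x ^ k) = n}"

definition gauss_sum :: "nat \<Rightarrow> nat \<Rightarrow> nat \<Rightarrow> complex" where
  "gauss_sum k q a = (\<Sum>r=1..q. e (of_nat a * of_nat r ^ k / of_nat q))"

definition singular_series_term :: "nat \<Rightarrow> nat \<Rightarrow> nat \<Rightarrow> nat \<Rightarrow> complex" where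
  "singular_series_term s k n q =
     (\<Sum>a | a \<in> {1..q} \<and> coprime a q.
        (inverse (of_nat q) * gauss_sum k q a) ^ s * e (- (of_nat a * of_nat n / of_nat q)))"

(* suminf starts at 0, hence the shift by Suc. The value is a real number, kept here as a
   complex one. For s = 5, k = 3 the series converges absolutely, so suminf is its true value. *)
definition singular_series :: "nat \<Rightarrow> nat \<Rightarrow> nat \<Rightarrow> complex" where
  "singular_series s k n = (\<Sum>q. singular_series_term s k n (Suc q))"

definition five_cubes_error :: "nat \<Rightarrow> real" where
  "five_cubes_error n =
     cmod (of_nat (waring_count 5 3 n)
       - of_real (Gamma (4/3) ^ 5 / Gamma (5/3)) * singular_series 5 3 n
           * of_real (real n powr (2/3)))"

end

theory Submission
  imports Defs "HOL-Computational_Algebra.Primes"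
begin

text \<open>
  The numbers of representations are Fourier coefficients of powers of \<open>f\<close>, the exponential sum over the cubes up to
  \<open>P \<approx> N powr (1/3)\<close>. Weyl's inequality on the minor arcs and a completion argument on the major arcs, whose widths
  are \<open>1/(q P\<^sup>2)\<close> with \<open>q \<le> P\<close>, give \<open>f = V + O(P powr (3/4 + \<epsilon>))\<close> at every frequency, where \<open>V\<close> is the usual
  model. The Fourier coefficients \<open>\<rho>\<close> of \<open>f\<^sup>5 - V\<^sup>5\<close> are the remainders in the statement, up to \<open>O(P powr (7/4))\<close>.
  Since \<open>\<rho>\<close> is nearly bounded below by \<open>- O(P\<^sup>2)\<close>, its absolute third moment is close to the sum of \<open>\<rho>\<^sup>3\<close>, which
  is a correlation of \<open>f\<^sup>5 - V\<^sup>5\<close> over triples of frequencies with sum zero. There each factor is at most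
  \<open>O(P powr (3/4 + \<epsilon>)) (|f|\<^sup>4 + |V|\<^sup>4)\<close>; in one of the three, \<open>|f|\<^sup>4\<close> is replaced by
  \<open>O(|V|\<^sup>4 + P powr (3/2 + \<epsilon>) |f|\<^sup>2)\<close>, whose Fourier coefficients are small because a nonzero integer is a difference
  of two cubes in \<open>O(P\<^sup>\<epsilon>)\<close> ways, and Hua's inequality bounds the mean square of the other two.
  The same correlation bounds the third moment of the number of representations by four cubes, and with Cauchy's
  inequality this bounds the number of \<open>n\<close> with many representations by five cubes, which yields the moments
  between \<open>3\<close> and \<open>7/2\<close>.
\<close>

section \<open>Fourier analysis modulo M\<close>

text \<open>The exponents come from a few sizes, all up to P\<epsilon>. Let B = P powr (3/4) be the
  uniform error in f = V. Weyl's bound has this size for denominators between P and P^2, and on an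
  arc with denominator q the completion error is q powr (3/4), so cutting at q = P loses nothing.
  The triple correlation of fourth powers is bounded by P^5, from Hua, times P powr (3/2), which is
  both B^2 and the bound for the mean of |V|^4; this gives P powr (13/2). With B^3 in front, the
  third moment is P powr (35/4) = N powr (35/12). The obstacle is that an absolute third power is
  not trilinear in Fourier coefficients; only the one-sided bound on the remainder makes it so. For
  h > 3 the level sets of the number of representations are controlled only above T = P powr (5/2),
  the cube root of P * P powr (13/2). The values below T cost T powr (h - 3) * P powr (35/4), which
  is smaller than P powr (2 h + 3) exactly when h < 7/2. The values above T would allow every h <
  18/5.\<close>

definition ee :: "real \<Rightarrow> complex" where
  "ee t = cis (2 * pi * t)"

lemma norm_ee [simp]: "norm (ee t) = 1"
  by (simp add: ee_def)

lemma ee_0 [simp]: "ee 0 = 1"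
  by (simp add: ee_def)

lemma ee_add: "ee (s + t) = ee s * ee t"
  by (simp add: ee_def cis_mult ring_distribs)

lemma ee_diff: "ee (s - t) = ee s * ee (- t)"
  using ee_add[of s "- t"] by simp

lemma cnj_ee [simp]: "cnj (ee t) = ee (- t)"
  by (simp add: ee_def cis_cnj)

lemma ee_of_int [simp]: "ee (of_int k) = 1"
  by (simp add: ee_def cis_multiple_2pi)

lemma ee_add_int: "ee (t + of_int k) = ee t"
  by (simp add: ee_add)

lemma ee_power: "ee t ^ n = ee (of_nat n * t)"
  by (induction n) (simp_all add: ee_add[symmetric] ring_distribs)

lemma e_of_real: "e (of_real t) = ee t"
  by (simp add: e_def ee_def cis_conv_exp algebra_simps)

lemma norm_one_minus_ee: "norm (1 - ee t) = 2 * \<bar>sin (pi * t)\<bar>"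
proof -
  have "(norm (1 - ee t))\<^sup>2 = (1 - cos (2 * (pi * t)))\<^sup>2 + (sin (2 * (pi * t)))\<^sup>2"
    by (simp add: ee_def cmod_power2 algebra_simps)
  also have "\<dots> = (2 * \<bar>sin (pi * t)\<bar>)\<^sup>2"
  proof -
    have "(1 - (1 - 2 * s\<^sup>2))\<^sup>2 + (2 * s * c)\<^sup>2 = 4 * s\<^sup>2 * (s\<^sup>2 + c\<^sup>2)" for s c :: real
      by (simp add: power2_eq_square algebra_simps)
    from this[of "sin (pi * t)" "cos (pi * t)"] show ?thesis
      unfolding cos_double_sin sin_double by (simp add: power_mult_distrib)
  qed
  finally have "(norm (1 - ee t))\<^sup>2 = (2 * \<bar>sin (pi * t)\<bar>)\<^sup>2" .
  then show ?thesis
    by (metis abs_ge_zero norm_ge_zero power2_eq_iff_nonneg zero_le_mult_iff zero_le_numeral)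
qed

lemma norm_one_minus_ee_le: "norm (1 - ee t) \<le> 2 * pi * \<bar>t\<bar>"
proof -
  have "\<bar>sin (pi * t)\<bar> \<le> \<bar>pi * t\<bar>"
    by (rule abs_sin_x_le_abs_x)
  then show ?thesis by (simp add: norm_one_minus_ee abs_mult)
qed

lemma norm_ee_diff_le: "norm (ee s - ee t) \<le> 2 * pi * \<bar>s - t\<bar>"
proof -
  have "ee s - ee t = ee s * (1 - ee (t - s))"
    unfolding right_diff_distrib ee_add[symmetric] by simp
  then have "norm (ee s - ee t) = norm (1 - ee (t - s))"
    by (simp only: norm_mult norm_ee mult_1)
  with norm_one_minus_ee_le[of "t - s"] show ?thesis by (simp add: abs_minus_commute)
qed

text \<open>Jordan's inequality: sine is concave on [0, pi/2], so it lies above its chord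
  there.\<close>

lemma sin_pi_ge: "2 * t \<le> sin (pi * t)" if "0 \<le> t" "t \<le> 1/2"
proof -
  have "convex_on {0..pi/2} (\<lambda>x. - sin x)"
    by (rule f''_ge0_imp_convex[where f' = "\<lambda>x. - cos x" and f'' = "\<lambda>x. sin x"])
       (auto intro!: derivative_eq_intros sin_ge_zero)
  from convex_onD[OF this, of "2 * t" 0 "pi/2"] that show ?thesis
    by (simp add: algebra_simps)
qed

lemma norm_one_minus_ee_ge: "4 * \<bar>t\<bar> \<le> norm (1 - ee t)" if "\<bar>t\<bar> \<le> 1/2"
proof -
  have "\<bar>sin (pi * t)\<bar> = \<bar>sin (pi * \<bar>t\<bar>)\<bar>" by (simp add: abs_if)
  with sin_pi_ge[of "\<bar>t\<bar>"] that show ?thesis by (simp add: norm_one_minus_ee)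
qed

lemma ee_eq_1_iff: "ee t = 1 \<longleftrightarrow> t \<in> \<int>"
proof
  assume "ee t = 1"
  then have "sin (pi * t) = 0" using norm_one_minus_ee[of t] by simp
  then obtain i where "pi * t = of_int i * pi" by (auto simp: sin_zero_iff_int2)
  then show "t \<in> \<int>" by (simp add: mult.commute)
qed (auto elim: Ints_cases)

lemma sum_ee_orthogonal:
  assumes "M > 0"
  shows "(\<Sum>j<M. ee (real j * of_int n / real M)) = (if int M dvd n then of_nat M else 0)"
proof -
  define z where "z = ee (of_int n / real M)"
  have pw: "ee (real j * of_int n / real M) = z ^ j" for j
    by (simp add: z_def ee_power)
  show ?thesis
  proof (cases "int M dvd n")
    case True
    then obtain k where "n = int M * k" by blast
    with assms have "z = 1" by (simp add: z_def)
    with True show ?thesis by (simp add: pw)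
  next
    case False
    have "z \<noteq> 1"
    proof
      assume "z = 1"
      then obtain k where "of_int n / real M = of_int k"
        by (auto simp: z_def ee_eq_1_iff elim: Ints_cases)
      then have "real_of_int n = of_int (k * int M)" using assms by (simp add: field_simps)
      then have "n = k * int M" by linarith
      with False show False by simp
    qed
    moreover have "z ^ M = 1" using assms by (simp add: z_def ee_power)
    ultimately show ?thesis using False by (simp add: pw sum_gp_strict)
  qed
qed

text \<open>With the factor 1/M on this side, averages over the frequencies j/M play the role of
  integrals over the circle. The index n is an integer because differences of cubes occur as
  indices.\<close>

definition hat :: "nat \<Rightarrow> (nat \<Rightarrow> complex) \<Rightarrow> int \<Rightarrow> complex" where
  "hat M F n = (\<Sum>j<M. F j * ee (- (real j * of_int n / real M))) / of_nat M"

lemma norm_hat_le: "norm (hat M F n) \<le> (\<Sum>j<M. norm (F j)) / real M"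
  unfolding hat_def norm_divide
  by (auto simp: norm_mult intro!: divide_right_mono order_trans[OF norm_sum])

text \<open>Orthogonality. When all \<open>c t\<close> are 1, the coefficient counts the t with
  \<open>\<phi> t\<close> congruent to n modulo M; the representation numbers below are obtained in
  this way.\<close>

lemma hat_trig_poly:
  assumes "M > 0" "finite T" "\<And>j. j < M \<Longrightarrow> F j = (\<Sum>t\<in>T. c t * ee (real j * of_int (\<phi> t) / real M))"
  shows "hat M F n = (\<Sum>t | t \<in> T \<and> int M dvd \<phi> t - n. c t)"
proof -
  have "(\<Sum>j<M. F j * ee (- (real j * of_int n / real M)))
      = (\<Sum>j<M. \<Sum>t\<in>T. c t * ee (real j * of_int (\<phi> t - n) / real M))"
  proof (rule sum.cong[OF refl])
    fix j assume "j \<in> {..<M}"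
    then have "F j = (\<Sum>t\<in>T. c t * ee (real j * of_int (\<phi> t) / real M))" using assms(3) by simp
    moreover have "ee (real j * of_int (\<phi> t) / real M) * ee (- (real j * of_int n / real M))
        = ee (real j * of_int (\<phi> t - n) / real M)" for t
      by (simp add: ee_add[symmetric] diff_divide_distrib algebra_simps)
    ultimately show "F j * ee (- (real j * of_int n / real M))
        = (\<Sum>t\<in>T. c t * ee (real j * of_int (\<phi> t - n) / real M))"
      by (simp add: sum_distrib_right mult.assoc)
  qed
  also have "\<dots> = (\<Sum>t\<in>T. c t * (\<Sum>j<M. ee (real j * of_int (\<phi> t - n) / real M)))"
    by (subst sum.swap) (simp add: sum_distrib_left)
  also have "\<dots> = (\<Sum>t\<in>T. if int M dvd \<phi> t - n then c t * of_nat M else 0)"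
    by (intro sum.cong refl) (subst sum_ee_orthogonal[OF assms(1)], simp)
  also have "\<dots> = (\<Sum>t | t \<in> T \<and> int M dvd \<phi> t - n. c t * of_nat M)"
    using assms(2) by (simp add: sum.inter_filter)
  finally show ?thesis using assms(1) by (simp add: hat_def sum_divide_distrib)
qed

lemma hat_parseval:
  assumes "M > 0"
  shows "(\<Sum>n<M. (norm (hat M F (int n)))\<^sup>2) = (\<Sum>j<M. (norm (F j))\<^sup>2) / real M"
proof -
  have sq: "of_real ((norm (z::complex))\<^sup>2) = z * cnj z" for z by (rule complex_norm_square)
  have "complex_of_real (\<Sum>n<M. (norm (hat M F (int n)))\<^sup>2)
     = (\<Sum>n<M. \<Sum>i<M. \<Sum>j<M. F i * cnj (F j) * ee (real n * of_int (int j - int i) / real M)) / (of_nat M)\<^sup>2"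
    unfolding of_real_sum sq sum_divide_distrib
  proof (rule sum.cong[OF refl])
    fix n
    have "hat M F (int n) * cnj (hat M F (int n)) =
        (\<Sum>i<M. F i * ee (- (real i * real n / real M))) * (\<Sum>j<M. cnj (F j) * ee (real j * real n / real M)) / (of_nat M)\<^sup>2"
      by (simp add: hat_def power2_eq_square)
    also have "\<dots> = (\<Sum>i<M. \<Sum>j<M. F i * cnj (F j) * ee (real n * of_int (int j - int i) / real M)) / (of_nat M)\<^sup>2"
      unfolding sum_product
      by (intro arg_cong[where f = "\<lambda>x. x / _"] sum.cong refl)
         (simp add: ee_add[symmetric] diff_divide_distrib algebra_simps)
    finally show "hat M F (int n) * cnj (hat M F (int n)) =
      (\<Sum>i<M. \<Sum>j<M. F i * cnj (F j) * ee (real n * of_int (int j - int i) / real M) / (of_nat M)\<^sup>2)"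
      by (simp only: sum_divide_distrib)
  qed
  also have "(\<Sum>n<M. \<Sum>i<M. \<Sum>j<M. F i * cnj (F j) * ee (real n * of_int (int j - int i) / real M))
     = (\<Sum>i<M. \<Sum>j<M. F i * cnj (F j) * (\<Sum>n<M. ee (real n * of_int (int j - int i) / real M)))"
    by (subst sum.swap, rule sum.cong[OF refl], subst sum.swap) (simp add: sum_distrib_left)
  also have "\<dots> = (\<Sum>i<M. \<Sum>j<M. if j = i then F i * cnj (F j) * of_nat M else 0)"
  proof (intro sum.cong refl)
    fix i j assume ij: "i \<in> {..<M}" "j \<in> {..<M}"
    have "int M dvd int j - int i \<longleftrightarrow> j = i"
      using ij by (simp add: mod_eq_dvd_iff[symmetric] zmod_int[symmetric])
    then show "F i * cnj (F j) * (\<Sum>n<M. ee (real n * of_int (int j - int i) / real M)) =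
        (if j = i then F i * cnj (F j) * of_nat M else 0)"
      by (subst sum_ee_orthogonal[OF assms]) simp
  qed
  also have "\<dots> = of_nat M * (\<Sum>i<M. F i * cnj (F i))"
    by (simp add: sum_distrib_left mult.commute)
  also have "\<dots> / (of_nat M)\<^sup>2 = complex_of_real ((\<Sum>j<M. (norm (F j))\<^sup>2) / real M)"
    using assms by (simp add: sq[symmetric] power2_eq_square field_simps)
  finally show ?thesis using of_real_eq_iff by blast
qed

text \<open>A cubic sum of Fourier coefficients is a correlation over triples of frequencies with
  sum 0 modulo M. The third frequency is -i - j; the summand \<open>2 * M\<close> keeps the natural
  subtraction from being truncated, as i, j < M.\<close>

lemma hat_triple:
  assumes "M > 0"
  shows "(\<Sum>n<M. hat M F (int n) * hat M G (int n) * hat M H (int n))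
     = (\<Sum>i<M. \<Sum>j<M. F i * G j * H ((2 * M - i - j) mod M)) / (of_nat M)\<^sup>2"
proof -
  have "(\<Sum>n<M. hat M F (int n) * hat M G (int n) * hat M H (int n))
     = (\<Sum>n<M. \<Sum>i<M. \<Sum>j<M. \<Sum>k<M. F i * G j * H k * ee (real n * of_int (- int i - int j - int k) / real M)) / (of_nat M)^3"
    unfolding sum_divide_distrib
  proof (rule sum.cong[OF refl])
    fix n
    have "hat M F (int n) * hat M G (int n) * hat M H (int n) =
        (\<Sum>i<M. F i * ee (- (real i * real n / real M))) * ((\<Sum>j<M. G j * ee (- (real j * real n / real M)))
         * (\<Sum>k<M. H k * ee (- (real k * real n / real M)))) / (of_nat M)^3"
      by (simp add: hat_def power3_eq_cube)
    also have "\<dots> = (\<Sum>i<M. \<Sum>j<M. \<Sum>k<M. F i * G j * H k * ee (real n * of_int (- int i - int j - int k) / real M)) / (of_nat M)^3"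
      unfolding sum_distrib_right unfolding sum_distrib_left
      by (intro arg_cong[where f = "\<lambda>x. x / _"] sum.cong refl)
         (simp add: ee_add[symmetric] diff_divide_distrib add_divide_distrib algebra_simps)
    finally show "hat M F (int n) * hat M G (int n) * hat M H (int n) =
      (\<Sum>i<M. \<Sum>j<M. \<Sum>k<M. F i * G j * H k * ee (real n * of_int (- int i - int j - int k) / real M) / (of_nat M)^3)"
      by (simp only: sum_divide_distrib)
  qed
  also have "(\<Sum>n<M. \<Sum>i<M. \<Sum>j<M. \<Sum>k<M. F i * G j * H k * ee (real n * of_int (- int i - int j - int k) / real M))
     = (\<Sum>i<M. \<Sum>j<M. \<Sum>k<M. F i * G j * H k * (\<Sum>n<M. ee (real n * of_int (- int i - int j - int k) / real M)))"
    by (subst sum.swap, rule sum.cong[OF refl], subst sum.swap, rule sum.cong[OF refl], subst sum.swap)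
       (simp add: sum_distrib_left)
  also have "\<dots> = (\<Sum>i<M. \<Sum>j<M. \<Sum>k<M. if k = (2 * M - i - j) mod M then F i * G j * H k * of_nat M else 0)"
  proof (intro sum.cong refl)
    fix i j k assume ijk: "i \<in> {..<M}" "j \<in> {..<M}" "k \<in> {..<M}"
    have "int M dvd - int i - int j - int k \<longleftrightarrow> int M dvd int (2 * M - i - j) - int k"
    proof -
      have "int (2 * M - i - j) - int k = (- int i - int j - int k) + int M * 2"
        using ijk by (simp add: of_nat_diff)
      then show ?thesis by (metis dvd_add_times_triv_right_iff mult.commute)
    qed
    also have "\<dots> \<longleftrightarrow> int (2 * M - i - j) mod int M = int k mod int M"
      by (simp add: mod_eq_dvd_iff)
    also have "\<dots> \<longleftrightarrow> k = (2 * M - i - j) mod M"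
      using ijk by (metis int_ops(9) lessThan_iff mod_less of_nat_eq_iff)
    finally show "F i * G j * H k * (\<Sum>n<M. ee (real n * of_int (- int i - int j - int k) / real M)) =
        (if k = (2 * M - i - j) mod M then F i * G j * H k * of_nat M else 0)"
      by (subst sum_ee_orthogonal[OF assms]) simp
  qed
  also have "\<dots> = (\<Sum>i<M. \<Sum>j<M. F i * G j * H ((2 * M - i - j) mod M) * of_nat M)"
    using assms by (intro sum.cong refl) (simp add: sum.delta)
  also have "\<dots> = of_nat M * (\<Sum>i<M. \<Sum>j<M. F i * G j * H ((2 * M - i - j) mod M))"
    by (simp add: sum_distrib_left mult.commute)
  also have "\<dots> / (of_nat M)^3 = (\<Sum>i<M. \<Sum>j<M. F i * G j * H ((2 * M - i - j) mod M)) / (of_nat M)\<^sup>2"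
    using assms by (simp add: power3_eq_cube power2_eq_square)
  finally show ?thesis .
qed

section \<open>Powers of finite sums as sums over tuples\<close>

definition tuples :: "nat \<Rightarrow> 'a set \<Rightarrow> 'a list set" where
  "tuples s X = {xs. length xs = s \<and> set xs \<subseteq> X}"

lemma finite_tuples [simp]: "finite X \<Longrightarrow> finite (tuples s X)"
  using finite_lists_length_eq[of X s] by (simp add: tuples_def conj_commute)

lemma sum_power_tuples:
  fixes g :: "'a \<Rightarrow> 'b::comm_semiring_1"
  assumes "finite X"
  shows "(\<Sum>x\<in>X. g x) ^ s = (\<Sum>xs\<in>tuples s X. \<Prod>x\<leftarrow>xs. g x)"
proof (induction s)
  case 0
  have "tuples 0 X = {[]}" by (auto simp: tuples_def)
  then show ?case by simp
next
  case (Suc s)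
  have eq: "tuples (Suc s) X = (\<lambda>(x, xs). x # xs) ` (X \<times> tuples s X)"
    by (auto simp: tuples_def length_Suc_conv image_iff)
  have "inj_on (\<lambda>(x, xs). x # xs) (X \<times> tuples s X)" by (auto simp: inj_on_def)
  then have "(\<Sum>xs\<in>tuples (Suc s) X. \<Prod>x\<leftarrow>xs. g x) = (\<Sum>(x, xs)\<in>X \<times> tuples s X. g x * (\<Prod>x\<leftarrow>xs. g x))"
    unfolding eq by (subst sum.reindex) (auto intro!: sum.cong)
  also have "\<dots> = (\<Sum>x\<in>X. g x) * (\<Sum>xs\<in>tuples s X. \<Prod>x\<leftarrow>xs. g x)"
    by (simp add: sum_product sum.cartesian_product)
  finally show ?case using Suc by simp
qed

lemma prod_list_ee: "(\<Prod>x\<leftarrow>xs. ee (\<phi> x)) = ee (\<Sum>x\<leftarrow>xs. \<phi> x)"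
  by (induction xs) (simp_all add: ee_add)

section \<open>Divisor bounds\<close>

text \<open>The single parameter \<open>D\<close> carries all the factors of size \<open>P\<^sup>\<epsilon>\<close>.\<close>

definition tame :: "nat \<Rightarrow> real \<Rightarrow> bool" where
  "tame P D \<longleftrightarrow> P \<ge> 1 \<and> D \<ge> 1
     \<and> (\<forall>l::nat. 1 \<le> l \<and> l \<le> 12 * P ^ 3 \<longrightarrow> real (card {d. d dvd l}) \<le> D)
     \<and> (\<Sum>k=1..2000 * P\<^sup>2. 1 / real k) \<le> D"

lemma prime_dvd_prime_power_mult_iff:
  assumes "prime p" "l \<ge> 1" "prime x"
  shows "x dvd p ^ l * m \<longleftrightarrow> x = p \<or> x dvd (m::nat)"
proof -
  have "x dvd p ^ l \<longleftrightarrow> x = p"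
    using assms by (metis dvd_power not_one_le_zero bot_nat_0.not_eq_extremum prime_dvd_power primes_dvd_imp_eq)
  then show ?thesis using assms by (simp add: prime_dvd_mult_iff)
qed

text \<open>Induction that splits off a full prime power at a time. Large primes gain at least what
  the factor (l + 1)^2 loses, and each small prime costs a constant K. The square makes room for
  both applications: the divisor function, where l + 1 occurs, and 4 to the number of prime factors,
  where 4 <= (l + 1)^2.\<close>

lemma submultiplicative_powr_bound:
  fixes g :: "nat \<Rightarrow> real"
  assumes g1: "g 1 \<le> 1" and nonneg: "\<And>n. g n \<ge> 0" and "\<epsilon> > 0"
    and step: "\<And>p l m. prime p \<Longrightarrow> \<not> p dvd m \<Longrightarrow> l \<ge> 1 \<Longrightarrow> m \<ge> 1 \<Longrightarrow> g (p ^ l * m) \<le> (real l + 1)\<^sup>2 * g m"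
  shows "\<exists>C\<ge>1. \<forall>n\<ge>1. g n \<le> C * real n powr \<epsilon>"
proof -
  define t where "t = \<epsilon> * ln 2 / 2"
  \<comment> \<open>Chosen so that l + 1 <= c (1 + l t) <= c exp(l t); after squaring, exp(2 l t) is
    2 powr (\<epsilon> l).\<close>
  define c where "c = max 1 (1 / t)"
  define K where "K = c\<^sup>2"
  \<comment> \<open>For p at least 2 powr (2/\<epsilon>) one has p powr (\<epsilon> l) >= 4^l >= (l
    + 1)^2, so these primes cost nothing.\<close>
  define Y where "Y = nat \<lceil>2 powr (2 / \<epsilon>)\<rceil>"
  define A where "A n = {p. prime p \<and> p dvd n \<and> p \<le> Y}" for n :: nat
  have t: "t > 0" using assms by (simp add: t_def)
  have c: "c \<ge> 1" "c * t \<ge> 1" using t by (auto simp: c_def field_simps max_def)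
  have K: "K \<ge> 1" using c by (simp add: K_def)
  have small: "(real l + 1)\<^sup>2 \<le> K * 2 powr (\<epsilon> * real l)" for l
  proof -
    have "real l + 1 \<le> c * (1 + real l * t)"
      using c mult_left_mono[OF c(2), of "real l"] by (simp add: algebra_simps)
    also have "\<dots> \<le> c * exp (real l * t)"
      using c by (intro mult_left_mono exp_ge_add_one_self) auto
    finally have "(real l + 1)\<^sup>2 \<le> (c * exp (real l * t))\<^sup>2"
      by (intro power_mono) auto
    also have "\<dots> = K * 2 powr (\<epsilon> * real l)"
      by (simp add: K_def power_mult_distrib powr_def t_def flip: exp_of_nat_mult)
    finally show ?thesis .
  qed
  have pow: "real (p ^ l) powr \<epsilon> = real p powr (\<epsilon> * real l)" if "prime p" for p l :: nat
    using that prime_gt_0_nat[OF that] by (simp add: powr_realpow[symmetric] powr_powr mult.commute)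
  have main: "g n \<le> K ^ card (A n) * real n powr \<epsilon>" if "n \<ge> 1" for n
    using that
  proof (induction n rule: less_induct)
    case (less n)
    show ?case
    proof (cases "n = 1")
      case True
      then have "A n = {}" by (auto simp: A_def)
      with True g1 show ?thesis by simp
    next
      case False
      then obtain p where p: "prime p" "p dvd n" using prime_factor_nat by blast
      obtain m where m: "n = p ^ multiplicity p n * m" "\<not> p dvd m"
        using multiplicity_decompose'[of n p] less.prems p by (metis not_one_le_zero not_prime_unit)
      define l where "l = multiplicity p n"
      have l: "l \<ge> 1" using p less.prems by (simp add: l_def Suc_le_eq prime_multiplicity_gt_zero_iff)
      have n: "n = p ^ l * m" using m l_def by simp
      have m1: "m \<ge> 1" using less.prems n by (cases m) auto
      have p2: "p \<ge> 2" using p prime_ge_2_nat by blast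
      have "p ^ l \<ge> 2" using l p2 by (metis self_le_power le_trans one_le_numeral le_trans less_le_trans zero_less_one)
      then have "m < n" using n m1 by simp
      with less.IH m1 have IH: "g m \<le> K ^ card (A m) * real m powr \<epsilon>" by simp
      have fin: "finite (A m)" by (auto simp: A_def)
      have An: "A n = (if p \<le> Y then insert p (A m) else A m)"
        using p l prime_dvd_prime_power_mult_iff[OF p(1) l] by (auto simp: A_def n)
      have "(real l + 1)\<^sup>2 \<le> (if p \<le> Y then K else 1) * real p powr (\<epsilon> * real l)"
      proof (cases "p \<le> Y")
        case True
        have "2 powr (\<epsilon> * real l) \<le> real p powr (\<epsilon> * real l)"
          using p2 assms by (intro powr_mono2) auto
        with small[of l] K True show ?thesis
          by (smt (verit) mult_left_mono)
      next
        case False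
        then have "2 powr (2 / \<epsilon>) \<le> real p"
          unfolding Y_def by linarith
        then have "(2 powr (2 / \<epsilon>)) powr (\<epsilon> * real l) \<le> real p powr (\<epsilon> * real l)"
          using assms by (intro powr_mono2) auto
        moreover have "(2 powr (2 / \<epsilon>)) powr (\<epsilon> * real l) = (2 ^ l)\<^sup>2"
        proof -
          have "(2 powr (2 / \<epsilon>)) powr (\<epsilon> * real l) = (2::real) powr (real (l * 2))"
            using assms by (simp add: powr_powr mult.commute)
          also have "\<dots> = 2 ^ (l * 2)" by (rule powr_realpow) simp
          finally show ?thesis by (simp add: power_mult)
        qed
        moreover have "real l + 1 \<le> 2 ^ l"
        proof -
          have "l + 1 \<le> 2 ^ l" by (induction l) auto
          then have "real (l + 1) \<le> real (2 ^ l)" by (rule of_nat_mono)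
          then show ?thesis by simp
        qed
        then have "(real l + 1)\<^sup>2 \<le> (2 ^ l)\<^sup>2" by (intro power_mono) auto
        ultimately have "(real l + 1)\<^sup>2 \<le> real p powr (\<epsilon> * real l)" by linarith
        then show ?thesis using False by (simp only: if_False mult_1)
      qed
      then have "g n \<le> ((if p \<le> Y then K else 1) * real p powr (\<epsilon> * real l)) * (K ^ card (A m) * real m powr \<epsilon>)"
        unfolding n using nonneg[of m] IH K
        by (intro order_trans[OF step[OF p(1) m(2) l m1]] mult_mono) auto
      also have "\<dots> = K ^ card (A n) * (real (p ^ l) powr \<epsilon> * real m powr \<epsilon>)"
        using An fin m(2) pow[OF p(1)] by (auto simp: A_def)
      also have "real (p ^ l) powr \<epsilon> * real m powr \<epsilon> = real n powr \<epsilon>"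
        by (simp add: n powr_mult)
      finally show ?thesis .
    qed
  qed
  have "g n \<le> K ^ Suc Y * real n powr \<epsilon>" if "n \<ge> 1" for n
  proof -
    have "card (A n) \<le> card {..Y}" by (intro card_mono) (auto simp: A_def)
    then have "K ^ card (A n) \<le> K ^ Suc Y" using K by (intro power_increasing) auto
    then have "K ^ card (A n) * real n powr \<epsilon> \<le> K ^ Suc Y * real n powr \<epsilon>"
      by (intro mult_right_mono) auto
    with main[OF that] show ?thesis by linarith
  qed
  moreover have "K ^ Suc Y \<ge> 1" using K by (rule one_le_power)
  ultimately show ?thesis by blast
qed

lemma card_divisors_powr_bound:
  assumes "\<epsilon> > 0"
  shows "\<exists>C\<ge>1. \<forall>n\<ge>1. real (card {d. d dvd n}) \<le> C * real n powr \<epsilon>"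
proof (rule submultiplicative_powr_bound)
  fix p l m :: nat
  assume p: "prime p" "\<not> p dvd m" "l \<ge> 1" "m \<ge> 1"
  have fin: "finite {d. d dvd m}" using p by simp
  have "{d. d dvd p ^ l * m} \<subseteq> (\<lambda>(i, d). p ^ i * d) ` ({..l} \<times> {d. d dvd m})"
  proof
    fix d assume "d \<in> {d. d dvd p ^ l * m}"
    then obtain b c where "d = b * c" "b dvd p ^ l" "c dvd m"
      using division_decomp by blast
    moreover from \<open>b dvd p ^ l\<close> obtain i where "i \<le> l" "b = p ^ i"
      using divides_primepow_nat[OF p(1)] by blast
    ultimately show "d \<in> (\<lambda>(i, d). p ^ i * d) ` ({..l} \<times> {d. d dvd m})" by auto
  qed
  then have "card {d. d dvd p ^ l * m} \<le> card ({..l} \<times> {d. d dvd m})"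
    using fin by (meson card_image_le card_mono finite_SigmaI finite_atMost finite_imageI le_trans)
  also have "\<dots> = (l + 1) * card {d. d dvd m}" by (simp add: card_cartesian_product)
  finally have "real (card {d. d dvd p ^ l * m}) \<le> real ((l + 1) * card {d. d dvd m})" by (rule of_nat_mono)
  also have "\<dots> = (real l + 1) * real (card {d. d dvd m})" by (simp add: distrib_right)
  also have "\<dots> \<le> (real l + 1)\<^sup>2 * real (card {d. d dvd m})"
    by (intro mult_right_mono) (auto simp: power2_eq_square)
  finally show "real (card {d. d dvd p ^ l * m}) \<le> (real l + 1)\<^sup>2 * real (card {d. d dvd m})" .
qed (use assms in auto)

text \<open>Absorbs the constant 4 that the bounds for Gauss sums lose at every prime divisor of the
  modulus.\<close>

lemma prime_factors_powr_bound:
  assumes "\<epsilon> > 0"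
  shows "\<exists>C\<ge>1. \<forall>n\<ge>1. 4 ^ card (prime_factors (n::nat)) \<le> C * real n powr \<epsilon>"
proof (rule submultiplicative_powr_bound)
  fix p l m :: nat
  assume p: "prime p" "\<not> p dvd m" "l \<ge> 1" "m \<ge> 1"
  have "prime_factors (p ^ l * m) = insert p (prime_factors m)"
    using p prime_dvd_prime_power_mult_iff[OF p(1,3)] by (auto simp: prime_factors_dvd)
  moreover have "p \<notin> prime_factors m" using p by auto
  moreover have "4 \<le> (real l + 1)\<^sup>2"
    using p power_mono[of 2 "real l + 1" 2] by simp
  ultimately show "4 ^ card (prime_factors (p ^ l * m)) \<le> (real l + 1)\<^sup>2 * 4 ^ card (prime_factors m)"
    by (simp only: card_insert_disjoint finite_set_mset not_False_eq_True power_Suc)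
       (rule mult_right_mono, simp_all)
qed (use assms in auto)

lemma sum_inverse_le_ln: "n \<ge> 1 \<Longrightarrow> (\<Sum>k=1..n. 1 / real k) \<le> 1 + ln (real n)"
proof (induction n rule: nat_induct_at_least)
  case (Suc n)
  have "1 / (real n + 1) \<le> ln (real n + 1) - ln (real n)"
  proof -
    have "ln (real n / (real n + 1)) \<le> real n / (real n + 1) - 1"
      using Suc.hyps by (intro ln_le_minus_one) auto
    also have "\<dots> = - (1 / (real n + 1))" by (simp add: field_simps)
    finally show ?thesis using Suc.hyps by (simp add: ln_div)
  qed
  with Suc show ?case by (simp add: add.commute)
qed auto

text \<open>The divisor bound is taken with exponent \<epsilon>/3 because l is as large as P^3, and
  the logarithm of P^2 is bounded by a power \<epsilon>/2 of P^2.\<close>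

lemma tame_exists:
  assumes "\<epsilon> > 0"
  shows "\<exists>C\<ge>1. \<forall>P\<ge>1. tame P (C * real P powr \<epsilon>)"
proof -
  obtain C1 where C1: "C1 \<ge> 1" "\<And>n. n \<ge> 1 \<Longrightarrow> real (card {d. d dvd n}) \<le> C1 * real n powr (\<epsilon>/3)"
    using card_divisors_powr_bound[of "\<epsilon>/3"] assms by auto
  define C where "C = C1 * 12 powr (\<epsilon>/3) + 1 + 2000 powr (\<epsilon>/2) / (\<epsilon>/2)"
  have C: "C \<ge> 1" "C \<ge> C1 * 12 powr (\<epsilon>/3)" "C \<ge> 1 + 2000 powr (\<epsilon>/2) / (\<epsilon>/2)"
    using C1 assms by (auto simp: C_def)
  have "tame P (C * real P powr \<epsilon>)" if P: "P \<ge> 1" for P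
    unfolding tame_def
  proof (intro conjI allI impI)
    have Pe: "real P powr \<epsilon> \<ge> 1" using P assms by (simp add: ge_one_powr_ge_zero)
    then show "1 \<le> C * real P powr \<epsilon>" using C(1) mult_mono[of 1 C 1 "real P powr \<epsilon>"] by simp
    fix l :: nat assume l: "1 \<le> l \<and> l \<le> 12 * P ^ 3"
    have "real l \<le> real (12 * P ^ 3)" using l by (intro of_nat_mono) simp
    then have "real l powr (\<epsilon>/3) \<le> (12 * real P ^ 3) powr (\<epsilon>/3)"
      using l assms by (intro powr_mono2) auto
    also have "\<dots> = 12 powr (\<epsilon>/3) * real P powr \<epsilon>"
    proof -
      have "real P ^ 3 = real P powr 3" using P by simp
      then have "(real P ^ 3) powr (\<epsilon>/3) = real P powr \<epsilon>" by (simp only: powr_powr) simp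
      then show ?thesis by (simp add: powr_mult)
    qed
    finally have "C1 * real l powr (\<epsilon>/3) \<le> C1 * 12 powr (\<epsilon>/3) * real P powr \<epsilon>"
      using C1(1) mult_left_mono[of "real l powr (\<epsilon>/3)" "12 powr (\<epsilon>/3) * real P powr \<epsilon>" C1] by simp
    also have "\<dots> \<le> C * real P powr \<epsilon>" by (rule mult_right_mono[OF C(2)]) simp
    finally show "real (card {d. d dvd l}) \<le> C * real P powr \<epsilon>"
      using C1(2)[of l] l by (meson order_trans)
  next
    have Pe: "real P powr \<epsilon> \<ge> 1" using P assms by (simp add: ge_one_powr_ge_zero)
    have "(\<Sum>k=1..2000 * P\<^sup>2. 1 / real k) \<le> 1 + ln (real (2000 * P\<^sup>2))"
      using P by (intro sum_inverse_le_ln) simp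
    also have "\<dots> \<le> 1 + real (2000 * P\<^sup>2) powr (\<epsilon>/2) / (\<epsilon>/2)"
    proof (intro add_left_mono ln_powr_bound)
      have "1 \<le> P\<^sup>2" using P by (rule one_le_power)
      then have "1 \<le> 2000 * P\<^sup>2" by linarith
      then have "real 1 \<le> real (2000 * P\<^sup>2)" by (rule of_nat_mono)
      then show "1 \<le> real (2000 * P\<^sup>2)" by (simp only: of_nat_1)
    qed (use assms in simp)
    also have "real (2000 * P\<^sup>2) powr (\<epsilon>/2) = 2000 powr (\<epsilon>/2) * real P powr \<epsilon>"
    proof -
      have "(real P)\<^sup>2 = real P powr 2" by (rule powr_numeral[symmetric]) simp
      then have "((real P)\<^sup>2) powr (\<epsilon>/2) = real P powr \<epsilon>" by (simp only: powr_powr) simp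
      then show ?thesis by (simp add: powr_mult)
    qed
    also have "1 + 2000 powr (\<epsilon>/2) * real P powr \<epsilon> / (\<epsilon>/2) \<le> (1 + 2000 powr (\<epsilon>/2) / (\<epsilon>/2)) * real P powr \<epsilon>"
    proof -
      have "1 + a * x / b \<le> (1 + a / b) * x" if "1 \<le> x" for a b x :: real
        using that by (simp add: distrib_right)
      from this[OF Pe] show ?thesis .
    qed
    also have "\<dots> \<le> C * real P powr \<epsilon>" by (rule mult_right_mono[OF C(3)]) simp
    finally show "(\<Sum>k=1..2000 * P\<^sup>2. 1 / real k) \<le> C * real P powr \<epsilon>" .
  next
    show "1 \<le> P" by (rule P)
  qed
  then show ?thesis using C(1) by (intro exI[of _ C]) simp
qed

lemma sum_le_card_fibre:
  fixes g :: "'b \<Rightarrow> real"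
  assumes "finite T" "finite R" "\<And>t. t \<in> T \<Longrightarrow> \<phi> t \<in> R"
    and "\<And>m. m \<in> R \<Longrightarrow> g m \<ge> 0" "\<And>m. m \<in> R \<Longrightarrow> real (card {t\<in>T. \<phi> t = m}) \<le> K"
  shows "(\<Sum>t\<in>T. g (\<phi> t)) \<le> K * (\<Sum>m\<in>R. g m)"
proof -
  have "(\<Sum>t\<in>T. g (\<phi> t)) = (\<Sum>m\<in>R. \<Sum>t\<in>{t\<in>T. \<phi> t = m}. g (\<phi> t))"
    using assms(1-3) by (intro sum.group[symmetric]) auto
  also have "\<dots> = (\<Sum>m\<in>R. real (card {t\<in>T. \<phi> t = m}) * g m)"
    by (intro sum.cong refl) (simp add: sum.inter_filter[symmetric])
  also have "\<dots> \<le> (\<Sum>m\<in>R. K * g m)"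
    using assms(4,5) by (intro sum_mono mult_right_mono) auto
  finally show ?thesis by (simp add: sum_distrib_left)
qed

section \<open>Weyl's inequality\<close>

definition dist_int :: "real \<Rightarrow> real" where
  "dist_int t = min (frac t) (1 - frac t)"

lemma dist_int_nonneg [simp]: "dist_int t \<ge> 0"
  by (simp add: dist_int_def frac_lt_1 less_imp_le)

lemma dist_int_eq_obtains:
  obtains k where "dist_int t = \<bar>t - of_int k\<bar>"
proof (cases "frac t \<le> 1 - frac t")
  case True
  then show ?thesis by (intro that[of "\<lfloor>t\<rfloor>"]) (simp add: dist_int_def frac_def min_def)
next
  case False
  then show ?thesis
    by (intro that[of "\<lfloor>t\<rfloor> + 1"]) (use frac_lt_1[of t] in \<open>simp add: dist_int_def frac_def min_def\<close>)
qed

lemma dist_int_le_half: "dist_int t \<le> 1/2"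
  unfolding dist_int_def by linarith

lemma norm_one_minus_ee_ge_dist_int: "4 * dist_int t \<le> norm (1 - ee t)"
proof -
  obtain k where k: "dist_int t = \<bar>t - of_int k\<bar>" by (rule dist_int_eq_obtains)
  have "ee t = ee (t - of_int k)" using ee_add_int[of "t - of_int k" k] by simp
  then show ?thesis using norm_one_minus_ee_ge[of "t - of_int k"] k dist_int_le_half[of t] by simp
qed

text \<open>The majorant of a geometric sum of n terms with ratio e(t). The case of integral t is
  separate because 1/0 = 0 would make the minimum vanish.\<close>

definition recip_cap :: "real \<Rightarrow> real \<Rightarrow> real" where
  "recip_cap n t = (if dist_int t = 0 then n else min n (1 / (2 * dist_int t)))"

lemma recip_cap_le: "recip_cap n t \<le> n"
  by (simp add: recip_cap_def)

lemma recip_cap_nonneg: "n \<ge> 0 \<Longrightarrow> recip_cap n t \<ge> 0"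
  by (simp add: recip_cap_def)

lemma recip_cap_minus [simp]: "recip_cap n (- t) = recip_cap n t"
proof -
  have "dist_int (- t) = dist_int t"
    using frac_lt_1[of t] by (cases "t \<in> \<int>") (simp_all add: dist_int_def frac_neg min.commute frac_eq_0_iff[THEN iffD2])
  then show ?thesis by (simp add: recip_cap_def)
qed

lemma norm_geometric_sum_ee_le:
  fixes a b :: int
  assumes "b - a < n" "n \<ge> 0"
  shows "norm (\<Sum>y\<in>{a..b}. ee (\<theta> * of_int y + c)) \<le> recip_cap (of_int n) \<theta>"
proof (cases "a \<le> b")
  case True
  define m where "m = nat (b - a + 1)"
  have "(\<Sum>y\<in>{a..b}. ee (\<theta> * of_int y + c)) = (\<Sum>i<m. ee (\<theta> * of_int (a + int i) + c))"
    by (rule sum.reindex_bij_witness[of _ "\<lambda>i. a + int i" "\<lambda>y. nat (y - a)"])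
       (use True in \<open>auto simp: m_def\<close>)
  also have "\<dots> = ee (\<theta> * of_int a + c) * (\<Sum>i<m. ee \<theta> ^ i)"
    unfolding sum_distrib_left
    by (intro sum.cong refl) (simp add: ee_power ee_add[symmetric] algebra_simps)
  finally have eq: "norm (\<Sum>y\<in>{a..b}. ee (\<theta> * of_int y + c)) = norm (\<Sum>i<m. ee \<theta> ^ i)"
    by (simp add: norm_mult)
  have "norm (\<Sum>i<m. ee \<theta> ^ i) \<le> (\<Sum>i<m. 1)"
    by (intro sum_norm_le) (simp add: norm_power)
  also have "\<dots> \<le> of_int n" using True assms by (simp add: m_def)
  finally have 1: "norm (\<Sum>i<m. ee \<theta> ^ i) \<le> of_int n" .
  have 2: "norm (\<Sum>i<m. ee \<theta> ^ i) \<le> 1 / (2 * dist_int \<theta>)" if "dist_int \<theta> \<noteq> 0"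
  proof -
    have pos: "dist_int \<theta> > 0" using that dist_int_nonneg[of \<theta>] by linarith
    have ne: "norm (1 - ee \<theta>) > 0" using norm_one_minus_ee_ge_dist_int[of \<theta>] pos by linarith
    then have "(\<Sum>i<m. ee \<theta> ^ i) = (1 - ee \<theta> ^ m) / (1 - ee \<theta>)"
      by (subst sum_gp_strict) auto
    then have "norm (\<Sum>i<m. ee \<theta> ^ i) = norm (1 - ee \<theta> ^ m) / norm (1 - ee \<theta>)"
      by (simp add: norm_divide)
    also have "\<dots> \<le> 2 / (4 * dist_int \<theta>)"
    proof (rule frac_le)
      show "norm (1 - ee \<theta> ^ m) \<le> 2"
        by (rule order_trans[OF norm_triangle_ineq4]) (simp add: norm_power)
    qed (use pos norm_one_minus_ee_ge_dist_int[of \<theta>] in auto)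
    finally show ?thesis by simp
  qed
  show ?thesis unfolding eq recip_cap_def using 1 2 by auto
qed (use assms dist_int_nonneg[of \<theta>] in \<open>auto simp: recip_cap_def\<close>)

text \<open>Weyl differencing, as an exact identity: the pairs (x, y) are sorted by h = x - y, and y
  runs over the intersection of the interval with its translate by -h.\<close>

lemma norm_sum_squared_eq:
  fixes a b N :: int
  assumes "b - a < N"
  shows "complex_of_real ((norm (\<Sum>x\<in>{a..b}. ee (\<phi> x)))\<^sup>2)
     = (\<Sum>h\<in>{-N<..<N}. \<Sum>y\<in>{max a (a - h)..min b (b - h)}. ee (\<phi> (y + h) - \<phi> y))"
proof -
  have "complex_of_real ((norm (\<Sum>x\<in>{a..b}. ee (\<phi> x)))\<^sup>2) = (\<Sum>x\<in>{a..b}. ee (\<phi> x)) * cnj (\<Sum>x\<in>{a..b}. ee (\<phi> x))"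
    by (rule complex_norm_square)
  also have "\<dots> = (\<Sum>(x, y)\<in>{a..b} \<times> {a..b}. ee (\<phi> x - \<phi> y))"
    by (simp add: sum_product sum.cartesian_product ee_add[symmetric])
  also have "\<dots> = (\<Sum>(h, y)\<in>(SIGMA h:{-N<..<N}. {max a (a - h)..min b (b - h)}). ee (\<phi> (y + h) - \<phi> y))"
    by (rule sum.reindex_bij_witness[of _ "\<lambda>(h, y). (y + h, y)" "\<lambda>(x, y). (x - y, y)"])
       (use assms in auto)
  finally show ?thesis by (simp add: sum.Sigma)
qed

lemma norm_sum_squared_le:
  fixes a b N :: int
  assumes "b - a < N"
  shows "(norm (\<Sum>x\<in>{a..b}. ee (\<phi> x)))\<^sup>2
     \<le> (\<Sum>h\<in>{-N<..<N}. norm (\<Sum>y\<in>{max a (a - h)..min b (b - h)}. ee (\<phi> (y + h) - \<phi> y)))"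
proof -
  have "(norm (\<Sum>x\<in>{a..b}. ee (\<phi> x)))\<^sup>2 = norm (complex_of_real ((norm (\<Sum>x\<in>{a..b}. ee (\<phi> x)))\<^sup>2))"
    unfolding norm_of_real by simp
  also have "\<dots> \<le> (\<Sum>h\<in>{-N<..<N}. norm (\<Sum>y\<in>{max a (a - h)..min b (b - h)}. ee (\<phi> (y + h) - \<phi> y)))"
    unfolding norm_sum_squared_eq[OF assms] by (rule norm_sum)
  finally show ?thesis .
qed

text \<open>Cauchy's inequality over the 2 N - 1 shifts h. The inner squares are left unexpanded: a
  second differencing leads to Weyl's inequality, and expanding them into pairs (y, z) leads to
  Hua's.\<close>

lemma norm_sum_pow4_le:
  fixes N :: int
  assumes "N \<ge> 1"
  shows "(norm (\<Sum>x\<in>{1..N}. ee (\<phi> x))) ^ 4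
     \<le> 2 * of_int N * (\<Sum>h\<in>{-N<..<N}. (norm (\<Sum>y\<in>{max 1 (1 - h)..min N (N - h)}. ee (\<phi> (y + h) - \<phi> y)))\<^sup>2)"
    (is "_ \<le> _ * (\<Sum>h\<in>?H. (?A h)\<^sup>2)")
proof -
  have "(norm (\<Sum>x\<in>{1..N}. ee (\<phi> x)))\<^sup>2 \<le> (\<Sum>h\<in>?H. 1 * ?A h)"
    using norm_sum_squared_le[of N 1 N \<phi>] by simp
  then have "((norm (\<Sum>x\<in>{1..N}. ee (\<phi> x)))\<^sup>2)\<^sup>2 \<le> (\<Sum>h\<in>?H. 1 * ?A h)\<^sup>2"
    by (intro power_mono) auto
  also have "\<dots> \<le> (\<Sum>h\<in>?H. 1\<^sup>2) * (\<Sum>h\<in>?H. (?A h)\<^sup>2)"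
    by (rule Cauchy_Schwarz_ineq_sum)
  also have "\<dots> \<le> (2 * of_int N) * (\<Sum>h\<in>?H. (?A h)\<^sup>2)"
    using assms by (intro mult_right_mono sum_nonneg) auto
  finally show ?thesis by simp
qed

text \<open>Any \<open>\<lceil>q/2\<rceil>\<close> consecutive multiples of \<open>\<alpha>\<close> are \<open>1/(2q)\<close>-separated modulo 1.\<close>

lemma sum_recip_cap_block_le:
  fixes \<alpha> n :: real and m0 :: int
  assumes q: "q \<ge> 1" and cop: "coprime a (int q)" and ap: "\<bar>\<alpha> - of_int a / of_nat q\<bar> \<le> 1 / (real q)\<^sup>2"
    and n: "n \<ge> 0"
  shows "(\<Sum>i<(q + 1) div 2. recip_cap n (\<alpha> * of_int (m0 + int i))) \<le> 2 * n + 2 * real q * (\<Sum>k=1..2*q. 1 / real k)"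
proof -
  define L where "L = (q + 1) div 2"
  define t where "t i = \<alpha> * of_int (m0 + int i)" for i
  \<comment> \<open>The circle is cut into 2q boxes of width 1/(2q), and \<open>bk i\<close> is the
    box that contains \<open>t i\<close>.\<close>
  define bk where "bk i = nat \<lfloor>2 * real q * frac (t i)\<rfloor>" for i
  define g where "g b = (if b = 0 then n else real q / real b)" for b :: nat
  have g0: "g b \<ge> 0" for b using n by (simp add: g_def)
  have bk: "real (bk i) \<le> 2 * real q * frac (t i)" "2 * real q * frac (t i) < real (bk i) + 1" for i
  proof -
    have "0 \<le> 2 * real q * frac (t i)" by (intro mult_nonneg_nonneg) auto
    then have "real (bk i) = of_int \<lfloor>2 * real q * frac (t i)\<rfloor>" unfolding bk_def by simp
    then show "real (bk i) \<le> 2 * real q * frac (t i)" "2 * real q * frac (t i) < real (bk i) + 1"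
      by linarith+
  qed
  have bkl: "bk i < 2 * q" for i
  proof -
    have "2 * real q * frac (t i) < 2 * real q * 1"
      using q by (intro mult_strict_left_mono frac_lt_1) simp
    then show ?thesis using bk(1)[of i] by linarith
  qed
  have inj: "inj_on bk {..<L}"
  proof (rule linorder_inj_onI')
    fix i j assume ij: "i \<in> {..<L}" "j \<in> {..<L}" "i < j"
    show "bk i \<noteq> bk j"
    proof
      \<comment> \<open>Two points in one box give |\<alpha> d - z| < 1/(2q) with 0 < d < q/2.
        Replacing \<alpha> by a/q costs d/q after multiplication by q, so |a d - z q| < 1/2 + d/q <
        1. The integer a d - z q is therefore 0 and q divides d, which is impossible.\<close>
      assume eq: "bk i = bk j"
      define d where "d = int j - int i"
      define z where "z = \<lfloor>t j\<rfloor> - \<lfloor>t i\<rfloor>"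
      have d: "0 < d" "2 * d \<le> int q - 1" using ij by (auto simp: d_def L_def)
      have "\<bar>2 * real q * frac (t i) - 2 * real q * frac (t j)\<bar> < 1"
        using bk[of i] bk[of j] eq by linarith
      then have "2 * real q * \<bar>frac (t j) - frac (t i)\<bar> < 1"
        using q by (simp add: abs_mult right_diff_distrib[symmetric] abs_minus_commute)
      moreover have "frac (t j) - frac (t i) = \<alpha> * of_int d - of_int z"
        by (simp add: frac_def t_def d_def z_def algebra_simps)
      ultimately have 1: "2 * real q * \<bar>\<alpha> * of_int d - of_int z\<bar> < 1" by simp
      have 2: "real q * \<bar>(\<alpha> - of_int a / of_nat q) * of_int d\<bar> \<le> of_int d / real q"
      proof -
        have "real q * \<bar>(\<alpha> - of_int a / of_nat q) * of_int d\<bar> = real q * of_int d * \<bar>\<alpha> - of_int a / of_nat q\<bar>"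
          using d by (simp add: abs_mult)
        also have "\<dots> \<le> real q * of_int d * (1 / (real q)\<^sup>2)"
          using ap d by (intro mult_left_mono) auto
        finally show ?thesis using q by (simp add: power2_eq_square)
      qed
      have "of_int (a * d - z * int q) = real q * (\<alpha> * of_int d - of_int z) - real q * ((\<alpha> - of_int a / of_nat q) * of_int d)"
        using q by (simp add: left_diff_distrib right_diff_distrib mult.commute)
      then have 3: "2 * \<bar>real_of_int (a * d - z * int q)\<bar> < 1 + 2 * (of_int d / real q)"
      proof -
        have tri: "2 * \<bar>u - v\<bar> < 1 + 2 * w" if "2 * \<bar>u\<bar> < 1" "\<bar>v\<bar> \<le> w" for u v w :: real
          using that abs_triangle_ineq4[of u v] by argo
        assume "of_int (a * d - z * int q) = real q * (\<alpha> * of_int d - of_int z) - real q * ((\<alpha> - of_int a / of_nat q) * of_int d)"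
        then show ?thesis using 1 2 by (simp only: mult.assoc abs_mult abs_of_nat tri)
      qed
      have "2 * (of_int d / real q) < 1"
      proof -
        have "real_of_int (2 * d) \<le> of_int (int q - 1)" using d(2) by (rule of_int_le_iff[THEN iffD2])
        then show ?thesis using q by (simp add: field_simps)
      qed
      with 3 have "\<bar>real_of_int (a * d - z * int q)\<bar> < 1" by argo
      then have "\<bar>a * d - z * int q\<bar> < 1" by (simp only: of_int_abs[symmetric] of_int_less_1_iff)
      then have "int q dvd a * d" by (simp add: dvd_def mult.commute)
      then have "int q dvd d" using cop by (simp add: coprime_commute coprime_dvd_mult_right_iff)
      with d show False by (auto dest: zdvd_imp_le)
    qed
  qed
  \<comment> \<open>A point in box b is at distance at least b/(2q) from 0 and (2q - 1 - b)/(2q)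
    from 1. Adding both bounds covers whichever is nearer, and the two outermost boxes take the cap
    n.\<close>
  have termb: "recip_cap n (t i) \<le> g (bk i) + g (2 * q - 1 - bk i)" for i
  proof (cases "bk i = 0 \<or> bk i = 2 * q - 1")
    case True
    then have "g (bk i) = n \<or> g (2 * q - 1 - bk i) = n" by (auto simp: g_def)
    then show ?thesis using recip_cap_le[of n "t i"] g0[of "bk i"] g0[of "2 * q - 1 - bk i"] by (elim disjE) linarith+
  next
    case False
    define c where "c = 2 * q - 1 - bk i"
    have bc: "bk i \<ge> 1" "c \<ge> 1" using False bkl[of i] by (auto simp: c_def)
    have rc: "real c = 2 * real q - 1 - real (bk i)" using bkl[of i] by (simp add: c_def of_nat_diff)
    have f: "real (bk i) / (2 * real q) \<le> frac (t i)" "real c / (2 * real q) \<le> 1 - frac (t i)"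
      using bk[of i] q rc by (simp_all add: field_simps)
    have pos: "0 < real (bk i) / (2 * real q)" "0 < real c / (2 * real q)" using bc q by auto
    then have nd0: "dist_int (t i) > 0" using f unfolding dist_int_def by linarith
    have "1 / (2 * dist_int (t i)) \<le> g (bk i) + g c"
    proof (cases "frac (t i) \<le> 1 - frac (t i)")
      case True
      then have "1 / (2 * dist_int (t i)) \<le> 1 / (2 * (real (bk i) / (2 * real q)))"
        using f pos nd0 by (intro divide_left_mono mult_pos_pos) (auto simp: dist_int_def min_def)
      then have "1 / (2 * dist_int (t i)) \<le> g (bk i)" using bc by (simp add: g_def)
      then show ?thesis using g0[of c] by linarith
    next
      case False
      then have "1 / (2 * dist_int (t i)) \<le> 1 / (2 * (real c / (2 * real q)))"
        using f pos nd0 by (intro divide_left_mono mult_pos_pos) (auto simp: dist_int_def min_def)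
      then have "1 / (2 * dist_int (t i)) \<le> g c" using bc by (simp add: g_def)
      then show ?thesis using g0[of "bk i"] by linarith
    qed
    then show ?thesis using nd0 by (simp add: recip_cap_def c_def)
  qed
  have "(\<Sum>i<L. recip_cap n (t i)) \<le> (\<Sum>i<L. g (bk i) + g (2 * q - 1 - bk i))"
    by (intro sum_mono termb)
  also have "\<dots> = (\<Sum>b\<in>bk ` {..<L}. g b + g (2 * q - 1 - b))"
    using inj by (simp add: sum.reindex)
  also have "\<dots> \<le> (\<Sum>b<2*q. g b + g (2 * q - 1 - b))"
    using bkl g0 by (intro sum_mono2) auto
  also have "\<dots> = 2 * (\<Sum>b<2*q. g b)"
  proof -
    have "(\<Sum>b<2*q. g (2 * q - 1 - b)) = (\<Sum>b<2*q. g b)"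
      using sum.nat_diff_reindex[of g "2 * q"] by (simp add: algebra_simps)
    then show ?thesis by (simp add: sum.distrib)
  qed
  also have "(\<Sum>b<2*q. g b) \<le> n + real q * (\<Sum>k=1..2*q. 1 / real k)"
  proof -
    have "(\<Sum>b<2*q. g b) = g 0 + (\<Sum>b\<in>{1..<2*q}. g b)"
    proof -
      have "{..<2*q} = insert 0 {1..<2*q}" using q by auto
      then show ?thesis by simp
    qed
    also have "(\<Sum>b\<in>{1..<2*q}. g b) \<le> (\<Sum>b\<in>{1..2*q}. real q / real b)"
      by (intro order_trans[OF _ sum_mono2[of "{1..2*q}" "{1..<2*q}"]] sum_mono) (auto simp: g_def)
    finally show ?thesis by (simp add: g_def sum_distrib_left)
  qed
  finally show ?thesis by (simp add: L_def t_def algebra_simps)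
qed

text \<open>The range is covered by R div L + 1 blocks of length L = (q + 1) div 2, on each of which
  the separation bound applies. This is the familiar (R/q + 1)(n + q log q).\<close>

lemma sum_recip_cap_le:
  fixes \<alpha> n :: real
  assumes q: "q \<ge> 1" and cop: "coprime a (int q)" and ap: "\<bar>\<alpha> - of_int a / of_nat q\<bar> \<le> 1 / (real q)\<^sup>2"
    and n: "n \<ge> 0" and H: "(\<Sum>k=1..2*q. 1 / real k) \<le> H"
  shows "(\<Sum>m=1..R. recip_cap n (\<alpha> * real m)) \<le> (2 * real R / real q + 1) * (2 * n + 2 * real q * H)"
proof -
  define L where "L = (q + 1) div 2"
  define K where "K = R div L + 1"
  have L: "L \<ge> 1" "real q \<le> 2 * real L" using q by (auto simp: L_def)
  have "(\<Sum>m=1..R. recip_cap n (\<alpha> * real m)) \<le> (\<Sum>m<K * L. recip_cap n (\<alpha> * real m))"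
  proof (intro sum_mono2)
    have "R mod L < L" using L by simp
    then have "R < K * L" using div_mult_mod_eq[of R L] unfolding K_def add_mult_distrib by linarith
    then show "{1..R} \<subseteq> {..<K * L}" by auto
  qed (use n recip_cap_nonneg in auto)
  also have "\<dots> = (\<Sum>k<K. \<Sum>i<L. recip_cap n (\<alpha> * of_int (int (k * L) + int i)))"
    unfolding sum.nat_group[symmetric]
  proof (rule sum.cong[OF refl])
    fix k
    show "(\<Sum>m\<in>{k * L..<k * L + L}. recip_cap n (\<alpha> * real m)) = (\<Sum>i<L. recip_cap n (\<alpha> * of_int (int (k * L) + int i)))"
      by (rule sum.reindex_bij_witness[of _ "\<lambda>i. k * L + i" "\<lambda>m. m - k * L"]) auto
  qed
  also have "\<dots> \<le> (\<Sum>k<K. 2 * n + 2 * real q * H)"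
  proof (intro sum_mono)
    fix k
    have "(\<Sum>i<L. recip_cap n (\<alpha> * of_int (int (k * L) + int i))) \<le> 2 * n + 2 * real q * (\<Sum>k=1..2*q. 1 / real k)"
      unfolding L_def by (rule sum_recip_cap_block_le[OF q cop ap n])
    also have "\<dots> \<le> 2 * n + 2 * real q * H" using H by (intro add_left_mono mult_left_mono) auto
    finally show "(\<Sum>i<L. recip_cap n (\<alpha> * of_int (int (k * L) + int i))) \<le> 2 * n + 2 * real q * H" .
  qed
  also have "\<dots> = real K * (2 * n + 2 * real q * H)" by simp
  also have "\<dots> \<le> (2 * real R / real q + 1) * (2 * n + 2 * real q * H)"
  proof (rule mult_right_mono)
    have "real (R div L) \<le> real R / real L" by (rule of_nat_div_le_of_nat)
    also have "\<dots> \<le> real R / (real q / 2)" using L q by (intro divide_left_mono) auto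
    finally show "real K \<le> 2 * real R / real q + 1" by (simp add: K_def mult.commute)
    have "0 \<le> H" using H by (rule order_trans[rotated]) (intro sum_nonneg, auto)
    then show "0 \<le> 2 * n + 2 * real q * H" using n by simp
  qed
  finally show ?thesis .
qed

lemma tame_divisors: "tame P D \<Longrightarrow> 1 \<le> l \<Longrightarrow> l \<le> 12 * P ^ 3 \<Longrightarrow> real (card {d. d dvd l}) \<le> D"
  by (simp add: tame_def)

text \<open>The limit is set by Weyl's inequality: moduli up to 1000 P^2 occur there, with a
  harmonic sum up to 2q.\<close>

lemma tame_harmonic:
  assumes "tame P D" "K \<le> 2000 * P\<^sup>2"
  shows "(\<Sum>k=1..K. 1 / real k) \<le> D"
proof -
  have "(\<Sum>k=1..K. 1 / real k) \<le> (\<Sum>k=1..2000 * P\<^sup>2. 1 / real k)"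
    using assms(2) by (intro sum_mono2) auto
  then show ?thesis using assms(1) by (simp add: tame_def)
qed

text \<open>The pair (h, k) is determined by |h|, which divides m, and by the two signs; hence the
  factor 4. The 6 is the one in the second difference of a cube.\<close>

lemma card_mult_eq_le:
  fixes N :: int
  assumes "m \<ge> 1"
  shows "card {t \<in> {-N<..<N} \<times> {-N<..<N}. nat (6 * \<bar>fst t * snd t\<bar>) = m} \<le> 4 * card {d. d dvd m}" (is "card ?F \<le> _")
proof -
  let ?f = "\<lambda>(h, k). (nat \<bar>h\<bar>, h > 0, k > (0::int))"
  have fin: "finite ({d. d dvd m} \<times> (UNIV :: (bool \<times> bool) set))" using assms by simp
  have inj: "inj_on ?f ?F"
  proof (rule inj_onI, clarify)
    fix h k h' k' :: int
    assume *: "m = nat (6 * \<bar>fst (h, k) * snd (h, k)\<bar>)" "nat (6 * \<bar>fst (h', k') * snd (h', k')\<bar>) = nat (6 * \<bar>fst (h, k) * snd (h, k)\<bar>)"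
      "nat \<bar>h\<bar> = nat \<bar>h'\<bar>" "(0 < h) = (0 < h')" "(0 < k) = (0 < k')"
    have h: "h = h'" using *(3,4) by linarith
    have "h \<noteq> 0" using *(1) assms by auto
    moreover have "\<bar>h\<bar> * \<bar>k\<bar> = \<bar>h\<bar> * \<bar>k'\<bar>" using eq_nat_nat_iff[THEN iffD1, OF _ _ *(2)] h by (auto simp: abs_mult)
    ultimately have "\<bar>k\<bar> = \<bar>k'\<bar>" by simp
    with *(5) have "k = k'" by linarith
    with h show "h = h' \<and> k = k'" by simp
  qed
  have sub: "?f ` ?F \<subseteq> {d. d dvd m} \<times> UNIV"
  proof (rule image_subsetI)
    fix t assume t: "t \<in> ?F"
    obtain h k where hk: "t = (h, k)" by (cases t)
    have "nat (6 * \<bar>h * k\<bar>) = nat \<bar>h\<bar> * nat (6 * \<bar>k\<bar>)"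
      by (simp add: abs_mult nat_mult_distrib)
    then have "nat \<bar>h\<bar> dvd nat (6 * \<bar>h * k\<bar>)" by simp
    then show "?f t \<in> {d. d dvd m} \<times> UNIV"
      using t by (simp only: hk mem_Collect_eq fst_conv snd_conv prod.case mem_Times_iff UNIV_I simp_thms)
  qed
  have "card ?F \<le> card ({d. d dvd m} \<times> (UNIV :: (bool \<times> bool) set))"
    by (rule card_inj_on_le[OF inj sub fin])
  then show ?thesis by (simp add: card_cartesian_product UNIV_bool UNIV_Times_UNIV[symmetric] del: UNIV_Times_UNIV)
qed

text \<open>The second difference of a cubic phase is linear in y with slope 6 \<alpha> h k, and
  \<gamma> cancels, so each inner sum is geometric.\<close>

lemma norm_cubic_second_difference_le:
  fixes N h :: int
  assumes N: "N \<ge> 1" and \<phi>: "\<And>x. \<phi> x = \<alpha> * of_int x ^ 3 + \<gamma> * of_int x"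
  shows "(norm (\<Sum>y\<in>{max 1 (1 - h)..min N (N - h)}. ee (\<phi> (y + h) - \<phi> y)))\<^sup>2
     \<le> (\<Sum>k\<in>{-N<..<N}. recip_cap (of_int N) (6 * \<alpha> * of_int (h * k)))"
proof -
  define A B where "A = max 1 (1 - h)" and "B = min N (N - h)"
  define \<psi> where "\<psi> y = \<phi> (y + h) - \<phi> y" for y
  have AB: "B - A < N" by (auto simp: A_def B_def)
  have "(norm (\<Sum>y\<in>{A..B}. ee (\<psi> y)))\<^sup>2
      \<le> (\<Sum>k\<in>{-N<..<N}. norm (\<Sum>y\<in>{max A (A - k)..min B (B - k)}. ee (\<psi> (y + k) - \<psi> y)))"
    by (rule norm_sum_squared_le[OF AB])
  also have "\<dots> \<le> (\<Sum>k\<in>{-N<..<N}. recip_cap (of_int N) (6 * \<alpha> * of_int (h * k)))"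
  proof (rule sum_mono)
    fix k :: int
    have "\<psi> (y + k) - \<psi> y = 6 * \<alpha> * of_int (h * k) * of_int y + 3 * \<alpha> * of_int (h * k * (h + k))" for y
      by (simp add: \<psi>_def \<phi> power3_eq_cube algebra_simps)
    then show "norm (\<Sum>y\<in>{max A (A - k)..min B (B - k)}. ee (\<psi> (y + k) - \<psi> y)) \<le> recip_cap (of_int N) (6 * \<alpha> * of_int (h * k))"
      using norm_geometric_sum_ee_le[of "min B (B - k)" "max A (A - k)" N "6 * \<alpha> * of_int (h * k)"] AB N
      by simp
  qed
  finally show ?thesis by (simp add: A_def B_def \<psi>_def)
qed

text \<open>The shifts with h k = 0 contribute n^3 trivially; the others are grouped by the value 6
  |h k|, which has few factorisations. The linear coefficient \<gamma> comes for free and is what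
  later allows twisted Gauss sums. The constant is 216 = 8 + 192 + 16, the largest total among the
  three terms.\<close>

lemma weyl_cubic:
  assumes tm: "tame P D" and n: "1 \<le> n" "n \<le> P" and q: "1 \<le> q" "q \<le> 1000 * P\<^sup>2"
    and cop: "coprime a (int q)" and ap: "\<bar>\<alpha> - of_int a / of_nat q\<bar> \<le> 1 / (real q)\<^sup>2"
  shows "norm (\<Sum>x\<in>{1..int n}. ee (\<alpha> * of_int x ^ 3 + \<gamma> * of_int x)) ^ 4
    \<le> 216 * D\<^sup>2 * (real n ^ 3 + real n ^ 4 / real q + real n * real q)"
proof -
  define N where "N = int n"
  define \<phi> where "\<phi> x = \<alpha> * of_int x ^ 3 + \<gamma> * of_int x" for x :: int
  define G where "G m = recip_cap (real n) (\<alpha> * real m)" for m :: nat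
  have D: "D \<ge> 1" using tm by (simp add: tame_def)
  have N: "N \<ge> 1" "of_int N = real n" using n by (auto simp: N_def)
  have G: "G m \<ge> 0" "G m \<le> real n" for m using recip_cap_nonneg recip_cap_le by (auto simp: G_def)
  let ?H = "{-N<..<N}"
  define g where "g t = G (nat (6 * \<bar>fst t * snd t\<bar>))" for t :: "int \<times> int"
  have g: "recip_cap (of_int N) (6 * \<alpha> * of_int (h * k)) = g (h, k)" for h k :: int
  proof (cases "h * k \<ge> 0")
    case True
    then show ?thesis by (simp add: g_def G_def N mult.assoc mult.left_commute)
  next
    case False
    then have "real (nat (6 * \<bar>h * k\<bar>)) = - (6 * of_int (h * k))" by simp
    then have "g (h, k) = recip_cap (real n) (- (6 * \<alpha> * of_int (h * k)))"
      by (simp add: g_def G_def algebra_simps)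
    then show ?thesis by (simp only: recip_cap_minus N)
  qed
  define T0 where "T0 = {t \<in> ?H \<times> ?H. fst t * snd t = 0}"
  define T1 where "T1 = {t \<in> ?H \<times> ?H. fst t * snd t \<noteq> 0}"
  have "norm (\<Sum>x\<in>{1..N}. ee (\<phi> x)) ^ 4
     \<le> 2 * of_int N * (\<Sum>h\<in>?H. (norm (\<Sum>y\<in>{max 1 (1 - h)..min N (N - h)}. ee (\<phi> (y + h) - \<phi> y)))\<^sup>2)"
    by (rule norm_sum_pow4_le[OF N(1)])
  also have "\<dots> \<le> 2 * of_int N * (\<Sum>h\<in>?H. \<Sum>k\<in>?H. g (h, k))"
    unfolding g[symmetric] using N
    by (intro mult_left_mono sum_mono norm_cubic_second_difference_le[OF N(1) \<phi>_def]) auto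
  also have "(\<Sum>h\<in>?H. \<Sum>k\<in>?H. g (h, k)) = (\<Sum>t\<in>T0 \<union> T1. g t)"
    unfolding sum.cartesian_product by (rule sum.cong) (auto simp: T0_def T1_def)
  also have "\<dots> = (\<Sum>t\<in>T0. g t) + (\<Sum>t\<in>T1. g t)"
    by (rule sum.union_disjoint) (auto simp: T0_def T1_def)
  also have "(\<Sum>t\<in>T0. g t) \<le> 4 * (real n)\<^sup>2"
  proof -
    have "T0 \<subseteq> {0} \<times> ?H \<union> ?H \<times> {0}" by (auto simp: T0_def)
    then have "card T0 \<le> card ({0} \<times> ?H \<union> ?H \<times> {0})" by (intro card_mono) auto
    also have "\<dots> \<le> card ({0::int} \<times> ?H) + card (?H \<times> {0::int})" by (rule card_Un_le)
    also have "\<dots> \<le> 4 * n" by (simp add: card_cartesian_product N_def)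
    finally have "real (card T0) \<le> 4 * real n" by linarith
    moreover have "(\<Sum>t\<in>T0. g t) \<le> (\<Sum>t\<in>T0. real n)" by (intro sum_mono) (simp add: g_def G)
    ultimately show ?thesis using mult_right_mono[of "real (card T0)" "4 * real n" "real n"]
      by (simp add: power2_eq_square)
  qed
  also have "(\<Sum>t\<in>T1. g t) \<le> (4 * D) * (\<Sum>m=1..6 * n\<^sup>2. G m)"
    unfolding g_def
  proof (rule sum_le_card_fibre)
    fix t assume "t \<in> T1"
    then obtain h k where t: "t = (h, k)" "h * k \<noteq> 0" "\<bar>h\<bar> \<le> N" "\<bar>k\<bar> \<le> N" by (auto simp: T1_def)
    have "\<bar>h\<bar> * \<bar>k\<bar> \<le> N * N" using t N by (intro mult_mono) auto
    then have "nat (6 * \<bar>h * k\<bar>) \<le> 6 * n\<^sup>2" by (simp add: N_def abs_mult power2_eq_square nat_le_iff)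
    moreover have "\<bar>h * k\<bar> \<ge> 1" using t(2) by linarith
    ultimately show "nat (6 * \<bar>fst t * snd t\<bar>) \<in> {1..6 * n\<^sup>2}" by (simp add: t(1) le_nat_iff)
  next
    fix m assume m: "m \<in> {1..6 * n\<^sup>2}"
    have "n\<^sup>2 \<le> P ^ 3"
      using n power_mono[of n P 2] power_increasing[of 2 3 P] by linarith
    then have "real (card {d. d dvd m}) \<le> D" using m by (intro tame_divisors[OF tm]) auto
    moreover have "card {t \<in> T1. nat (6 * \<bar>fst t * snd t\<bar>) = m} \<le> 4 * card {d. d dvd m}"
    proof (rule order_trans[OF card_mono card_mult_eq_le])
      show "finite {t \<in> ?H \<times> ?H. nat (6 * \<bar>fst t * snd t\<bar>) = m}" by simp
    qed (use m in \<open>auto simp: T1_def\<close>)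
    ultimately show "real (card {t \<in> T1. nat (6 * \<bar>fst t * snd t\<bar>) = m}) \<le> 4 * D" by linarith
  qed (auto simp: T1_def G)
  also have "(\<Sum>m=1..6 * n\<^sup>2. G m) \<le> (2 * real (6 * n\<^sup>2) / real q + 1) * (2 * real n + 2 * real q * D)"
    unfolding G_def using q
    by (intro sum_recip_cap_le[OF q(1) cop ap] tame_harmonic[OF tm]) auto
  finally have 1: "norm (\<Sum>x\<in>{1..N}. ee (\<phi> x)) ^ 4
      \<le> 2 * real n * (4 * (real n)\<^sup>2 + 4 * D * ((12 * (real n)\<^sup>2 / real q + 1) * (2 * real n + 2 * real q * D)))"
    using D N by simp
  have "2 * x * (4 * x\<^sup>2 + 4 * D * ((12 * x\<^sup>2 / r + 1) * (2 * x + 2 * r * D))) \<le> 216 * D\<^sup>2 * (x ^ 3 + x ^ 4 / r + x * r)"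
    if "x \<ge> 1" "r \<ge> 1" for x r :: real
  proof -
    have "2 * x * (4 * x\<^sup>2 + 4 * D * ((12 * x\<^sup>2 / r + 1) * (2 * x + 2 * r * D)))
       = 8 * x ^ 3 + D * (192 * (x ^ 4 / r)) + D\<^sup>2 * (192 * x ^ 3) + D * (16 * x\<^sup>2) + D\<^sup>2 * (16 * (x * r))"
      using that by (simp add: power2_eq_square power3_eq_cube power4_eq_xxxx field_simps)
    also have "\<dots> \<le> D\<^sup>2 * (8 * x ^ 3) + D\<^sup>2 * (192 * (x ^ 4 / r)) + D\<^sup>2 * (192 * x ^ 3) + D\<^sup>2 * (16 * x ^ 3) + D\<^sup>2 * (16 * (x * r))"
    proof -
      have d: "1 \<le> D\<^sup>2" "D \<le> D\<^sup>2" using D one_le_power[of D 2] self_le_power[of D 2] by auto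
      have "8 * x ^ 3 \<le> D\<^sup>2 * (8 * x ^ 3)" using d that mult_right_mono[of 1 "D\<^sup>2" "8 * x ^ 3"] by simp
      moreover have "D * (192 * (x ^ 4 / r)) \<le> D\<^sup>2 * (192 * (x ^ 4 / r))" using d that by (intro mult_right_mono) auto
      moreover have "D * (16 * x\<^sup>2) \<le> D\<^sup>2 * (16 * x ^ 3)" using d that D
        by (intro mult_mono) (auto intro: power_increasing)
      ultimately show ?thesis by linarith
    qed
    also have "\<dots> \<le> 216 * D\<^sup>2 * (x ^ 3 + x ^ 4 / r + x * r)"
    proof -
      have "0 \<le> D\<^sup>2 * (x ^ 4 / r)" "0 \<le> D\<^sup>2 * (x * r)" "0 \<le> D\<^sup>2 * x ^ 3" using that by auto
      moreover have "a * (8 * u) + a * (192 * v) + a * (192 * u) + a * (16 * u) + a * (16 * w) \<le> 216 * a * (u + v + w)"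
        if "0 \<le> a * v" "0 \<le> a * w" "0 \<le> a * u" for a u v w :: real
        using that by (simp add: algebra_simps)
      ultimately show ?thesis by blast
    qed
    finally show ?thesis .
  qed
  from this[of "real n" "real q"] n q 1 show ?thesis by (simp add: N_def \<phi>_def)
qed

section \<open>Cubic Gauss sums\<close>

text \<open>The sum \<open>gauss_sum 3\<close> with residues counted from 0 and an integer
  numerator, so that a may be replaced by any number congruent to it or multiplied freely.\<close>

definition gauss3 :: "nat \<Rightarrow> int \<Rightarrow> complex" where
  "gauss3 q a = (\<Sum>r<q. ee (of_int (a * int r ^ 3) / real q))"

lemma ee_cong_dvd:
  assumes "int q dvd x - y" "q \<ge> 1"
  shows "ee (of_int x / real q) = ee (of_int y / real q)"
proof -
  from assms(1) obtain k where "x = y + int q * k" by (metis add.commute diff_add_cancel dvdE)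
  then have "of_int x / real q = of_int y / real q + of_int k" using assms(2) by (simp add: field_simps)
  then show ?thesis by (simp only: ee_add_int)
qed

lemma gauss_sum_eq_gauss3:
  assumes "q \<ge> 1"
  shows "gauss_sum 3 q a = gauss3 q (int a)"
proof -
  let ?h = "\<lambda>r::nat. ee (of_int (int a * int r ^ 3) / real q)"
  have tm: "e (of_nat a * of_nat r ^ 3 / of_nat q) = ?h r" for r
    unfolding e_of_real[symmetric] by simp
  have "?h q = ?h 0" using assms by (intro ee_cong_dvd) (auto simp: power3_eq_cube)
  moreover have "{1..q} = insert q {1..<q}" "{..<q} = insert 0 {1..<q}" using assms by auto
  ultimately show ?thesis by (simp add: gauss_sum_def gauss3_def tm)
qed

lemma norm_gauss3_le: "norm (gauss3 q a) \<le> real q"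
  unfolding gauss3_def by (rule order_trans[OF norm_sum]) simp

lemma gauss3_cong:
  assumes "int q dvd a - b" "q \<ge> 1"
  shows "gauss3 q a = gauss3 q b"
  unfolding gauss3_def
proof (rule sum.cong[OF refl], rule ee_cong_dvd[OF _ assms(2)])
  fix r
  have "a * int r ^ 3 - b * int r ^ 3 = (a - b) * int r ^ 3" by (simp add: algebra_simps)
  then show "int q dvd a * int r ^ 3 - b * int r ^ 3" using assms by simp
qed

text \<open>A map that is injective modulo q and preserves A modulo q permutes A. The set A is all
  residues for dilations, and one residue class modulo p for translations.\<close>

lemma sum_residues_bij:
  fixes f :: "nat \<Rightarrow> int" and h :: "int \<Rightarrow> complex"
  assumes fin: "finite A" and q: "q \<ge> 1" and cong: "\<And>x y. int q dvd x - y \<Longrightarrow> h x = h y"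
    and inj: "\<And>x y. x \<in> A \<Longrightarrow> y \<in> A \<Longrightarrow> int q dvd f x - f y \<Longrightarrow> x = y" and A: "A \<subseteq> {..<q}"
    and into: "\<And>x. x \<in> A \<Longrightarrow> nat (f x mod int q) \<in> A"
  shows "(\<Sum>x\<in>A. h (f x)) = (\<Sum>x\<in>A. h (int x))"
proof -
  define g where "g x = nat (f x mod int q)" for x
  have ig: "int (g x) = f x mod int q" for x using q by (simp add: g_def)
  have "inj_on g A"
  proof (rule inj_onI)
    fix x y assume xy: "x \<in> A" "y \<in> A" "g x = g y"
    then have "f x mod int q = f y mod int q" using ig by metis
    then show "x = y" using inj xy by (simp add: mod_eq_dvd_iff)
  qed
  moreover have "g ` A \<subseteq> A" using into by (auto simp: g_def)
  ultimately have "g ` A = A" "inj_on g A" using endo_inj_surj[OF fin] by auto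
  then have "(\<Sum>x\<in>A. h (int x)) = (\<Sum>x\<in>A. h (int (g x)))"
    by (metis (mono_tags, lifting) sum.reindex_cong)
  also have "\<dots> = (\<Sum>x\<in>A. h (f x))"
    by (intro sum.cong refl cong) (simp add: ig mod_eq_dvd_iff[symmetric])
  finally show ?thesis by simp
qed

text \<open>Substitution of t r for r, which permutes the residues when t is a unit.\<close>

lemma gauss3_mult_cube:
  assumes "q \<ge> 1" "coprime t (int q)"
  shows "gauss3 q (a * t ^ 3) = gauss3 q a"
proof -
  define h where "h x = ee (of_int (a * x ^ 3) / real q)" for x
  have cong: "h x = h y" if "int q dvd x - y" for x y
    unfolding h_def
  proof (rule ee_cong_dvd[OF _ assms(1)])
    have "a * x ^ 3 - a * y ^ 3 = (x - y) * (a * (x\<^sup>2 + x * y + y\<^sup>2))"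
      by (simp add: power2_eq_square power3_eq_cube algebra_simps)
    then show "int q dvd a * x ^ 3 - a * y ^ 3" using that by simp
  qed
  have "(\<Sum>x<q. h (t * int x)) = (\<Sum>x<q. h (int x))"
  proof (rule sum_residues_bij[OF _ assms(1) cong])
    fix x y assume xy: "x \<in> {..<q}" "y \<in> {..<q}" "int q dvd t * int x - t * int y"
    then have "int q dvd t * (int x - int y)" by (simp add: right_diff_distrib)
    then have "int q dvd int x - int y"
      using assms(2) by (simp add: coprime_commute coprime_dvd_mult_right_iff)
    then show "x = y" using xy by (simp add: mod_eq_dvd_iff[symmetric] zmod_int[symmetric])
  next
    fix x assume "x \<in> {..<q}"
    then show "nat (t * int x mod int q) \<in> {..<q}" by (simp add: nat_less_iff)
  qed auto
  then show ?thesis by (simp add: h_def gauss3_def power_mult_distrib mult.assoc)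
qed

text \<open>Chinese remainder theorem in the form r = q2 x + q1 y: in the cube of r both mixed terms
  are divisible by q1 q2, so the phase splits.\<close>

lemma gauss3_mult:
  assumes cop: "coprime q1 q2" and q: "q1 \<ge> 1" "q2 \<ge> 1"
  shows "gauss3 (q1 * q2) a = gauss3 q1 (a * int q2 ^ 2) * gauss3 q2 (a * int q1 ^ 2)"
proof -
  define g where "g = (\<lambda>(x, y). (q2 * x + q1 * y) mod (q1 * q2))"
  let ?A = "{..<q1} \<times> {..<q2}"
  have inj: "inj_on g ?A"
  proof (rule inj_onI)
    fix s t assume st: "s \<in> ?A" "t \<in> ?A" "g s = g t"
    obtain x y x' y' where xy: "s = (x, y)" "t = (x', y')" by (cases s, cases t)
    have lt: "x < q1" "x' < q1" "y < q2" "y' < q2" and eq: "g (x, y) = g (x', y')" using st xy by auto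
    have "int (q1 * q2) dvd int (q2 * x + q1 * y) - int (q2 * x' + q1 * y')"
      using eq by (simp add: g_def mod_eq_dvd_iff[symmetric] zmod_int[symmetric] del: of_nat_mult of_nat_add)
    then have d: "int q1 * int q2 dvd int q2 * (int x - int x') + int q1 * (int y - int y')"
      by (simp add: algebra_simps)
    then have "int q1 dvd int q2 * (int x - int x')"
      by (meson dvd_add_left_iff dvd_mult_left dvd_triv_left)
    then have 1: "int q1 dvd int x - int x'" using cop by (simp add: coprime_dvd_mult_right_iff)
    have "int q2 dvd int q1 * (int y - int y')"
      using d by (meson dvd_add_right_iff dvd_mult_right dvd_triv_left)
    then have 2: "int q2 dvd int y - int y'" using cop by (simp add: coprime_dvd_mult_right_iff coprime_commute)
    show "s = t"
      using 1 2 lt by (simp add: xy mod_eq_dvd_iff[symmetric] zmod_int[symmetric])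
  qed
  have "g ` ?A \<subseteq> {..<q1 * q2}" using q by (auto simp: g_def)
  moreover have "card (g ` ?A) = card {..<q1 * q2}" using inj by (simp add: card_image)
  ultimately have im: "g ` ?A = {..<q1 * q2}" by (intro card_subset_eq) auto
  have "gauss3 (q1 * q2) a = (\<Sum>t\<in>?A. ee (of_int (a * int (g t) ^ 3) / real (q1 * q2)))"
    unfolding gauss3_def im[symmetric] using inj by (simp add: sum.reindex)
  also have "\<dots> = (\<Sum>(x, y)\<in>?A. ee (of_int (a * int q2 ^ 2 * int x ^ 3) / real q1) * ee (of_int (a * int q1 ^ 2 * int y ^ 3) / real q2))"
  proof (rule sum.cong[OF refl], clarify)
    fix x y
    have gm: "int (q1 * q2) dvd int (g (x, y)) - int (q2 * x + q1 * y)"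
      by (simp add: g_def mod_eq_dvd_iff[symmetric] zmod_int del: of_nat_mult of_nat_add)
    have "ee (of_int (a * int (g (x, y)) ^ 3) / real (q1 * q2))
       = ee (of_int (a * int q2 ^ 3 * int x ^ 3 + a * int q1 ^ 3 * int y ^ 3) / real (q1 * q2))"
    proof (rule ee_cong_dvd)
      let ?u = "int (g (x, y))" and ?v = "int q2 * int x + int q1 * int y"
      have "a * ?u ^ 3 - (a * int q2 ^ 3 * int x ^ 3 + a * int q1 ^ 3 * int y ^ 3)
         = (?u - ?v) * (a * (?u\<^sup>2 + ?u * ?v + ?v\<^sup>2)) + int q1 * int q2 * (3 * a * int x * int y * ?v)"
        by (simp add: power2_eq_square power3_eq_cube algebra_simps)
      then show "int (q1 * q2) dvd a * ?u ^ 3 - (a * int q2 ^ 3 * int x ^ 3 + a * int q1 ^ 3 * int y ^ 3)"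
        using gm by (auto intro!: dvd_add)
    qed (use q in simp)
    also have "of_int (a * int q2 ^ 3 * int x ^ 3 + a * int q1 ^ 3 * int y ^ 3) / real (q1 * q2)
       = of_int (a * int q2 ^ 2 * int x ^ 3) / real q1 + of_int (a * int q1 ^ 2 * int y ^ 3) / real q2"
    proof -
      have aux: "(A * v ^ 3 * X + A * u ^ 3 * Y) / (u * v) = A * v\<^sup>2 * X / u + A * u\<^sup>2 * Y / v"
        if "u \<noteq> 0" "v \<noteq> 0" for A u v X Y :: real
      proof -
        have "A * v ^ 3 * X = (A * v\<^sup>2 * X) * v" "A * u ^ 3 * Y = (A * u\<^sup>2 * Y) * u"
          by (simp_all add: power2_eq_square power3_eq_cube)
        then show ?thesis by (simp only: add_frac_eq[OF that])
      qed
      show ?thesis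
        unfolding of_int_add of_int_mult of_int_power of_int_of_nat_eq of_nat_mult
        by (rule aux) (use q in auto)
    qed
    finally show "ee (of_int (a * int (g (x, y)) ^ 3) / real (q1 * q2))
        = ee (of_int (a * int q2 ^ 2 * int x ^ 3) / real q1) * ee (of_int (a * int q1 ^ 2 * int y ^ 3) / real q2)"
      by (simp only: ee_add)
  qed
  also have "\<dots> = gauss3 q1 (a * int q2 ^ 2) * gauss3 q2 (a * int q1 ^ 2)"
    by (simp add: gauss3_def sum_product sum.cartesian_product)
  finally show ?thesis .
qed

text \<open>Divided differences: two roots give x^2 + x y + y^2 = 0 modulo p, three give x + y + z =
  0, and a fourth would coincide with another.\<close>

lemma card_cube_roots_le:
  assumes p: "prime p"
  shows "card {x. x < p \<and> int p dvd int x ^ 3 - n} \<le> 3" (is "card ?A \<le> 3")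
proof (rule ccontr)
  assume "\<not> ?thesis"
  then have "4 \<le> card ?A" by simp
  then obtain T where T: "T \<subseteq> ?A" "card T = 4" by (rule obtain_subset_with_card_n)
  then obtain x1 B where B: "T = insert x1 B" "x1 \<notin> B" "card B = 3"
    using card_eq_SucD[of T 3] by fastforce
  then obtain x2 x3 x4 where B3: "B = {x2, x3, x4}" and ne3: "x2 \<noteq> x3" "x2 \<noteq> x4" "x3 \<noteq> x4"
    by (metis card_3_iff)
  have "{x1, x2, x3, x4} \<subseteq> ?A" using T(1) unfolding B(1) B3 .
  then have x: "x1 \<in> ?A" "x2 \<in> ?A" "x3 \<in> ?A" "x4 \<in> ?A" by (simp_all only: insert_subset)
  have "x1 \<noteq> x2" "x1 \<noteq> x3" "x1 \<noteq> x4" using B(2) unfolding B3 by simp_all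
  note ne = this ne3
  have pi: "prime (int p)" using p by simp
  have ndvd: "\<not> int p dvd int x - int y" if "x \<in> ?A" "y \<in> ?A" "x \<noteq> y" for x y
    using that by (simp add: mod_eq_dvd_iff[symmetric] zmod_int[symmetric])
  have quad: "int p dvd (int x)\<^sup>2 + int x * int y + (int y)\<^sup>2" if "x \<in> ?A" "y \<in> ?A" "x \<noteq> y" for x y
  proof -
    have "int p dvd (int x ^ 3 - n) - (int y ^ 3 - n)" by (rule dvd_diff) (use that in auto)
    also have "(int x ^ 3 - n) - (int y ^ 3 - n) = (int x - int y) * ((int x)\<^sup>2 + int x * int y + (int y)\<^sup>2)"
      by (simp add: power2_eq_square power3_eq_cube algebra_simps)
    finally show ?thesis using ndvd[OF that] pi by (simp add: prime_dvd_mult_iff)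
  qed
  have lin: "int p dvd int x + int y + int z" if "x \<in> ?A" "y \<in> ?A" "z \<in> ?A" "x \<noteq> y" "x \<noteq> z" "y \<noteq> z" for x y z
  proof -
    have "int p dvd ((int x)\<^sup>2 + int x * int y + (int y)\<^sup>2) - ((int x)\<^sup>2 + int x * int z + (int z)\<^sup>2)"
      using quad that by (intro dvd_diff) auto
    also have "\<dots> = (int y - int z) * (int x + int y + int z)"
      by (simp add: power2_eq_square algebra_simps)
    finally show ?thesis using ndvd[of y z] that pi by (simp add: prime_dvd_mult_iff)
  qed
  have "int p dvd (int x1 + int x2 + int x3) - (int x4 + int x2 + int x3)"
    using lin x ne by (intro dvd_diff) auto
  then show False using ndvd[of x1 x4] x ne by simp
qed

text \<open>Parseval modulo p: the Fourier coefficient of b -> S(p, b) at n is the number of cube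
  roots of n, which is at most 3, and these numbers add up to at most p.\<close>

lemma sum_norm_gauss3_squared_le:
  assumes p: "prime p"
  shows "(\<Sum>b<p. (norm (gauss3 p (int b)))\<^sup>2) \<le> 3 * (real p)\<^sup>2"
proof -
  have p0: "p > 0" using p prime_gt_0_nat by blast
  define c where "c n = card {x. x < p \<and> int p dvd int x ^ 3 - int n}" for n
  have "hat p (\<lambda>j. gauss3 p (int j)) (int n) = of_nat (c n)" for n
  proof -
    have "hat p (\<lambda>j. gauss3 p (int j)) (int n) = (\<Sum>x | x \<in> {..<p} \<and> int p dvd int x ^ 3 - int n. 1)"
      by (rule hat_trig_poly[OF p0]) (auto simp: gauss3_def)
    then show ?thesis by (simp add: c_def)
  qed
  then have "(\<Sum>b<p. (norm (gauss3 p (int b)))\<^sup>2) = real p * (\<Sum>n<p. (real (c n))\<^sup>2)"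
    using hat_parseval[OF p0, of "\<lambda>j. gauss3 p (int j)"] p0 by (simp add: field_simps)
  also have "(\<Sum>n<p. (real (c n))\<^sup>2) \<le> (\<Sum>n<p. 3 * real (c n))"
    using card_cube_roots_le[OF p] by (intro sum_mono) (auto simp: power2_eq_square c_def intro!: mult_right_mono)
  also have "\<dots> = 3 * real (\<Sum>n<p. c n)" by (simp add: sum_distrib_left)
  also have "(\<Sum>n<p. c n) = card (\<Union>n\<in>{..<p}. {x. x < p \<and> int p dvd int x ^ 3 - int n})"
    unfolding c_def
  proof (rule card_UN_disjoint[symmetric]; (intro ballI impI)?)
    fix i j assume ij: "i \<in> {..<p}" "j \<in> {..<p}" "i \<noteq> j"
    have "\<not> int p dvd int i - int j"
      using ij by (simp add: mod_eq_dvd_iff[symmetric] zmod_int[symmetric])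
    moreover have "int p dvd int i - int j" if "int p dvd int x ^ 3 - int i" "int p dvd int x ^ 3 - int j" for x
      using dvd_diff[OF that(2,1)] by simp
    ultimately show "{x. x < p \<and> int p dvd int x ^ 3 - int i} \<inter> {x. x < p \<and> int p dvd int x ^ 3 - int j} = {}" by blast
  qed auto
  also have "\<dots> \<le> card {..<p}" by (intro card_mono) auto
  finally have "(\<Sum>b<p. (norm (gauss3 p (int b)))\<^sup>2) \<le> real p * (3 * real p)" by (simp add: mult_left_mono)
  then show ?thesis by (simp add: power2_eq_square)
qed

text \<open>The values at \<open>a t\<^sup>3\<close> all agree and cover at least a third of the nonzero residues,
  so that the second moment controls each single sum.\<close>

lemma norm_gauss3_prime_le:
  assumes p: "prime p" and a: "\<not> int p dvd a"
  shows "norm (gauss3 p a) \<le> 4 * sqrt (real p)"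
proof -
  have p2: "p \<ge> 2" using p prime_ge_2_nat by blast
  have pi: "prime (int p)" using p by simp
  have p1: "p \<ge> 1" using p2 by simp
  define \<phi> where "\<phi> t = nat (a * int t ^ 3 mod int p)" for t
  have i\<phi>: "int (\<phi> t) = a * int t ^ 3 mod int p" for t using p1 by (simp add: \<phi>_def)
  have same: "gauss3 p (int (\<phi> t)) = gauss3 p a" if "t \<in> {1..<p}" for t
  proof -
    have "\<not> int p dvd int t" using that by (auto dest: nat_dvd_not_less)
    then have "coprime (int t) (int p)" using pi by (metis coprime_commute prime_imp_coprime)
    then have "gauss3 p (a * int t ^ 3) = gauss3 p a" using p1 by (intro gauss3_mult_cube)
    moreover have "gauss3 p (int (\<phi> t)) = gauss3 p (a * int t ^ 3)"
      using p1 by (intro gauss3_cong) (simp_all add: i\<phi> mod_eq_dvd_iff[symmetric])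
    ultimately show ?thesis by simp
  qed
  have "real (p - 1) * (norm (gauss3 p a))\<^sup>2 = (\<Sum>t\<in>{1..<p}. (norm (gauss3 p (int (\<phi> t))))\<^sup>2)"
    by (simp add: same)
  \<comment> \<open>At most three t give the same residue a t^3, by the count of cube roots.\<close>
  also have "\<dots> \<le> 3 * (\<Sum>b\<in>{1..<p}. (norm (gauss3 p (int b)))\<^sup>2)"
  proof (rule sum_le_card_fibre[where g = "\<lambda>b. (norm (gauss3 p (int b)))\<^sup>2"])
    fix t assume t: "t \<in> {1..<p}"
    have "\<not> int p dvd int t" using t by (auto dest: nat_dvd_not_less)
    then have "\<not> int p dvd a * int t ^ 3" using a pi by (simp add: prime_dvd_mult_iff prime_dvd_power_iff)
    then have "a * int t ^ 3 mod int p \<noteq> 0" by auto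
    moreover have "\<phi> t < p" using p1 by (simp add: \<phi>_def nat_less_iff)
    ultimately show "\<phi> t \<in> {1..<p}" using i\<phi>[of t] by (cases "\<phi> t") auto
  next
    fix m assume "m \<in> {1..<p}"
    show "real (card {t \<in> {1..<p}. \<phi> t = m}) \<le> 3"
    proof (cases "{t \<in> {1..<p}. \<phi> t = m} = {}")
      case False
      then obtain s where s: "s \<in> {1..<p}" "\<phi> s = m" by blast
      have "{t \<in> {1..<p}. \<phi> t = m} \<subseteq> {x. x < p \<and> int p dvd int x ^ 3 - int s ^ 3}"
      proof clarify
        fix t assume t: "t \<in> {1..<p}" "m = \<phi> t"
        then have "a * int t ^ 3 mod int p = a * int s ^ 3 mod int p" using i\<phi> s by metis
        then have "int p dvd a * (int t ^ 3 - int s ^ 3)" by (simp add: mod_eq_dvd_iff right_diff_distrib)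
        then show "t < p \<and> int p dvd int t ^ 3 - int s ^ 3" using a pi t by (simp add: prime_dvd_mult_iff)
      qed
      then have "card {t \<in> {1..<p}. \<phi> t = m} \<le> card {x. x < p \<and> int p dvd int x ^ 3 - int s ^ 3}"
        by (intro card_mono) auto
      with card_cube_roots_le[OF p, of "int s ^ 3"] show ?thesis by linarith
    next
      case True
      then show ?thesis by (metis card.empty of_nat_0 zero_le_numeral)
    qed
  qed auto
  \<comment> \<open>Removing b = 0, where the sum equals p, lowers the second moment from 3 p^2 to 2
    p^2.\<close>
  also have "(\<Sum>b\<in>{1..<p}. (norm (gauss3 p (int b)))\<^sup>2) = (\<Sum>b<p. (norm (gauss3 p (int b)))\<^sup>2) - (real p)\<^sup>2"
  proof -
    have "{..<p} = insert 0 {1..<p}" using p1 by auto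
    moreover have "gauss3 p 0 = of_nat p" by (simp add: gauss3_def)
    ultimately show ?thesis by simp
  qed
  also have "3 * \<dots> \<le> 6 * (real p)\<^sup>2" using sum_norm_gauss3_squared_le[OF p] by simp
  finally have "real (p - 1) * (norm (gauss3 p a))\<^sup>2 \<le> 6 * (real p)\<^sup>2" .
  \<comment> \<open>Since p <= 2 (p - 1), the square of the sum is at most 12 p, which is below 16
    p.\<close>
  moreover have "real p * (norm (gauss3 p a))\<^sup>2 \<le> 2 * (real (p - 1) * (norm (gauss3 p a))\<^sup>2)"
    using p2 mult_right_mono[of "real p" "2 * real (p - 1)" "(norm (gauss3 p a))\<^sup>2"] by (simp add: of_nat_diff algebra_simps)
  ultimately have "real p * (norm (gauss3 p a))\<^sup>2 \<le> real p * (12 * real p)" by (simp add: power2_eq_square)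
  then have "(norm (gauss3 p a))\<^sup>2 \<le> (4 * sqrt (real p))\<^sup>2" using p1 by (simp add: power_mult_distrib)
  then show ?thesis by (rule power2_le_imp_le) simp
qed

text \<open>Translation by \<open>T\<close> preserves the residue class of \<open>r\<close> modulo \<open>p\<close> and multiplies the summand by
  a root of unity that depends only on this class, so all classes but \<open>0\<close> contribute nothing.\<close>

lemma gauss3_eq_sum_multiples:
  fixes T c :: int
  assumes p: "prime p" and q: "q \<ge> 1" "p dvd q" and T: "int q dvd T ^ 3" "int q dvd 3 * T\<^sup>2" "int p dvd T"
    and c: "3 * T * int p = c * int q" "\<not> int p dvd c" and a: "\<not> int p dvd a"
  shows "gauss3 q a = (\<Sum>r | r < q \<and> p dvd r. ee (of_int (a * int r ^ 3) / real q))"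
proof -
  have pi: "prime (int p)" and p1: "p \<ge> 1" using p prime_ge_1_nat by auto
  define h where "h x = ee (of_int (a * x ^ 3) / real q)" for x
  have cong: "h x = h y" if "int q dvd x - y" for x y
    unfolding h_def
  proof (rule ee_cong_dvd[OF _ q(1)])
    have "a * x ^ 3 - a * y ^ 3 = (x - y) * (a * (x\<^sup>2 + x * y + y\<^sup>2))"
      by (simp add: power2_eq_square power3_eq_cube algebra_simps)
    then show "int q dvd a * x ^ 3 - a * y ^ 3" using that by simp
  qed
  define A where "A s = {r. r < q \<and> r mod p = s}" for s
  have zero: "(\<Sum>r\<in>A s. h (int r)) = 0" if s: "s \<in> {1..<p}" for s
  proof -
    \<comment> \<open>In (r + T)^3 only 3 r^2 T survives modulo q besides r^3, and 3 T/q = c/p, so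
      the rotation is e(a c r^2/p). It is not 1 because p divides none of a, c, s.\<close>
    define \<zeta> where "\<zeta> = ee (of_int (a * c * int s ^ 2) / real p)"
    have shift: "h (int r + T) = \<zeta> * h (int r)" if r: "r \<in> A s" for r
    proof -
      have rs: "int p dvd int r - int s" using r
        by (simp add: A_def mod_eq_dvd_iff[symmetric] zmod_int[symmetric]) (metis mod_mod_trivial)
      have "h (int r + T) = ee (of_int (a * int r ^ 3 + a * int r ^ 2 * (3 * T)) / real q)"
        unfolding h_def
      proof (rule ee_cong_dvd[OF _ q(1)])
        have "a * (int r + T) ^ 3 - (a * int r ^ 3 + a * int r ^ 2 * (3 * T)) = a * int r * (3 * T\<^sup>2) + a * T ^ 3"
          by (simp add: power2_eq_square power3_eq_cube algebra_simps)
        then show "int q dvd a * (int r + T) ^ 3 - (a * int r ^ 3 + a * int r ^ 2 * (3 * T))"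
          using T by simp
      qed
      also have "of_int (a * int r ^ 2 * (3 * T)) / real q = of_int (a * c * int r ^ 2) / real p"
      proof -
        have "real_of_int (3 * T) * real p = of_int c * real q"
          using c(1) by (metis of_int_mult of_int_of_nat_eq)
        then have "real_of_int (3 * T) / real q = of_int c / real p"
          using q(1) p1 by (simp add: field_simps)
        moreover have "of_int (a * int r ^ 2 * (3 * T)) / real q = real_of_int (a * int r ^ 2) * (real_of_int (3 * T) / real q)"
          by simp
        ultimately show ?thesis by simp
      qed
      then have "ee (of_int (a * int r ^ 3 + a * int r ^ 2 * (3 * T)) / real q) = ee (of_int (a * c * int r ^ 2) / real p) * h (int r)"
        unfolding of_int_add add_divide_distrib ee_add h_def by simp
      also have "ee (of_int (a * c * int r ^ 2) / real p) = \<zeta>"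
        unfolding \<zeta>_def
      proof (rule ee_cong_dvd[OF _ p1])
        have "a * c * int r ^ 2 - a * c * int s ^ 2 = (int r - int s) * (a * c * (int r + int s))"
          by (simp add: power2_eq_square algebra_simps)
        then show "int p dvd a * c * int r ^ 2 - a * c * int s ^ 2" using rs by simp
      qed
      finally show ?thesis .
    qed
    have "(\<Sum>r\<in>A s. h (int r + T)) = (\<Sum>r\<in>A s. h (int r))"
    proof (rule sum_residues_bij[OF _ q(1) cong])
      fix x y assume "x \<in> A s" "y \<in> A s" "int q dvd int x + T - (int y + T)"
      then show "x = y" by (simp add: A_def mod_eq_dvd_iff[symmetric] zmod_int[symmetric])
    next
      fix x assume x: "x \<in> A s"
      define y where "y = nat ((int x + T) mod int q)"
      have iy: "int y = (int x + T) mod int q" using q by (simp add: y_def)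
      have "int y mod int p = int x mod int p"
        using q T(3) by (simp add: iy mod_mod_cancel mod_eq_dvd_iff)
      then have "y mod p = s" using x by (simp add: A_def zmod_int[symmetric])
      moreover have "y < q" using q by (simp add: y_def nat_less_iff)
      ultimately show "nat ((int x + T) mod int q) \<in> A s" by (simp add: A_def y_def)
    qed (auto simp: A_def)
    then have "\<zeta> * (\<Sum>r\<in>A s. h (int r)) = (\<Sum>r\<in>A s. h (int r))"
      by (simp add: shift sum_distrib_left)
    moreover have "\<zeta> \<noteq> 1"
    proof
      assume "\<zeta> = 1"
      then obtain k where "of_int (a * c * int s ^ 2) / real p = of_int k"
        by (auto simp: \<zeta>_def ee_eq_1_iff elim: Ints_cases)
      then have "real_of_int (a * c * int s ^ 2) = of_int (k * int p)" using p1 by (simp add: field_simps)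
      then have "a * c * int s ^ 2 = k * int p" by (simp only: of_int_eq_iff)
      then have "int p dvd a * c * int s ^ 2" by simp
      moreover have "\<not> int p dvd int s" using s by (auto dest: nat_dvd_not_less)
      ultimately show False using a c(2) pi by (simp add: prime_dvd_mult_iff prime_dvd_power_iff)
    qed
    ultimately show ?thesis by simp
  qed
  have "gauss3 q a = (\<Sum>s<p. \<Sum>r | r \<in> {..<q} \<and> r mod p = s. h (int r))"
    unfolding gauss3_def h_def by (rule sum.group[symmetric]) (use p1 in auto)
  also have "\<dots> = (\<Sum>s<p. \<Sum>r\<in>A s. h (int r))" by (simp add: A_def)
  also have "\<dots> = (\<Sum>s\<in>insert 0 {1..<p}. \<Sum>r\<in>A s. h (int r))"
    by (rule sum.cong) (use p1 in auto)
  also have "\<dots> = (\<Sum>r\<in>A 0. h (int r))" by (simp add: zero)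
  finally show ?thesis by (simp add: A_def h_def mod_eq_0_iff_dvd)
qed

text \<open>The shift is p^(l-1), with c = 3. For p = 3 this shift would produce a trivial rotation,
  since 3 * 3^(l-1) = q; then 3^(l-2) is used, with c = 1.\<close>

lemma gauss3_prime_power_eq:
  assumes p: "prime p" and l: "l \<ge> 2" "p = 3 \<Longrightarrow> l \<ge> 4" and a: "\<not> int p dvd a"
  shows "gauss3 (p ^ l) a = (\<Sum>w<p ^ (l - 1). ee (of_int (a * (int p * int w) ^ 3) / real (p ^ l)))"
proof -
  have p1: "p \<ge> 1" using p prime_ge_1_nat by auto
  have eq: "gauss3 (p ^ l) a = (\<Sum>r | r < p ^ l \<and> p dvd r. ee (of_int (a * int r ^ 3) / real (p ^ l)))"
  proof (cases "p = 3")
    case True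
    define T where "T = int p ^ (l - 2)"
    have l4: "l \<ge> 4" using l True by simp
    show ?thesis
    proof (rule gauss3_eq_sum_multiples[OF p _ _ _ _ _ _ _ a, where T = T and c = 1])
      have "T ^ 3 = int p ^ ((l - 2) * 3)" by (simp add: T_def power_mult)
      then show "int (p ^ l) dvd T ^ 3" using l4 by (simp add: le_imp_power_dvd)
      have "3 * T\<^sup>2 = int p ^ (1 + (l - 2) * 2)" by (simp add: T_def True power_mult)
      then show "int (p ^ l) dvd 3 * T\<^sup>2" using l4 by (simp only: of_nat_power) (rule le_imp_power_dvd, simp)
      show "int p dvd T" using l4 by (simp add: T_def)
      have "3 * T * int p = int p ^ (1 + (l - 2) + 1)" by (simp add: T_def True power_add)
      moreover have "1 + (l - 2) + 1 = l" using l4 by simp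
      ultimately show "3 * T * int p = 1 * int (p ^ l)" by (simp only: of_nat_power mult_1)
    qed (use p1 l4 True in auto)
  next
    case False
    define T where "T = int p ^ (l - 1)"
    show ?thesis
    proof (rule gauss3_eq_sum_multiples[OF p _ _ _ _ _ _ _ a, where T = T and c = 3])
      have "T ^ 3 = int p ^ ((l - 1) * 3)" by (simp add: T_def power_mult)
      then show "int (p ^ l) dvd T ^ 3" using l by (simp add: le_imp_power_dvd)
      have "T\<^sup>2 = int p ^ ((l - 1) * 2)" by (simp add: T_def power_mult)
      then show "int (p ^ l) dvd 3 * T\<^sup>2" using l by (simp add: le_imp_power_dvd dvd_mult)
      show "int p dvd T" using l by (simp add: T_def)
      have "T * int p = int p ^ Suc (l - 1)" by (simp add: T_def)
      then show "3 * T * int p = 3 * int (p ^ l)" using l by simp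
      show "\<not> int p dvd 3"
      proof
        assume "int p dvd 3"
        then have "p dvd 3" by (metis int_dvd_int_iff of_nat_numeral)
        then show False using p False primes_dvd_imp_eq[of p 3] by simp
      qed
    qed (use p1 l in auto)
  qed
  have pl: "p ^ l = p * p ^ (l - 1)" using l by (cases l) auto
  note eq
  also have "(\<Sum>r | r < p ^ l \<and> p dvd r. ee (of_int (a * int r ^ 3) / real (p ^ l)))
      = (\<Sum>w<p ^ (l - 1). ee (of_int (a * (int p * int w) ^ 3) / real (p ^ l)))"
    by (rule sum.reindex_bij_witness[of _ "\<lambda>w. p * w" "\<lambda>r. r div p"]) (use p1 pl in auto)
  finally show ?thesis .
qed

text \<open>With r = p w the phase becomes a w^3/p^(l-3), and w runs over p^2 complete
  periods.\<close>

lemma gauss3_prime_power_rec: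
  assumes p: "prime p" and l: "l \<ge> 4" and a: "\<not> int p dvd a"
  shows "gauss3 (p ^ l) a = of_nat (p\<^sup>2) * gauss3 (p ^ (l - 3)) a"
proof -
  have p1: "p \<ge> 1" using p prime_ge_1_nat by auto
  define m where "m = p ^ (l - 3)"
  have m: "m \<ge> 1" using p1 by (simp add: m_def)
  have "l = 3 + (l - 3)" "l - 1 = 2 + (l - 3)" using l by auto
  then have pl: "p ^ l = p ^ 3 * m" "p ^ (l - 1) = p\<^sup>2 * m" unfolding m_def by (metis power_add)+
  define h where "h w = ee (of_int (a * int w ^ 3) / real m)" for w
  have "gauss3 (p ^ l) a = (\<Sum>w<p\<^sup>2 * m. ee (of_int (a * (int p * int w) ^ 3) / real (p ^ l)))"
    using gauss3_prime_power_eq[OF p _ _ a, of l] l unfolding pl(2) by simp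
  also have "\<dots> = (\<Sum>w<p\<^sup>2 * m. h w)"
  proof (rule sum.cong[OF refl])
    fix w
    have "x * (y * z) ^ 3 / (y ^ 3 * v) = x * z ^ 3 / v" if "y \<noteq> 0" for x y z v :: real
      using that by (simp add: power_mult_distrib)
    from this[of "real p" "of_int a" "real w" "real m"] p1
    show "ee (of_int (a * (int p * int w) ^ 3) / real (p ^ l)) = h w" by (simp add: pl h_def)
  qed
  also have "\<dots> = (\<Sum>k<p\<^sup>2. \<Sum>w\<in>{k * m..<k * m + m}. h w)" by (rule sum.nat_group[symmetric])
  also have "\<dots> = (\<Sum>k<p\<^sup>2. gauss3 m a)"
  proof (rule sum.cong[OF refl])
    fix k
    have "(\<Sum>w\<in>{k * m..<k * m + m}. h w) = (\<Sum>i<m. h (k * m + i))"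
      by (rule sum.reindex_bij_witness[of _ "\<lambda>i. k * m + i" "\<lambda>w. w - k * m"]) auto
    also have "\<dots> = (\<Sum>i<m. h i)"
    proof (rule sum.cong[OF refl])
      fix i
      show "h (k * m + i) = h i"
        unfolding h_def
      proof (rule ee_cong_dvd[OF _ m])
        let ?x = "int (k * m + i)" and ?y = "int i"
        have "a * ?x ^ 3 - a * ?y ^ 3 = (?x - ?y) * (a * (?x\<^sup>2 + ?x * ?y + ?y\<^sup>2))"
          by (simp add: power2_eq_square power3_eq_cube algebra_simps)
        then show "int m dvd a * ?x ^ 3 - a * ?y ^ 3" by simp
      qed
    qed
    finally show "(\<Sum>w\<in>{k * m..<k * m + m}. h w) = gauss3 m a" by (simp add: gauss3_def h_def)
  qed
  finally show ?thesis by (simp add: m_def)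
qed

text \<open>Once r is restricted to multiples of p, only p^(l-1) terms are left and the trivial
  bound suffices. For p = 3 the trivial bound of the whole sum is 3 p^(l-1), within the factor
  4.\<close>

lemma norm_gauss3_prime_square_cube_le:
  assumes p: "prime p" and l: "l = 2 \<or> l = 3" and a: "\<not> int p dvd a"
  shows "norm (gauss3 (p ^ l) a) \<le> 4 * real p ^ (l - 1)"
proof (cases "p = 3")
  case True
  then show ?thesis using norm_gauss3_le[of "p ^ l" a] l by auto
next
  case False
  have p1: "p \<ge> 1" using p prime_ge_1_nat by auto
  have "norm (gauss3 (p ^ l) a) \<le> (\<Sum>w<p ^ (l - 1). 1)"
    using gauss3_prime_power_eq[OF p _ _ a, of l] l False
    by (auto intro!: order_trans[OF norm_sum])
  also have "\<dots> \<le> 4 * real p ^ (l - 1)" by simp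
  finally show ?thesis .
qed

text \<open>The factorisation records the exponent modulo 3: a remaining p goes into u, a remaining
  p^2 into v^2, and each step of the recursion puts p into b. The saving is the square root of the
  modulus on the parts u and v^2, but only the cube root on b^3.\<close>

lemma gauss3_prime_power_bound:
  assumes p: "prime p"
  shows "l \<ge> 1 \<Longrightarrow> \<exists>u v b. u \<ge> 1 \<and> v \<ge> 1 \<and> b \<ge> 1 \<and> p ^ l = u * v\<^sup>2 * b ^ 3 \<and>
    (\<forall>a. \<not> int p dvd a \<longrightarrow> norm (gauss3 (p ^ l) a) \<le> 4 * real (p ^ l) / (sqrt (real u) * real v * real b))"
proof (induction l rule: less_induct)
  case (less l)
  have p1: "p \<ge> 1" using p prime_ge_1_nat by auto
  consider "l = 1" | "l = 2" | "l = 3" | "l \<ge> 4" using less.prems by linarith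
  then show ?case
  proof cases
    case 1
    have "4 * sqrt (real p) = 4 * real p / sqrt (real p)" using p1 by (simp add: field_simps)
    then show ?thesis using norm_gauss3_prime_le[OF p] 1 p1 by (intro exI[of _ p] exI[of _ 1]) auto
  next
    case 2
    have "4 * real p = 4 * real (p ^ 2) / real p" using p1 by (simp add: power2_eq_square)
    then show ?thesis using norm_gauss3_prime_square_cube_le[OF p, of 2] 2 p1
      by (intro exI[of _ 1] exI[of _ p]) auto
  next
    case 3
    have "4 * real p ^ 2 = 4 * real (p ^ 3) / real p" using p1 by (simp add: power2_eq_square power3_eq_cube)
    then show ?thesis using norm_gauss3_prime_square_cube_le[OF p, of 3] 3 p1
      by (intro exI[of _ 1] exI[of _ p]) auto
  next
    case 4
    then have "l - 3 < l" "1 \<le> l - 3" by auto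
    from less.IH[OF this] obtain u v b where uvb: "u \<ge> 1" "v \<ge> 1" "b \<ge> 1" "p ^ (l - 3) = u * v\<^sup>2 * b ^ 3"
      and bd: "\<And>a. \<not> int p dvd a \<Longrightarrow> norm (gauss3 (p ^ (l - 3)) a) \<le> 4 * real (p ^ (l - 3)) / (sqrt (real u) * real v * real b)"
      by blast
    have l: "l = 3 + (l - 3)" using 4 by simp
    have pl: "p ^ l = p ^ 3 * p ^ (l - 3)" by (subst l, rule power_add)
    have "norm (gauss3 (p ^ l) a) \<le> 4 * real (p ^ l) / (sqrt (real u) * real v * real (b * p))" if "\<not> int p dvd a" for a
    proof -
      have "norm (gauss3 (p ^ l) a) = real (p\<^sup>2) * norm (gauss3 (p ^ (l - 3)) a)"
        unfolding gauss3_prime_power_rec[OF p 4 that] by (simp add: norm_mult norm_power)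
      also have "\<dots> \<le> real (p\<^sup>2) * (4 * real (p ^ (l - 3)) / (sqrt (real u) * real v * real b))"
        using bd[OF that] by (intro mult_left_mono) auto
      also have "\<dots> = 4 * real (p ^ l) / (sqrt (real u) * real v * real (b * p))"
        unfolding pl using p1 by (simp add: power2_eq_square power3_eq_cube ac_simps)
      finally show ?thesis .
    qed
    moreover have "p ^ l = u * v\<^sup>2 * (b * p) ^ 3" unfolding pl uvb(4) by (simp add: power_mult_distrib)
    ultimately show ?thesis using uvb p1 by (intro exI[of _ u] exI[of _ v] exI[of _ "b * p"]) auto
  qed
qed

text \<open>Multiplicativity over prime powers: the shapes u v^2 b^3 multiply, and the constants 4
  accumulate to a power of the number of prime factors.\<close>

lemma gauss3_bound:
  "q \<ge> 1 \<Longrightarrow> \<exists>u v b. u \<ge> 1 \<and> v \<ge> 1 \<and> b \<ge> 1 \<and> q = u * v\<^sup>2 * b ^ 3 \<and>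
    (\<forall>a. coprime a (int q) \<longrightarrow> norm (gauss3 q a) \<le> 4 ^ card (prime_factors q) * real q / (sqrt (real u) * real v * real b))"
proof (induction q rule: less_induct)
  case (less q)
  show ?case
  proof (cases "q = 1")
    case True
    have "prime_factors (1::nat) = {}" by simp
    then show ?thesis using True norm_gauss3_le[of 1] by (intro exI[of _ 1]) auto
  next
    case False
    then obtain p where p: "prime p" "p dvd q" using prime_factor_nat by blast
    obtain m where m: "q = p ^ multiplicity p q * m" "\<not> p dvd m"
      using multiplicity_decompose'[of q p] less.prems p by (metis not_one_le_zero not_prime_unit)
    define l where "l = multiplicity p q"
    have l: "l \<ge> 1" using p less.prems by (simp add: l_def Suc_le_eq prime_multiplicity_gt_zero_iff)
    have q: "q = p ^ l * m" using m l_def by simp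
    have m1: "m \<ge> 1" using less.prems q by (cases m) auto
    have p2: "p \<ge> 2" using p prime_ge_2_nat by blast
    have "p ^ l \<ge> 2" using l p2 self_le_power[of p l] by linarith
    then have mq: "m < q" using q m1 by simp
    have cop: "coprime p m" using p(1) m(2) by (simp add: prime_imp_coprime)
    then have copl: "coprime (p ^ l) m" by simp
    obtain u v b where uvb: "u \<ge> 1" "v \<ge> 1" "b \<ge> 1" "p ^ l = u * v\<^sup>2 * b ^ 3"
      and bd: "\<And>a. \<not> int p dvd a \<Longrightarrow> norm (gauss3 (p ^ l) a) \<le> 4 * real (p ^ l) / (sqrt (real u) * real v * real b)"
      using gauss3_prime_power_bound[OF p(1) l] by blast
    obtain u' v' b' where uvb': "u' \<ge> 1" "v' \<ge> 1" "b' \<ge> 1" "m = u' * v'\<^sup>2 * b' ^ 3"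
      and bd': "\<And>a. coprime a (int m) \<Longrightarrow> norm (gauss3 m a) \<le> 4 ^ card (prime_factors m) * real m / (sqrt (real u') * real v' * real b')"
      using less.IH[OF mq m1] by blast
    have pf: "prime_factors q = insert p (prime_factors m)"
      unfolding q using p(1) m1 prime_dvd_prime_power_mult_iff[OF p(1) l] p2 by (auto simp: prime_factors_dvd)
    have card: "card (prime_factors q) = Suc (card (prime_factors m))"
      unfolding pf using m(2) by (intro card_insert_disjoint) auto
    have "norm (gauss3 q a) \<le> 4 ^ card (prime_factors q) * real q / (sqrt (real (u * u')) * real (v * v') * real (b * b'))"
      if a: "coprime a (int q)" for a
    proof -
      have ca: "coprime a (int p)" "coprime a (int m)" using a q l by auto
      have pi: "prime (int p)" using p(1) by simp
      have "\<not> int p dvd a" using ca(1) pi by (metis coprime_absorb_right not_prime_unit)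
      moreover have "\<not> int p dvd int m" using m(2) by simp
      ultimately have "\<not> int p dvd a * int m ^ 2" using pi by (simp add: prime_dvd_mult_iff prime_dvd_power_iff)
      note 1 = bd[OF this]
      have "coprime (a * int (p ^ l) ^ 2) (int m)" using ca(2) cop by simp
      note 2 = bd'[OF this]
      have "norm (gauss3 q a) = norm (gauss3 (p ^ l) (a * int m ^ 2)) * norm (gauss3 m (a * int (p ^ l) ^ 2))"
        unfolding q using gauss3_mult[OF copl _ m1, of a] p2 by (simp add: norm_mult)
      also have "\<dots> \<le> (4 * real (p ^ l) / (sqrt (real u) * real v * real b)) *
          (4 ^ card (prime_factors m) * real m / (sqrt (real u') * real v' * real b'))"
        by (rule mult_mono[OF 1 2]) auto
      also have "\<dots> = 4 ^ card (prime_factors q) * real q / (sqrt (real (u * u')) * real (v * v') * real (b * b'))"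
        unfolding card by (subst q) (simp add: real_sqrt_mult ac_simps)
      finally show ?thesis .
    qed
    moreover have "q = (u * u') * (v * v')\<^sup>2 * (b * b') ^ 3"
      by (subst q, unfold uvb(4), subst (1) uvb'(4)) (simp add: power_mult_distrib)
    moreover have "u * u' \<ge> 1" "v * v' \<ge> 1" "b * b' \<ge> 1" using uvb uvb' by simp_all
    ultimately show ?thesis by blast
  qed
qed

text \<open>The exponent 5/4 consists of 1 for the number of numerators a and 1/4 as a surplus. The
  surplus makes the tail of the singular series beyond P of size P powr (-1/4).\<close>

definition gauss_majorant :: "(nat \<Rightarrow> real) \<Rightarrow> real \<Rightarrow> bool" where
  "gauss_majorant \<kappa> C \<longleftrightarrow> (\<forall>q. 0 \<le> \<kappa> q \<and> \<kappa> q \<le> 1)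
     \<and> (\<forall>q\<ge>1. \<forall>a. coprime a q \<longrightarrow> norm (gauss_sum 3 q a) \<le> real q * \<kappa> q)
     \<and> (\<forall>X. (\<Sum>q=1..X. real q powr (5/4) * \<kappa> q ^ 5) \<le> C)"

text \<open>The majorant \<open>\<kappa> q\<close> is of size \<open>q powr (-1/2)\<close> apart from the cubefull part of \<open>q\<close>, which is what makes
  the weighted fifth moment converge although in general only about \<open>q powr (-1/3)\<close> is available.\<close>

lemma gauss_sum_majorant: "\<exists>\<kappa> C. gauss_majorant \<kappa> C"
proof -
  obtain U V B where UVB: "\<And>q. q \<ge> 1 \<Longrightarrow> U q \<ge> 1 \<and> V q \<ge> 1 \<and> B q \<ge> 1 \<and> q = U q * (V q)\<^sup>2 * B q ^ 3 \<and>
    (\<forall>a. coprime a (int q) \<longrightarrow> norm (gauss3 q a) \<le> 4 ^ card (prime_factors q) * real q / (sqrt (real (U q)) * real (V q) * real (B q)))"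
    using gauss3_bound by metis
  obtain C where C: "C \<ge> 1" "\<And>q. q \<ge> 1 \<Longrightarrow> 4 ^ card (prime_factors q) \<le> C * real q powr (1/150)"
    using prime_factors_powr_bound[of "1/150"] by auto
  define W where "W q = 4 ^ card (prime_factors q) / (sqrt (real (U q)) * real (V q) * real (B q))" for q
  define \<kappa> where "\<kappa> q = min 1 (W q)" for q
  \<comment> \<open>The exponent -23/20 is the one left for b: 3 (5/4 + 1/30) - 5, where 1/30 is
    five times the 1/150 spent on the prime factors. The exponents of u and v are smaller.\<close>
  define Z where "Z = (\<Sum>n. real n powr (-23/20))"
  have model4_bound: "W q \<ge> 0" for q by (simp add: W_def)
  have \<kappa>: "0 \<le> \<kappa> q" "\<kappa> q \<le> 1" for q using model4_bound by (auto simp: \<kappa>_def)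
  have smb: "summable (\<lambda>n. real n powr (-23/20))" by (subst summable_real_powr_iff) simp
  have gb: "norm (gauss_sum 3 q a) \<le> real q * \<kappa> q" if "q \<ge> 1" "coprime a q" for q a
  proof -
    have "norm (gauss3 q (int a)) \<le> real q * W q" using UVB[OF that(1)] that(2) by (simp add: W_def mult.commute)
    moreover have "norm (gauss3 q (int a)) \<le> real q * 1" using norm_gauss3_le by simp
    ultimately show ?thesis using gauss_sum_eq_gauss3[OF that(1)] by (simp add: \<kappa>_def min_def)
  qed
  define t where "t = (\<lambda>(u, v, b). real u powr (-23/20) * real v powr (-23/20) * real b powr (-23/20))"
  have t0: "t x \<ge> 0" for x by (simp add: t_def split: prod.splits)
  have tq: "real q powr (5/4) * \<kappa> q ^ 5 \<le> C ^ 5 * t (U q, V q, B q)" if q: "q \<ge> 1" for q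
  proof -
    define u v b where "u = real (U q)" and "v = real (V q)" and "b = real (B q)"
    have uvb: "u \<ge> 1" "v \<ge> 1" "b \<ge> 1" using UVB[OF q] by (auto simp: u_def v_def b_def)
    have "q = U q * (V q)\<^sup>2 * B q ^ 3" using UVB[OF q] by blast
    then have "real q = real (U q * (V q)\<^sup>2 * B q ^ 3)" by simp
    then have rq: "real q = u * v\<^sup>2 * b ^ 3" by (simp add: u_def v_def b_def)
    have "\<kappa> q ^ 5 \<le> W q ^ 5" using \<kappa> by (intro power_mono) (auto simp: \<kappa>_def)
    also have "\<dots> \<le> ((C * real q powr (1/150)) / (sqrt u * v * b)) ^ 5"
      using C(2)[OF q] uvb by (intro power_mono) (auto simp: W_def u_def v_def b_def intro!: divide_right_mono)
    also have "\<dots> = C ^ 5 * real q powr (1/30) / (sqrt u ^ 5 * v ^ 5 * b ^ 5)"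
    proof -
      have "(real q powr (1/150)) ^ 5 = real q powr (1/30)"
        using q by (simp add: powr_power)
      then show ?thesis by (simp add: power_divide power_mult_distrib)
    qed
    finally have "real q powr (5/4) * \<kappa> q ^ 5 \<le> real q powr (5/4) * (C ^ 5 * real q powr (1/30) / (sqrt u ^ 5 * v ^ 5 * b ^ 5))"
      by (intro mult_left_mono) auto
    also have "\<dots> = C ^ 5 * (real q powr (77/60) / (sqrt u ^ 5 * v ^ 5 * b ^ 5))"
      using q powr_add[of "real q" "5/4" "1/30"] by simp
    also have "real q powr (77/60) = u powr (77/60) * v powr (77/30) * b powr (77/20)"
    proof -
      have "v\<^sup>2 = v powr 2" "b ^ 3 = b powr 3" using uvb by (simp_all add: powr_numeral)
      then have "(v\<^sup>2) powr (77/60) = v powr (77/30)" "(b ^ 3) powr (77/60) = b powr (77/20)"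
        by (simp_all only: powr_powr) simp_all
      then show ?thesis unfolding rq using uvb by (simp add: powr_mult)
    qed
    also have "\<dots> / (sqrt u ^ 5 * v ^ 5 * b ^ 5) = u powr (77/60 - 5/2) * v powr (77/30 - 5) * b powr (77/20 - 5)"
    proof -
      have "sqrt u ^ 5 = (u powr (1/2)) ^ 5" using uvb by (simp add: powr_half_sqrt)
      also have "\<dots> = u powr (5/2)" using uvb by (simp add: powr_power)
      finally have "sqrt u ^ 5 = u powr (5/2)" .
      moreover have "v ^ 5 = v powr 5" "b ^ 5 = b powr 5" using uvb by (simp_all add: powr_numeral)
      ultimately show ?thesis unfolding powr_diff by simp
    qed
    also have "\<dots> \<le> u powr (-23/20) * v powr (-23/20) * b powr (-23/20)"
      using uvb by (intro mult_mono powr_mono mult_nonneg_nonneg) auto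
    finally show ?thesis using C(1) by (simp add: t_def u_def v_def b_def mult_left_mono)
  qed
  have "(\<Sum>q=1..X. real q powr (5/4) * \<kappa> q ^ 5) \<le> C ^ 5 * Z ^ 3" for X
  proof -
    \<comment> \<open>The triple determines q, so the sum over q is at most a sum over all triples,
      which is a cube of one convergent series.\<close>
    let ?f = "\<lambda>q. (U q, V q, B q)" and ?S = "{..X} \<times> {..X} \<times> {..X}"
    have inj: "inj_on ?f {1..X}"
    proof (rule inj_onI)
      fix x y assume "x \<in> {1..X}" "y \<in> {1..X}" "?f x = ?f y"
      then show "x = y" using UVB[of x] UVB[of y] by (metis atLeastAtMost_iff prod.inject)
    qed
    have sub: "?f ` {1..X} \<subseteq> ?S"
    proof (rule image_subsetI)
      fix q assume q: "q \<in> {1..X}"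
      then have 1: "U q \<ge> 1" "V q \<ge> 1" "B q \<ge> 1" and eq: "q = U q * (V q)\<^sup>2 * B q ^ 3" using UVB[of q] by auto
      have "U q dvd q" "V q dvd q" "B q dvd q"
        by (subst (2) eq, simp add: power2_eq_square power3_eq_cube)+
      then have "U q \<le> q" "V q \<le> q" "B q \<le> q" using q by (auto intro!: dvd_imp_le)
      then show "?f q \<in> ?S" using q by auto
    qed
    have "(\<Sum>q=1..X. real q powr (5/4) * \<kappa> q ^ 5) \<le> (\<Sum>q=1..X. C ^ 5 * t (?f q))"
      by (intro sum_mono tq) auto
    also have "\<dots> = C ^ 5 * (\<Sum>x\<in>?f ` {1..X}. t x)"
      using inj by (simp add: sum_distrib_left sum.reindex)
    also have "\<dots> \<le> C ^ 5 * (\<Sum>x\<in>?S. t x)"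
      using sub t0 C(1) by (intro mult_left_mono sum_mono2) auto
    also have "(\<Sum>x\<in>?S. t x) = (\<Sum>n\<le>X. real n powr (-23/20)) ^ 3"
    proof -
      define s where "s n = real n powr (-23/20)" for n
      have "(\<Sum>x\<in>?S. t x) = (\<Sum>u\<le>X. \<Sum>v\<le>X. \<Sum>b\<le>X. s u * (s v * s b))"
        unfolding sum.cartesian_product by (intro sum.cong) (auto simp: t_def s_def)
      also have "\<dots> = (\<Sum>u\<le>X. s u) * ((\<Sum>v\<le>X. s v) * (\<Sum>b\<le>X. s b))"
        by (simp only: sum_distrib_left[symmetric] sum_distrib_right[symmetric])
      finally show ?thesis by (simp add: s_def power3_eq_cube)
    qed
    also have "\<dots> \<le> Z ^ 3"
      unfolding Z_def using smb by (intro power_mono sum_le_suminf) (auto intro: sum_nonneg)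
    finally show ?thesis using C(1) by (simp add: mult_left_mono)
  qed
  with \<kappa> gb show ?thesis unfolding gauss_majorant_def by (intro exI[of _ \<kappa>] exI[of _ "C ^ 5 * Z ^ 3"]) blast
qed

section \<open>Mean values of cubic exponential sums\<close>

lemma sum_card_residue_classes:
  fixes \<phi> :: "'a \<Rightarrow> int"
  assumes "M > 0" "finite T"
  shows "(\<Sum>n<M. card {t \<in> T. int M dvd \<phi> t - int n}) = card T"
proof -
  have "(\<Sum>n<M. card {t \<in> T. int M dvd \<phi> t - int n}) = (\<Sum>n<M. \<Sum>t\<in>{t\<in>T. nat (\<phi> t mod int M) = n}. 1)"
  proof (rule sum.cong[OF refl])
    fix n assume n: "n \<in> {..<M}"
    have "{t \<in> T. int M dvd \<phi> t - int n} = {t \<in> T. nat (\<phi> t mod int M) = n}"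
      using n assms by (auto simp: mod_eq_dvd_iff[symmetric])
    then show "card {t \<in> T. int M dvd \<phi> t - int n} = (\<Sum>t\<in>{t\<in>T. nat (\<phi> t mod int M) = n}. 1)" by simp
  qed
  also have "\<dots> = (\<Sum>t\<in>T. 1)"
    using assms by (intro sum.group) (auto simp: nat_less_iff)
  finally show ?thesis by simp
qed

text \<open>The circle is replaced by the fractions with denominator \<open>6 P\<^sup>3\<close>. As this exceeds every sum of at most five
  cubes of numbers up to \<open>P\<close>, congruences modulo it between such sums are equalities.\<close>

definition cmod3 :: "nat \<Rightarrow> nat" where
  "cmod3 P = 6 * P ^ 3"

definition cubesum :: "nat \<Rightarrow> nat \<Rightarrow> complex" where
  "cubesum P j = (\<Sum>x=1..P. ee (real j * real x ^ 3 / real (cmod3 P)))"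

definition cdiff :: "nat \<Rightarrow> int \<Rightarrow> nat" where
  "cdiff P n = card {t \<in> {1..P} \<times> {1..P}. int (cmod3 P) dvd (int (fst t) ^ 3 - int (snd t) ^ 3) - n}"

text \<open>The Fourier coefficients of |f|^4; the one at 0 is the fourth moment, and over all
  residue classes they add up to P^4.\<close>

definition cdiff2 :: "nat \<Rightarrow> int \<Rightarrow> nat" where
  "cdiff2 P n = card {t \<in> ({1..P} \<times> {1..P}) \<times> ({1..P} \<times> {1..P}).
     int (cmod3 P) dvd ((int (fst (fst t)) ^ 3 - int (snd (fst t)) ^ 3) + (int (fst (snd t)) ^ 3 - int (snd (snd t)) ^ 3)) - n}"

lemma cmod3_pos: "P \<ge> 1 \<Longrightarrow> cmod3 P > 0"
  by (simp add: cmod3_def)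

lemma norm_cubesum_squared:
  "complex_of_real ((norm (cubesum P j))\<^sup>2) =
     (\<Sum>t\<in>{1..P} \<times> {1..P}. ee (real j * of_int (int (fst t) ^ 3 - int (snd t) ^ 3) / real (cmod3 P)))"
proof -
  have "complex_of_real ((norm (cubesum P j))\<^sup>2) = cubesum P j * cnj (cubesum P j)" by (rule complex_norm_square)
  also have "\<dots> = (\<Sum>x=1..P. \<Sum>y=1..P. ee (real j * of_int (int x ^ 3 - int y ^ 3) / real (cmod3 P)))"
    unfolding cubesum_def cnj_sum sum_product
    by (intro sum.cong refl) (simp add: ee_add[symmetric] diff_divide_distrib right_diff_distrib)
  finally show ?thesis by (simp add: sum.cartesian_product split_def)
qed

lemma hat_norm_cubesum_squared:
  assumes "P \<ge> 1"
  shows "hat (cmod3 P) (\<lambda>j. of_real ((norm (cubesum P j))\<^sup>2)) n = of_nat (cdiff P n)"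
proof -
  have "hat (cmod3 P) (\<lambda>j. of_real ((norm (cubesum P j))\<^sup>2)) n =
     (\<Sum>t | t \<in> {1..P} \<times> {1..P} \<and> int (cmod3 P) dvd (int (fst t) ^ 3 - int (snd t) ^ 3) - n. 1)"
    by (rule hat_trig_poly[OF cmod3_pos[OF assms]]) (simp_all add: norm_cubesum_squared del: of_real_power)
  then show ?thesis by (simp add: cdiff_def)
qed

lemma hat_norm_cubesum_pow4:
  assumes "P \<ge> 1"
  shows "hat (cmod3 P) (\<lambda>j. of_real (norm (cubesum P j) ^ 4)) n = of_nat (cdiff2 P n)"
proof -
  let ?X = "({1..P} \<times> {1..P}) \<times> ({1..P} \<times> {1..P})"
  let ?\<phi> = "\<lambda>t. (int (fst (fst t)) ^ 3 - int (snd (fst t)) ^ 3) + (int (fst (snd t)) ^ 3 - int (snd (snd t)) ^ 3)"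
  have "hat (cmod3 P) (\<lambda>j. of_real (norm (cubesum P j) ^ 4)) n = (\<Sum>t | t \<in> ?X \<and> int (cmod3 P) dvd ?\<phi> t - n. 1)"
  proof (rule hat_trig_poly[OF cmod3_pos[OF assms]])
    fix j
    have "complex_of_real (norm (cubesum P j) ^ 4) = complex_of_real ((norm (cubesum P j))\<^sup>2) * complex_of_real ((norm (cubesum P j))\<^sup>2)"
      by (simp add: power2_eq_square power4_eq_xxxx)
    also have "\<dots> = (\<Sum>t\<in>?X. 1 * ee (real j * of_int (?\<phi> t) / real (cmod3 P)))"
      unfolding norm_cubesum_squared sum_product sum.cartesian_product
      by (intro sum.cong refl) (simp add: split_def ee_add[symmetric] add_divide_distrib[symmetric] ring_distribs)
    finally show "complex_of_real (norm (cubesum P j) ^ 4) = (\<Sum>t\<in>?X. 1 * ee (real j * of_int (?\<phi> t) / real (cmod3 P)))" .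
  qed simp
  then show ?thesis by (simp add: cdiff2_def)
qed

lemma cube_difference_bound:
  assumes "x \<in> {1..P}" "y \<in> {1..P}"
  shows "\<bar>int x ^ 3 - int y ^ 3\<bar> < int P ^ 3"
proof -
  have "1 \<le> int x ^ 3" "int x ^ 3 \<le> int P ^ 3" "1 \<le> int y ^ 3" "int y ^ 3 \<le> int P ^ 3"
    using assms by (auto intro!: one_le_power power_mono)
  then show ?thesis by linarith
qed

lemma eq_if_congruent_small:
  fixes a b m :: int
  assumes "m dvd a - b" "\<bar>a - b\<bar> < m"
  shows "a = b"
  using assms zdvd_imp_le[of m "a - b"] zdvd_imp_le[of m "b - a"] by (auto simp: dvd_diff_commute) linarith

text \<open>The difference x - y divides l and has the sign of l. Once it is fixed and nonzero, x^2
  + x y + y^2 is determined, and this in turn determines the positive pair.\<close>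

lemma card_cube_difference_le:
  assumes tm: "tame P D" and l: "l \<noteq> 0"
  shows "real (card {t \<in> {1..P} \<times> {1..P}. int (fst t) ^ 3 - int (snd t) ^ 3 = l}) \<le> D" (is "real (card ?A) \<le> D")
proof (cases "?A = {}")
  case True
  then show ?thesis using tm by (simp only: card.empty) (simp add: tame_def)
next
  case False
  then obtain x0 y0 where 0: "x0 \<in> {1..P}" "y0 \<in> {1..P}" "int x0 ^ 3 - int y0 ^ 3 = l" by auto
  define m where "m = nat \<bar>l\<bar>"
  have P: "P \<ge> 1" using tm by (simp add: tame_def)
  have "\<bar>l\<bar> \<le> int P ^ 3" using cube_difference_bound[OF 0(1,2)] 0(3) by linarith
  then have "m \<le> P ^ 3" by (simp add: m_def nat_le_iff)
  then have m: "1 \<le> m" "m \<le> 12 * P ^ 3" using l by (auto simp: m_def)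
  have "inj_on (\<lambda>t. nat \<bar>int (fst t) - int (snd t)\<bar>) ?A"
  proof (rule inj_onI)
    fix s t assume st: "s \<in> ?A" "t \<in> ?A" "nat \<bar>int (fst s) - int (snd s)\<bar> = nat \<bar>int (fst t) - int (snd t)\<bar>"
    define x y x' y' where "x = int (fst s)" and "y = int (snd s)" and "x' = int (fst t)" and "y' = int (snd t)"
    have pos: "x \<ge> 1" "y \<ge> 1" "x' \<ge> 1" "y' \<ge> 1" using st by (auto simp: x_def y_def x'_def y'_def)
    have eq: "x ^ 3 - y ^ 3 = l" "x' ^ 3 - y' ^ 3 = l" using st by (auto simp: x_def y_def x'_def y'_def)
    have ab: "\<bar>x - y\<bar> = \<bar>x' - y'\<bar>" using st(3) by (simp add: x_def y_def x'_def y'_def)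
    have fac: "u ^ 3 - v ^ 3 = (u - v) * (u\<^sup>2 + u * v + v\<^sup>2)" for u v :: int
      by (simp add: power2_eq_square power3_eq_cube algebra_simps)
    have sg: "sgn l = sgn (u - v)" if "u \<ge> 1" "v \<ge> 1" "u ^ 3 - v ^ 3 = l" for u v :: int
    proof -
      have "u\<^sup>2 + u * v + v\<^sup>2 > 0" using that by (intro add_pos_pos) auto
      moreover have "l = (u - v) * (u\<^sup>2 + u * v + v\<^sup>2)" using fac[of u v] that(3) by simp
      ultimately show ?thesis by (simp only: sgn_mult sgn_pos mult_1_right)
    qed
    have "x - y = sgn (x - y) * \<bar>x - y\<bar>" by (simp add: mult_sgn_abs mult.commute abs_sgn)
    also have "\<dots> = sgn (x' - y') * \<bar>x' - y'\<bar>" using sg[OF pos(1,2) eq(1)] sg[OF pos(3,4) eq(2)] ab by simp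
    also have "\<dots> = x' - y'" by (simp add: mult_sgn_abs mult.commute abs_sgn)
    finally have d: "x - y = x' - y'" .
    have "x - y \<noteq> 0" using eq l by auto
    moreover have "(x - y) * (x\<^sup>2 + x * y + y\<^sup>2) = (x - y) * (x'\<^sup>2 + x' * y' + y'\<^sup>2)"
      using eq fac[of x y] fac[of x' y'] d by simp
    ultimately have "x\<^sup>2 + x * y + y\<^sup>2 = x'\<^sup>2 + x' * y' + y'\<^sup>2" by simp
    moreover have quad: "((v + c)\<^sup>2 + (v + c) * v + v\<^sup>2) - ((w + c)\<^sup>2 + (w + c) * w + w\<^sup>2) = 3 * ((v - w) * (v + (w + c)))"
      for v w c :: int by (simp add: power2_eq_square algebra_simps)
    have x: "x = y + (x' - y')" "x' = y' + (x' - y')" using d by simp_all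
    ultimately have "3 * ((y - y') * (y + x')) = 0"
      using quad[of y "x' - y'" y'] x by (metis diff_self)
    then have "y = y'" using pos by auto
    with x have "x = x'" by simp
    with \<open>y = y'\<close> show "s = t" by (simp add: x_def y_def x'_def y'_def prod_eq_iff)
  qed
  moreover have "(\<lambda>t. nat \<bar>int (fst t) - int (snd t)\<bar>) ` ?A \<subseteq> {d. d dvd m}"
  proof (rule image_subsetI)
    fix t assume "t \<in> ?A"
    then have "l = (int (fst t) - int (snd t)) * ((int (fst t))\<^sup>2 + int (fst t) * int (snd t) + (int (snd t))\<^sup>2)"
      by (auto simp: power2_eq_square power3_eq_cube algebra_simps)
    then have "int (fst t) - int (snd t) dvd l" by (metis dvd_triv_left)
    then show "nat \<bar>int (fst t) - int (snd t)\<bar> \<in> {d. d dvd m}" by (simp add: m_def)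
  qed
  moreover have "finite {d. d dvd m}" using m by simp
  ultimately have "card ?A \<le> card {d. d dvd m}" by (intro card_inj_on_le)
  then show ?thesis using tame_divisors[OF tm m] by linarith
qed

lemma cdiff_0_le: "cdiff P 0 \<le> P"
proof -
  have "{t \<in> {1..P} \<times> {1..P}. int (cmod3 P) dvd (int (fst t) ^ 3 - int (snd t) ^ 3) - 0} \<subseteq> (\<lambda>x. (x, x)) ` {1..P}"
  proof
    fix t assume t: "t \<in> {t \<in> {1..P} \<times> {1..P}. int (cmod3 P) dvd (int (fst t) ^ 3 - int (snd t) ^ 3) - 0}"
    have "\<bar>int (fst t) ^ 3 - int (snd t) ^ 3\<bar> < int (cmod3 P)"
      using t cube_difference_bound[of "fst t" P "snd t"] by (auto simp: cmod3_def)
    moreover have "int (cmod3 P) dvd int (fst t) ^ 3 - int (snd t) ^ 3" using t by simp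
    ultimately have "int (fst t) ^ 3 = int (snd t) ^ 3" by (rule eq_if_congruent_small[rotated])
    then have "int (fst t) = int (snd t)" by (rule power_eq_imp_eq_base) auto
    then show "t \<in> (\<lambda>x. (x, x)) ` {1..P}" using t by (auto simp: image_iff prod_eq_iff)
  qed
  then have "cdiff P 0 \<le> card ((\<lambda>x. (x, x)) ` {1..P})" unfolding cdiff_def by (intro card_mono) auto
  also have "\<dots> \<le> P" using card_image_le[of "{1..P}" "\<lambda>x. (x, x)"] by simp
  finally show ?thesis .
qed

text \<open>Two differences of cubes are less than 2 P^3 apart, hence equal if congruent modulo 6
  P^3; so the divisor bound for a single nonzero difference applies.\<close>

lemma cdiff_le:
  assumes tm: "tame P D" and n: "\<not> int (cmod3 P) dvd n"
  shows "real (cdiff P n) \<le> D"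
proof (cases "{t \<in> {1..P} \<times> {1..P}. int (cmod3 P) dvd (int (fst t) ^ 3 - int (snd t) ^ 3) - n} = {}")
  case True
  then show ?thesis using tm unfolding cdiff_def by (simp only: card.empty) (simp add: tame_def)
next
  case False
  then obtain s where s: "s \<in> {1..P} \<times> {1..P}" "int (cmod3 P) dvd (int (fst s) ^ 3 - int (snd s) ^ 3) - n" by blast
  define l where "l = int (fst s) ^ 3 - int (snd s) ^ 3"
  have P: "P \<ge> 1" using tm by (simp add: tame_def)
  have lb: "\<bar>int (fst t) ^ 3 - int (snd t) ^ 3\<bar> < int P ^ 3" if "t \<in> {1..P} \<times> {1..P}" for t
    using that by (intro cube_difference_bound) auto
  have "l \<noteq> 0" using s(2) n l_def by (auto simp: dvd_diff_commute)
  have "{t \<in> {1..P} \<times> {1..P}. int (cmod3 P) dvd (int (fst t) ^ 3 - int (snd t) ^ 3) - n}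
     \<subseteq> {t \<in> {1..P} \<times> {1..P}. int (fst t) ^ 3 - int (snd t) ^ 3 = l}"
  proof
    fix t assume t: "t \<in> {t \<in> {1..P} \<times> {1..P}. int (cmod3 P) dvd (int (fst t) ^ 3 - int (snd t) ^ 3) - n}"
    obtain a b where tab: "t = (a, b)" by (cases t)
    have ab: "a \<in> {1..P}" "b \<in> {1..P}" "int (cmod3 P) dvd (int a ^ 3 - int b ^ 3) - n" using t by (auto simp: tab)
    have "int (cmod3 P) dvd ((int a ^ 3 - int b ^ 3) - n) - (l - n)"
      unfolding l_def by (rule dvd_diff) (use ab(3) s(2) in simp_all)
    moreover have "((int a ^ 3 - int b ^ 3) - n) - (l - n) = (int a ^ 3 - int b ^ 3) - l" by linarith
    ultimately have "int (cmod3 P) dvd (int a ^ 3 - int b ^ 3) - l" by (simp only:)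
    moreover have "\<bar>(int a ^ 3 - int b ^ 3) - l\<bar> < int (cmod3 P)"
      using lb[of "(a, b)"] lb[OF s(1)] ab P unfolding l_def cmod3_def by simp
    ultimately have "int a ^ 3 - int b ^ 3 = l" by (rule eq_if_congruent_small)
    then show "t \<in> {t \<in> {1..P} \<times> {1..P}. int (fst t) ^ 3 - int (snd t) ^ 3 = l}" using t by (simp add: tab)
  qed
  then have "cdiff P n \<le> card {t \<in> {1..P} \<times> {1..P}. int (fst t) ^ 3 - int (snd t) ^ 3 = l}"
    unfolding cdiff_def by (intro card_mono) auto
  with card_cube_difference_le[OF tm \<open>l \<noteq> 0\<close>] show ?thesis by linarith
qed

text \<open>Parseval for |f|^2: the coefficient at 0 contributes P^2, and the others are at most D
  each with sum at most P^2.\<close>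

lemma fourth_moment:
  assumes tm: "tame P D"
  shows "(\<Sum>j<cmod3 P. norm (cubesum P j) ^ 4) / real (cmod3 P) \<le> 2 * D * real P ^ 2"
proof -
  have P: "P \<ge> 1" and D: "D \<ge> 1" using tm by (auto simp: tame_def)
  have M: "cmod3 P > 0" using cmod3_pos P by blast
  have "(\<Sum>j<cmod3 P. norm (cubesum P j) ^ 4) / real (cmod3 P)
      = (\<Sum>j<cmod3 P. (norm (complex_of_real ((norm (cubesum P j))\<^sup>2)))\<^sup>2) / real (cmod3 P)"
    by (simp add: norm_power flip: power_mult)
  also have "\<dots> = (\<Sum>n<cmod3 P. (norm (hat (cmod3 P) (\<lambda>j. of_real ((norm (cubesum P j))\<^sup>2)) (int n)))\<^sup>2)"
    by (rule hat_parseval[OF M, symmetric])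
  also have "\<dots> = (\<Sum>n<cmod3 P. (real (cdiff P (int n)))\<^sup>2)" by (simp only: hat_norm_cubesum_squared[OF P]) simp
  also have "\<dots> \<le> (\<Sum>n<cmod3 P. (if n = 0 then (real P)\<^sup>2 else 0) + D * real (cdiff P (int n)))"
  proof (rule sum_mono)
    fix n assume n: "n \<in> {..<cmod3 P}"
    show "(real (cdiff P (int n)))\<^sup>2 \<le> (if n = 0 then (real P)\<^sup>2 else 0) + D * real (cdiff P (int n))"
    proof (cases "n = 0")
      case True
      have "(real (cdiff P 0))\<^sup>2 \<le> (real P)\<^sup>2" using cdiff_0_le[of P] by (intro power_mono) auto
      moreover have "0 \<le> D * real (cdiff P 0)" using D by simp
      ultimately show ?thesis by (simp only: True simp_thms if_True of_nat_0 le_add_same_cancel1 add_increasing2)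
    next
      case False
      then have "\<not> int (cmod3 P) dvd int n" using n by (auto dest: nat_dvd_not_less)
      from cdiff_le[OF tm this] show ?thesis using False by (simp add: power2_eq_square mult_right_mono)
    qed
  qed
  also have "\<dots> = (real P)\<^sup>2 + D * real (\<Sum>n<cmod3 P. cdiff P (int n))"
    using M by (simp add: sum.distrib sum_distrib_left)
  also have "(\<Sum>n<cmod3 P. cdiff P (int n)) = P * P"
    unfolding cdiff_def using sum_card_residue_classes[OF M, of "{1..P} \<times> {1..P}"] by (simp add: card_cartesian_product)
  finally show ?thesis using D mult_right_mono[of 1 D "(real P)\<^sup>2"] by (simp add: power2_eq_square)
qed

text \<open>Here \<open>\<psi>\<close> factors as 3 h (y - z)(y + z + h), whose last factor is
  positive. It vanishes only for h = 0 or y = z, on at most 3 P^2 triples. A nonzero value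
  determines the triple up to the choice of the divisors h and y - z with their signs, hence 4
  D^2.\<close>

lemma hua_second_difference_moment:
  fixes P :: nat
  assumes tm: "tame P D"
  defines "M \<equiv> cmod3 P" and "H \<equiv> {- int P<..<int P}"
  defines "I \<equiv> \<lambda>h. {max 1 (1 - h)..min (int P) (int P - h)}"
  defines "T \<equiv> SIGMA h:H. I h \<times> I h"
  defines "\<psi> \<equiv> \<lambda>(h, y, z). ((y + h) ^ 3 - y ^ 3) - ((z + h) ^ 3 - z ^ 3)"
  shows "(\<Sum>t\<in>T. real (cdiff2 P (- \<psi> t))) \<le> 3 * (real P)\<^sup>2 * real (cdiff2 P 0) + 4 * D\<^sup>2 * real P ^ 4"
proof -
  have P: "P \<ge> 1" and D: "D \<ge> 1" using tm by (auto simp: tame_def)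
  have M: "M > 0" using cmod3_pos P by (simp add: M_def)
  have finT: "finite T" by (auto simp: T_def H_def I_def)
  have \<psi>_eq: "\<psi> (h, y, z) = 3 * h * (y - z) * (y + z + h)" for h y z
    by (simp add: \<psi>_def power3_eq_cube algebra_simps)
  have pos: "y \<ge> 1 \<and> z \<ge> 1 \<and> y + h \<ge> 1 \<and> z + h \<ge> 1 \<and> y \<le> int P \<and> z \<le> int P \<and> y + h \<le> int P \<and> z + h \<le> int P"
    if "(h, y, z) \<in> T" for h y z using that by (auto simp: T_def I_def)
  have bound: "\<bar>\<psi> t\<bar> < 2 * int P ^ 3" if t: "t \<in> T" for t
  proof -
    obtain h y z where hyz: "t = (h, y, z)" by (cases t)
    note p = pos[OF t[unfolded hyz]]
    have "\<bar>(y + h) ^ 3 - y ^ 3\<bar> < int P ^ 3" "\<bar>(z + h) ^ 3 - z ^ 3\<bar> < int P ^ 3"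
    proof -
      have "\<bar>u ^ 3 - v ^ 3\<bar> < int P ^ 3" if "1 \<le> u" "u \<le> int P" "1 \<le> v" "v \<le> int P" for u v
        using that cube_difference_bound[of "nat u" P "nat v"] by (simp add: nat_le_iff le_nat_iff)
      then show "\<bar>(y + h) ^ 3 - y ^ 3\<bar> < int P ^ 3" "\<bar>(z + h) ^ 3 - z ^ 3\<bar> < int P ^ 3" using p by blast+
    qed
    then show ?thesis by (simp add: hyz \<psi>_def)
  qed
  define T0 where "T0 = {t \<in> T. \<psi> t = 0}"
  define T1 where "T1 = {t \<in> T. \<psi> t \<noteq> 0}"
  have T: "T = T0 \<union> T1" "T0 \<inter> T1 = {}" "finite T0" "finite T1"
    using finT by (auto simp: T0_def T1_def)
  have "(\<Sum>t\<in>T. real (cdiff2 P (- \<psi> t))) = (\<Sum>t\<in>T0. real (cdiff2 P (- \<psi> t))) + (\<Sum>t\<in>T1. real (cdiff2 P (- \<psi> t)))"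
    unfolding T(1) using T by (intro sum.union_disjoint) auto
  also have "(\<Sum>t\<in>T0. real (cdiff2 P (- \<psi> t))) = real (card T0) * real (cdiff2 P 0)"
    by (simp add: T0_def)
  also have "\<dots> \<le> (3 * (real P)\<^sup>2) * real (cdiff2 P 0)"
  proof (rule mult_right_mono)
    have "T0 \<subseteq> ({0} \<times> {1..int P} \<times> {1..int P}) \<union> (\<lambda>(h, y). (h, y, y)) ` (H \<times> {1..int P})"
    proof
      fix t assume t: "t \<in> T0"
      obtain h y z where hyz: "t = (h, y, z)" by (cases t)
      have tT: "(h, y, z) \<in> T" and "\<psi> (h, y, z) = 0" using t hyz by (auto simp: T0_def)
      then have "h = 0 \<or> y = z" using pos[OF tT] by (auto simp: \<psi>_eq)
      then show "t \<in> ({0} \<times> {1..int P} \<times> {1..int P}) \<union> (\<lambda>(h, y). (h, y, y)) ` (H \<times> {1..int P})"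
        using pos[OF tT] tT by (auto simp: hyz image_iff T_def)
    qed
    then have "card T0 \<le> card (({0::int} \<times> {1..int P} \<times> {1..int P}) \<union> (\<lambda>(h, y). (h, y, y)) ` (H \<times> {1..int P}))"
      by (intro card_mono) (auto simp: H_def)
    also have "\<dots> \<le> card ({0::int} \<times> {1..int P} \<times> {1..int P}) + card (H \<times> {1..int P})"
      by (intro order_trans[OF card_Un_le] add_left_mono card_image_le) (auto simp: H_def)
    also have "\<dots> \<le> P * P + (2 * P) * P" by (auto simp: card_cartesian_product H_def nat_le_iff)
    finally have "real (card T0) \<le> real (P * P + (2 * P) * P)" by (rule of_nat_mono)
    then show "real (card T0) \<le> 3 * (real P)\<^sup>2" by (simp add: power2_eq_square)
  qed simp
  also have "(\<Sum>t\<in>T1. real (cdiff2 P (- \<psi> t))) \<le> 4 * D\<^sup>2 * (\<Sum>n<M. real (cdiff2 P (int n)))"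
  proof -
    define w where "w t = nat ((- \<psi> t) mod int M)" for t
    have iw: "int (w t) = (- \<psi> t) mod int M" for t using M by (simp add: w_def)
    have per: "cdiff2 P (- \<psi> t) = cdiff2 P (int (w t))" for t
    proof -
      have "int M dvd x - (- \<psi> t) \<longleftrightarrow> int M dvd x - int (w t)" for x
        unfolding mod_eq_dvd_iff[symmetric] iw by simp
      then show ?thesis unfolding cdiff2_def M_def by simp
    qed
    have "(\<Sum>t\<in>T1. real (cdiff2 P (int (w t)))) \<le> 4 * D\<^sup>2 * (\<Sum>n\<in>{..<M}. real (cdiff2 P (int n)))"
    proof (rule sum_le_card_fibre[OF T(4)])
      fix m
      show "real (card {t \<in> T1. w t = m}) \<le> 4 * D\<^sup>2"
      proof (cases "{t \<in> T1. w t = m} = {}")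
        case True
        then show ?thesis by (simp only: card.empty) simp
      next
        case False
        then obtain s where s: "s \<in> T1" "w s = m" by blast
        define l where "l = nat \<bar>\<psi> s\<bar>"
        have l: "1 \<le> l" "l \<le> 12 * P ^ 3" using s bound[of s] by (auto simp: l_def T1_def nat_le_iff)
        have same: "\<psi> t = \<psi> s" if t: "t \<in> {t \<in> T1. w t = m}" for t
        proof (rule eq_if_congruent_small[of "int M"])
          have "(- \<psi> t) mod int M = (- \<psi> s) mod int M" using iw[of t] iw[of s] t s by simp
          then show "int M dvd \<psi> t - \<psi> s" by (simp add: mod_eq_dvd_iff dvd_diff_commute)
          show "\<bar>\<psi> t - \<psi> s\<bar> < int M" using bound[of t] bound[of s] t s P
            by (simp add: T1_def M_def cmod3_def)
        qed
        let ?g = "\<lambda>(h, y, z). ((nat \<bar>h\<bar>, h > (0::int)), (nat \<bar>y - z\<bar>, y > (z::int)))"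
        let ?R = "({d. d dvd l} \<times> (UNIV::bool set)) \<times> ({d. d dvd l} \<times> (UNIV::bool set))"
        have "card {t \<in> T1. w t = m} \<le> card ?R"
        proof (rule card_inj_on_le)
          show "finite ?R" using l by simp
          show "inj_on ?g {t \<in> T1. w t = m}"
          proof (rule inj_onI)
            fix t u assume tu: "t \<in> {t \<in> T1. w t = m}" "u \<in> {t \<in> T1. w t = m}" "?g t = ?g u"
            obtain h y z h' y' z' where e: "t = (h, y, z)" "u = (h', y', z')" by (cases t, cases u)
            have "nat \<bar>h\<bar> = nat \<bar>h'\<bar>" "(h > 0) = (h' > 0)" "nat \<bar>y - z\<bar> = nat \<bar>y' - z'\<bar>" "(y > z) = (y' > z')"
              using tu(3) by (simp_all only: e prod.case prod.inject)
            then have hk: "h = h'" "y - z = y' - z'" by linarith+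
            have "\<psi> t = \<psi> u" using same tu by simp
            then have "3 * h * (y - z) * (y + z + h) = 3 * h * (y - z) * (y' + z' + h)"
              unfolding e \<psi>_eq hk(1)[symmetric] hk(2)[symmetric] .
            moreover have "3 * h * (y - z) \<noteq> 0" using tu(1) by (auto simp: e T1_def \<psi>_eq)
            ultimately have "y + z + h = y' + z' + h" by (simp only: mult_cancel_left) blast
            then show "t = u" using hk e by auto
          qed
          show "?g ` {t \<in> T1. w t = m} \<subseteq> ?R"
          proof (rule image_subsetI)
            fix t assume t: "t \<in> {t \<in> T1. w t = m}"
            obtain h y z where e: "t = (h, y, z)" by (cases t)
            have "3 * h * (y - z) * (y + z + h) = \<psi> s" using same[OF t] by (simp add: e \<psi>_eq)
            then have "h dvd \<psi> s" "y - z dvd \<psi> s" by (metis dvd_mult dvd_mult2 dvd_refl)+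
            then show "?g t \<in> ?R" by (simp add: e l_def)
          qed
        qed
        also have "\<dots> = 4 * (card {d. d dvd l})\<^sup>2"
          by (simp add: card_cartesian_product power2_eq_square)
        finally have "real (card {t \<in> T1. w t = m}) \<le> real (4 * (card {d. d dvd l})\<^sup>2)" by (rule of_nat_mono)
        also have "\<dots> \<le> 4 * D\<^sup>2" using tame_divisors[OF tm l] by (simp add: power_mono)
        finally show ?thesis .
      qed
    qed (use M in \<open>auto simp: w_def nat_less_iff\<close>)
    then show ?thesis by (simp only: per)
  qed
  also have "(\<Sum>n<M. real (cdiff2 P (int n))) = real P ^ 4"
  proof -
    let ?X = "({1..P} \<times> {1..P}) \<times> ({1..P} \<times> {1..P})"
    have "(\<Sum>n<M. cdiff2 P (int n)) = card ?X"
      unfolding cdiff2_def M_def using M unfolding M_def by (intro sum_card_residue_classes) auto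
    then have "real (\<Sum>n<M. cdiff2 P (int n)) = real (card ?X)" by (simp only:)
    then show ?thesis by (simp add: card_cartesian_product power4_eq_xxxx)
  qed
  finally show ?thesis by simp
qed

text \<open>One factor |f|^4 is bounded by a differenced sum with phases \<open>\<psi>\<close>, and
  the average of the other |f|^4 against each phase is its Fourier coefficient at
  \<open>- \<psi> t\<close>. The constant is 20 = 2 (3 * 2 + 4).\<close>

lemma hua_eighth_moment:
  assumes tm: "tame P D"
  shows "(\<Sum>j<cmod3 P. norm (cubesum P j) ^ 8) / real (cmod3 P) \<le> 20 * D\<^sup>2 * real P ^ 5"
proof -
  have P: "P \<ge> 1" and D: "D \<ge> 1" using tm by (auto simp: tame_def)
  define M where "M = cmod3 P"
  have M: "M > 0" using cmod3_pos P by (simp add: M_def)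
  define H where "H = {- int P<..<int P}"
  define I where "I h = {max 1 (1 - h)..min (int P) (int P - h)}" for h
  define T where "T = (SIGMA h:H. I h \<times> I h)"
  define \<psi> where "\<psi> = (\<lambda>(h, y, z). ((y + h) ^ 3 - y ^ 3) - ((z + h) ^ 3 - z ^ 3) :: int)"
  have fourth: "complex_of_real (norm (cubesum P j) ^ 4) = of_real (norm (cubesum P j) ^ 4)" for j by simp
  have pt: "norm (cubesum P j) ^ 4 \<le> 2 * real P * Re (\<Sum>t\<in>T. ee (real j * of_int (\<psi> t) / real M))" for j
  proof -
    define \<phi> where "\<phi> x = real j * of_int x ^ 3 / real M" for x :: int
    have cubesum: "cubesum P j = (\<Sum>x\<in>{1..int P}. ee (\<phi> x))"
      unfolding cubesum_def
      by (rule sum.reindex_bij_witness[of _ nat int]) (auto simp: \<phi>_def M_def)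
    have "norm (cubesum P j) ^ 4 \<le> 2 * of_int (int P) * (\<Sum>h\<in>H. (norm (\<Sum>y\<in>I h. ee (\<phi> (y + h) - \<phi> y)))\<^sup>2)"
      unfolding cubesum H_def I_def using P by (intro norm_sum_pow4_le) auto
    also have "(\<Sum>h\<in>H. (norm (\<Sum>y\<in>I h. ee (\<phi> (y + h) - \<phi> y)))\<^sup>2)
        = Re (\<Sum>t\<in>T. ee (real j * of_int (\<psi> t) / real M))"
    proof -
      have "complex_of_real (\<Sum>h\<in>H. (norm (\<Sum>y\<in>I h. ee (\<phi> (y + h) - \<phi> y)))\<^sup>2)
         = (\<Sum>h\<in>H. \<Sum>(y, z)\<in>I h \<times> I h. ee (real j * of_int (\<psi> (h, y, z)) / real M))"
        unfolding of_real_sum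
      proof (rule sum.cong[OF refl])
        fix h
        have "complex_of_real ((norm (\<Sum>y\<in>I h. ee (\<phi> (y + h) - \<phi> y)))\<^sup>2)
           = (\<Sum>y\<in>I h. ee (\<phi> (y + h) - \<phi> y)) * cnj (\<Sum>y\<in>I h. ee (\<phi> (y + h) - \<phi> y))"
          by (rule complex_norm_square)
        also have "\<dots> = (\<Sum>y\<in>I h. \<Sum>z\<in>I h. ee (real j * of_int (\<psi> (h, y, z)) / real M))"
          unfolding cnj_sum sum_product
          by (intro sum.cong refl) (simp add: ee_add[symmetric] \<phi>_def \<psi>_def diff_divide_distrib add_divide_distrib algebra_simps)
        finally show "complex_of_real ((norm (\<Sum>y\<in>I h. ee (\<phi> (y + h) - \<phi> y)))\<^sup>2)
           = (\<Sum>(y, z)\<in>I h \<times> I h. ee (real j * of_int (\<psi> (h, y, z)) / real M))"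
          by (simp only: sum.cartesian_product)
      qed
      also have "\<dots> = (\<Sum>t\<in>T. ee (real j * of_int (\<psi> t) / real M))"
        unfolding T_def by (subst sum.Sigma) (auto simp: H_def I_def split_def)
      finally have "Re (complex_of_real (\<Sum>h\<in>H. (norm (\<Sum>y\<in>I h. ee (\<phi> (y + h) - \<phi> y)))\<^sup>2))
         = Re (\<Sum>t\<in>T. ee (real j * of_int (\<psi> t) / real M))" by (rule arg_cong)
      then show ?thesis by (simp only: Re_complex_of_real)
    qed
    finally show ?thesis by simp
  qed
  have "(\<Sum>j<M. norm (cubesum P j) ^ 8) \<le> (\<Sum>j<M. norm (cubesum P j) ^ 4 * (2 * real P * Re (\<Sum>t\<in>T. ee (real j * of_int (\<psi> t) / real M))))"
  proof (rule sum_mono)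
    fix j
    have "norm (cubesum P j) ^ 8 = norm (cubesum P j) ^ 4 * norm (cubesum P j) ^ 4" by (simp flip: power_add)
    also have "\<dots> \<le> norm (cubesum P j) ^ 4 * (2 * real P * Re (\<Sum>t\<in>T. ee (real j * of_int (\<psi> t) / real M)))"
      by (intro mult_left_mono pt) auto
    finally show "norm (cubesum P j) ^ 8 \<le> \<dots>" .
  qed
  also have "\<dots> = 2 * real P * Re (\<Sum>j<M. \<Sum>t\<in>T. of_real (norm (cubesum P j) ^ 4) * ee (real j * of_int (\<psi> t) / real M))"
    by (simp add: Re_sum sum_distrib_left algebra_simps del: of_real_power)
  also have "(\<Sum>j<M. \<Sum>t\<in>T. of_real (norm (cubesum P j) ^ 4) * ee (real j * of_int (\<psi> t) / real M))
      = (\<Sum>t\<in>T. of_nat M * hat M (\<lambda>j. of_real (norm (cubesum P j) ^ 4)) (- \<psi> t))"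
    using M by (subst sum.swap) (simp add: hat_def)
  also have "\<dots> = of_nat M * of_nat (\<Sum>t\<in>T. cdiff2 P (- \<psi> t))"
    unfolding M_def hat_norm_cubesum_pow4[OF P] by (simp add: sum_distrib_left)
  finally have "(\<Sum>j<M. norm (cubesum P j) ^ 8) / real M \<le> 2 * real P * (\<Sum>t\<in>T. real (cdiff2 P (- \<psi> t)))"
    using M by (simp add: field_simps del: of_real_power)
  also have "\<dots> \<le> 2 * real P * (3 * (real P)\<^sup>2 * real (cdiff2 P 0) + 4 * D\<^sup>2 * real P ^ 4)"
    unfolding T_def H_def I_def \<psi>_def
    by (intro mult_left_mono hua_second_difference_moment[OF tm]) auto
  \<comment> \<open>The coefficient of |f|^4 at 0 is the fourth moment, already bounded.\<close>
  also have "\<dots> \<le> 2 * real P * (3 * (real P)\<^sup>2 * (2 * D\<^sup>2 * (real P)\<^sup>2) + 4 * D\<^sup>2 * real P ^ 4)"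
  proof -
    have "complex_of_real (real (cdiff2 P 0)) = hat M (\<lambda>j. of_real (norm (cubesum P j) ^ 4)) 0"
      unfolding M_def hat_norm_cubesum_pow4[OF P] by simp
    also have "\<dots> = of_real ((\<Sum>j<M. norm (cubesum P j) ^ 4) / real M)" by (simp add: hat_def)
    finally have "real (cdiff2 P 0) = (\<Sum>j<M. norm (cubesum P j) ^ 4) / real M" by (simp only: of_real_eq_iff)
    also have "\<dots> \<le> 2 * D * (real P)\<^sup>2" unfolding M_def by (rule fourth_moment[OF tm])
    also have "\<dots> \<le> 2 * D\<^sup>2 * (real P)\<^sup>2" using D self_le_power[of D 2] by (intro mult_right_mono) auto
    finally show ?thesis by (intro mult_left_mono add_right_mono) auto
  qed
  also have "\<dots> = 20 * D\<^sup>2 * real P ^ 5" by (simp add: power2_eq_square power4_eq_xxxx eval_nat_numeral algebra_simps)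
  finally show ?thesis by (simp add: M_def)
qed

lemma hat_cubesum_power:
  assumes "P \<ge> 1"
  shows "hat (cmod3 P) (\<lambda>j. cubesum P j ^ s) n
     = of_nat (card {xs \<in> tuples s {1..P}. int (cmod3 P) dvd int (\<Sum>x\<leftarrow>xs. x ^ 3) - n})"
proof -
  have "hat (cmod3 P) (\<lambda>j. cubesum P j ^ s) n = (\<Sum>xs | xs \<in> tuples s {1..P} \<and> int (cmod3 P) dvd int (\<Sum>x\<leftarrow>xs. x ^ 3) - n. 1)"
  proof (rule hat_trig_poly[OF cmod3_pos[OF assms]])
    fix j
    have "(\<Sum>x\<leftarrow>xs. real j * real x ^ 3 / real (cmod3 P)) = real j * of_int (int (\<Sum>x\<leftarrow>xs. x ^ 3)) / real (cmod3 P)" for xs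
      by (induction xs) (simp_all add: ring_distribs add_divide_distrib)
    then show "cubesum P j ^ s = (\<Sum>xs\<in>tuples s {1..P}. 1 * ee (real j * of_int (int (\<Sum>x\<leftarrow>xs. x ^ 3)) / real (cmod3 P)))"
      unfolding cubesum_def sum_power_tuples[OF finite_atLeastAtMost] prod_list_ee by simp
  qed simp
  then show ?thesis by simp
qed

text \<open>Summation by parts, with the boundary coefficient \<open>c n\<close> taken just past the
  range. The bound is the largest partial sum times the total variation, the shape needed for the
  absorption arguments below.\<close>

lemma norm_abel_sum_le:
  fixes a c :: "nat \<Rightarrow> complex"
  assumes A: "\<And>k. k \<le> n \<Longrightarrow> norm (\<Sum>i<k. a i) \<le> A"
  shows "norm (\<Sum>i<n. c i * a i) \<le> A * (norm (c n) + (\<Sum>i<n. norm (c i - c (Suc i))))"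
proof -
  have eq: "(\<Sum>i<n. c i * a i) = c n * (\<Sum>i<n. a i) + (\<Sum>i<n. (c i - c (Suc i)) * (\<Sum>j<Suc i. a j))" for n
    by (induction n) (simp_all add: algebra_simps)
  have "norm (\<Sum>i<n. c i * a i) \<le> norm (c n) * norm (\<Sum>i<n. a i) + (\<Sum>i<n. norm (c i - c (Suc i)) * norm (\<Sum>j<Suc i. a j))"
    unfolding eq by (intro order_trans[OF norm_triangle_ineq] add_mono order_trans[OF norm_sum] sum_mono) (simp_all only: norm_mult order_refl)
  also have "\<dots> \<le> norm (c n) * A + (\<Sum>i<n. norm (c i - c (Suc i)) * A)"
    by (intro add_mono sum_mono mult_left_mono A) auto
  finally show ?thesis by (simp add: sum_distrib_left algebra_simps)
qed

text \<open>Bernoulli's inequality, as the weighted inequality of arithmetic and geometric means for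
  1 + x and 1.\<close>

lemma one_plus_powr_le: "(1 + x) powr c \<le> 1 + c * x" if "0 \<le> c" "c \<le> 1" "x \<ge> 0" for x c :: real
  using Youngs_inequality_0[of c "1 - c" "1 + x" 1] that by (simp add: algebra_simps)

section \<open>The smooth model\<close>

lemma powr_third_cubed [simp]: "(x powr (1/3)) ^ 3 = x" if "x \<ge> 0" for x :: real
  using that by (cases "x = 0") (simp_all add: powr_power)

lemma cube_powr_third [simp]: "(x ^ 3) powr (1/3) = x" if "x \<ge> 0" for x :: real
proof -
  have "((x ^ 3) powr (1/3)) ^ 3 = x ^ 3" using that by simp
  then show ?thesis by (rule power_eq_imp_eq_base) (use that in auto)
qed

text \<open>Telescoping: for consecutive cube roots b < a, 1 = a^3 - b^3 <= 3 (a - b) a^2.\<close>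

lemma sum_powr_neg_two_thirds_le: "(\<Sum>m<t. real (Suc m) powr (-2/3)) \<le> 3 * real t powr (1/3)"
proof (induction t)
  case (Suc t)
  define a b where "a = real (Suc t) powr (1/3)" and "b = real t powr (1/3)"
  have a: "a > 0" "b \<ge> 0" "b \<le> a" by (auto simp: a_def b_def intro: powr_mono2)
  have cub: "a ^ 3 = real (Suc t)" "b ^ 3 = real t" by (simp_all add: a_def b_def)
  have "real (Suc t) powr (-2/3) = 1 / a\<^sup>2"
    by (simp add: a_def powr_power powr_minus_divide[symmetric])
  moreover have "1 \<le> 3 * (a - b) * a\<^sup>2"
  proof -
    have "1 = (a - b) * (a\<^sup>2 + a * b + b\<^sup>2)" using cub by (simp add: power2_eq_square power3_eq_cube algebra_simps)
    also have "\<dots> \<le> (a - b) * (a\<^sup>2 + a * a + a\<^sup>2)"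
      using a by (intro mult_left_mono add_mono power_mono mult_left_mono) auto
    also have "\<dots> = 3 * (a - b) * a\<^sup>2" by (simp add: power2_eq_square algebra_simps)
    finally show ?thesis .
  qed
  then have "1 / a\<^sup>2 \<le> 3 * (a - b)" using a by (simp add: divide_le_eq)
  ultimately show ?case using Suc by (simp add: a_def b_def)
qed auto

text \<open>The first \<open>1/\<bar>\<beta>\<bar>\<close> terms are estimated trivially, the others by partial summation.\<close>

lemma norm_monotone_sum_ee_le:
  fixes b :: "nat \<Rightarrow> real"
  assumes dec: "\<And>m. b (Suc m) \<le> b m" and b0: "\<And>m. 0 \<le> b m" and b: "\<And>m. b m \<le> real (Suc m) powr (-2/3)"
    and \<beta>: "\<beta> \<noteq> 0" "\<bar>\<beta>\<bar> \<le> 1/2"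
  shows "norm (\<Sum>m<K. of_real (b m) * ee (\<beta> * real m)) \<le> 7 * \<bar>\<beta>\<bar> powr (-1/3)"
proof -
  define t where "t = nat \<lceil>1 / \<bar>\<beta>\<bar>\<rceil>"
  have t: "1 / \<bar>\<beta>\<bar> \<le> real t" "real t \<le> 2 / \<bar>\<beta>\<bar>"
  proof -
    have inv: "2 \<le> 1 / \<bar>\<beta>\<bar>" using \<beta> by (simp add: field_simps)
    show "1 / \<bar>\<beta>\<bar> \<le> real t" by (simp add: t_def)
    have "real t = of_int \<lceil>1 / \<bar>\<beta>\<bar>\<rceil>" using inv by (simp add: t_def)
    then have "real t \<le> 1 / \<bar>\<beta>\<bar> + 1" by linarith
    then show "real t \<le> 2 / \<bar>\<beta>\<bar>" using inv by simp
  qed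
  have triv: "norm (\<Sum>m<s. of_real (b m) * ee (\<beta> * real m)) \<le> 6 * \<bar>\<beta>\<bar> powr (-1/3)" if "s \<le> t" for s
  proof -
    have "norm (\<Sum>m<s. of_real (b m) * ee (\<beta> * real m)) \<le> (\<Sum>m<s. real (Suc m) powr (-2/3))"
      using b b0 by (intro sum_norm_le) (simp add: norm_mult)
    also have "\<dots> \<le> 3 * real s powr (1/3)" by (rule sum_powr_neg_two_thirds_le)
    also have "real s powr (1/3) \<le> (2 / \<bar>\<beta>\<bar>) powr (1/3)" using t(2) that by (intro powr_mono2) auto
    also have "\<dots> = 2 powr (1/3) * \<bar>\<beta>\<bar> powr (-1/3)" by (simp add: powr_divide powr_minus_divide)
    also have "(2::real) powr (1/3) \<le> 2 powr 1" by (intro powr_mono) auto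
    finally show ?thesis by (simp add: mult_right_mono)
  qed
  show ?thesis
  proof (cases "K \<le> t")
    case True
    then show ?thesis using triv[of K] powr_ge_zero[of "\<bar>\<beta>\<bar>" "-1/3"] by linarith
  next
    case False
    define n where "n = K - t"
    have split: "(\<Sum>m<K. of_real (b m) * ee (\<beta> * real m)) = (\<Sum>m<t. of_real (b m) * ee (\<beta> * real m))
        + (\<Sum>i<n. of_real (b (t + i)) * ee (\<beta> * real (t + i)))"
    proof -
      have "(\<Sum>m<K. of_real (b m) * ee (\<beta> * real m)) = (\<Sum>m<t. of_real (b m) * ee (\<beta> * real m)) + (\<Sum>m\<in>{t..<K}. of_real (b m) * ee (\<beta> * real m))"
        using False by (simp add: lessThan_atLeast0 sum.atLeastLessThan_concat)
      also have "(\<Sum>m\<in>{t..<K}. of_real (b m) * ee (\<beta> * real m)) = (\<Sum>i<n. of_real (b (t + i)) * ee (\<beta> * real (t + i)))"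
        by (rule sum.reindex_bij_witness[of _ "\<lambda>i. t + i" "\<lambda>m. m - t"]) (use False in \<open>auto simp: n_def\<close>)
      finally show ?thesis .
    qed
    have geo: "norm (\<Sum>i<k. ee (\<beta> * real (t + i))) \<le> 1 / (2 * \<bar>\<beta>\<bar>)" for k
    proof -
      have ne: "norm (1 - ee \<beta>) \<ge> 4 * \<bar>\<beta>\<bar>" using \<beta> by (intro norm_one_minus_ee_ge)
      then have ne1: "ee \<beta> \<noteq> 1" using \<beta> by auto
      have "(\<Sum>i<k. ee (\<beta> * real (t + i))) = ee (\<beta> * real t) * (\<Sum>i<k. ee \<beta> ^ i)"
        by (simp add: sum_distrib_left ee_power ee_add[symmetric] algebra_simps)
      then have "norm (\<Sum>i<k. ee (\<beta> * real (t + i))) = norm (1 - ee \<beta> ^ k) / norm (1 - ee \<beta>)"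
        using ne1 by (simp add: norm_mult sum_gp_strict norm_divide)
      also have "\<dots> \<le> 2 / (4 * \<bar>\<beta>\<bar>)"
      proof (rule frac_le)
        show "norm (1 - ee \<beta> ^ k) \<le> 2" by (rule order_trans[OF norm_triangle_ineq4]) (simp add: norm_power)
      qed (use \<beta> ne in auto)
      finally show ?thesis by simp
    qed
    have "norm (\<Sum>i<n. of_real (b (t + i)) * ee (\<beta> * real (t + i)))
       \<le> 1 / (2 * \<bar>\<beta>\<bar>) * (norm (complex_of_real (b (t + n))) + (\<Sum>i<n. norm (complex_of_real (b (t + i)) - of_real (b (t + Suc i)))))"
      by (rule norm_abel_sum_le[where c = "\<lambda>i. of_real (b (t + i))" and a = "\<lambda>i. ee (\<beta> * real (t + i))"]) (rule geo)
    also have "(\<Sum>i<n. norm (complex_of_real (b (t + i)) - of_real (b (t + Suc i)))) = (\<Sum>i<n. b (t + i) - b (t + Suc i))"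
    proof (intro sum.cong refl)
      fix i
      show "norm (complex_of_real (b (t + i)) - of_real (b (t + Suc i))) = b (t + i) - b (t + Suc i)"
        using dec[of "t + i"] by (simp flip: of_real_diff)
    qed
    also have "\<dots> = b t - b (t + n)" using sum_lessThan_telescope'[of "\<lambda>i. b (t + i)" n] by simp
    also have "norm (complex_of_real (b (t + n))) + (b t - b (t + n)) = b t" using b0 by simp
    finally have tail: "norm (\<Sum>i<n. of_real (b (t + i)) * ee (\<beta> * real (t + i))) \<le> 1 / (2 * \<bar>\<beta>\<bar>) * b t" .
    have bt: "b t \<le> \<bar>\<beta>\<bar> powr (2/3)"
    proof -
      have "b t \<le> real (Suc t) powr (-2/3)" by (rule b)
      also have "\<dots> \<le> (1 / \<bar>\<beta>\<bar>) powr (-2/3)" using t(1) \<beta> by (intro powr_mono2') auto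
      finally show ?thesis using \<beta> by (simp add: powr_divide powr_minus_divide)
    qed
    have "1 / (2 * \<bar>\<beta>\<bar>) * b t \<le> 1 / (2 * \<bar>\<beta>\<bar>) * \<bar>\<beta>\<bar> powr (2/3)"
      using bt by (intro mult_left_mono) auto
    also have "\<dots> = 1/2 * \<bar>\<beta>\<bar> powr (-1/3)"
    proof -
      have "\<bar>\<beta>\<bar> powr (2/3) = \<bar>\<beta>\<bar> powr 1 * \<bar>\<beta>\<bar> powr (-1/3)" unfolding powr_add[symmetric] by simp
      then show ?thesis using \<beta> by simp
    qed
    finally have "norm (\<Sum>i<n. of_real (b (t + i)) * ee (\<beta> * real (t + i))) \<le> 1/2 * \<bar>\<beta>\<bar> powr (-1/3)"
      using tail by linarith
    then show ?thesis unfolding split using triv[of t] powr_ge_zero[of "\<bar>\<beta>\<bar>" "-1/3"]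
      by (intro order_trans[OF norm_triangle_ineq]) linarith
  qed
qed

section \<open>Binomial coefficients with negative exponent and ratios of Gamma values\<close>

definition neg_binom :: "real \<Rightarrow> nat \<Rightarrow> real" where
  "neg_binom a n = pochhammer a n / fact n"

lemma neg_binom_Suc: "neg_binom a (Suc n) = neg_binom a n * (a + real n) / (real n + 1)"
  by (simp add: neg_binom_def pochhammer_Suc field_simps)

lemma neg_binom_nonneg: "a > 0 \<Longrightarrow> neg_binom a n \<ge> 0"
  by (simp add: neg_binom_def pochhammer_nonneg)

lemma neg_binom_decreasing: "0 < a \<Longrightarrow> a \<le> 1 \<Longrightarrow> neg_binom a (Suc n) \<le> neg_binom a n"
  using neg_binom_nonneg[of a n] unfolding neg_binom_Suc by (simp add: divide_le_eq mult_left_mono)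

text \<open>Induction on the ratio of consecutive terms, which is 1 - (1 - a)/s with s = n + 1. By
  Bernoulli, ((s + 1)/s) powr (1 - a) is at most 1 + (1 - a)/s, and the product of the two is at
  most 1.\<close>

lemma neg_binom_le_powr:
  assumes "0 < a" "a \<le> 1"
  shows "neg_binom a n \<le> real (Suc n) powr (a - 1)"
proof (induction n)
  case (Suc n)
  define s where "s = real n + 1"
  have s: "s \<ge> 1" by (simp add: s_def)
  have "neg_binom a (Suc n) = neg_binom a n * ((s + a - 1) / s)" by (simp add: neg_binom_Suc s_def add.commute)
  also have "\<dots> \<le> s powr (a - 1) * ((s + a - 1) / s)"
    using Suc s assms by (intro mult_right_mono) (auto simp: s_def add.commute)
  also have "\<dots> \<le> (s + 1) powr (a - 1)"
  proof -
    have "((s + 1) / s) powr (1 - a) = (1 + 1 / s) powr (1 - a)" using s by (simp add: field_simps)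
    also have "\<dots> \<le> 1 + (1 - a) * (1 / s)" using assms s by (intro one_plus_powr_le) auto
    finally have "((s + 1) / s) powr (1 - a) * ((s + a - 1) / s) \<le> (1 + (1 - a) * (1 / s)) * ((s + a - 1) / s)"
      using s assms by (intro mult_right_mono) auto
    also have "\<dots> = (s + (1 - a)) * (s - (1 - a)) / s\<^sup>2" using s by (simp add: field_simps power2_eq_square)
    also have "\<dots> = 1 - ((1 - a) / s)\<^sup>2" using s by (simp add: field_simps power2_eq_square)
    also have "\<dots> \<le> 1" by simp
    finally have le1: "((s + 1) / s) powr (1 - a) * ((s + a - 1) / s) \<le> 1" .
    have "s powr (a - 1) * ((s + a - 1) / s) = (s + 1) powr (a - 1) * (((s + 1) / s) powr (1 - a) * ((s + a - 1) / s))"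
    proof -
      have "(s + 1) powr (a - 1) * ((s + 1) / s) powr (1 - a) = (s + 1) powr ((a - 1) + (1 - a)) / s powr (1 - a)"
        using s by (simp add: powr_divide powr_add[symmetric])
      also have "\<dots> = s powr (a - 1)" using s by (simp add: powr_minus_divide[symmetric])
      finally show ?thesis by (simp add: mult.assoc[symmetric])
    qed
    also have "\<dots> \<le> (s + 1) powr (a - 1) * 1" using le1 by (intro mult_left_mono) auto
    finally show ?thesis by simp
  qed
  finally show ?case by (simp add: s_def add.commute)
qed (simp add: neg_binom_def)

text \<open>Vandermonde's identity for rising factorials; it makes convolution add the
  parameters.\<close>

lemma neg_binom_convolution: "neg_binom (a + b) n = (\<Sum>k\<le>n. neg_binom a k * neg_binom b (n - k))"
proof -
  have "neg_binom (a + b) n = (\<Sum>k\<le>n. of_nat (n choose k) * pochhammer a k * pochhammer b (n - k) / fact n)"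
    unfolding neg_binom_def pochhammer_binomial_sum by (simp add: sum_divide_distrib)
  also have "\<dots> = (\<Sum>k\<le>n. neg_binom a k * neg_binom b (n - k))"
    by (intro sum.cong refl) (simp add: neg_binom_def binomial_fact field_simps)
  finally show ?thesis .
qed

definition neg_binom_fps :: "real \<Rightarrow> real fps" where
  "neg_binom_fps a = Abs_fps (neg_binom a)"

lemma neg_binom_fps_power: "s \<ge> 1 \<Longrightarrow> neg_binom_fps a ^ s = neg_binom_fps (real s * a)"
proof (induction s rule: nat_induct_at_least)
  case (Suc s)
  have "neg_binom_fps x * neg_binom_fps y = neg_binom_fps (x + y)" for x y
    by (rule fps_ext) (simp add: neg_binom_fps_def fps_mult_nth neg_binom_convolution atMost_atLeast0)
  then show ?case using Suc by (simp add: algebra_simps)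
qed auto

text \<open>Truncating the entries at K loses nothing, because no entry exceeds the sum n. This is
  the s-th convolution power, read off from a power of formal power series.\<close>

lemma sum_tuples_neg_binom:
  assumes s: "s \<ge> 1" and n: "n \<le> K"
  shows "(\<Sum>ms | ms \<in> tuples s {..K} \<and> sum_list ms = n. \<Prod>m\<leftarrow>ms. neg_binom a m) = neg_binom (real s * a) n"
proof -
  have mem: "m \<le> sum_list ms" if "m \<in> set ms" for m and ms :: "nat list"
    using that by (intro member_le_sum_list) auto
  have set_eq: "{ms. ms \<in> tuples s {..K} \<and> sum_list ms = n} = natpermute n s"
    using n by (auto simp: tuples_def natpermute_def dest!: mem)
  have "(\<Sum>ms\<in>natpermute n s. \<Prod>m\<leftarrow>ms. neg_binom a m) = (\<Sum>v\<in>natpermute n s. \<Prod>j = 0..s - 1. fps_nth (neg_binom_fps a) (v ! j))"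
  proof (rule sum.cong[OF refl])
    fix v assume "v \<in> natpermute n s"
    then have l: "length v = s" by (simp add: natpermute_def)
    have "(\<Prod>m\<leftarrow>v. neg_binom a m) = (\<Prod>j = 0..<s. neg_binom a (v ! j))" by (simp add: prod.list_conv_set_nth l)
    also have "{0..<s} = {0..s - 1}" using s by auto
    finally show "(\<Prod>m\<leftarrow>v. neg_binom a m) = (\<Prod>j = 0..s - 1. fps_nth (neg_binom_fps a) (v ! j))" by (simp add: neg_binom_fps_def)
  qed
  also have "\<dots> = fps_nth (neg_binom_fps a ^ s) n" using s by (simp add: fps_power_nth)
  finally show ?thesis unfolding set_eq neg_binom_fps_power[OF s] by (simp add: neg_binom_fps_def)
qed

text \<open>Gautschi's inequality from the logarithmic convexity of Gamma: x + s lies between x and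
  x + 1, which gives the upper bound, and x + 1 lies between x + s and x + s + 1, which gives the
  lower one.\<close>

lemma Gamma_ratio_bounds:
  fixes x s :: real
  assumes x: "x > 0" and s: "0 < s" "s < 1"
  shows "(x + s) powr (s - 1) * Gamma (x + 1) \<le> Gamma (x + s)" "Gamma (x + s) \<le> x powr (s - 1) * Gamma (x + 1)"
proof -
  note cvx = convex_onD[OF log_convex_Gamma_real]
  have pos: "Gamma x > 0" "Gamma (x + s) > 0" "Gamma (x + 1) > 0" "Gamma (x + s + 1) > 0" using x s by (auto intro!: Gamma_real_pos)
  have rec: "Gamma (x + 1) = x * Gamma x" "Gamma (x + s + 1) = (x + s) * Gamma (x + s)"
    using x s by (intro Gamma_plus1; auto elim!: nonpos_Ints_cases)+
  have "ln (Gamma (x + s)) \<le> (1 - s) * ln (Gamma x) + s * ln (Gamma (x + 1))"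
    using cvx[of s x "x + 1"] x s by (simp add: algebra_simps)
  also have "ln (Gamma x) = ln (Gamma (x + 1)) - ln x" 
  proof -
    have "Gamma x \<noteq> 0" using pos(1) by (rule less_imp_neq[symmetric])
    then show ?thesis unfolding rec(1) using x by (simp add: ln_mult)
  qed
  also have "(1 - s) * (ln (Gamma (x + 1)) - ln x) + s * ln (Gamma (x + 1)) = ln (x powr (s - 1) * Gamma (x + 1))"
  proof -
    have "Gamma (x + 1) \<noteq> 0" using pos(3) by (rule less_imp_neq[symmetric])
    then have "ln (x powr (s - 1) * Gamma (x + 1)) = (s - 1) * ln x + ln (Gamma (x + 1))"
      using x by (simp add: ln_mult ln_powr)
    then show ?thesis by (simp add: algebra_simps)
  qed
  finally show "Gamma (x + s) \<le> x powr (s - 1) * Gamma (x + 1)" using x pos by simp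
  have "ln (Gamma (x + 1)) \<le> s * ln (Gamma (x + s)) + (1 - s) * ln (Gamma (x + s + 1))"
    using cvx[of "1 - s" "x + s" "x + s + 1"] x s by (simp add: algebra_simps)
  also have "ln (Gamma (x + s + 1)) = ln (x + s) + ln (Gamma (x + s))"
  proof -
    have "Gamma (x + s) \<noteq> 0" using pos(2) by (rule less_imp_neq[symmetric])
    then show ?thesis unfolding rec(2) using x s by (simp add: ln_mult)
  qed
  finally have "ln (Gamma (x + 1)) - (1 - s) * ln (x + s) \<le> ln (Gamma (x + s))" by (simp add: algebra_simps)
  moreover have "ln ((x + s) powr (s - 1) * Gamma (x + 1)) = ln (Gamma (x + 1)) - (1 - s) * ln (x + s)"
  proof -
    have "Gamma (x + 1) \<noteq> 0" using pos(3) by (rule less_imp_neq[symmetric])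
    then have "ln ((x + s) powr (s - 1) * Gamma (x + 1)) = (s - 1) * ln (x + s) + ln (Gamma (x + 1))"
      using x s by (simp add: ln_mult ln_powr)
    then show ?thesis by (simp add: algebra_simps)
  qed
  ultimately have le: "ln ((x + s) powr (s - 1) * Gamma (x + 1)) \<le> ln (Gamma (x + s))" by linarith
  have "(x + s) powr (s - 1) * Gamma (x + 1) > 0" using x s pos(3) by (intro mult_pos_pos) auto
  with le pos(2) show "(x + s) powr (s - 1) * Gamma (x + 1) \<le> Gamma (x + s)" by (simp only: ln_le_cancel_iff)
qed

lemma neg_binom_Gamma: "a > 0 \<Longrightarrow> neg_binom a n = Gamma (a + real n) / (Gamma a * Gamma (real n + 1))"
  by (subst neg_binom_def, subst pochhammer_Gamma) (auto simp: Gamma_fact add.commute elim!: nonpos_Ints_cases)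

lemma Gamma_four_thirds: "0 < Gamma (4/3 :: real)" "Gamma (4/3 :: real) \<le> 1" "Gamma (4/3 :: real) = Gamma (1/3) / 3"
proof -
  show "0 < Gamma (4/3 :: real)" by (rule Gamma_real_pos) simp
  show "Gamma (4/3 :: real) \<le> 1" using Gamma_ratio_bounds(2)[of 1 "1/3"] by (simp add: Gamma_numeral)
  have "Gamma (1/3 + 1 :: real) = 1/3 * Gamma (1/3)" by (rule Gamma_plus1) (auto elim!: nonpos_Ints_cases)
  then show "Gamma (4/3 :: real) = Gamma (1/3) / 3" by simp
qed

text \<open>After scaling by Gamma (4/3), the coefficient is close to the derivative of the cube
  root at m, that is, to the density of the cubes.\<close>

lemma neg_binom_third_bounds:
  assumes "m \<ge> 1"
  shows "(real m + 1/3) powr (-2/3) / 3 \<le> Gamma (4/3) * neg_binom (1/3) m" "Gamma (4/3) * neg_binom (1/3) m \<le> real m powr (-2/3) / 3"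
proof -
  have pos: "Gamma (1/3 :: real) > 0" "Gamma (real m + 1) > 0" by (auto intro!: Gamma_real_pos)
  have ne: "Gamma (1/3 :: real) \<noteq> 0" using pos(1) by (rule less_imp_neq[symmetric])
  have "Gamma (4/3) * neg_binom (1/3) m = Gamma (real m + 1/3) / Gamma (real m + 1) / 3"
    using ne by (simp add: neg_binom_Gamma Gamma_four_thirds(3) add.commute)
  then show "(real m + 1/3) powr (-2/3) / 3 \<le> Gamma (4/3) * neg_binom (1/3) m" "Gamma (4/3) * neg_binom (1/3) m \<le> real m powr (-2/3) / 3"
    using Gamma_ratio_bounds[of "real m" "1/3"] assms pos by (auto simp: field_simps)
qed

text \<open>The functional equation moves x + 5/3 to x + 2/3, within the range of the ratio bounds.
  The two bounds pin the ratio between x powr (2/3) and x powr (2/3) + 1.\<close>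

lemma neg_binom_five_thirds_approx:
  assumes "n \<ge> 1"
  shows "\<bar>neg_binom (5/3) n - real n powr (2/3) / Gamma (5/3)\<bar> \<le> 1 / Gamma (5/3)"
proof -
  define x where "x = real n"
  have x: "x \<ge> 1" using assms by (simp add: x_def)
  have pos: "Gamma (5/3 :: real) > 0" "Gamma (x + 1) > 0" using x by (auto intro!: Gamma_real_pos)
  have rec: "Gamma (x + 5/3) = (x + 2/3) * Gamma (x + 2/3)"
  proof -
    have "x + 2/3 \<notin> \<int>\<^sub>\<le>\<^sub>0" using x by (auto elim!: nonpos_Ints_cases)
    from Gamma_plus1[OF this] show ?thesis by (simp add: add.assoc)
  qed
  define R where "R = Gamma (x + 5/3) / Gamma (x + 1)"
  have pcR: "neg_binom (5/3) n = R / Gamma (5/3)" by (simp add: neg_binom_Gamma R_def x_def add.commute)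
  have "R \<le> (x + 2/3) * (x powr (2/3 - 1))"
  proof -
    have "Gamma (x + 2/3) / Gamma (x + 1) \<le> x powr (2/3 - 1)"
      using Gamma_ratio_bounds(2)[of x "2/3"] x pos by (simp add: pos_divide_le_eq)
    then have "(x + 2/3) * (Gamma (x + 2/3) / Gamma (x + 1)) \<le> (x + 2/3) * (x powr (2/3 - 1))"
      using x by (intro mult_left_mono) auto
    then show ?thesis by (simp add: R_def rec)
  qed
  also have "\<dots> = x powr (2/3) + 2/3 * x powr (-1/3)"
  proof -
    have "x * x powr (-1/3) = x powr (2/3)" using x powr_add[of x 1 "-1/3"] by simp
    then show ?thesis by (simp add: distrib_right)
  qed
  also have "x powr (-1/3) \<le> 1" using x powr_mono[of "-1/3" 0 x] by simp
  finally have 1: "R \<le> x powr (2/3) + 1" by simp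
  have "x powr (2/3) \<le> (x + 2/3) powr (2/3)" using x by (intro powr_mono2) auto
  also have "\<dots> = (x + 2/3) * (x + 2/3) powr (2/3 - 1)" using x powr_add[of "x + 2/3" 1 "2/3 - 1"] by simp
  also have "\<dots> \<le> R"
  proof -
    have "(x + 2/3) powr (2/3 - 1) \<le> Gamma (x + 2/3) / Gamma (x + 1)"
      using Gamma_ratio_bounds(1)[of x "2/3"] x pos by (simp add: pos_le_divide_eq)
    then have "(x + 2/3) * (x + 2/3) powr (2/3 - 1) \<le> (x + 2/3) * (Gamma (x + 2/3) / Gamma (x + 1))"
      using x by (intro mult_left_mono) auto
    then show ?thesis by (simp add: R_def rec)
  qed
  finally have 2: "x powr (2/3) \<le> R" .
  have "\<bar>R - x powr (2/3)\<bar> / Gamma (5/3) \<le> 1 / Gamma (5/3)" using 1 2 pos by (intro divide_right_mono) auto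
  moreover have "neg_binom (5/3) n - real n powr (2/3) / Gamma (5/3) = (R - x powr (2/3)) / Gamma (5/3)"
    by (simp add: pcR x_def diff_divide_distrib)
  ultimately show ?thesis using pos by simp
qed

text \<open>The usual model is the integral of \<open>e(\<beta> t\<^sup>3)\<close> over \<open>t \<le> P\<close>. Here \<open>neg_binom (1/3) m\<close> is the coefficient of
  \<open>x\<^sup>m\<close> in \<open>(1 - x) powr (-1/3)\<close>, so the singular integral, a fifth convolution power, is exactly
  \<open>Gamma (4/3)\<^sup>5 neg_binom (5/3) n\<close>.\<close>

definition smooth_sum :: "nat \<Rightarrow> real \<Rightarrow> complex" where
  "smooth_sum P \<beta> = of_real (Gamma (4/3)) * (\<Sum>m\<le>P ^ 3. of_real (neg_binom (1/3) m) * ee (\<beta> * real m))"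

lemma norm_smooth_sum_le: "norm (smooth_sum P \<beta>) \<le> 7 * \<bar>\<beta>\<bar> powr (-1/3)" if "\<beta> \<noteq> 0" "\<bar>\<beta>\<bar> \<le> 1/2"
proof -
  have "norm (smooth_sum P \<beta>) = Gamma (4/3) * norm (\<Sum>m<Suc (P ^ 3). of_real (neg_binom (1/3) m) * ee (\<beta> * real m))"
    using Gamma_four_thirds(1) by (simp add: smooth_sum_def norm_mult lessThan_Suc_atMost)
  also have "\<dots> \<le> 1 * (7 * \<bar>\<beta>\<bar> powr (-1/3))"
    using Gamma_four_thirds neg_binom_le_powr[of "1/3"] that
    by (intro mult_mono norm_monotone_sum_ee_le neg_binom_decreasing neg_binom_nonneg) auto
  finally show ?thesis by simp
qed

lemma norm_smooth_sum_le_trivial: "norm (smooth_sum P \<beta>) \<le> 6 * real P" if "P \<ge> 1"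
proof -
  have "norm (smooth_sum P \<beta>) \<le> 1 * (\<Sum>m<Suc (P ^ 3). real (Suc m) powr (-2/3))"
    unfolding smooth_sum_def norm_mult lessThan_Suc_atMost using Gamma_four_thirds neg_binom_le_powr[of "1/3"] neg_binom_nonneg[of "1/3"]
    by (intro mult_mono sum_norm_le) (auto simp: norm_mult)
  also have "\<dots> \<le> 1 * (3 * real (Suc (P ^ 3)) powr (1/3))"
    by (intro mult_left_mono sum_powr_neg_two_thirds_le) auto
  also have "real (Suc (P ^ 3)) powr (1/3) \<le> ((2 * real P) ^ 3) powr (1/3)"
  proof (rule powr_mono2)
    have "1 \<le> real P ^ 3" using that by (intro one_le_power) simp
    then show "real (Suc (P ^ 3)) \<le> (2 * real P) ^ 3" by (simp add: power_mult_distrib)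
  qed auto
  also have "((2 * real P) ^ 3) powr (1/3) = 2 * real P" by (rule cube_powr_third) simp
  finally show ?thesis by simp
qed

lemma smooth_sum_periodic: "smooth_sum P (\<beta> + of_int k) = smooth_sum P \<beta>"
proof -
  have "ee ((\<beta> + of_int k) * real m) = ee (\<beta> * real m)" for m
    using ee_add_int[of "\<beta> * real m" "k * int m"] by (simp add: distrib_right)
  then show ?thesis by (simp add: smooth_sum_def)
qed

lemma smooth_sum_power:
  "smooth_sum P \<beta> ^ s = of_real (Gamma (4/3) ^ s) * (\<Sum>ms\<in>tuples s {..P ^ 3}. of_real (\<Prod>m\<leftarrow>ms. neg_binom (1/3) m) * ee (\<beta> * real (sum_list ms)))"
proof -
  have "(\<Prod>m\<leftarrow>ms. complex_of_real (neg_binom (1/3) m) * ee (\<beta> * real m)) = of_real (\<Prod>m\<leftarrow>ms. neg_binom (1/3) m) * ee (\<beta> * real (sum_list ms))" for ms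
    by (induction ms) (simp_all add: distrib_left ee_add)
  then show ?thesis by (simp add: smooth_sum_def power_mult_distrib sum_power_tuples)
qed


section \<open>Comparison of the cubic sum with weighted sums over the blocks between cubes\<close>

definition cube_gap :: "nat \<Rightarrow> nat" where
  "cube_gap x = 3 * x\<^sup>2 + 3 * x + 1"

lemma Suc_cube: "Suc x ^ 3 = x ^ 3 + cube_gap x"
  by (simp add: cube_gap_def power2_eq_square power3_eq_cube algebra_simps)

lemma cube_gap_pos [simp]: "0 < cube_gap x"
  by (simp add: cube_gap_def)

lemma cube_gap_mono: "x \<le> y \<Longrightarrow> cube_gap x \<le> cube_gap y"
  by (auto simp: cube_gap_def intro: add_mono power_mono)

lemma cube_gap_le: "1 \<le> P \<Longrightarrow> x \<le> P \<Longrightarrow> real (cube_gap x) \<le> 7 * (real P)\<^sup>2"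
proof -
  assume P: "1 \<le> P" "x \<le> P"
  have "real (cube_gap x) \<le> real (cube_gap P)" using cube_gap_mono[OF P(2)] by simp
  also have "\<dots> = 3 * (real P)\<^sup>2 + 3 * real P + 1" by (simp add: cube_gap_def)
  also have "\<dots> \<le> 7 * (real P)\<^sup>2"
  proof -
    have "3 * y\<^sup>2 + 3 * y + 1 \<le> 7 * y\<^sup>2" if "1 \<le> y" for y :: real
      using self_le_power[of y 2] one_le_power[of y 2] that by simp
    then show ?thesis using P(1) by simp
  qed
  finally show ?thesis .
qed

text \<open>The mean of e(\<beta> m) over L consecutive integers, normalised to start at 0. For L =
  \<open>cube_gap x\<close> its distance from 1 is the relative error of replacing the point x^3 by
  the block that begins there.\<close>

definition phase_mean :: "nat \<Rightarrow> real \<Rightarrow> complex" where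
  "phase_mean L \<beta> = (\<Sum>j<L. ee (\<beta> * real j)) / of_nat L"

text \<open>One more term moves the mean by a 1/(K + 1) part of its distance to e(\<beta> K), which
  is at most 2 pi |\<beta>| K. Being Lipschitz in the length, the means have total variation
  O(|\<beta>| P^2) along the blocks.\<close>

lemma norm_phase_mean_diff_le:
  assumes "1 \<le> L" "L \<le> K"
  shows "norm (phase_mean L \<beta> - phase_mean K \<beta>) \<le> 2 * pi * \<bar>\<beta>\<bar> * (real K - real L)"
  using assms(2)
proof (induction K rule: dec_induct)
  case (step K)
  have K: "K \<ge> 1" using step assms by simp
  have "of_nat K * (phase_mean K \<beta> - ee (\<beta> * real K)) = (\<Sum>j<K. ee (\<beta> * real j) - ee (\<beta> * real K))"
    using K by (simp add: phase_mean_def sum_subtractf right_diff_distrib)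
  moreover have "norm (\<Sum>j<K. ee (\<beta> * real j) - ee (\<beta> * real K)) \<le> (\<Sum>j<K. 2 * pi * \<bar>\<beta>\<bar> * real K)"
  proof (intro sum_norm_le order_trans[OF norm_ee_diff_le])
    fix j assume "j \<in> {..<K}"
    then have "\<bar>\<beta> * real j - \<beta> * real K\<bar> \<le> \<bar>\<beta>\<bar> * real K"
      by (simp add: abs_mult mult_left_mono flip: right_diff_distrib)
    then show "2 * pi * \<bar>\<beta> * real j - \<beta> * real K\<bar> \<le> 2 * pi * \<bar>\<beta>\<bar> * real K" by simp
  qed
  ultimately have "real K * norm (phase_mean K \<beta> - ee (\<beta> * real K)) \<le> real K * (2 * pi * \<bar>\<beta>\<bar> * real K)"
    by (metis norm_mult norm_of_nat sum_constant card_lessThan)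
  then have d: "norm (phase_mean K \<beta> - ee (\<beta> * real K)) \<le> 2 * pi * \<bar>\<beta>\<bar> * real K" using K by simp
  have "phase_mean K \<beta> - phase_mean (Suc K) \<beta> = (phase_mean K \<beta> - ee (\<beta> * real K)) / of_nat (Suc K)"
    using K by (simp add: phase_mean_def field_simps del: of_nat_Suc) (simp add: algebra_simps)
  then have "norm (phase_mean K \<beta> - phase_mean (Suc K) \<beta>) = norm (phase_mean K \<beta> - ee (\<beta> * real K)) / real (Suc K)"
    by (simp add: norm_divide del: of_nat_Suc)
  also have "\<dots> \<le> (2 * pi * \<bar>\<beta>\<bar> * real K) / real (Suc K)" using d by (intro divide_right_mono) auto
  also have "\<dots> \<le> 2 * pi * \<bar>\<beta>\<bar>" by (simp add: divide_le_eq mult_left_mono)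
  finally have "norm (phase_mean L \<beta> - phase_mean (Suc K) \<beta>) \<le> 2 * pi * \<bar>\<beta>\<bar> * (real K - real L) + 2 * pi * \<bar>\<beta>\<bar>"
    using step.IH norm_triangle_ineq[of "phase_mean L \<beta> - phase_mean K \<beta>" "phase_mean K \<beta> - phase_mean (Suc K) \<beta>"] by simp
  then show ?case by (simp add: algebra_simps)
qed simp

lemma norm_one_minus_phase_mean_le: "1 \<le> L \<Longrightarrow> norm (1 - phase_mean L \<beta>) \<le> 2 * pi * \<bar>\<beta>\<bar> * real L"
  using norm_phase_mean_diff_le[of 1 L \<beta>] by (simp add: phase_mean_def) (smt (verit) mult_left_mono mult_nonneg_nonneg abs_ge_zero pi_ge_zero)

definition cube_root_floor :: "nat \<Rightarrow> nat" where
  "cube_root_floor m = (LEAST x. m < Suc x ^ 3)"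

lemma cube_root_floor_less: "m < Suc (cube_root_floor m) ^ 3"
  unfolding cube_root_floor_def
  by (rule LeastI[of "\<lambda>x. m < Suc x ^ 3" m]) (rule less_le_trans[OF lessI self_le_power], auto)

lemma cube_root_floor_le: "m < Suc x ^ 3 \<Longrightarrow> cube_root_floor m \<le> x"
  unfolding cube_root_floor_def by (rule Least_le)

lemma cube_root_floor_block: "j < cube_gap x \<Longrightarrow> cube_root_floor (x ^ 3 + j) = x"
proof (rule antisym)
  assume j: "j < cube_gap x"
  then show "cube_root_floor (x ^ 3 + j) \<le> x" by (intro cube_root_floor_le) (simp add: Suc_cube)
  have "x ^ 3 < Suc (cube_root_floor (x ^ 3 + j)) ^ 3" using cube_root_floor_less[of "x ^ 3 + j"] by simp
  then show "x \<le> cube_root_floor (x ^ 3 + j)" by (metis less_Suc_eq_le power_less_imp_less_base zero_le)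
qed

lemma cube_root_floor_mono: "m \<le> n \<Longrightarrow> cube_root_floor m \<le> cube_root_floor n"
  using cube_root_floor_less[of n] by (intro cube_root_floor_le) simp

text \<open>The weights of the integers between two consecutive cubes have sum \<open>1\<close>.\<close>

definition block_weight :: "nat \<Rightarrow> real" where
  "block_weight m = 1 / real (cube_gap (cube_root_floor m))"

lemma block_weight_nonneg: "block_weight m \<ge> 0"
  by (simp add: block_weight_def)

lemma block_weight_decreasing: "block_weight (Suc m) \<le> block_weight m"
  unfolding block_weight_def using cube_gap_mono[OF cube_root_floor_mono[of m "Suc m"]]
  by (intro divide_left_mono mult_pos_pos) auto

lemma block_weight_le_powr: "block_weight m \<le> real (Suc m) powr (-2/3)"
proof -
  define y where "y = real (Suc (cube_root_floor m))"
  have y: "y \<ge> 1" by (simp add: y_def)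
  have "Suc m \<le> Suc (cube_root_floor m) ^ 3" using cube_root_floor_less[of m] by simp
  then have "real (Suc m) \<le> y ^ 3" unfolding y_def by (metis of_nat_le_iff of_nat_power)
  then have "(y ^ 3) powr (-2/3) \<le> real (Suc m) powr (-2/3)" by (intro powr_mono2') auto
  moreover have "(y ^ 3) powr (-2/3) = 1 / y\<^sup>2"
  proof -
    have "(y ^ 3) powr (-2/3) = ((y ^ 3) powr (1/3)) powr (-2)" by (simp only: powr_powr) simp
    also have "\<dots> = 1 / y\<^sup>2" using y by (simp add: powr_minus_divide)
    finally show ?thesis .
  qed
  moreover have "block_weight m \<le> 1 / y\<^sup>2"
  proof -
    have "y\<^sup>2 \<le> real (cube_gap (cube_root_floor m))" by (simp add: y_def cube_gap_def power2_eq_square algebra_simps)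
    then show ?thesis unfolding block_weight_def using y by (intro divide_left_mono) (auto intro!: mult_pos_pos)
  qed
  ultimately show ?thesis by simp
qed

lemma sum_cube_blocks: "(\<Sum>m<y ^ 3. h m) = (\<Sum>x<y. \<Sum>j<cube_gap x. h (x ^ 3 + j))" for h :: "nat \<Rightarrow> 'a::comm_monoid_add"
proof (induction y)
  case (Suc y)
  have "(\<Sum>m<y ^ 3 + cube_gap y. h m) = (\<Sum>m<y ^ 3. h m) + (\<Sum>m\<in>{y ^ 3..<y ^ 3 + cube_gap y}. h m)"
    by (simp add: lessThan_atLeast0 sum.atLeastLessThan_concat)
  also have "(\<Sum>m\<in>{y ^ 3..<y ^ 3 + cube_gap y}. h m) = (\<Sum>j<cube_gap y. h (y ^ 3 + j))"
    by (rule sum.reindex_bij_witness[of _ "\<lambda>j. y ^ 3 + j" "\<lambda>m. m - y ^ 3"]) auto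
  finally show ?case using Suc by (simp only: Suc_cube sum.lessThan_Suc)
qed simp

text \<open>On a block the weight is constant, so the smooth side is the cubic sum with each term
  multiplied by a mean close to 1. The comparison thus reduces to partial summation.\<close>

lemma sum_block_weight_eq: "(\<Sum>m<y ^ 3. of_real (block_weight m) * ee (\<beta> * real m)) = (\<Sum>x<y. phase_mean (cube_gap x) \<beta> * ee (\<beta> * real x ^ 3))"
  unfolding sum_cube_blocks
proof (rule sum.cong[OF refl])
  fix x
  have "(\<Sum>j<cube_gap x. complex_of_real (block_weight (x ^ 3 + j)) * ee (\<beta> * real (x ^ 3 + j)))
      = (\<Sum>j<cube_gap x. ee (\<beta> * real j) / of_nat (cube_gap x) * ee (\<beta> * real x ^ 3))"
    by (intro sum.cong refl) (simp add: block_weight_def cube_root_floor_block distrib_left ee_add)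
  then show "(\<Sum>j<cube_gap x. complex_of_real (block_weight (x ^ 3 + j)) * ee (\<beta> * real (x ^ 3 + j))) = phase_mean (cube_gap x) \<beta> * ee (\<beta> * real x ^ 3)"
    by (simp add: phase_mean_def sum_divide_distrib sum_distrib_right)
qed

text \<open>The error is bounded by a small multiple of the largest partial sum, so this largest
  partial sum is controlled by its smooth counterpart.\<close>

lemma cubic_sum_block_weight_approx:
  assumes P: "P \<ge> 1" and \<beta>: "\<bar>\<beta>\<bar> \<le> 1 / (200 * (real P)\<^sup>2)"
  shows "norm ((\<Sum>x<P. ee (\<beta> * real x ^ 3)) - (\<Sum>m<P ^ 3. of_real (block_weight m) * ee (\<beta> * real m))) \<le> 1300 * real P powr (2/3)"
proof -
  define S V where "S y = (\<Sum>x<y. ee (\<beta> * real x ^ 3))" and "V y = (\<Sum>m<y ^ 3. of_real (block_weight m) * ee (\<beta> * real m))" for y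
  define A where "A = Max ((\<lambda>y. norm (S y)) ` {..P})"
  \<comment> \<open>The factor 88 is (88/7) * 7, from 4 pi <= 88/7 and \<open>cube_gap\<close> <= 7
    P^2. The 200 in the hypothesis makes K <= 1/2.\<close>
  define K where "K = 88 * (real P)\<^sup>2 * \<bar>\<beta>\<bar>"
  have P2: "1 \<le> (real P)\<^sup>2" using P by (intro one_le_power) simp
  have A: "norm (S y) \<le> A" if "y \<le> P" for y using that by (auto simp: A_def)
  have K: "K \<le> 1/2" "0 \<le> K"
  proof -
    have "0 < 200 * (real P)\<^sup>2" using P2 by linarith
    from \<beta> have "\<bar>\<beta>\<bar> * (200 * (real P)\<^sup>2) \<le> 1" unfolding pos_le_divide_eq[OF \<open>0 < 200 * (real P)\<^sup>2\<close>] .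
    then show "K \<le> 1/2" by (simp add: K_def algebra_simps)
  qed (simp add: K_def)
  have Lc0: "real (cube_gap 0) = 1" by (simp add: cube_gap_def)
  have A0: "0 \<le> A" using A[of 0] norm_ge_zero order_trans by blast
  have err: "norm (S y - V y) \<le> A * K" if y: "y \<le> P" for y
  proof -
    have "S y - V y = (\<Sum>x<y. (1 - phase_mean (cube_gap x) \<beta>) * ee (\<beta> * real x ^ 3))"
      unfolding S_def V_def sum_block_weight_eq by (simp add: sum_subtractf left_diff_distrib)
    also have "norm \<dots> \<le> A * (norm (1 - phase_mean (cube_gap y) \<beta>) + (\<Sum>x<y. norm ((1 - phase_mean (cube_gap x) \<beta>) - (1 - phase_mean (cube_gap (Suc x)) \<beta>))))"
      using y A by (intro norm_abel_sum_le) (auto simp: S_def)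
    also have "\<dots> \<le> A * (2 * pi * \<bar>\<beta>\<bar> * real (cube_gap y) + (\<Sum>x<y. 2 * pi * \<bar>\<beta>\<bar> * (real (cube_gap (Suc x)) - real (cube_gap x))))"
    proof (intro mult_left_mono add_mono sum_mono)
      show "norm (1 - phase_mean (cube_gap y) \<beta>) \<le> 2 * pi * \<bar>\<beta>\<bar> * real (cube_gap y)" by (intro norm_one_minus_phase_mean_le) (simp add: cube_gap_def)
      fix x
      have "norm ((1 - phase_mean (cube_gap x) \<beta>) - (1 - phase_mean (cube_gap (Suc x)) \<beta>)) = norm (phase_mean (cube_gap x) \<beta> - phase_mean (cube_gap (Suc x)) \<beta>)"
        by (simp add: norm_minus_commute)
      also have "\<dots> \<le> 2 * pi * \<bar>\<beta>\<bar> * (real (cube_gap (Suc x)) - real (cube_gap x))"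
        using cube_gap_mono[of x "Suc x"] by (intro norm_phase_mean_diff_le) (simp_all add: cube_gap_def)
      finally show "norm ((1 - phase_mean (cube_gap x) \<beta>) - (1 - phase_mean (cube_gap (Suc x)) \<beta>)) \<le> 2 * pi * \<bar>\<beta>\<bar> * (real (cube_gap (Suc x)) - real (cube_gap x))" .
    qed (rule A0)
    also have "(\<Sum>x<y. 2 * pi * \<bar>\<beta>\<bar> * (real (cube_gap (Suc x)) - real (cube_gap x))) = 2 * pi * \<bar>\<beta>\<bar> * (real (cube_gap y) - 1)"
      using sum_lessThan_telescope[of "\<lambda>x. real (cube_gap x)" y] Lc0 by (simp only: sum_distrib_left[symmetric])
    also have "A * (2 * pi * \<bar>\<beta>\<bar> * real (cube_gap y) + 2 * pi * \<bar>\<beta>\<bar> * (real (cube_gap y) - 1)) \<le> A * K"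
    proof (intro mult_left_mono A0)
      have "2 * pi * \<bar>\<beta>\<bar> * real (cube_gap y) + 2 * pi * \<bar>\<beta>\<bar> * (real (cube_gap y) - 1) \<le> (4 * pi) * (\<bar>\<beta>\<bar> * real (cube_gap y))"
        by (simp add: algebra_simps)
      also have "\<dots> \<le> (88 / 7) * (\<bar>\<beta>\<bar> * (7 * (real P)\<^sup>2))"
        using pi_less_4 pi_approx cube_gap_le[OF P y] by (intro mult_mono) (auto simp: field_simps)
      finally show "2 * pi * \<bar>\<beta>\<bar> * real (cube_gap y) + 2 * pi * \<bar>\<beta>\<bar> * (real (cube_gap y) - 1) \<le> K" by (simp add: K_def mult.commute mult.left_commute)
    qed
    finally show ?thesis .
  qed
  show ?thesis
  proof (cases "\<beta> = 0")
    case True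
    then have "K = 0" by (simp add: K_def)
    with err[of P] show ?thesis by (simp add: S_def V_def)
  next
    case False
    have "1 / (200 * (real P)\<^sup>2) \<le> 1/2" using P2 by (intro frac_le) auto
    then have \<beta>2: "\<bar>\<beta>\<bar> \<le> 1/2" using \<beta> by linarith
    define Q where "Q = 7 * \<bar>\<beta>\<bar> powr (-1/3)"
    have V: "norm (V y) \<le> Q" for y
      unfolding V_def Q_def by (intro norm_monotone_sum_ee_le block_weight_decreasing block_weight_nonneg block_weight_le_powr False \<beta>2)
    have "norm (S y) \<le> A * K + Q" if "y \<le> P" for y
      using err[OF that] V[of y] norm_triangle_ineq[of "S y - V y" "V y"] by simp
    then have "A \<le> A * K + Q" unfolding A_def by (intro Max.boundedI) (auto simp: A_def[symmetric])
    also have "A * K \<le> A * (1/2)" using K A0 by (intro mult_left_mono) auto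
    finally have A2: "A \<le> 2 * Q" by simp
    \<comment> \<open>The error is a constant times P^2 |\<beta>| powr (2/3), hence O(P powr (2/3))
      on the arc; 1232 = 2 * 7 * 88.\<close>
    have "norm (S P - V P) \<le> (2 * Q) * K" using err[of P] mult_right_mono[OF A2 K(2)] by simp
    also have "\<dots> = 1232 * (real P)\<^sup>2 * (\<bar>\<beta>\<bar> * \<bar>\<beta>\<bar> powr (-1/3))" by (simp add: Q_def K_def)
    also have "\<bar>\<beta>\<bar> * \<bar>\<beta>\<bar> powr (-1/3) = \<bar>\<beta>\<bar> powr (2/3)"
      using powr_add[of "\<bar>\<beta>\<bar>" 1 "-1/3"] by simp
    also have "\<bar>\<beta>\<bar> powr (2/3) \<le> (1 / (real P)\<^sup>2) powr (2/3)"
    proof (intro powr_mono2)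
      have "1 / (200 * (real P)\<^sup>2) \<le> 1 / (real P)\<^sup>2" using P2 P by (intro divide_left_mono) auto
      then show "\<bar>\<beta>\<bar> \<le> 1 / (real P)\<^sup>2" using \<beta> by linarith
    qed auto
    also have "(1 / (real P)\<^sup>2) powr (2/3) = real P powr (-4/3)"
    proof -
      have "1 / (real P)\<^sup>2 = real P powr (-2)" using P by (simp add: powr_minus_divide)
      then show ?thesis by (simp only: powr_powr) simp
    qed
    also have "1232 * (real P)\<^sup>2 * real P powr (-4/3) = 1232 * real P powr (2/3)"
    proof -
      have "(real P)\<^sup>2 = real P powr 2" using P by (intro powr_numeral[symmetric]) simp
      then have "(real P)\<^sup>2 * real P powr (-4/3) = real P powr (2/3)" by (simp only: powr_add[symmetric]) simp
      then show ?thesis by simp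
    qed
    finally have "norm (S P - V P) \<le> 1232 * real P powr (2/3)" by (simp add: mult_left_mono)
    then have "norm (S P - V P) \<le> 1300 * real P powr (2/3)" using powr_ge_zero[of "real P" "2/3"] by linarith
    then show ?thesis by (simp only: S_def V_def)
  qed
qed

text \<open>Both quantities lie between 1/(3 (x + 1)^2) and 1/(3 x^2), and these bounds differ by at
  most 1/x^3.\<close>

lemma block_weight_neg_binom_close:
  assumes x: "x \<ge> 1" and j: "j < cube_gap x"
  shows "\<bar>block_weight (x ^ 3 + j) - Gamma (4/3) * neg_binom (1/3) (x ^ 3 + j)\<bar> \<le> 1 / real x ^ 3"
proof -
  define m where "m = x ^ 3 + j"
  define X where "X = real x"
  have X: "X \<ge> 1" using x by (simp add: X_def)
  have sq: "(y ^ 3) powr (-2/3) = 1 / y\<^sup>2" if "y > 0" for y :: real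
  proof -
    have "(y ^ 3) powr (-2/3) = ((y ^ 3) powr (1/3)) powr (-2)" by (simp only: powr_powr) simp
    also have "\<dots> = 1 / y\<^sup>2" using that by (simp add: powr_minus_divide)
    finally show ?thesis .
  qed
  have m: "X ^ 3 \<le> real m" "real m + 1 \<le> (X + 1) ^ 3" "m \<ge> 1"
  proof -
    show "X ^ 3 \<le> real m" by (simp add: X_def m_def)
    have "m + 1 \<le> Suc x ^ 3" using j by (simp add: m_def Suc_cube)
    then have "real (m + 1) \<le> real (Suc x ^ 3)" by (rule of_nat_mono)
    then show "real m + 1 \<le> (X + 1) ^ 3" by (simp add: X_def add.commute)
    show "m \<ge> 1" using one_le_power[OF x, of 3] by (simp add: m_def)
  qed
  have "Gamma (4/3) * neg_binom (1/3) m \<le> real m powr (-2/3) / 3" by (rule neg_binom_third_bounds(2)[OF m(3)])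
  also have "real m powr (-2/3) \<le> (X ^ 3) powr (-2/3)" using m X by (intro powr_mono2') auto
  finally have up: "Gamma (4/3) * neg_binom (1/3) m \<le> 1 / X\<^sup>2 / 3" using sq[of X] X by simp
  have "((X + 1) ^ 3) powr (-2/3) \<le> (real m + 1/3) powr (-2/3)" using m X by (intro powr_mono2') auto
  then have lo: "1 / (X + 1)\<^sup>2 / 3 \<le> Gamma (4/3) * neg_binom (1/3) m"
    using neg_binom_third_bounds(1)[OF m(3)] sq[of "X + 1"] X by simp
  have block_weight: "block_weight m = 1 / (3 * X\<^sup>2 + 3 * X + 1)" using j by (simp add: block_weight_def m_def cube_root_floor_block cube_gap_def X_def)
  have block_weight_up: "block_weight m \<le> 1 / X\<^sup>2 / 3" 
  proof -
    have "block_weight m \<le> 1 / (3 * X\<^sup>2)" unfolding block_weight using X by (intro frac_le) auto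
    then show ?thesis by simp
  qed
  have block_weight_lo: "1 / (X + 1)\<^sup>2 / 3 \<le> block_weight m" 
  proof -
    have "1 / (3 * (X + 1)\<^sup>2) \<le> block_weight m" unfolding block_weight using X
      by (intro frac_le) (auto simp: power2_eq_square algebra_simps add_pos_pos)
    then show ?thesis by simp
  qed
  have "1 / X\<^sup>2 / 3 - 1 / (X + 1)\<^sup>2 / 3 \<le> 1 / X ^ 3"
  proof -
    have "1 / X\<^sup>2 / 3 - 1 / (X + 1)\<^sup>2 / 3 = (2 * X + 1) * X / (3 * X ^ 3 * (X + 1)\<^sup>2)"
      using X by (simp add: divide_simps) (simp add: power2_eq_square power3_eq_cube algebra_simps)
    also have "\<dots> \<le> (3 * (X + 1)\<^sup>2) / (3 * X ^ 3 * (X + 1)\<^sup>2)"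
      using X by (intro divide_right_mono) (auto simp: power2_eq_square algebra_simps)
    also have "\<dots> = 1 / X ^ 3" using X by simp
    finally show ?thesis .
  qed
  then show ?thesis using up lo block_weight_up block_weight_lo by (simp add: m_def X_def)
qed

text \<open>A block of at most 7 x^2 integers with weight error 1/x^3 contributes 7/x, so all blocks
  together cost a logarithm. The block of x = 0 and the last index P^3 add at most 1 each.\<close>

lemma cubic_sum_smooth_sum_approx:
  assumes tm: "tame P D" and \<beta>: "\<bar>\<beta>\<bar> \<le> 1 / (200 * (real P)\<^sup>2)"
  shows "norm ((\<Sum>x<P. ee (\<beta> * real x ^ 3)) - smooth_sum P \<beta>) \<le> 1300 * real P powr (2/3) + 9 * D"
proof -
  have P: "P \<ge> 1" and D: "D \<ge> 1" using tm by (auto simp: tame_def)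
  define d where "d m = block_weight m - Gamma (4/3) * neg_binom (1/3) m" for m
  define V where "V = (\<Sum>m<P ^ 3. of_real (block_weight m) * ee (\<beta> * real m))"
  have smooth_sum: "smooth_sum P \<beta> = (\<Sum>m<P ^ 3. of_real (Gamma (4/3) * neg_binom (1/3) m) * ee (\<beta> * real m)) + of_real (Gamma (4/3) * neg_binom (1/3) (P ^ 3)) * ee (\<beta> * real (P ^ 3))"
    unfolding smooth_sum_def lessThan_Suc_atMost[symmetric] sum.lessThan_Suc by (simp add: distrib_left sum_distrib_left mult.assoc)
  have last: "\<bar>Gamma (4/3) * neg_binom (1/3) m\<bar> \<le> 1" for m
  proof -
    have "neg_binom (1/3) m \<le> 1" using neg_binom_le_powr[of "1/3" m] powr_mono[of "-2/3" 0 "real (Suc m)"] by simp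
    then show ?thesis using Gamma_four_thirds(1,2) neg_binom_nonneg[of "1/3" m] by (simp add: abs_mult mult_le_one)
  qed
  have "V - smooth_sum P \<beta> = (\<Sum>m<P ^ 3. of_real (d m) * ee (\<beta> * real m)) - of_real (Gamma (4/3) * neg_binom (1/3) (P ^ 3)) * ee (\<beta> * real (P ^ 3))"
    unfolding smooth_sum V_def d_def by (simp add: sum_subtractf left_diff_distrib)
  also have "norm \<dots> \<le> (\<Sum>m<P ^ 3. \<bar>d m\<bar>) + 1"
  proof (intro order_trans[OF norm_triangle_ineq4] add_mono)
    show "norm (\<Sum>m<P ^ 3. of_real (d m) * ee (\<beta> * real m)) \<le> (\<Sum>m<P ^ 3. \<bar>d m\<bar>)"
      by (intro sum_norm_le) (simp add: norm_mult)
    show "norm (complex_of_real (Gamma (4/3) * neg_binom (1/3) (P ^ 3)) * ee (\<beta> * real (P ^ 3))) \<le> 1"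
      using last[of "P ^ 3"] by (simp only: norm_mult norm_ee norm_of_real mult_1_right)
  qed
  also have "(\<Sum>m<P ^ 3. \<bar>d m\<bar>) \<le> 1 + (\<Sum>x=1..P. 7 / real x)"
  proof -
    have "(\<Sum>m<P ^ 3. \<bar>d m\<bar>) = (\<Sum>x<P. \<Sum>j<cube_gap x. \<bar>d (x ^ 3 + j)\<bar>)" by (rule sum_cube_blocks)
    also have "\<dots> \<le> (\<Sum>x<P. if x = 0 then 1 else 7 / real x)"
    proof (rule sum_mono)
      fix x
      show "(\<Sum>j<cube_gap x. \<bar>d (x ^ 3 + j)\<bar>) \<le> (if x = 0 then 1 else 7 / real x)"
      proof (cases "x = 0")
        case True
        have "cube_root_floor 0 = 0" using cube_root_floor_block[of 0 0] by (simp add: cube_gap_def)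
        then have "block_weight 0 = 1" by (simp add: block_weight_def cube_gap_def)
        then have "\<bar>d 0\<bar> \<le> 1" using Gamma_four_thirds(1,2) by (simp add: d_def neg_binom_def)
        then show ?thesis using True by (simp add: cube_gap_def)
      next
        case False
        then have "(\<Sum>j<cube_gap x. \<bar>d (x ^ 3 + j)\<bar>) \<le> (\<Sum>j<cube_gap x. 1 / real x ^ 3)"
          unfolding d_def by (intro sum_mono block_weight_neg_binom_close) auto
        also have "\<dots> = real (cube_gap x) / real x ^ 3" by simp
        also have "\<dots> \<le> (7 * (real x)\<^sup>2) / real x ^ 3" using False cube_gap_le[of x x] by (intro divide_right_mono) auto
        also have "\<dots> = 7 / real x" using False by (simp add: power2_eq_square power3_eq_cube)
        finally show ?thesis using False by simp
      qed
    qed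
    also have "\<dots> \<le> (\<Sum>x\<in>insert 0 {1..P}. if x = 0 then 1 else 7 / real x)"
      by (intro sum_mono2) auto
    also have "\<dots> = 1 + (\<Sum>x=1..P. 7 / real x)" by (subst sum.insert) (auto intro!: sum.cong)
    finally show ?thesis .
  qed
  also have "(\<Sum>x=1..P. 7 / real x) = 7 * (\<Sum>x=1..P. 1 / real x)" by (simp add: sum_distrib_left)
  also have "(\<Sum>x=1..P. 1 / real x) \<le> D"
    using P by (intro tame_harmonic[OF tm]) (simp add: power2_eq_square)
  finally have "norm (V - smooth_sum P \<beta>) \<le> 9 * D" using D by simp
  moreover have "norm ((\<Sum>x<P. ee (\<beta> * real x ^ 3)) - V) \<le> 1300 * real P powr (2/3)"
    unfolding V_def by (rule cubic_sum_block_weight_approx[OF P \<beta>])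
  ultimately show ?thesis
    using norm_triangle_ineq[of "(\<Sum>x<P. ee (\<beta> * real x ^ 3)) - V" "V - smooth_sum P \<beta>"] by simp
qed

lemma cube_shift_ee: "ee (\<beta> * real (Suc x) ^ 3) = ee (\<beta> * real x ^ 3) * ee (\<beta> * real (cube_gap x))"
proof -
  have "real (Suc x) ^ 3 = real x ^ 3 + real (cube_gap x)" using Suc_cube[of x] by (metis of_nat_add of_nat_power)
  then show ?thesis by (simp only: distrib_left ee_add)
qed

text \<open>Multiplying the sum by \<open>1 - z\<close>, where \<open>z = e(-c/q)\<close>, telescopes it up to a sum with slowly
  varying small weights, which is absorbed.\<close>

lemma norm_twisted_cubic_sum_le:
  assumes P: "P \<ge> 1" and q: "1 \<le> q" and c: "1 \<le> c" "c < q" and \<beta>: "\<bar>\<beta>\<bar> \<le> 1 / (200 * real q * (real P)\<^sup>2)"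
  shows "norm (\<Sum>x<P. ee (\<beta> * real x ^ 3 - real c / real q * real x)) \<le> real q / real c + real q / real (q - c)"
proof -
  define \<theta> where "\<theta> = real c / real q"
  define z where "z = ee (- \<theta>)"
  define a where "a x = ee (\<beta> * real x ^ 3 - \<theta> * real x)" for x :: nat
  define S where "S y = (\<Sum>x<y. a x)" for y
  define A where "A = Max ((\<lambda>y. norm (S y)) ` {..P})"
  define d where "d x = 1 - ee (\<beta> * real (cube_gap x))" for x
  have P2: "1 \<le> (real P)\<^sup>2" using P by (intro one_le_power) simp
  have A: "norm (S y) \<le> A" if "y \<le> P" for y using that by (auto simp: A_def)
  have A0: "0 \<le> A" using A[of 0] norm_ge_zero order_trans by blast
  \<comment> \<open>The factor q in the width of the arc is needed here: |1 - z| is at least 4/q, so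
    the perturbation is at most half of it and is absorbed.\<close>
  have \<beta>q: "88 * (real P)\<^sup>2 * \<bar>\<beta>\<bar> \<le> 1 / (2 * real q)"
  proof -
    have pos: "0 < 200 * real q * (real P)\<^sup>2" using P q by simp
    from \<beta> have "\<bar>\<beta>\<bar> * (200 * real q * (real P)\<^sup>2) \<le> 1" unfolding pos_le_divide_eq[OF pos] .
    then have "88 * (real P)\<^sup>2 * \<bar>\<beta>\<bar> * (2 * real q) \<le> 1" by (simp add: algebra_simps)
    then show ?thesis using q by (simp add: pos_le_divide_eq)
  qed
  have z4: "norm (1 - z) \<ge> 4 / real q" "norm (1 - z) > 0" "norm (1 - z) \<ge> 4 * dist_int \<theta>"
  proof -
    have dist_int: "dist_int \<theta> = min \<theta> (1 - \<theta>)"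
    proof -
      have "frac \<theta> = \<theta>" using c by (simp add: frac_eq \<theta>_def)
      then show ?thesis by (simp add: dist_int_def)
    qed
    have nz: "norm (1 - z) = norm (1 - ee \<theta>)" by (simp add: z_def norm_one_minus_ee)
    show "norm (1 - z) \<ge> 4 * dist_int \<theta>" unfolding nz by (rule norm_one_minus_ee_ge_dist_int)
    moreover have "dist_int \<theta> \<ge> 1 / real q"
    proof -
      have "1 / real q \<le> \<theta>" using c by (simp add: \<theta>_def divide_right_mono)
      moreover have "1 / real q \<le> 1 - \<theta>" using c q by (simp add: \<theta>_def field_simps)
      ultimately show ?thesis by (simp add: dist_int)
    qed
    ultimately show "norm (1 - z) \<ge> 4 / real q" by simp
    then show "norm (1 - z) > 0" using q by (smt (verit) divide_pos_pos of_nat_0_less_iff Suc_le_eq One_nat_def)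
  qed
  have step: "norm (1 - z) * norm (S y) \<le> 2 + A * (norm (1 - z) / 2)" if y: "y \<le> P" for y
  proof -
    have aS: "a (Suc x) = a x * z * ee (\<beta> * real (cube_gap x))" for x
    proof -
      have "a (Suc x) = ee (\<beta> * real (Suc x) ^ 3) * ee (- (\<theta> * real x)) * ee (- \<theta>)"
        by (simp add: a_def ee_add[symmetric] algebra_simps)
      then show ?thesis unfolding cube_shift_ee by (simp add: a_def z_def ee_diff)
    qed
    have "a x - a (Suc x) = (1 - z) * a x + z * (d x * a x)" for x by (simp add: aS d_def algebra_simps)
    then have "(\<Sum>x<y. a x - a (Suc x)) = (1 - z) * S y + z * (\<Sum>x<y. d x * a x)"
      by (simp add: S_def sum.distrib sum_distrib_left)
    then have "(1 - z) * S y = (a 0 - a y) - z * (\<Sum>x<y. d x * a x)"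
      by (simp add: sum_lessThan_telescope')
    then have "norm ((1 - z) * S y) \<le> norm (a 0 - a y) + norm (z * (\<Sum>x<y. d x * a x))"
      by (metis norm_triangle_ineq4)
    also have "norm (a 0 - a y) \<le> 2" by (rule order_trans[OF norm_triangle_ineq4]) (simp add: a_def)
    also have "norm (z * (\<Sum>x<y. d x * a x)) = norm (\<Sum>x<y. d x * a x)" by (simp add: norm_mult z_def)
    also have "\<dots> \<le> A * (norm (d y) + (\<Sum>x<y. norm (d x - d (Suc x))))"
      using y A by (intro norm_abel_sum_le) (auto simp: S_def)
    also have "\<dots> \<le> A * (2 * pi * \<bar>\<beta>\<bar> * real (cube_gap y) + (\<Sum>x<y. 2 * pi * \<bar>\<beta>\<bar> * (real (cube_gap (Suc x)) - real (cube_gap x))))"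
    proof (intro mult_left_mono add_mono sum_mono A0)
      show "norm (d y) \<le> 2 * pi * \<bar>\<beta>\<bar> * real (cube_gap y)"
        unfolding d_def by (rule order_trans[OF norm_one_minus_ee_le]) (simp add: abs_mult)
      fix x
      have "d x - d (Suc x) = ee (\<beta> * real (cube_gap (Suc x))) - ee (\<beta> * real (cube_gap x))" by (simp add: d_def)
      then have "norm (d x - d (Suc x)) \<le> 2 * pi * \<bar>\<beta> * real (cube_gap (Suc x)) - \<beta> * real (cube_gap x)\<bar>"
        using norm_ee_diff_le by simp
      also have "\<bar>\<beta> * real (cube_gap (Suc x)) - \<beta> * real (cube_gap x)\<bar> = \<bar>\<beta>\<bar> * (real (cube_gap (Suc x)) - real (cube_gap x))"
        using cube_gap_mono[of x "Suc x"] by (simp add: abs_mult right_diff_distrib[symmetric])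
      finally show "norm (d x - d (Suc x)) \<le> 2 * pi * \<bar>\<beta>\<bar> * (real (cube_gap (Suc x)) - real (cube_gap x))" by simp
    qed
    also have "(\<Sum>x<y. 2 * pi * \<bar>\<beta>\<bar> * (real (cube_gap (Suc x)) - real (cube_gap x))) = 2 * pi * \<bar>\<beta>\<bar> * (real (cube_gap y) - real (cube_gap 0))"
      using sum_lessThan_telescope[of "\<lambda>x. real (cube_gap x)" y] by (simp only: sum_distrib_left[symmetric])
    also have "A * (2 * pi * \<bar>\<beta>\<bar> * real (cube_gap y) + 2 * pi * \<bar>\<beta>\<bar> * (real (cube_gap y) - real (cube_gap 0))) \<le> A * (norm (1 - z) / 2)"
    proof (intro mult_left_mono A0)
      have "2 * pi * \<bar>\<beta>\<bar> * real (cube_gap y) + 2 * pi * \<bar>\<beta>\<bar> * (real (cube_gap y) - real (cube_gap 0)) \<le> (4 * pi) * (\<bar>\<beta>\<bar> * real (cube_gap y))"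
        by (simp add: algebra_simps)
      also have "\<dots> \<le> (88 / 7) * (\<bar>\<beta>\<bar> * (7 * (real P)\<^sup>2))"
        using pi_approx cube_gap_le[OF P y] by (intro mult_mono) (auto simp: field_simps)
      also have "\<dots> = 88 * (real P)\<^sup>2 * \<bar>\<beta>\<bar>" by simp
      also have "\<dots> \<le> norm (1 - z) / 2" 
      proof -
        have "1 / (2 * real q) = (1/2) * (1 / real q)" "4 / real q = 4 * (1 / real q)" "0 \<le> 1 / real q" by simp_all
        then show ?thesis using \<beta>q z4(1) by linarith
      qed
      finally show "2 * pi * \<bar>\<beta>\<bar> * real (cube_gap y) + 2 * pi * \<bar>\<beta>\<bar> * (real (cube_gap y) - real (cube_gap 0)) \<le> norm (1 - z) / 2" .
    qed
    finally show ?thesis by (simp only: norm_mult)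
  qed
  have "norm (S y) \<le> (2 + A * (norm (1 - z) / 2)) / norm (1 - z)" if "y \<le> P" for y
    using step[OF that] z4(2) by (simp add: pos_le_divide_eq mult.commute)
  then have "A \<le> (2 + A * (norm (1 - z) / 2)) / norm (1 - z)" unfolding A_def by (intro Max.boundedI) (auto simp: A_def[symmetric])
  then have "A * norm (1 - z) \<le> 4" using z4(2) by (simp add: pos_le_divide_eq)
  then have A4: "A \<le> 4 / norm (1 - z)" using z4(2) by (simp add: pos_le_divide_eq)
  have "1 / dist_int \<theta> \<le> real q / real c + real q / real (q - c)"
  proof -
    have "frac \<theta> = \<theta>" using c by (simp add: frac_eq \<theta>_def)
    then have "dist_int \<theta> = \<theta> \<or> dist_int \<theta> = 1 - \<theta>" by (auto simp: dist_int_def min_def)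
    moreover have "1 / \<theta> = real q / real c" by (simp add: \<theta>_def)
    moreover have "1 / (1 - \<theta>) = real q / real (q - c)" using c by (simp add: \<theta>_def of_nat_diff field_simps)
    ultimately show ?thesis by auto
  qed
  moreover have "4 / norm (1 - z) \<le> 1 / dist_int \<theta>"
  proof -
    have "frac \<theta> = \<theta>" using c by (simp add: frac_eq \<theta>_def)
    moreover have "0 < \<theta>" "\<theta> < 1" using c by (auto simp: \<theta>_def)
    ultimately have "dist_int \<theta> > 0" by (simp add: dist_int_def)
    then have "4 / norm (1 - z) \<le> 4 / (4 * dist_int \<theta>)" using z4 by (intro divide_left_mono) auto
    then show ?thesis by simp
  qed
  ultimately show ?thesis using A4 A[of P] by (simp add: S_def a_def \<theta>_def)
qed

section \<open>Major and minor arcs\<close>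

definition gauss3_twisted :: "nat \<Rightarrow> int \<Rightarrow> nat \<Rightarrow> complex" where
  "gauss3_twisted q a c = (\<Sum>r<q. ee (of_int (a * int r ^ 3 + int c * int r) / real q))"

text \<open>Weyl's inequality for a sum of length q at the exact frequency a/q, uniformly in the
  linear twist c. The exponent 3/4 is not best possible, but for q <= P it stays within the error
  allowed on the minor arcs.\<close>

lemma norm_gauss3_twisted_le:
  assumes tm: "tame P D" and q: "1 \<le> q" "q \<le> P" and cop: "coprime a (int q)"
  shows "norm (gauss3_twisted q a c) \<le> 6 * D * real q powr (3/4)"
proof -
  have D: "D \<ge> 1" using tm by (simp add: tame_def)
  define h where "h x = ee (of_int (a * x ^ 3 + int c * x) / real q)" for x :: int
  have h: "h x = ee (of_int a / real q * of_int x ^ 3 + real c / real q * of_int x)" for x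
    by (simp add: h_def add_divide_distrib)
  have "h (int q) = h 0"
  proof -
    have "(of_int (a * int q ^ 3 + int c * int q) / real q) = of_int (a * int q ^ 2 + int c)"
      using q by (simp add: power2_eq_square power3_eq_cube field_simps)
    then show ?thesis unfolding h_def by (simp only: ee_of_int) simp
  qed
  moreover have "(\<Sum>x\<in>{1..int q}. h x) = (\<Sum>r\<in>{1..q}. h (int r))"
    by (rule sum.reindex_bij_witness[of _ int nat]) auto
  moreover have "{1..q} = insert q {1..<q}" "{..<q} = insert 0 {1..<q}" using q by auto
  ultimately have eq: "gauss3_twisted q a c = (\<Sum>x\<in>{1..int q}. h x)" by (simp add: gauss3_twisted_def h_def)
  have "norm (gauss3_twisted q a c) ^ 4 \<le> 216 * D\<^sup>2 * (real q ^ 3 + real q ^ 4 / real q + real q * real q)"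
    unfolding eq h
  proof (rule weyl_cubic[OF tm q(1) q(2) q(1) _ cop])
    have "q \<le> P\<^sup>2" using q self_le_power[of P 2] by linarith
    then show "q \<le> 1000 * P\<^sup>2" by linarith
  qed simp
  also have "\<dots> \<le> 216 * D\<^sup>2 * (3 * real q ^ 3)"
  proof (intro mult_left_mono)
    have "real q * real q \<le> real q ^ 3" using q power_increasing[of 2 3 "real q"] by (simp add: power2_eq_square)
    moreover have "real q ^ 4 / real q = real q ^ 3" using q by (simp add: eval_nat_numeral)
    ultimately show "real q ^ 3 + real q ^ 4 / real q + real q * real q \<le> 3 * real q ^ 3" by linarith
  qed simp
  also have "\<dots> \<le> 1296 * (D ^ 4 * real q ^ 3)"
  proof -
    have "D\<^sup>2 * real q ^ 3 \<le> D ^ 4 * real q ^ 3" using D by (intro mult_right_mono power_increasing) auto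
    moreover have "0 \<le> D ^ 4 * real q ^ 3" using D by simp
    moreover have "216 * D\<^sup>2 * (3 * real q ^ 3) = 648 * (D\<^sup>2 * real q ^ 3)" by simp
    ultimately show ?thesis by linarith
  qed
  also have "\<dots> = (6 * D * real q powr (3/4)) ^ 4"
  proof -
    have "(real q powr (3/4)) ^ 4 = real q ^ 3" using q by (simp add: powr_power powr_numeral)
    then show ?thesis by (simp add: power_mult_distrib)
  qed
  finally show ?thesis by (rule power_le_imp_le_base[of _ 3, simplified]) (use D in auto)
qed

text \<open>Completion: e(a x^3/q) depends only on x modulo q and is expanded in the additive
  characters modulo q.\<close>

lemma cubic_sum_gauss3_twisted_expansion:
  assumes q: "1 \<le> q"
  shows "(\<Sum>x<P. ee ((of_int a / real q + \<beta>) * real x ^ 3))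
    = (\<Sum>c<q. gauss3_twisted q a c * (\<Sum>x<P. ee (\<beta> * real x ^ 3 - real c / real q * real x))) / of_nat q"
proof -
  have inv: "of_nat q * ee (of_int a / real q * real x ^ 3) = (\<Sum>c<q. gauss3_twisted q a c * ee (- (real c / real q * real x)))" for x :: nat
  proof -
    have "(\<Sum>c<q. gauss3_twisted q a c * ee (- (real c / real q * real x)))
       = (\<Sum>r<q. ee (of_int a / real q * real r ^ 3) * (\<Sum>c<q. ee (real c * of_int (int r - int x) / real q)))"
      unfolding gauss3_twisted_def sum_distrib_right sum_distrib_left
      by (subst sum.swap) (intro sum.cong refl, simp add: ee_add[symmetric] add_divide_distrib diff_divide_distrib algebra_simps)
    also have "\<dots> = (\<Sum>r<q. if r = x mod q then ee (of_int a / real q * real r ^ 3) * of_nat q else 0)"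
    proof (intro sum.cong refl)
      fix r assume r: "r \<in> {..<q}"
      have "int q dvd int r - int x \<longleftrightarrow> r = x mod q"
        using r by (simp add: mod_eq_dvd_iff[symmetric] zmod_int[symmetric])
      then show "ee (of_int a / real q * real r ^ 3) * (\<Sum>c<q. ee (real c * of_int (int r - int x) / real q))
        = (if r = x mod q then ee (of_int a / real q * real r ^ 3) * of_nat q else 0)"
        using q by (subst sum_ee_orthogonal) auto
    qed
    also have "\<dots> = ee (of_int a / real q * real (x mod q) ^ 3) * of_nat q" using q by simp
    also have "ee (of_int a / real q * real (x mod q) ^ 3) = ee (of_int a / real q * real x ^ 3)"
    proof -
      define k where "k = x div q"
      have x: "real x = real (x mod q) + real q * real k"
        using mod_mult_div_eq[of x q] unfolding k_def by (metis of_nat_add of_nat_mult)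
      let ?y = "x mod q"
      have "of_int a / real q * real x ^ 3 = of_int a / real q * real ?y ^ 3
          + of_int (a * int k * (3 * int ?y ^ 2 + 3 * int ?y * int q * int k + int q ^ 2 * int k ^ 2))"
        unfolding x using q by (simp add: field_simps power2_eq_square power3_eq_cube)
      then show ?thesis by (simp only: ee_add_int)
    qed
    finally show ?thesis by simp
  qed
  have "of_nat q * (\<Sum>x<P. ee ((of_int a / real q + \<beta>) * real x ^ 3))
     = (\<Sum>x<P. \<Sum>c<q. gauss3_twisted q a c * ee (\<beta> * real x ^ 3 - real c / real q * real x))"
    unfolding sum_distrib_left
  proof (intro sum.cong refl)
    fix x :: nat
    have "of_nat q * ee ((of_int a / real q + \<beta>) * real x ^ 3) = (of_nat q * ee (of_int a / real q * real x ^ 3)) * ee (\<beta> * real x ^ 3)"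
      by (simp add: distrib_right ee_add)
    also have "\<dots> = (\<Sum>c<q. gauss3_twisted q a c * ee (\<beta> * real x ^ 3 - real c / real q * real x))"
      unfolding inv sum_distrib_right by (intro sum.cong refl) (simp add: ee_diff)
    finally show "of_nat q * ee ((of_int a / real q + \<beta>) * real x ^ 3) = \<dots>" .
  qed
  also have "\<dots> = (\<Sum>c<q. gauss3_twisted q a c * (\<Sum>x<P. ee (\<beta> * real x ^ 3 - real c / real q * real x)))"
    by (subst sum.swap) (simp add: sum_distrib_left)
  finally show ?thesis using q by (simp add: field_simps)
qed

text \<open>The twist c = 0 gives the main term. The others contribute q powr (3/4) times a harmonic
  sum, as each twisted sum is O(q/c + q/(q - c)). Moving the range from 1..P to 0..P-1 costs 2, and
  the constants 2 + 1300 + 9 + 12 fit into 1400.\<close>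

lemma major_arc_approx:
  assumes tm: "tame P D" and q: "1 \<le> q" "q \<le> P" and cop: "coprime a (int q)"
    and \<beta>: "\<bar>\<beta>\<bar> \<le> 1 / (200 * real q * (real P)\<^sup>2)"
  shows "norm ((\<Sum>x=1..P. ee ((of_int a / real q + \<beta>) * real x ^ 3)) - gauss3_twisted q a 0 / of_nat q * smooth_sum P \<beta>)
    \<le> 1400 * D\<^sup>2 * real P powr (3/4)"
proof -
  have P: "P \<ge> 1" and D: "D \<ge> 1" using tm by (auto simp: tame_def)
  define F where "F x = ee ((of_int a / real q + \<beta>) * real x ^ 3)" for x :: nat
  define T where "T c = (\<Sum>x<P. ee (\<beta> * real x ^ 3 - real c / real q * real x))" for c :: nat
  have Pp: "1 \<le> real P powr (3/4)" using P by (simp add: ge_one_powr_ge_zero)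
  have split: "(\<Sum>x<P. F x) = gauss3_twisted q a 0 / of_nat q * T 0 + (\<Sum>c\<in>{1..<q}. gauss3_twisted q a c * T c) / of_nat q"
  proof -
    have "{..<q} = insert 0 {1..<q}" using q by auto
    then have "(\<Sum>c<q. gauss3_twisted q a c * T c) = gauss3_twisted q a 0 * T 0 + (\<Sum>c\<in>{1..<q}. gauss3_twisted q a c * T c)" by simp
    then show ?thesis unfolding F_def T_def cubic_sum_gauss3_twisted_expansion[OF q(1)] by (simp add: add_divide_distrib)
  qed
  have "norm ((\<Sum>c\<in>{1..<q}. gauss3_twisted q a c * T c) / of_nat q) \<le> 12 * D\<^sup>2 * real P powr (3/4)"
  proof -
    have "norm (\<Sum>c\<in>{1..<q}. gauss3_twisted q a c * T c) \<le> (\<Sum>c\<in>{1..<q}. (6 * D * real q powr (3/4)) * (real q / real c + real q / real (q - c)))"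
    proof (rule sum_norm_le)
      fix c assume c: "c \<in> {1..<q}"
      have "norm (T c) \<le> real q / real c + real q / real (q - c)"
        unfolding T_def using c by (intro norm_twisted_cubic_sum_le[OF P q(1) _ _ \<beta>]) auto
      then show "norm (gauss3_twisted q a c * T c) \<le> (6 * D * real q powr (3/4)) * (real q / real c + real q / real (q - c))"
        unfolding norm_mult using norm_gauss3_twisted_le[OF tm q cop, of c] D by (intro mult_mono) auto
    qed
    also have "\<dots> = (6 * D * real q powr (3/4)) * (real q * (2 * (\<Sum>c\<in>{1..<q}. 1 / real c)))"
    proof -
      have "(\<Sum>c\<in>{1..<q}. 1 / real (q - c)) = (\<Sum>c\<in>{1..<q}. 1 / real c)"
        by (rule sum.reindex_bij_witness[of _ "\<lambda>c. q - c" "\<lambda>c. q - c"]) auto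
      moreover have "(\<Sum>c\<in>{1..<q}. real q / real c + real q / real (q - c)) = real q * ((\<Sum>c\<in>{1..<q}. 1 / real c) + (\<Sum>c\<in>{1..<q}. 1 / real (q - c)))"
        unfolding sum.distrib[symmetric] sum_distrib_left by (intro sum.cong refl) (simp add: distrib_left)
      ultimately show ?thesis by (simp only: sum_distrib_left[symmetric]) simp
    qed
    also have "\<dots> \<le> (6 * D * real P powr (3/4)) * (real q * (2 * D))"
    proof (intro mult_mono mult_left_mono)
      show "real q powr (3/4) \<le> real P powr (3/4)" using q by (intro powr_mono2) auto
      have "(\<Sum>c\<in>{1..<q}. 1 / real c) \<le> (\<Sum>c=1..q. 1 / real c)" by (intro sum_mono2) auto
      also have "q \<le> 2000 * P\<^sup>2" using q self_le_power[of P 2] by linarith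
      then have "(\<Sum>c=1..q. 1 / real c) \<le> D" by (rule tame_harmonic[OF tm])
      finally show "(\<Sum>c\<in>{1..<q}. 1 / real c) \<le> D" .
    qed (use D in \<open>auto intro!: sum_nonneg mult_nonneg_nonneg\<close>)
    finally have "norm (\<Sum>c\<in>{1..<q}. gauss3_twisted q a c * T c) \<le> real q * (12 * D\<^sup>2 * real P powr (3/4))"
      by (simp add: power2_eq_square mult_ac)
    then show ?thesis using q by (simp add: norm_divide pos_divide_le_eq mult.commute)
  qed
  moreover have "norm (gauss3_twisted q a 0 / of_nat q * T 0 - gauss3_twisted q a 0 / of_nat q * smooth_sum P \<beta>) \<le> 1300 * real P powr (2/3) + 9 * D"
  proof -
    have "norm (gauss3_twisted q a 0) \<le> (\<Sum>r<q. 1)" unfolding gauss3_twisted_def by (intro sum_norm_le) simp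
    then have g1: "norm (gauss3_twisted q a 0 / of_nat q) \<le> 1" using q by (simp add: norm_divide)
    have \<beta>': "\<bar>\<beta>\<bar> \<le> 1 / (200 * (real P)\<^sup>2)"
    proof -
      have "1 / (200 * real q * (real P)\<^sup>2) \<le> 1 / (200 * (real P)\<^sup>2)" using q P by (intro divide_left_mono) auto
      then show ?thesis using \<beta> by linarith
    qed
    have "norm (gauss3_twisted q a 0 / of_nat q * T 0 - gauss3_twisted q a 0 / of_nat q * smooth_sum P \<beta>) = norm (gauss3_twisted q a 0 / of_nat q) * norm (T 0 - smooth_sum P \<beta>)"
      by (simp only: right_diff_distrib[symmetric] norm_mult)
    also have "\<dots> \<le> 1 * (1300 * real P powr (2/3) + 9 * D)"
      using g1 cubic_sum_smooth_sum_approx[OF tm \<beta>'] by (intro mult_mono) (auto simp: T_def)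
    finally show ?thesis by simp
  qed
  moreover have "norm ((\<Sum>x=1..P. F x) - (\<Sum>x<P. F x)) \<le> 2"
  proof -
    have "{1..P} = insert P {1..<P}" "{..<P} = insert 0 {1..<P}" using P by auto
    then have "(\<Sum>x=1..P. F x) - (\<Sum>x<P. F x) = F P - F 0" by simp
    then show ?thesis using norm_triangle_ineq4[of "F P" "F 0"] by (simp add: F_def)
  qed
  ultimately have "norm ((\<Sum>x=1..P. F x) - gauss3_twisted q a 0 / of_nat q * smooth_sum P \<beta>)
      \<le> 2 + (1300 * real P powr (2/3) + 9 * D) + 12 * D\<^sup>2 * real P powr (3/4)"
  proof -
    assume "norm ((\<Sum>c\<in>{1..<q}. gauss3_twisted q a c * T c) / of_nat q) \<le> 12 * D\<^sup>2 * real P powr (3/4)"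
      "norm (gauss3_twisted q a 0 / of_nat q * T 0 - gauss3_twisted q a 0 / of_nat q * smooth_sum P \<beta>) \<le> 1300 * real P powr (2/3) + 9 * D"
      "norm ((\<Sum>x=1..P. F x) - (\<Sum>x<P. F x)) \<le> 2"
    moreover have "(\<Sum>x=1..P. F x) - gauss3_twisted q a 0 / of_nat q * smooth_sum P \<beta> = ((\<Sum>x=1..P. F x) - (\<Sum>x<P. F x))
      + (gauss3_twisted q a 0 / of_nat q * T 0 - gauss3_twisted q a 0 / of_nat q * smooth_sum P \<beta>) + (\<Sum>c\<in>{1..<q}. gauss3_twisted q a c * T c) / of_nat q"
      by (simp add: split)
    ultimately show ?thesis
      by (metis (no_types, lifting) add_mono norm_triangle_le)
  qed
  also have "\<dots> \<le> 1400 * D\<^sup>2 * real P powr (3/4)"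
  proof -
    define w where "w = real P powr (3/4)"
    have one_le_D2: "D \<le> D\<^sup>2" "1 \<le> D\<^sup>2" using D self_le_power[of D 2] one_le_power[of D 2] by auto
    have w: "real P powr (2/3) \<le> w" "1 \<le> w" using P Pp by (auto simp: w_def intro: powr_mono)
    have "w \<le> D\<^sup>2 * w" "D\<^sup>2 \<le> D\<^sup>2 * w" using w one_le_D2 mult_right_mono[of 1 "D\<^sup>2" w] mult_left_mono[of 1 w "D\<^sup>2"] by auto
    then show ?thesis using w one_le_D2 unfolding w_def[symmetric] by linarith
  qed
  finally show ?thesis by (simp add: F_def)
qed

text \<open>For q between P and 200 P^2 all three terms of Weyl's inequality are O(P^3). The
  constant is much weaker than needed, so that the bound agrees with the one on the major
  arcs.\<close>

lemma minor_arc_bound: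
  assumes tm: "tame P D" and q: "P < q" "q \<le> 200 * P\<^sup>2" and cop: "coprime a (int q)"
    and ap: "\<bar>\<alpha> - of_int a / of_nat q\<bar> \<le> 1 / (real q)\<^sup>2"
  shows "norm (\<Sum>x=1..P. ee (\<alpha> * real x ^ 3)) \<le> 1400 * D\<^sup>2 * real P powr (3/4)"
proof -
  have P: "P \<ge> 1" and D: "D \<ge> 1" using tm by (auto simp: tame_def)
  have eq: "(\<Sum>x=1..P. ee (\<alpha> * real x ^ 3)) = (\<Sum>x\<in>{1..int P}. ee (\<alpha> * of_int x ^ 3 + 0 * of_int x))"
    by (rule sum.reindex_bij_witness[of _ nat int]) auto
  have "norm (\<Sum>x=1..P. ee (\<alpha> * real x ^ 3)) ^ 4 \<le> 216 * D\<^sup>2 * (real P ^ 3 + real P ^ 4 / real q + real P * real q)"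
    unfolding eq by (rule weyl_cubic[OF tm P order_refl _ _ cop ap]) (use q in auto)
  also have "\<dots> \<le> 216 * D\<^sup>2 * (202 * real P ^ 3)"
  proof (intro mult_left_mono)
    have "real P ^ 4 / real q \<le> real P ^ 4 / real P" using q P by (intro divide_left_mono) auto
    also have "\<dots> = real P ^ 3" using P by (simp add: eval_nat_numeral)
    finally have 1: "real P ^ 4 / real q \<le> real P ^ 3" .
    have "real q \<le> real (200 * P\<^sup>2)" using q(2) by (rule of_nat_mono)
    then have "real P * real q \<le> real P * (200 * (real P)\<^sup>2)" by (intro mult_left_mono) auto
    then have "real P * real q \<le> 200 * real P ^ 3" by (simp add: power2_eq_square power3_eq_cube)
    with 1 show "real P ^ 3 + real P ^ 4 / real q + real P * real q \<le> 202 * real P ^ 3" by linarith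
  qed simp
  also have "\<dots> \<le> 1400 ^ 4 * (D ^ 8 * real P ^ 3)"
  proof -
    have "D\<^sup>2 * real P ^ 3 \<le> D ^ 8 * real P ^ 3" using D by (intro mult_right_mono power_increasing) auto
    moreover have "0 \<le> D ^ 8 * real P ^ 3" using D by (intro mult_nonneg_nonneg) auto
    then have "43632 * (D ^ 8 * real P ^ 3) \<le> 1400 ^ 4 * (D ^ 8 * real P ^ 3)" by (intro mult_right_mono) auto
    moreover have "216 * D\<^sup>2 * (202 * real P ^ 3) = 43632 * (D\<^sup>2 * real P ^ 3)" by simp
    ultimately show ?thesis by linarith
  qed
  also have "\<dots> = (1400 * D\<^sup>2 * real P powr (3/4)) ^ 4"
  proof -
    have "(real P powr (3/4)) ^ 4 = real P ^ 3" using P by (simp add: powr_power powr_numeral)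
    then show ?thesis by (simp add: power_mult_distrib)
  qed
  finally show ?thesis by (rule power_le_imp_le_base[of _ 3, simplified]) (use D in auto)
qed

section \<open>The main term\<close>

definition units_upto :: "nat \<Rightarrow> nat set" where
  "units_upto q = {a \<in> {1..q}. coprime a q}"

definition fractions :: "nat \<Rightarrow> (nat \<times> nat) set" where
  "fractions P = (SIGMA q:{1..P}. units_upto q)"

text \<open>The integer k lets the arc wrap around the circle; in particular the fraction 1/1 serves
  as 0.\<close>

definition major_arc :: "nat \<Rightarrow> nat \<times> nat \<Rightarrow> nat set" where
  "major_arc P = (\<lambda>(q, a). {j. j < cmod3 P \<and> (\<exists>k::int. \<bar>real j / real (cmod3 P) - real a / real q - of_int k\<bar> \<le> 1 / (200 * real q * (real P)\<^sup>2))})"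

definition arc_model :: "nat \<Rightarrow> nat \<times> nat \<Rightarrow> nat \<Rightarrow> complex" where
  "arc_model P = (\<lambda>(q, a) j. gauss_sum 3 q a / of_nat q * smooth_sum P (real j / real (cmod3 P) - real a / real q))"

text \<open>Written as a sum over all fractions, although the arcs are disjoint and at most one term
  is present. This form allows averages to be taken arc by arc.\<close>

definition major_model :: "nat \<Rightarrow> nat \<Rightarrow> complex" where
  "major_model P j = (\<Sum>t\<in>fractions P. if j \<in> major_arc P t then arc_model P t j else 0)"

lemma finite_units_upto [simp]: "finite (units_upto q)"
  by (simp add: units_upto_def)

lemma card_units_upto_le: "card (units_upto q) \<le> q"
proof -
  have "units_upto q \<subseteq> {1..q}" by (auto simp: units_upto_def)
  then have "card (units_upto q) \<le> card {1..q}" by (intro card_mono) auto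
  then show ?thesis by simp
qed

lemma finite_fractions [simp]: "finite (fractions P)"
  by (simp add: fractions_def)

lemma sum_fractions: "(\<Sum>t\<in>fractions P. h t) = (\<Sum>q=1..P. \<Sum>a\<in>units_upto q. h (q, a))"
  by (simp add: fractions_def sum.Sigma split_def)

text \<open>A common point would give an integer m, the numerator of the difference of the two
  fractions over q q', of absolute value at most 1/100. Hence m = 0, each denominator divides the
  other, and the numerators agree modulo q.\<close>

lemma arcs_disjoint:
  assumes t: "t \<in> fractions P" "t' \<in> fractions P" and j: "j \<in> major_arc P t" "j \<in> major_arc P t'"
  shows "t = t'"
proof -
  obtain q a q' a' where e: "t = (q, a)" "t' = (q', a')" by (cases t, cases t')
  have q: "1 \<le> q" "q \<le> P" "1 \<le> a" "a \<le> q" "coprime a q" "1 \<le> q'" "q' \<le> P" "1 \<le> a'" "a' \<le> q'" "coprime a' q'"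
    using t by (auto simp: e fractions_def units_upto_def)
  define \<theta> where "\<theta> = real j / real (cmod3 P)"
  obtain k k' :: int where k: "\<bar>\<theta> - real a / real q - of_int k\<bar> \<le> 1 / (200 * real q * (real P)\<^sup>2)"
    "\<bar>\<theta> - real a' / real q' - of_int k'\<bar> \<le> 1 / (200 * real q' * (real P)\<^sup>2)"
    using j by (auto simp: e major_arc_def \<theta>_def)
  define m where "m = int a * int q' - int a' * int q + (k - k') * int q * int q'"
  have pos: "real q > 0" "real q' > 0" "real P > 0" "real P \<ge> 1" using q by auto
  have m: "of_int m = real q * real q' * ((real a / real q + of_int k) - (real a' / real q' + of_int k'))"
    using pos by (simp add: m_def field_simps)
  have small: "real q * real q' * (1 / (200 * real q * (real P)\<^sup>2)) \<le> 1/200" if "q' \<le> P" "real q > 0" "1 \<le> real P" for q q' P :: nat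
  proof -
    have "real q * real q' * (1 / (200 * real q * (real P)\<^sup>2)) = real q' / (200 * (real P)\<^sup>2)" using that by simp
    also have "\<dots> \<le> real P / (200 * (real P)\<^sup>2)" using that by (intro divide_right_mono) auto
    also have "\<dots> = 1 / (200 * real P)" using that by (simp add: power2_eq_square)
    also have "\<dots> \<le> 1 / (200 * 1)" using that by (intro divide_left_mono) auto
    finally show ?thesis by simp
  qed
  have "\<bar>(real a / real q + of_int k) - (real a' / real q' + of_int k')\<bar>
     \<le> 1 / (200 * real q * (real P)\<^sup>2) + 1 / (200 * real q' * (real P)\<^sup>2)"
    using k by linarith
  then have "real q * real q' * \<bar>(real a / real q + of_int k) - (real a' / real q' + of_int k')\<bar>
     \<le> real q * real q' * (1 / (200 * real q * (real P)\<^sup>2) + 1 / (200 * real q' * (real P)\<^sup>2))"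
    using pos by (intro mult_left_mono) auto
  also have "\<dots> = real q * real q' * (1 / (200 * real q * (real P)\<^sup>2)) + real q' * real q * (1 / (200 * real q' * (real P)\<^sup>2))"
    by (simp only: distrib_left mult.commute)
  also have "\<dots> \<le> 1/200 + 1/200"
    using small[of q' P q] small[of q P q'] q pos by (intro add_mono) auto
  finally have "\<bar>real_of_int m\<bar> < 1" unfolding m abs_mult using pos by simp
  then have m0: "int a * int q' - int a' * int q + (k - k') * int q * int q' = 0" using m_def by linarith
  have "int q dvd int a * int q'"
  proof -
    have "int a * int q' = int q * (int a' - (k - k') * int q')" using m0 by (simp add: algebra_simps)
    then show ?thesis by simp
  qed
  then have "q dvd a * q'" by (metis of_nat_mult int_dvd_int_iff)
  then have 1: "q dvd q'" using q(5) by (simp add: coprime_commute coprime_dvd_mult_right_iff)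
  have "int q' dvd int a' * int q"
  proof -
    have "int a' * int q = int q' * (int a + (k - k') * int q)" using m0 by (simp add: algebra_simps)
    then show ?thesis by simp
  qed
  then have "q' dvd a' * q" by (metis of_nat_mult int_dvd_int_iff)
  then have 2: "q' dvd q" using q(10) by (simp add: coprime_commute coprime_dvd_mult_right_iff)
  have qq: "q = q'" using 1 2 by (rule dvd_antisym)
  have "int q * (int a - int a' + (k - k') * int q) = 0" using m0 by (simp add: qq algebra_simps)
  then have aa: "int a - int a' + (k - k') * int q = 0" using q by simp
  have "int a = int a'"
  proof (rule eq_if_congruent_small[of "int q"])
    have "int a - int a' = int q * - (k - k')" using aa by (simp add: algebra_simps)
    then show "int q dvd int a - int a'" by (metis dvd_triv_left)
  qed (use q qq in auto)
  with qq show ?thesis by (simp add: e)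
qed

lemma sum_major_arc:
  assumes "t \<in> fractions P" "j \<in> major_arc P t"
  shows "(\<Sum>s\<in>fractions P. if j \<in> major_arc P s then h s else 0) = h t"
proof -
  have "j \<in> major_arc P s \<longleftrightarrow> s = t" if "s \<in> fractions P" for s
    using arcs_disjoint[OF that assms(1)] assms by blast
  then have "(\<Sum>s\<in>fractions P. if j \<in> major_arc P s then h s else 0) = (\<Sum>s\<in>fractions P. if s = t then h s else 0)"
    by (intro sum.cong refl) simp
  then show ?thesis using assms by simp
qed

text \<open>As at most one term is present, any function that fixes 0 passes through the sum; it is
  applied to fifth powers and to powers of the norm.\<close>

lemma major_model_apply:
  fixes \<phi> :: "complex \<Rightarrow> 'b::comm_monoid_add"
  assumes "\<phi> 0 = 0"
  shows "\<phi> (major_model P j) = (\<Sum>t\<in>fractions P. if j \<in> major_arc P t then \<phi> (arc_model P t j) else 0)"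
proof (cases "\<exists>t\<in>fractions P. j \<in> major_arc P t")
  case True
  then obtain t where t: "t \<in> fractions P" "j \<in> major_arc P t" by blast
  show ?thesis unfolding major_model_def sum_major_arc[OF t] ..
next
  case False
  then have "major_model P j = 0" unfolding major_model_def by (intro sum.neutral) auto
  moreover have "(\<Sum>t\<in>fractions P. if j \<in> major_arc P t then \<phi> (arc_model P t j) else 0) = 0"
    using False by (intro sum.neutral) auto
  ultimately show ?thesis using assms by simp
qed

lemma gauss3_twisted_0_eq: "q \<ge> 1 \<Longrightarrow> gauss3_twisted q (int a) 0 = gauss_sum 3 q a"
  by (simp add: gauss3_twisted_def gauss_sum_eq_gauss3 gauss3_def)

text \<open>Dirichlet's theorem with 200 P^2 gives an approximation within exactly the arc width
  1/(200 q P^2). If q <= P the frequency would lie on an arc, so off the arcs q > P and the minor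
  arc bound applies.\<close>

lemma norm_cubesum_minus_major_model_le:
  assumes tm: "tame P D" and j: "j < cmod3 P"
  shows "norm (cubesum P j - major_model P j) \<le> 1400 * D\<^sup>2 * real P powr (3/4)"
proof -
  have P: "P \<ge> 1" using tm by (simp add: tame_def)
  define \<theta> where "\<theta> = real j / real (cmod3 P)"
  have cubesum: "cubesum P j = (\<Sum>x=1..P. ee (\<theta> * real x ^ 3))" by (simp add: cubesum_def \<theta>_def)
  show ?thesis
  proof (cases "\<exists>t\<in>fractions P. j \<in> major_arc P t")
    case True
    then obtain q a where t: "(q, a) \<in> fractions P" "j \<in> major_arc P (q, a)" by auto
    have q: "1 \<le> q" "q \<le> P" "coprime a q" using t by (auto simp: fractions_def units_upto_def)
    obtain k :: int where k: "\<bar>\<theta> - real a / real q - of_int k\<bar> \<le> 1 / (200 * real q * (real P)\<^sup>2)"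
      using t by (auto simp: major_arc_def \<theta>_def)
    define \<beta> where "\<beta> = \<theta> - real a / real q - of_int k"
    have "major_model P j = arc_model P (q, a) j" unfolding major_model_def by (rule sum_major_arc[OF t])
    also have "\<dots> = gauss3_twisted q (int a) 0 / of_nat q * smooth_sum P \<beta>"
      using smooth_sum_periodic[of P \<beta> k] by (simp add: arc_model_def gauss3_twisted_0_eq[OF q(1)] \<beta>_def \<theta>_def)
    finally have v: "major_model P j = gauss3_twisted q (int a) 0 / of_nat q * smooth_sum P \<beta>" .
    have "ee (\<theta> * real x ^ 3) = ee ((of_int (int a) / real q + \<beta>) * real x ^ 3)" for x :: nat
    proof -
      have "\<theta> * real x ^ 3 = (of_int (int a) / real q + \<beta>) * real x ^ 3 + of_int (k * int x ^ 3)"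
        by (simp add: \<beta>_def algebra_simps)
      then show ?thesis by (simp only: ee_add_int)
    qed
    then have "cubesum P j = (\<Sum>x=1..P. ee ((of_int (int a) / real q + \<beta>) * real x ^ 3))" unfolding cubesum by simp
    then show ?thesis unfolding v
      using major_arc_approx[OF tm q(1,2), of "int a" \<beta>] q k by (simp add: \<beta>_def)
  next
    case False
    then have v: "major_model P j = 0" unfolding major_model_def by (intro sum.neutral) auto
    have N: "200 * P\<^sup>2 > 0" using P by simp
    obtain h k where hk: "coprime h k" "0 < k" "k \<le> int (200 * P\<^sup>2)" "\<bar>of_int k * \<theta> - of_int h\<bar> < 1 / real (200 * P\<^sup>2)"
      using Dirichlet_approx_coprime[OF N, of \<theta>] by blast
    define q where "q = nat k"
    have q: "q \<ge> 1" "int q = k" "q \<le> 200 * P\<^sup>2" using hk by (auto simp: q_def nat_le_iff)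
    have rq: "real q > 0" "of_int k = real q" using q by (auto simp flip: q(2))
    have ap: "\<bar>\<theta> - of_int h / real q\<bar> \<le> 1 / (200 * real q * (real P)\<^sup>2)"
    proof -
      have "real q * \<bar>\<theta> - of_int h / real q\<bar> = \<bar>real q * (\<theta> - of_int h / real q)\<bar>" using rq by (simp add: abs_mult)
      also have "real q * (\<theta> - of_int h / real q) = of_int k * \<theta> - of_int h" using rq by (simp add: right_diff_distrib)
      finally have "real q * \<bar>\<theta> - of_int h / real q\<bar> \<le> 1 / (200 * (real P)\<^sup>2)" using hk(4) by simp
      then have "\<bar>\<theta> - of_int h / real q\<bar> \<le> 1 / (200 * (real P)\<^sup>2) / real q"
        using rq(1) by (subst pos_le_divide_eq) (simp_all add: mult.commute)
      then show ?thesis by (simp add: mult_ac)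
    qed
    have "P < q"
    proof (rule ccontr)
      assume "\<not> P < q"
      \<comment> \<open>The representative of h in 1..q, as residues in \<open>units_upto\<close>
        start at 1.\<close>
      define a where "a = nat ((h - 1) mod k) + 1"
      have ia: "int a = (h - 1) mod k + 1" using hk(2) by (simp add: a_def)
      have h: "h = int a + k * ((h - 1) div k)" using ia by simp
      have "coprime (int a) k" using hk(1) h by (metis coprime_iff_gcd_eq_1 gcd.commute gcd_add_mult mult.commute add.commute)
      then have "coprime a q" unfolding q(2)[symmetric] by simp
      moreover have "1 \<le> a" by (simp add: a_def)
      moreover have "a \<le> q" using pos_mod_bound[OF hk(2), of "h - 1"] ia q(2) by linarith
      ultimately have t: "(q, a) \<in> fractions P" using q \<open>\<not> P < q\<close> by (auto simp: fractions_def units_upto_def)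
      have "of_int h / real q = real a / real q + of_int ((h - 1) div k)"
      proof -
        have "real_of_int h = real a + real q * of_int ((h - 1) div k)"
          using h rq(2) by (metis of_int_add of_int_mult of_int_of_nat_eq)
        then show ?thesis using rq by (simp add: field_simps)
      qed
      then have "j \<in> major_arc P (q, a)" using j ap by (auto simp: major_arc_def \<theta>_def diff_diff_eq intro!: exI[of _ "(h - 1) div k"])
      with t False show False by blast
    qed
    moreover have "\<bar>\<theta> - of_int h / of_nat q\<bar> \<le> 1 / (real q)\<^sup>2"
    proof -
      have "real q \<le> real (200 * P\<^sup>2)" using q(3) by (rule of_nat_mono)
      then have "(real q)\<^sup>2 \<le> 200 * real q * (real P)\<^sup>2" using rq by (simp add: power2_eq_square mult_ac)
      then have "1 / (200 * real q * (real P)\<^sup>2) \<le> 1 / (real q)\<^sup>2" using rq P by (intro divide_left_mono) auto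
      then show ?thesis using ap by linarith
    qed
    moreover have "coprime h (int q)" using hk(1) q(2) by simp
    ultimately have "norm (cubesum P j) \<le> 1400 * D\<^sup>2 * real P powr (3/4)"
      unfolding cubesum using q(3) by (intro minor_arc_bound[OF tm]) auto
    then show ?thesis by (simp add: v)
  qed
qed

section \<open>Moments and Fourier coefficients of the model\<close>

lemma hat_smooth_sum_power:
  fixes n :: nat
  assumes P: "P \<ge> 1"
  shows "hat (cmod3 P) (\<lambda>j. smooth_sum P (real j / real (cmod3 P) - \<theta>) ^ s) (int n)
    = (\<Sum>ms | ms \<in> tuples s {..P ^ 3} \<and> int (cmod3 P) dvd int (sum_list ms) - int n.
        of_real (Gamma (4/3) ^ s * (\<Prod>m\<leftarrow>ms. neg_binom (1/3) m)) * ee (- (\<theta> * real (sum_list ms))))"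
proof (rule hat_trig_poly[OF cmod3_pos[OF P]])
  fix j
  show "smooth_sum P (real j / real (cmod3 P) - \<theta>) ^ s = (\<Sum>ms\<in>tuples s {..P ^ 3}.
     (of_real (Gamma (4/3) ^ s * (\<Prod>m\<leftarrow>ms. neg_binom (1/3) m)) * ee (- (\<theta> * real (sum_list ms)))) * ee (real j * of_int (int (sum_list ms)) / real (cmod3 P)))"
    unfolding smooth_sum_power sum_distrib_left
    by (intro sum.cong refl) (simp add: ee_diff left_diff_distrib)
qed simp

lemma sum_list_tuples_le: "ms \<in> tuples s {..K} \<Longrightarrow> sum_list ms \<le> s * K" for ms :: "nat list"
proof -
  assume "ms \<in> tuples s {..K}"
  then have "length ms = s" "\<forall>m\<in>set ms. m \<le> K" by (auto simp: tuples_def)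
  then show ?thesis by (induction ms arbitrary: s) fastforce+
qed

lemma sum_list_tuples_cong:
  assumes "ms \<in> tuples s {..P ^ 3}" "s \<le> 5" "n < cmod3 P" "P \<ge> 1" "int (cmod3 P) dvd int (sum_list ms) - int n"
  shows "sum_list ms = n"
proof -
  have "sum_list ms \<le> s * P ^ 3" by (rule sum_list_tuples_le[OF assms(1)])
  also have "\<dots> < cmod3 P" using assms by (simp add: cmod3_def)
  finally have "int (sum_list ms) = int n"
    using assms(3,5) by (intro eq_if_congruent_small[of "int (cmod3 P)"]) auto
  then show ?thesis by simp
qed

lemma prod_list_neg_binom_nonneg: "(\<Prod>m\<leftarrow>ms. neg_binom (1/3) m) \<ge> 0"
  by (induction ms) (simp_all add: neg_binom_nonneg)

text \<open>Parseval for the square of the smooth sum: its coefficients are at most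
  \<open>neg_binom (2/3) n\<close>, hence at most (n + 1) powr (-1/3), whose squares sum to O(P).
  The twist by \<theta> does not affect norms.\<close>

lemma smooth_sum_fourth_moment:
  assumes P: "P \<ge> 1"
  shows "(\<Sum>j<cmod3 P. norm (smooth_sum P (real j / real (cmod3 P) - \<theta>)) ^ 4) / real (cmod3 P) \<le> 6 * real P"
proof -
  have M: "cmod3 P > 0" using P by (rule cmod3_pos)
  let ?F = "\<lambda>j. smooth_sum P (real j / real (cmod3 P) - \<theta>) ^ 2"
  have "(\<Sum>j<cmod3 P. norm (smooth_sum P (real j / real (cmod3 P) - \<theta>)) ^ 4) / real (cmod3 P)
     = (\<Sum>n<cmod3 P. (norm (hat (cmod3 P) ?F (int n)))\<^sup>2)"
    by (subst hat_parseval[OF M]) (simp add: norm_power flip: power_mult)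
  also have "\<dots> \<le> (\<Sum>n<cmod3 P. real (Suc n) powr (-2/3))"
  proof (rule sum_mono)
    fix n assume n: "n \<in> {..<cmod3 P}"
    have "norm (hat (cmod3 P) ?F (int n)) \<le> (\<Sum>ms | ms \<in> tuples 2 {..cmod3 P} \<and> sum_list ms = n. \<Prod>m\<leftarrow>ms. neg_binom (1/3) m)"
      unfolding hat_smooth_sum_power[OF P]
    proof (rule order_trans[OF norm_sum], rule order_trans[OF sum_mono sum_mono2])
      fix ms
      show "norm (of_real (Gamma (4/3) ^ 2 * (\<Prod>m\<leftarrow>ms. neg_binom (1/3) m)) * ee (- (\<theta> * real (sum_list ms)))) \<le> (\<Prod>m\<leftarrow>ms. neg_binom (1/3) m)"
      proof -
        have "Gamma (4/3 :: real) ^ 2 \<le> 1" using Gamma_four_thirds by (intro power_le_one) auto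
        then show ?thesis using prod_list_neg_binom_nonneg[of ms] by (simp add: norm_mult norm_power mult_left_le_one_le)
      qed
    next
      \<comment> \<open>For n > P^3 the truncated convolution is only part of the full one, so the
        entries are enlarged up to the modulus; the summands are nonnegative.\<close>
      show "{ms. ms \<in> tuples 2 {..P ^ 3} \<and> int (cmod3 P) dvd int (sum_list ms) - int n} \<subseteq> {ms. ms \<in> tuples 2 {..cmod3 P} \<and> sum_list ms = n}"
        using n P by (auto intro!: sum_list_tuples_cong[of _ 2] simp: tuples_def cmod3_def)
    qed (auto simp: prod_list_neg_binom_nonneg)
    also have "\<dots> = neg_binom (2/3) n" using n by (subst sum_tuples_neg_binom) auto
    also have "\<dots> \<le> real (Suc n) powr (2/3 - 1)" by (rule neg_binom_le_powr) auto
    finally have "(norm (hat (cmod3 P) ?F (int n)))\<^sup>2 \<le> (real (Suc n) powr (-1/3))\<^sup>2" by (intro power_mono) auto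
    also have "\<dots> = real (Suc n) powr (-2/3)" by (simp add: powr_power)
    finally show "(norm (hat (cmod3 P) ?F (int n)))\<^sup>2 \<le> real (Suc n) powr (-2/3)" .
  qed
  also have "\<dots> \<le> 3 * real (cmod3 P) powr (1/3)" by (rule sum_powr_neg_two_thirds_le)
  also have "real (cmod3 P) powr (1/3) \<le> ((2 * real P) ^ 3) powr (1/3)"
    by (intro powr_mono2) (auto simp: cmod3_def power_mult_distrib)
  also have "((2 * real P) ^ 3) powr (1/3) = 2 * real P" by (rule cube_powr_third) simp
  finally show ?thesis by simp
qed

lemma gauss_majorantD:
  assumes "gauss_majorant \<kappa> C"
  shows "0 \<le> \<kappa> q" "\<kappa> q \<le> 1" "(\<Sum>q=1..X. real q powr (5/4) * \<kappa> q ^ 5) \<le> C" "0 \<le> C"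
    and "q \<ge> 1 \<Longrightarrow> coprime a q \<Longrightarrow> norm (gauss_sum 3 q a / of_nat q) \<le> \<kappa> q"
proof -
  show "0 \<le> \<kappa> q" "\<kappa> q \<le> 1" "(\<Sum>q=1..X. real q powr (5/4) * \<kappa> q ^ 5) \<le> C" for q X
    using assms by (auto simp: gauss_majorant_def)
  from this(3)[of 0] show "0 \<le> C" by simp
  show "norm (gauss_sum 3 q a / of_nat q) \<le> \<kappa> q" if "q \<ge> 1" "coprime a q"
  proof -
    have "norm (gauss_sum 3 q a) \<le> real q * \<kappa> q" using assms that by (auto simp: gauss_majorant_def)
    then show ?thesis using that(1) by (simp add: norm_divide pos_divide_le_eq mult.commute)
  qed
qed

lemma sum_weighted_fifth_le:
  assumes gm: "gauss_majorant \<kappa> C" and "c \<le> 5/4"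
  shows "(\<Sum>q=1..X. real q powr c * \<kappa> q ^ 5) \<le> C"
proof -
  have "(\<Sum>q=1..X. real q powr c * \<kappa> q ^ 5) \<le> (\<Sum>q=1..X. real q powr (5/4) * \<kappa> q ^ 5)"
    using gauss_majorantD(1)[OF gm] assms(2) by (intro sum_mono mult_right_mono powr_mono) auto
  then show ?thesis using gauss_majorantD(3)[OF gm, of X] by linarith
qed

text \<open>By positivity each arc may be completed to the whole circle, and there are at most q
  numerators for each denominator.\<close>

lemma mean_major_model_power_le:
  assumes gm: "gauss_majorant \<kappa> C" and s: "s \<ge> 1"
    and R: "\<And>\<theta>. (\<Sum>j<cmod3 P. norm (smooth_sum P (real j / real (cmod3 P) - \<theta>)) ^ s) / real (cmod3 P) \<le> R"
  shows "(\<Sum>j<cmod3 P. norm (major_model P j) ^ s) / real (cmod3 P) \<le> (\<Sum>q=1..P. real q * \<kappa> q ^ s) * R"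
proof -
  let ?M = "cmod3 P"
  have R0: "0 \<le> R" by (rule order_trans[OF _ R[of 0]]) (intro divide_nonneg_nonneg sum_nonneg, auto)
  have "(\<Sum>j<?M. norm (major_model P j) ^ s) \<le> (\<Sum>j<?M. \<Sum>t\<in>fractions P. norm (arc_model P t j) ^ s)"
  proof (rule sum_mono)
    fix j
    have "norm (major_model P j) ^ s = (\<Sum>t\<in>fractions P. if j \<in> major_arc P t then norm (arc_model P t j) ^ s else 0)"
      using s by (intro major_model_apply[of "\<lambda>z. norm z ^ s"]) auto
    also have "\<dots> \<le> (\<Sum>t\<in>fractions P. norm (arc_model P t j) ^ s)" by (intro sum_mono) auto
    finally show "norm (major_model P j) ^ s \<le> (\<Sum>t\<in>fractions P. norm (arc_model P t j) ^ s)" .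
  qed
  also have "\<dots> = (\<Sum>q=1..P. \<Sum>a\<in>units_upto q. \<Sum>j<?M. norm (arc_model P (q, a) j) ^ s)"
    by (subst sum.swap) (rule sum_fractions)
  finally have "(\<Sum>j<?M. norm (major_model P j) ^ s) / real ?M
     \<le> (\<Sum>q=1..P. \<Sum>a\<in>units_upto q. \<Sum>j<?M. norm (arc_model P (q, a) j) ^ s) / real ?M"
    by (rule divide_right_mono) simp
  also have "\<dots> = (\<Sum>q=1..P. \<Sum>a\<in>units_upto q. (\<Sum>j<?M. norm (arc_model P (q, a) j) ^ s) / real ?M)"
    by (simp only: sum_divide_distrib)
  also have "\<dots> \<le> (\<Sum>q=1..P. \<Sum>a\<in>units_upto q. \<kappa> q ^ s * R)"
  proof (intro sum_mono)
    fix q a assume q: "q \<in> {1..P}" and a: "a \<in> units_upto q"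
    have "(\<Sum>j<?M. norm (arc_model P (q, a) j) ^ s) / real ?M
       = norm (gauss_sum 3 q a / of_nat q) ^ s * ((\<Sum>j<?M. norm (smooth_sum P (real j / real ?M - real a / real q)) ^ s) / real ?M)"
      by (simp only: arc_model_def prod.case norm_mult power_mult_distrib sum_distrib_left[symmetric] times_divide_eq_right)
    also have "\<dots> \<le> \<kappa> q ^ s * R"
      using q a R gauss_majorantD[OF gm]
      by (intro mult_mono power_mono) (auto simp: units_upto_def intro!: divide_nonneg_nonneg sum_nonneg)
    finally show "(\<Sum>j<?M. norm (arc_model P (q, a) j) ^ s) / real ?M \<le> \<kappa> q ^ s * R" .
  qed
  also have "\<dots> \<le> (\<Sum>q=1..P. real q * (\<kappa> q ^ s * R))"
  proof (rule sum_mono)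
    fix q
    have "real (card (units_upto q)) * (\<kappa> q ^ s * R) \<le> real q * (\<kappa> q ^ s * R)"
      using card_units_upto_le[of q] gauss_majorantD(1)[OF gm, of q] R0 by (intro mult_right_mono) auto
    then show "(\<Sum>a\<in>units_upto q. \<kappa> q ^ s * R) \<le> real q * (\<kappa> q ^ s * R)" by simp
  qed
  finally show ?thesis by (simp add: sum_distrib_right mult.assoc)
qed

lemma mean_smooth_sum_power_le:
  assumes P: "P \<ge> 1"
  shows "(\<Sum>j<cmod3 P. norm (smooth_sum P (real j / real (cmod3 P) - \<theta>)) ^ (4 + s)) / real (cmod3 P) \<le> (6 * real P) ^ Suc s"
proof -
  have "(\<Sum>j<cmod3 P. norm (smooth_sum P (real j / real (cmod3 P) - \<theta>)) ^ (4 + s))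
      \<le> (\<Sum>j<cmod3 P. norm (smooth_sum P (real j / real (cmod3 P) - \<theta>)) ^ 4 * (6 * real P) ^ s)"
    unfolding power_add by (intro sum_mono mult_left_mono power_mono norm_smooth_sum_le_trivial P) auto
  then have "(\<Sum>j<cmod3 P. norm (smooth_sum P (real j / real (cmod3 P) - \<theta>)) ^ (4 + s)) / real (cmod3 P)
      \<le> (\<Sum>j<cmod3 P. norm (smooth_sum P (real j / real (cmod3 P) - \<theta>)) ^ 4) / real (cmod3 P) * (6 * real P) ^ s"
    by (simp add: sum_distrib_right[symmetric] divide_right_mono)
  also have "\<dots> \<le> 6 * real P * (6 * real P) ^ s"
    by (intro mult_right_mono smooth_sum_fourth_moment P) auto
  finally show ?thesis by simp
qed

text \<open>Only the fifth moment of \<kappa> is bounded. Where \<kappa> q >= P powr (-1/2) one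
  factor is traded for P powr (1/2); elsewhere a term is at most 1/P. The result P powr (3/2) has
  the size of the squared approximation error.\<close>

lemma mean_major_model_fourth_le:
  assumes gm: "gauss_majorant \<kappa> C" and P: "P \<ge> 1"
  shows "(\<Sum>j<cmod3 P. norm (major_model P j) ^ 4) / real (cmod3 P) \<le> 6 * (C + 1) * real P powr (3/2)"
proof -
  have Ph: "real P powr (1/2) \<ge> 1" using P by (simp add: ge_one_powr_ge_zero)
  have "(\<Sum>q=1..P. real q * \<kappa> q ^ 4) \<le> (\<Sum>q=1..P. real P powr (1/2) * (real q powr (5/4) * \<kappa> q ^ 5) + 1 / real P)"
  proof (rule sum_mono)
    fix q assume q: "q \<in> {1..P}"
    note k = gauss_majorantD(1,2)[OF gm, of q]
    show "real q * \<kappa> q ^ 4 \<le> real P powr (1/2) * (real q powr (5/4) * \<kappa> q ^ 5) + 1 / real P"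
    proof (cases "\<kappa> q \<ge> real P powr (-1/2)")
      case True
      then have "real P powr (1/2) * real P powr (-1/2) \<le> real P powr (1/2) * \<kappa> q" by (intro mult_left_mono) auto
      then have 1: "1 \<le> real P powr (1/2) * \<kappa> q" using P by (simp flip: powr_add)
      have "real q powr 1 \<le> real q powr (5/4)" using q by (intro powr_mono) auto
      then have "real q * \<kappa> q ^ 4 * 1 \<le> (real q powr (5/4) * \<kappa> q ^ 4) * (real P powr (1/2) * \<kappa> q)"
        using 1 k by (intro mult_mono mult_right_mono mult_nonneg_nonneg) auto
      also have "\<dots> = real P powr (1/2) * (real q powr (5/4) * \<kappa> q ^ 5)" by (simp add: eval_nat_numeral)
      finally show ?thesis using P by (simp add: add_increasing2)
    next
      case False
      then have "real q * \<kappa> q ^ 4 \<le> real P * (real P powr (-1/2)) ^ 4"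
        using q k by (intro mult_mono power_mono) auto
      also have "(real P powr (-1/2)) ^ 4 = 1 / (real P)\<^sup>2"
      proof -
        have "(real P powr (-1/2)) ^ 4 = real P powr (real 4 * (-1/2))" by (rule powr_power) (use P in simp)
        also have "\<dots> = real P powr (-2)" by simp
        also have "\<dots> = 1 / (real P)\<^sup>2" using P by (simp add: powr_minus_divide)
        finally show ?thesis .
      qed
      also have "real P * (1 / (real P)\<^sup>2) = 1 / real P" using P by (simp add: power2_eq_square)
      finally show ?thesis using k by (simp add: add_increasing)
    qed
  qed
  also have "\<dots> = real P powr (1/2) * (\<Sum>q=1..P. real q powr (5/4) * \<kappa> q ^ 5) + 1"
    using P by (simp add: sum.distrib sum_distrib_left)
  also have "\<dots> \<le> real P powr (1/2) * C + real P powr (1/2)"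
    using gauss_majorantD(3)[OF gm, of P] Ph by (intro add_mono mult_left_mono) auto
  finally have S: "(\<Sum>q=1..P. real q * \<kappa> q ^ 4) \<le> (C + 1) * real P powr (1/2)" by (simp add: algebra_simps)
  have "(\<Sum>j<cmod3 P. norm (major_model P j) ^ 4) / real (cmod3 P) \<le> (\<Sum>q=1..P. real q * \<kappa> q ^ 4) * (6 * real P)"
    by (rule mean_major_model_power_le[OF gm]) (use smooth_sum_fourth_moment[OF P] in auto)
  also have "\<dots> \<le> ((C + 1) * real P powr (1/2)) * (6 * real P)" by (intro mult_right_mono S) auto
  also have "\<dots> = 6 * (C + 1) * (real P powr (1/2) * real P)" by simp
  also have "real P powr (1/2) * real P = real P powr (3/2)" using P powr_add[of "real P" "1/2" 1] by simp
  finally show ?thesis .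
qed

text \<open>From the fifth power on, the sum over denominators is bounded, so the model behaves like
  one arc around 0.\<close>

lemma mean_major_model_higher_le:
  assumes gm: "gauss_majorant \<kappa> C" and P: "P \<ge> 1" and s: "s \<ge> 1"
  shows "(\<Sum>j<cmod3 P. norm (major_model P j) ^ (4 + s)) / real (cmod3 P) \<le> C * (6 * real P) ^ Suc s"
proof -
  have "(\<Sum>q=1..P. real q * \<kappa> q ^ (4 + s)) \<le> (\<Sum>q=1..P. real q powr 1 * \<kappa> q ^ 5)"
    using gauss_majorantD(1,2)[OF gm] s by (intro sum_mono mult_mono power_decreasing) auto
  also have "\<dots> \<le> C" by (rule sum_weighted_fifth_le[OF gm]) simp
  finally have S: "(\<Sum>q=1..P. real q * \<kappa> q ^ (4 + s)) \<le> C" .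
  have "(\<Sum>j<cmod3 P. norm (major_model P j) ^ (4 + s)) / real (cmod3 P) \<le> (\<Sum>q=1..P. real q * \<kappa> q ^ (4 + s)) * (6 * real P) ^ Suc s"
    by (rule mean_major_model_power_le[OF gm _ mean_smooth_sum_power_le[OF P]]) simp
  also have "\<dots> \<le> C * (6 * real P) ^ Suc s" by (intro mult_right_mono S) auto
  finally show ?thesis .
qed

lemma norm_hat_major_model_fifth_le:
  assumes gm: "gauss_majorant \<kappa> C" and P: "P \<ge> 1"
  shows "norm (hat (cmod3 P) (\<lambda>j. major_model P j ^ 5) n) \<le> 36 * C * (real P)\<^sup>2"
proof -
  have "norm (hat (cmod3 P) (\<lambda>j. major_model P j ^ 5) n) \<le> (\<Sum>j<cmod3 P. norm (major_model P j) ^ (4 + 1)) / real (cmod3 P)"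
    by (rule order_trans[OF norm_hat_le]) (simp add: norm_power)
  also have "\<dots> \<le> C * (6 * real P) ^ Suc 1" by (rule mean_major_model_higher_le[OF gm P order_refl])
  finally show ?thesis by (simp add: power2_eq_square mult_ac)
qed

section \<open>The singular series and the singular integral\<close>

lemma norm_singular_series_term_le:
  assumes gm: "gauss_majorant \<kappa> C" and q: "q \<ge> 1"
  shows "norm (singular_series_term 5 3 n q) \<le> real q * \<kappa> q ^ 5"
proof -
  have set: "{a. a \<in> {1..q} \<and> coprime a q} = units_upto q" by (auto simp: units_upto_def)
  have ne: "norm (e (- (of_nat a * of_nat n / of_nat q))) = 1" for a
  proof -
    have "e (- (of_nat a * of_nat n / of_nat q)) = ee (- (real a * real n / real q))"
      using e_of_real[of "- (real a * real n / real q)"] by simp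
    then show ?thesis by (simp only: norm_ee)
  qed
  have "norm (singular_series_term 5 3 n q) \<le> (\<Sum>a\<in>units_upto q. \<kappa> q ^ 5)"
    unfolding singular_series_term_def set
  proof (rule sum_norm_le)
    fix a assume a: "a \<in> units_upto q"
    have "norm (inverse (of_nat q) * gauss_sum 3 q a) \<le> \<kappa> q"
      using gauss_majorantD(5)[OF gm q, of a] a by (simp add: units_upto_def divide_inverse mult.commute)
    then show "norm ((inverse (of_nat q) * gauss_sum 3 q a) ^ 5 * e (- (of_nat a * of_nat n / of_nat q))) \<le> \<kappa> q ^ 5"
      unfolding norm_mult[of "_ ^ 5"] ne norm_power by (simp add: power_mono)
  qed
  also have "\<dots> \<le> real q * \<kappa> q ^ 5"
    using card_units_upto_le[of q] gauss_majorantD(1)[OF gm, of q] by (simp add: mult_right_mono)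
  finally show ?thesis .
qed

text \<open>Absolute convergence, with the surplus weight q powr (1/4) of the majorant turned into
  the decay of the tail. The partial sums are bounded uniformly, which also proves
  summability.\<close>

lemma singular_series_bounds:
  assumes gm: "gauss_majorant \<kappa> C" and P: "P \<ge> 1"
  shows "norm (singular_series 5 3 n) \<le> C"
    and "norm (singular_series 5 3 n - (\<Sum>q=1..P. singular_series_term 5 3 n q)) \<le> C * real P powr (-1/4)"
proof -
  define A where "A k = singular_series_term 5 3 n (Suc k)" for k
  define b where "b q = real q * \<kappa> q ^ 5" for q
  have b0: "0 \<le> b q" for q using gauss_majorantD(1)[OF gm, of q] by (simp add: b_def)
  have Ab: "norm (A k) \<le> b (Suc k)" for k unfolding A_def b_def by (rule norm_singular_series_term_le[OF gm]) simp
  have shift: "(\<Sum>k<m. b (Suc (k + l))) = (\<Sum>q\<in>{Suc l..l + m}. b q)" for l m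
    by (rule sum.reindex_bij_witness[of _ "\<lambda>q. q - Suc l" "\<lambda>k. Suc (k + l)"]) auto
  have tail: "(\<Sum>k<m. norm (A (k + l))) \<le> C * (if l = 0 then 1 else real l powr (-1/4))" for l m
  proof -
    \<comment> \<open>At l = 0 the power of l would be 0, so the full series takes the weight
      1.\<close>
    define w where "w = (if l = 0 then 1 else real l powr (-1/4))"
    have "(\<Sum>k<m. norm (A (k + l))) \<le> (\<Sum>k<m. b (Suc (k + l)))" by (intro sum_mono Ab)
    also have "\<dots> = (\<Sum>q\<in>{Suc l..l + m}. b q)" by (rule shift)
    also have "\<dots> \<le> (\<Sum>q\<in>{Suc l..l + m}. w * (real q powr (5/4) * \<kappa> q ^ 5))"
    proof (rule sum_mono)
      fix q assume q: "q \<in> {Suc l..l + m}"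
      have "1 \<le> w * real q powr (1/4)"
      proof (cases "l = 0")
        case True
        then show ?thesis using q by (simp add: w_def ge_one_powr_ge_zero)
      next
        case False
        have "real l powr (-1/4) * real l powr (1/4) \<le> real l powr (-1/4) * real q powr (1/4)"
          using q by (intro mult_left_mono powr_mono2) auto
        then show ?thesis using False by (simp add: w_def flip: powr_add)
      qed
      then have "b q * 1 \<le> b q * (w * real q powr (1/4))" using b0 by (intro mult_left_mono) auto
      also have "real q powr (5/4) = real q * real q powr (1/4)" using powr_add[of "real q" 1 "1/4"] by simp
      then have "b q * (w * real q powr (1/4)) = w * (real q powr (5/4) * \<kappa> q ^ 5)" by (simp add: b_def)
      finally show "b q \<le> w * (real q powr (5/4) * \<kappa> q ^ 5)" by simp
    qed
    also have "\<dots> = w * (\<Sum>q\<in>{Suc l..l + m}. real q powr (5/4) * \<kappa> q ^ 5)" by (simp add: sum_distrib_left)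
    also have "\<dots> \<le> w * (\<Sum>q=1..l + m. real q powr (5/4) * \<kappa> q ^ 5)"
      using gauss_majorantD(1)[OF gm] by (intro mult_left_mono sum_mono2) (auto simp: w_def)
    also have "\<dots> \<le> w * C" using gauss_majorantD(3)[OF gm] by (intro mult_left_mono) (auto simp: w_def)
    finally show ?thesis by (simp add: w_def mult.commute)
  qed
  have smn: "summable (\<lambda>k. norm (A k))"
  proof (rule bounded_imp_summable[of _ C])
    show "(\<Sum>k\<le>m. norm (A k)) \<le> C" for m using tail[of 0 "Suc m"] unfolding lessThan_Suc_atMost by simp
  qed simp
  have sm: "summable A" using smn by (rule summable_norm_cancel)
  have ss: "singular_series 5 3 n = suminf A" by (simp add: singular_series_def A_def[abs_def])
  have bound: "norm (suminf (\<lambda>k. A (k + l))) \<le> C * (if l = 0 then 1 else real l powr (-1/4))" for l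
  proof -
    have s1: "summable (\<lambda>k. norm (A (k + l)))" using smn by (rule summable_ignore_initial_segment)
    have "norm (suminf (\<lambda>k. A (k + l))) \<le> suminf (\<lambda>k. norm (A (k + l)))" by (rule summable_norm[OF s1])
    also have "\<dots> \<le> C * (if l = 0 then 1 else real l powr (-1/4))" by (rule suminf_le_const[OF s1 tail])
    finally show ?thesis .
  qed
  show "norm (singular_series 5 3 n) \<le> C" using bound[of 0] by (simp add: ss)
  have "(\<Sum>q=1..P. singular_series_term 5 3 n q) = (\<Sum>k<P. A k)"
    by (rule sum.reindex_bij_witness[of _ Suc "\<lambda>q. q - 1"]) (auto simp: A_def)
  then have "singular_series 5 3 n - (\<Sum>q=1..P. singular_series_term 5 3 n q) = suminf (\<lambda>k. A (k + P))"
    unfolding ss using suminf_minus_initial_segment[OF sm, of P] by simp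
  then show "norm (singular_series 5 3 n - (\<Sum>q=1..P. singular_series_term 5 3 n q)) \<le> C * real P powr (-1/4)"
    using bound[of P] P by simp
qed

text \<open>Modulo 1 the distance \<gamma> to the fraction exceeds the arc width, and the bound 7
  |\<gamma>| powr (-1/3) applies; 42 = 7 * 6, since 200 <= 6^3.\<close>

lemma norm_smooth_sum_off_arc_le:
  assumes P: "P \<ge> 1" and q: "1 \<le> q" and j: "j < cmod3 P" "j \<notin> major_arc P (q, a)"
  shows "norm (smooth_sum P (real j / real (cmod3 P) - real a / real q)) \<le> 42 * real q powr (1/3) * real P powr (2/3)"
proof -
  define \<beta> where "\<beta> = real j / real (cmod3 P) - real a / real q"
  define k where "k = round \<beta>"
  define \<gamma> where "\<gamma> = \<beta> - of_int k"
  have \<gamma>h: "\<bar>\<gamma>\<bar> \<le> 1/2" using of_int_round_abs_le[of \<beta>] by (simp add: \<gamma>_def k_def abs_minus_commute)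
  have large: "1 / (200 * real q * (real P)\<^sup>2) < \<bar>\<gamma>\<bar>"
  proof (rule ccontr)
    assume "\<not> ?thesis"
    then have "\<bar>real j / real (cmod3 P) - real a / real q - of_int k\<bar> \<le> 1 / (200 * real q * (real P)\<^sup>2)"
      by (simp only: \<gamma>_def \<beta>_def not_less)
    then have "j \<in> major_arc P (q, a)" using j(1) unfolding major_arc_def by blast
    with j show False by simp
  qed
  have pos: "0 < 1 / (200 * real q * (real P)\<^sup>2)" using P q by simp
  have \<gamma>0: "\<gamma> \<noteq> 0"
  proof
    assume "\<gamma> = 0"
    then have "\<bar>\<gamma>\<bar> = 0" by simp
    with large pos show False by linarith
  qed
  have "smooth_sum P \<beta> = smooth_sum P \<gamma>" using smooth_sum_periodic[of P \<gamma> k] by (simp add: \<gamma>_def)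
  then have "norm (smooth_sum P \<beta>) \<le> 7 * \<bar>\<gamma>\<bar> powr (-1/3)" using norm_smooth_sum_le[OF \<gamma>0 \<gamma>h, of P] by simp
  also have "\<bar>\<gamma>\<bar> powr (-1/3) \<le> (1 / (200 * real q * (real P)\<^sup>2)) powr (-1/3)" using large pos by (intro powr_mono2') auto
  also have "\<dots> = (200 * real q * (real P)\<^sup>2) powr (1/3)" using P q by (simp add: powr_minus_divide powr_divide)
  also have "\<dots> = 200 powr (1/3) * real q powr (1/3) * ((real P)\<^sup>2) powr (1/3)" by (simp add: powr_mult)
  also have "((real P)\<^sup>2) powr (1/3) = real P powr (2/3)"
  proof -
    have "(real P)\<^sup>2 = real P powr 2" by (rule powr_numeral[symmetric]) simp
    then show ?thesis by (simp only: powr_powr) simp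
  qed
  also have "7 * (200 powr (1/3) * real q powr (1/3) * real P powr (2/3)) \<le> 7 * (6 * real q powr (1/3) * real P powr (2/3))"
  proof -
    have "(200::real) powr (1/3) \<le> (6 ^ 3) powr (1/3)" by (intro powr_mono2) auto
    also have "((6::real) ^ 3) powr (1/3) = 6" by (rule cube_powr_third) simp
    finally show ?thesis by (intro mult_left_mono mult_right_mono) auto
  qed
  finally show ?thesis by (simp add: \<beta>_def)
qed

definition sing_integral :: "nat \<Rightarrow> real" where
  "sing_integral n = Gamma (4/3) ^ 5 * neg_binom (5/3) n"

text \<open>Five entries up to P^3 sum to less than 6 P^3, so congruence is equality, and for n <=
  P^3 no tuple is lost by truncation. The centre a/q of the arc only rotates the value.\<close>

lemma full_circle_integral:
  assumes P: "P \<ge> 1" and n: "n \<le> P ^ 3"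
  shows "hat (cmod3 P) (\<lambda>j. smooth_sum P (real j / real (cmod3 P) - \<theta>) ^ 5) (int n) = of_real (sing_integral n) * ee (- (\<theta> * real n))"
proof -
  have nM: "n < cmod3 P" using n one_le_power[OF P, of 3] by (simp add: cmod3_def)
  have set: "{ms. ms \<in> tuples 5 {..P ^ 3} \<and> int (cmod3 P) dvd int (sum_list ms) - int n} = {ms. ms \<in> tuples 5 {..P ^ 3} \<and> sum_list ms = n}"
    using sum_list_tuples_cong[OF _ order_refl nM P] by auto
  have "hat (cmod3 P) (\<lambda>j. smooth_sum P (real j / real (cmod3 P) - \<theta>) ^ 5) (int n)
     = (\<Sum>ms | ms \<in> tuples 5 {..P ^ 3} \<and> sum_list ms = n. of_real (Gamma (4/3) ^ 5 * (\<Prod>m\<leftarrow>ms. neg_binom (1/3) m)) * ee (- (\<theta> * real n)))"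
    unfolding hat_smooth_sum_power[OF P] set by (intro sum.cong refl) auto
  also have "\<dots> = of_real (Gamma (4/3) ^ 5 * (\<Sum>ms | ms \<in> tuples 5 {..P ^ 3} \<and> sum_list ms = n. \<Prod>m\<leftarrow>ms. neg_binom (1/3) m)) * ee (- (\<theta> * real n))"
    by (simp only: sum_distrib_left sum_distrib_right of_real_sum)
  also have "(\<Sum>ms | ms \<in> tuples 5 {..P ^ 3} \<and> sum_list ms = n. \<Prod>m\<leftarrow>ms. neg_binom (1/3) m) = neg_binom (5/3) n"
    by (subst sum_tuples_neg_binom) (use n in auto)
  finally show ?thesis by (simp only: sing_integral_def)
qed

text \<open>Off the arc one factor is bounded by its supremum and the other four by the fourth
  moment; 252 = 42 * 6.\<close>

lemma arc_integral:
  assumes P: "P \<ge> 1" and q: "1 \<le> q" and n: "n \<le> P ^ 3"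
  shows "norm ((\<Sum>j<cmod3 P. (if j \<in> major_arc P (q, a) then smooth_sum P (real j / real (cmod3 P) - real a / real q) ^ 5 else 0)
          * ee (- (real j * real n / real (cmod3 P)))) / of_nat (cmod3 P) - of_real (sing_integral n) * ee (- (real a * real n / real q)))
     \<le> 252 * real q powr (1/3) * real P powr (5/3)"
proof -
  let ?M = "cmod3 P"
  define v where "v j = smooth_sum P (real j / real ?M - real a / real q)" for j
  define E where "E j = ee (- (real j * real n / real ?M))" for j
  have full: "of_real (sing_integral n) * ee (- (real a * real n / real q)) = (\<Sum>j<?M. v j ^ 5 * E j) / of_nat ?M"
    using full_circle_integral[OF P n, of "real a / real q"] by (simp add: hat_def v_def E_def)
  have "(\<Sum>j<?M. (if j \<in> major_arc P (q, a) then v j ^ 5 else 0) * E j) / of_nat ?M - (\<Sum>j<?M. v j ^ 5 * E j) / of_nat ?M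
     = (\<Sum>j<?M. (if j \<in> major_arc P (q, a) then 0 else - (v j ^ 5)) * E j) / of_nat ?M"
    unfolding diff_divide_distrib[symmetric] sum_subtractf[symmetric]
    by (intro arg_cong[where f = "\<lambda>x. x / _"] sum.cong refl) auto
  also have "norm \<dots> \<le> (\<Sum>j<?M. (42 * real q powr (1/3) * real P powr (2/3)) * norm (v j) ^ 4) / real ?M"
    unfolding norm_divide norm_of_nat
  proof (intro divide_right_mono sum_norm_le)
    fix j assume j: "j \<in> {..<?M}"
    show "norm ((if j \<in> major_arc P (q, a) then 0 else - (v j ^ 5)) * E j) \<le> (42 * real q powr (1/3) * real P powr (2/3)) * norm (v j) ^ 4"
    proof (cases "j \<in> major_arc P (q, a)")
      case False
      have "norm (v j) * norm (v j) ^ 4 \<le> (42 * real q powr (1/3) * real P powr (2/3)) * norm (v j) ^ 4"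
        unfolding v_def using j False by (intro mult_right_mono norm_smooth_sum_off_arc_le[OF P q]) auto
      then show ?thesis using False by (simp add: norm_mult norm_power E_def eval_nat_numeral mult_ac)
    qed simp
  qed simp
  also have "\<dots> = (42 * real q powr (1/3) * real P powr (2/3)) * ((\<Sum>j<?M. norm (v j) ^ 4) / real ?M)"
    by (simp add: sum_distrib_left)
  also have "\<dots> \<le> (42 * real q powr (1/3) * real P powr (2/3)) * (6 * real P)"
    unfolding v_def by (intro mult_left_mono smooth_sum_fourth_moment P) auto
  also have "\<dots> = 252 * real q powr (1/3) * (real P powr (2/3) * real P)" by simp
  also have "real P powr (2/3) * real P = real P powr (5/3)" using powr_add[of "real P" "2/3" 1] by simp
  finally show ?thesis unfolding full by (simp only: v_def E_def)
qed

text \<open>There are three errors: completing the arcs, cutting the series at P, which costs P^2 *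
  P powr (-1/4), and replacing \<open>neg_binom (5/3) n\<close> by the power of n, which is bounded.
  The first two are O(P powr (7/4)).\<close>

lemma main_term:
  assumes gm: "gauss_majorant \<kappa> C" and P: "P \<ge> 1" and n: "1 \<le> n" "n \<le> P ^ 3"
  shows "norm (hat (cmod3 P) (\<lambda>j. major_model P j ^ 5) (int n)
      - of_real (Gamma (4/3) ^ 5 / Gamma (5/3)) * singular_series 5 3 n * of_real (real n powr (2/3)))
    \<le> C * (252 + 3 / Gamma (5/3)) * real P powr (7/4)"
proof -
  let ?M = "cmod3 P"
  define g where "g q a = gauss_sum 3 q a / of_nat q" for q a
  define c0 where "c0 = Gamma (4/3) ^ 5 / Gamma (5/3 :: real)"
  define S where "S = (\<Sum>q=1..P. singular_series_term 5 3 n q)"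
  define I where "I q a = (\<Sum>j<?M. (if j \<in> major_arc P (q, a) then smooth_sum P (real j / real ?M - real a / real q) ^ 5 else 0)
          * ee (- (real j * real n / real ?M))) / of_nat ?M" for q a
  have M: "?M > 0" using P by (rule cmod3_pos)
  have C0: "0 \<le> C" by (rule gauss_majorantD(4)[OF gm])
  have G5: "0 < Gamma (5/3 :: real)" by (rule Gamma_real_pos) simp
  have c0: "0 \<le> c0" "c0 \<le> 1 / Gamma (5/3)"
    using Gamma_four_thirds G5 unfolding c0_def by (auto intro!: divide_right_mono power_le_one)
  have "hat ?M (\<lambda>j. major_model P j ^ 5) (int n) = (\<Sum>t\<in>fractions P. g (fst t) (snd t) ^ 5 * I (fst t) (snd t))"
  proof -
    have "major_model P j ^ 5 = (\<Sum>t\<in>fractions P. g (fst t) (snd t) ^ 5 * (if j \<in> major_arc P t then smooth_sum P (real j / real ?M - real (snd t) / real (fst t)) ^ 5 else 0))" for j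
      by (subst major_model_apply[of "\<lambda>z. z ^ 5"]) (auto intro!: sum.cong simp: arc_model_def g_def power_mult_distrib[symmetric] split_def)
    then have "hat ?M (\<lambda>j. major_model P j ^ 5) (int n) = (\<Sum>j<?M. \<Sum>t\<in>fractions P. g (fst t) (snd t) ^ 5 *
       ((if j \<in> major_arc P t then smooth_sum P (real j / real ?M - real (snd t) / real (fst t)) ^ 5 else 0) * ee (- (real j * real n / real ?M)))) / of_nat ?M"
      by (simp add: hat_def sum_distrib_right mult.assoc)
    also have "\<dots> = (\<Sum>t\<in>fractions P. g (fst t) (snd t) ^ 5 * I (fst t) (snd t))"
      unfolding I_def by (subst sum.swap) (simp add: sum_distrib_left sum_divide_distrib)
    finally show ?thesis .
  qed
  also have "\<dots> = (\<Sum>q=1..P. \<Sum>a\<in>units_upto q. g q a ^ 5 * I q a)" by (simp add: sum_fractions)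
  finally have hat: "hat ?M (\<lambda>j. major_model P j ^ 5) (int n) = (\<Sum>q=1..P. \<Sum>a\<in>units_upto q. g q a ^ 5 * I q a)" .
  have sst: "singular_series_term 5 3 n q = (\<Sum>a\<in>units_upto q. g q a ^ 5 * ee (- (real a * real n / real q)))" for q
  proof -
    have set: "{a. a \<in> {1..q} \<and> coprime a q} = units_upto q" by (auto simp: units_upto_def)
    have "e (- (of_nat a * of_nat n / of_nat q)) = ee (- (real a * real n / real q))" for a
      using e_of_real[of "- (real a * real n / real q)"] by simp
    then show ?thesis unfolding singular_series_term_def set by (simp add: g_def divide_inverse mult.commute)
  qed
  have JS: "of_real (sing_integral n) * S = (\<Sum>q=1..P. \<Sum>a\<in>units_upto q. g q a ^ 5 * (of_real (sing_integral n) * ee (- (real a * real n / real q))))"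
    unfolding S_def sst by (simp add: sum_distrib_left mult_ac)
  have "norm (hat ?M (\<lambda>j. major_model P j ^ 5) (int n) - of_real (sing_integral n) * S)
     = norm (\<Sum>q=1..P. \<Sum>a\<in>units_upto q. g q a ^ 5 * (I q a - of_real (sing_integral n) * ee (- (real a * real n / real q))))"
    unfolding hat JS by (simp add: sum_subtractf right_diff_distrib)
  also have "\<dots> \<le> (\<Sum>q=1..P. \<Sum>a\<in>units_upto q. \<kappa> q ^ 5 * (252 * real q powr (1/3) * real P powr (5/3)))"
  proof (intro sum_norm_le)
    fix q a assume q: "q \<in> {1..P}" and a: "a \<in> units_upto q"
    have "norm (g q a) ^ 5 \<le> \<kappa> q ^ 5"
      unfolding g_def using q a by (intro power_mono gauss_majorantD(5)[OF gm]) (auto simp: units_upto_def)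
    then show "norm (g q a ^ 5 * (I q a - of_real (sing_integral n) * ee (- (real a * real n / real q)))) \<le> \<kappa> q ^ 5 * (252 * real q powr (1/3) * real P powr (5/3))"
      unfolding norm_mult norm_power I_def using q n gauss_majorantD(1)[OF gm, of q] by (intro mult_mono arc_integral P) auto
  qed
  also have "\<dots> \<le> (\<Sum>q=1..P. 252 * real P powr (7/4) * (real q powr (5/4) * \<kappa> q ^ 5))"
  proof (rule sum_mono)
    fix q assume q: "q \<in> {1..P}"
    \<comment> \<open>The weight q powr (4/3) exceeds the available q powr (5/4) by q powr (1/12) <=
      P powr (1/12), which raises P powr (5/3) to P powr (7/4).\<close>
    have "real q * real q powr (1/3) = real q powr (5/4) * real q powr (1/12)"
      using powr_add[of "real q" 1 "1/3"] powr_add[of "real q" "5/4" "1/12"] by simp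
    also have "\<dots> \<le> real q powr (5/4) * real P powr (1/12)" using q by (intro mult_left_mono powr_mono2) auto
    finally have 1: "real q * real q powr (1/3) \<le> real q powr (5/4) * real P powr (1/12)" .
    have "(\<Sum>a\<in>units_upto q. \<kappa> q ^ 5 * (252 * real q powr (1/3) * real P powr (5/3))) = real (card (units_upto q)) * (\<kappa> q ^ 5 * (252 * real q powr (1/3) * real P powr (5/3)))" by simp
    also have "\<dots> \<le> real q * (\<kappa> q ^ 5 * (252 * real q powr (1/3) * real P powr (5/3)))"
      using card_units_upto_le[of q] gauss_majorantD(1)[OF gm, of q] by (intro mult_right_mono) auto
    also have "\<dots> = (real q * real q powr (1/3)) * (\<kappa> q ^ 5 * 252 * real P powr (5/3))" by simp
    also have "\<dots> \<le> (real q powr (5/4) * real P powr (1/12)) * (\<kappa> q ^ 5 * 252 * real P powr (5/3))"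
      using 1 gauss_majorantD(1)[OF gm, of q] by (intro mult_right_mono) auto
    also have "\<dots> = 252 * (real P powr (1/12) * real P powr (5/3)) * (real q powr (5/4) * \<kappa> q ^ 5)" by simp
    also have "real P powr (1/12) * real P powr (5/3) = real P powr (7/4)" using powr_add[of "real P" "1/12" "5/3"] by simp
    finally show "(\<Sum>a\<in>units_upto q. \<kappa> q ^ 5 * (252 * real q powr (1/3) * real P powr (5/3))) \<le> 252 * real P powr (7/4) * (real q powr (5/4) * \<kappa> q ^ 5)" .
  qed
  also have "\<dots> \<le> 252 * real P powr (7/4) * C"
    unfolding sum_distrib_left[symmetric] by (intro mult_left_mono gauss_majorantD(3)[OF gm]) auto
  finally have e1: "norm (hat ?M (\<lambda>j. major_model P j ^ 5) (int n) - of_real (sing_integral n) * S) \<le> 252 * C * real P powr (7/4)" by (simp add: mult_ac)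
  have P74: "1 \<le> real P powr (7/4)" using P by (simp add: ge_one_powr_ge_zero)
  have nP: "real n powr (2/3) \<le> (real P)\<^sup>2"
  proof -
    have "real n \<le> real (P ^ 3)" using n(2) by (rule of_nat_mono)
    then have "real n powr (2/3) \<le> (real P ^ 3) powr (2/3)" by (intro powr_mono2) auto
    also have "\<dots> = ((real P ^ 3) powr (1/3)) powr 2" by (simp only: powr_powr) simp
    also have "\<dots> = (real P)\<^sup>2" using P by simp
    finally show ?thesis .
  qed
  have Jd: "\<bar>sing_integral n - c0 * real n powr (2/3)\<bar> \<le> c0"
  proof -
    have "sing_integral n - c0 * real n powr (2/3) = Gamma (4/3) ^ 5 * (neg_binom (5/3) n - real n powr (2/3) / Gamma (5/3))"
      by (simp add: sing_integral_def c0_def right_diff_distrib)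
    then have "\<bar>sing_integral n - c0 * real n powr (2/3)\<bar> = Gamma (4/3) ^ 5 * \<bar>neg_binom (5/3) n - real n powr (2/3) / Gamma (5/3)\<bar>"
      using Gamma_four_thirds(1) by (simp add: abs_mult)
    also have "\<dots> \<le> Gamma (4/3) ^ 5 * (1 / Gamma (5/3))"
      using Gamma_four_thirds by (intro mult_left_mono neg_binom_five_thirds_approx n) auto
    finally show ?thesis by (simp add: c0_def)
  qed
  have J: "\<bar>sing_integral n\<bar> \<le> 2 * c0 * (real P)\<^sup>2"
  proof -
    have "\<bar>sing_integral n\<bar> \<le> c0 * real n powr (2/3) + c0" 
    proof -
      have "0 \<le> c0 * real n powr (2/3)" using c0(1) by simp
      then show ?thesis using Jd by linarith
    qed
    also have "\<dots> \<le> c0 * (real P)\<^sup>2 + c0 * (real P)\<^sup>2"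
      using c0(1) nP one_le_power[of "real P" 2] P mult_left_mono[of 1 "(real P)\<^sup>2" c0] by (intro add_mono mult_left_mono) auto
    finally show ?thesis by simp
  qed
  have "norm (of_real (sing_integral n) * S - of_real (sing_integral n) * singular_series 5 3 n) \<le> (2 * c0 * (real P)\<^sup>2) * (C * real P powr (-1/4))"
    unfolding right_diff_distrib[symmetric] norm_mult norm_of_real
    using J singular_series_bounds(2)[OF gm P, of n] c0 by (intro mult_mono) (auto simp: S_def norm_minus_commute)
  also have "\<dots> = 2 * c0 * C * ((real P)\<^sup>2 * real P powr (-1/4))" by simp
  also have "(real P)\<^sup>2 * real P powr (-1/4) = real P powr (7/4)"
  proof -
    have "(real P)\<^sup>2 = real P powr 2" by (rule powr_numeral[symmetric]) simp
    then show ?thesis by (simp only: powr_add[symmetric]) simp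
  qed
  finally have e2: "norm (of_real (sing_integral n) * S - of_real (sing_integral n) * singular_series 5 3 n) \<le> 2 * c0 * C * real P powr (7/4)" .
  have "norm (of_real (sing_integral n) * singular_series 5 3 n - of_real c0 * singular_series 5 3 n * of_real (real n powr (2/3)))
     = \<bar>sing_integral n - c0 * real n powr (2/3)\<bar> * norm (singular_series 5 3 n)"
  proof -
    have "of_real (sing_integral n) * singular_series 5 3 n - of_real c0 * singular_series 5 3 n * of_real (real n powr (2/3))
       = of_real (sing_integral n - c0 * real n powr (2/3)) * singular_series 5 3 n" by (simp add: algebra_simps)
    then show ?thesis by (simp only: norm_mult norm_of_real)
  qed
  also have "\<dots> \<le> c0 * C" using Jd singular_series_bounds(1)[OF gm P, of n] c0 by (intro mult_mono) auto
  also have "\<dots> \<le> c0 * C * real P powr (7/4)" using P74 c0 C0 mult_left_mono[of 1 "real P powr (7/4)" "c0 * C"] by simp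
  finally have e3: "norm (of_real (sing_integral n) * singular_series 5 3 n - of_real c0 * singular_series 5 3 n * of_real (real n powr (2/3))) \<le> c0 * C * real P powr (7/4)" .
  have "norm (hat ?M (\<lambda>j. major_model P j ^ 5) (int n) - of_real c0 * singular_series 5 3 n * of_real (real n powr (2/3)))
     \<le> 252 * C * real P powr (7/4) + 2 * c0 * C * real P powr (7/4) + c0 * C * real P powr (7/4)"
    using e1 e2 e3 by (intro norm_diff_triangle_le[of _ "of_real (sing_integral n) * singular_series 5 3 n"] norm_diff_triangle_le[of _ "of_real (sing_integral n) * S"])
  also have "\<dots> = C * (252 + 3 * c0) * real P powr (7/4)" by (simp add: algebra_simps)
  also have "\<dots> \<le> C * (252 + 3 / Gamma (5/3)) * real P powr (7/4)"
    using c0 C0 by (intro mult_right_mono mult_left_mono add_left_mono) auto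
  finally show ?thesis by (simp only: c0_def)
qed

section \<open>The third moment\<close>

definition fourth_powers :: "nat \<Rightarrow> nat \<Rightarrow> real" where
  "fourth_powers P j = norm (cubesum P j) ^ 4 + norm (major_model P j) ^ 4"

definition fifth_diff :: "nat \<Rightarrow> nat \<Rightarrow> complex" where
  "fifth_diff P j = cubesum P j ^ 5 - major_model P j ^ 5"

definition approx_bound :: "nat \<Rightarrow> real \<Rightarrow> real" where
  "approx_bound P D = 1400 * D\<^sup>2 * real P powr (3/4)"

lemma approx_bound_pos: "tame P D \<Longrightarrow> approx_bound P D > 0"
  by (auto simp: tame_def approx_bound_def)

lemma norm_power_product_le: "norm x ^ i * norm y ^ (4 - i) \<le> norm x ^ 4 + norm y ^ 4" if "i \<le> 4" for x y :: complex
proof -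
  define m where "m = max (norm x) (norm y)"
  have "norm x ^ i * norm y ^ (4 - i) \<le> m ^ i * m ^ (4 - i)"
    by (intro mult_mono power_mono) (auto simp: m_def le_max_iff_disj)
  also have "\<dots> = m ^ 4" using that by (simp flip: power_add)
  also have "\<dots> \<le> norm x ^ 4 + norm y ^ 4" by (simp add: m_def max_def)
  finally show ?thesis .
qed

text \<open>Factor x^5 - y^5: the difference x - y is at most B, and each of the five monomials of
  degree 4 is at most |x|^4 + |y|^4.\<close>

lemma norm_fifth_diff_le:
  assumes tm: "tame P D" and j: "j < cmod3 P"
  shows "norm (fifth_diff P j) \<le> 5 * approx_bound P D * fourth_powers P j"
proof -
  define x y where "x = cubesum P j" and "y = major_model P j"
  have eq: "x ^ 5 - y ^ 5 = (x - y) * (x ^ 4 * y ^ 0 + x ^ 3 * y ^ 1 + x ^ 2 * y ^ 2 + x ^ 1 * y ^ 3 + x ^ 0 * y ^ 4)"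
    by (simp add: eval_nat_numeral algebra_simps)
  have b: "norm (x ^ i * y ^ (4 - i)) \<le> norm x ^ 4 + norm y ^ 4" if "i \<le> 4" for i
    using norm_power_product_le[OF that, of x y] by (simp add: norm_mult norm_power)
  have "norm (x ^ 4 * y ^ 0 + x ^ 3 * y ^ 1 + x ^ 2 * y ^ 2 + x ^ 1 * y ^ 3 + x ^ 0 * y ^ 4) \<le> 5 * (norm x ^ 4 + norm y ^ 4)"
  proof -
    have "norm (x ^ 4 * y ^ 0 + x ^ 3 * y ^ 1 + x ^ 2 * y ^ 2 + x ^ 1 * y ^ 3 + x ^ 0 * y ^ 4)
      \<le> norm (x ^ 4 * y ^ 0) + norm (x ^ 3 * y ^ 1) + norm (x ^ 2 * y ^ 2) + norm (x ^ 1 * y ^ 3) + norm (x ^ 0 * y ^ 4)"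
      by (intro order_trans[OF norm_triangle_ineq] add_mono order_refl)
    also have "\<dots> \<le> 5 * (norm x ^ 4 + norm y ^ 4)"
      using b[of 4] b[of 3] b[of 2] b[of 1] b[of 0] by simp
    finally show ?thesis .
  qed
  moreover have "norm (x - y) \<le> approx_bound P D"
    unfolding x_def y_def approx_bound_def by (rule norm_cubesum_minus_major_model_le[OF tm j])
  ultimately have "norm (x ^ 5 - y ^ 5) \<le> approx_bound P D * (5 * (norm x ^ 4 + norm y ^ 4))"
    unfolding eq norm_mult using approx_bound_pos[OF tm] by (intro mult_mono) auto
  then show ?thesis by (simp add: fifth_diff_def fourth_powers_def x_def y_def algebra_simps)
qed

definition fourth_majorant :: "nat \<Rightarrow> real \<Rightarrow> nat \<Rightarrow> real" where
  "fourth_majorant P D j = 17 * norm (major_model P j) ^ 4 + 4 * (approx_bound P D)\<^sup>2 * (norm (cubesum P j))\<^sup>2"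

text \<open>Either |f| <= 2 |V| and |f|^4 <= 16 |V|^4, or |V| < |f|/2, so that |f| <= 2 B and two
  factors of |f|^4 may be replaced by 2 B. The gain is that |f|^2 has far smaller Fourier
  coefficients than |f|^4.\<close>

lemma fourth_powers_le_fourth_majorant:
  assumes tm: "tame P D" and j: "j < cmod3 P"
  shows "fourth_powers P j \<le> fourth_majorant P D j"
proof -
  define x y where "x = norm (cubesum P j)" and "y = norm (major_model P j)"
  have xy: "0 \<le> x" "0 \<le> y" by (auto simp: x_def y_def)
  have d: "x \<le> y + approx_bound P D"
    using norm_cubesum_minus_major_model_le[OF tm j] norm_triangle_ineq2[of "cubesum P j" "major_model P j"] by (simp add: x_def y_def approx_bound_def)
  have "x ^ 4 \<le> 16 * y ^ 4 + 4 * (approx_bound P D)\<^sup>2 * x\<^sup>2"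
  proof (cases "x \<le> 2 * y")
    case True
    then have "x ^ 4 \<le> (2 * y) ^ 4" using xy by (intro power_mono) auto
    moreover have "0 \<le> 4 * (approx_bound P D)\<^sup>2 * x\<^sup>2" by simp
    moreover have "(2 * y) ^ 4 = 16 * y ^ 4" by (simp add: power_mult_distrib)
    ultimately show ?thesis by linarith
  next
    case False
    then have "x \<le> 2 * approx_bound P D" using d by linarith
    then have "x\<^sup>2 * x\<^sup>2 \<le> (2 * approx_bound P D)\<^sup>2 * x\<^sup>2" using xy by (intro mult_right_mono power_mono) auto
    moreover have "0 \<le> 16 * y ^ 4" by simp
    moreover have "x\<^sup>2 * x\<^sup>2 = x ^ 4" "(2 * approx_bound P D)\<^sup>2 * x\<^sup>2 = 4 * (approx_bound P D)\<^sup>2 * x\<^sup>2" by (simp_all add: power_mult_distrib flip: power_add)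
    ultimately show ?thesis by linarith
  qed
  then show ?thesis by (simp add: fourth_powers_def fourth_majorant_def x_def y_def)
qed

lemma fourth_powers_nonneg: "0 \<le> fourth_powers P j"
  by (simp add: fourth_powers_def)

text \<open>X collects the constants and is at least 1 as well as C, so that every bound takes the
  form of a number times powers of X, D and P.\<close>

locale five_cubes_setup =
  fixes P :: nat and D :: real and \<kappa> :: "nat \<Rightarrow> real" and C X :: real
  assumes tm: "tame P D" and gm: "gauss_majorant \<kappa> C" and X: "C + 1 \<le> X"
begin

abbreviation "M \<equiv> cmod3 P"
abbreviation "B \<equiv> approx_bound P D"

lemma parameter_bounds: "P \<ge> 1" "D \<ge> 1" "M > 0" "C \<ge> 0" "X \<ge> 1" "B > 0"
  using tm gauss_majorantD(4)[OF gm] X cmod3_pos[of P] approx_bound_pos[OF tm] by (auto simp: tame_def)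

definition square_bound :: real where "square_bound = 16000 * X * D\<^sup>2 * real P ^ 5"

definition model4_bound :: real where "model4_bound = 6 * X * real P powr (3/2)"

lemma one_le_D2: "1 \<le> D\<^sup>2"
  using parameter_bounds by (intro one_le_power)

lemma mean_vstar4: "(\<Sum>j<M. norm (major_model P j) ^ 4) / real M \<le> model4_bound"
proof -
  have "(\<Sum>j<M. norm (major_model P j) ^ 4) / real M \<le> 6 * (C + 1) * real P powr (3/2)"
    by (rule mean_major_model_fourth_le[OF gm parameter_bounds(1)])
  also have "\<dots> \<le> model4_bound" unfolding model4_bound_def using X by (intro mult_right_mono) auto
  finally show ?thesis .
qed

lemma mean_fourth_powers_squared: "(\<Sum>j<M. (fourth_powers P j)\<^sup>2) / real M \<le> square_bound"
proof -
  have "(\<Sum>j<M. (fourth_powers P j)\<^sup>2) \<le> (\<Sum>j<M. 2 * norm (cubesum P j) ^ 8 + 2 * norm (major_model P j) ^ 8)"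
  proof (rule sum_mono)
    fix j
    have "(a + b)\<^sup>2 \<le> 2 * a\<^sup>2 + 2 * b\<^sup>2" for a b :: real
      using sum_squares_ge_zero[of "a - b" 0] by (simp add: power2_eq_square algebra_simps)
    from this[of "norm (cubesum P j) ^ 4" "norm (major_model P j) ^ 4"]
    show "(fourth_powers P j)\<^sup>2 \<le> 2 * norm (cubesum P j) ^ 8 + 2 * norm (major_model P j) ^ 8"
      by (simp add: fourth_powers_def flip: power_mult)
  qed
  then have "(\<Sum>j<M. (fourth_powers P j)\<^sup>2) / real M \<le> (\<Sum>j<M. 2 * norm (cubesum P j) ^ 8 + 2 * norm (major_model P j) ^ 8) / real M"
    by (rule divide_right_mono) simp
  also have "\<dots> = 2 * ((\<Sum>j<M. norm (cubesum P j) ^ 8) / real M) + 2 * ((\<Sum>j<M. norm (major_model P j) ^ (4 + 4)) / real M)"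
    by (simp add: sum.distrib sum_distrib_left add_divide_distrib)
  also have "\<dots> \<le> 2 * (20 * D\<^sup>2 * real P ^ 5) + 2 * (C * (6 * real P) ^ Suc 4)"
    by (intro add_mono mult_left_mono hua_eighth_moment[OF tm] mean_major_model_higher_le[OF gm parameter_bounds(1)]) auto
  also have "\<dots> = 40 * (D\<^sup>2 * real P ^ 5) + 15552 * (C * real P ^ 5)" by (simp add: power_mult_distrib)
  also have "\<dots> \<le> 40 * (X * (D\<^sup>2 * real P ^ 5)) + 15552 * (X * (D\<^sup>2 * real P ^ 5))"
  proof (intro add_mono mult_left_mono)
    show "D\<^sup>2 * real P ^ 5 \<le> X * (D\<^sup>2 * real P ^ 5)"
      using parameter_bounds mult_right_mono[of 1 X "D\<^sup>2 * real P ^ 5"] by simp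
    have "C * real P ^ 5 \<le> X * (1 * real P ^ 5)" using X parameter_bounds by (simp add: mult_right_mono)
    also have "\<dots> \<le> X * (D\<^sup>2 * real P ^ 5)" using one_le_D2 parameter_bounds by (intro mult_left_mono mult_right_mono) auto
    finally show "C * real P ^ 5 \<le> X * (D\<^sup>2 * real P ^ 5)" .
  qed auto
  also have "\<dots> \<le> square_bound" using parameter_bounds by (simp add: square_bound_def mult_ac)
  finally show ?thesis .
qed

lemma mean_fourth_powers: "(\<Sum>j<M. fourth_powers P j) / real M \<le> 8 * X * D * (real P)\<^sup>2"
proof -
  have "(\<Sum>j<M. fourth_powers P j) / real M = (\<Sum>j<M. norm (cubesum P j) ^ 4) / real M + (\<Sum>j<M. norm (major_model P j) ^ 4) / real M"
    by (simp add: fourth_powers_def sum.distrib add_divide_distrib)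
  also have "\<dots> \<le> 2 * D * (real P)\<^sup>2 + model4_bound" by (intro add_mono fourth_moment[OF tm] mean_vstar4)
  also have "model4_bound \<le> 6 * X * (real P)\<^sup>2"
  proof -
    have "real P powr (3/2) \<le> real P powr 2" using parameter_bounds by (intro powr_mono) auto
    then show ?thesis using parameter_bounds by (simp add: model4_bound_def)
  qed
  also have "2 * D * (real P)\<^sup>2 + 6 * X * (real P)\<^sup>2 \<le> 2 * (X * D) * (real P)\<^sup>2 + 6 * (X * D) * (real P)\<^sup>2"
    using parameter_bounds mult_right_mono[of 1 X D] mult_left_mono[of 1 D X] by (intro add_mono mult_right_mono mult_left_mono) auto
  finally show ?thesis by (simp add: mult_ac)
qed

definition triple_bound :: real where "triple_bound = 2 * 10 ^ 11 * X\<^sup>2 * D ^ 7 * real P powr (13/2)"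

lemma B_squared: "B\<^sup>2 = 1960000 * D ^ 4 * real P powr (3/2)"
proof -
  have "(real P powr (3/4))\<^sup>2 = real P powr (3/2)" using parameter_bounds by (simp add: powr_power)
  then show ?thesis by (simp add: approx_bound_def power_mult_distrib flip: power_mult)
qed

text \<open>Everything is of size P powr (3/2) up to powers of D, except at multiples of M, where
  |f|^2 has a coefficient of size up to P.\<close>

lemma norm_hat_fourth_majorant_le:
  "norm (hat M (\<lambda>j. of_real (fourth_majorant P D j)) n) \<le> (17 * model4_bound + 4 * B\<^sup>2 * D) + (if int M dvd n then 4 * B\<^sup>2 * real (cdiff P n) else 0)"
proof -
  have "hat M (\<lambda>j. of_real (fourth_majorant P D j)) n = 17 * hat M (\<lambda>j. of_real (norm (major_model P j) ^ 4)) n + of_real (4 * B\<^sup>2) * hat M (\<lambda>j. of_real ((norm (cubesum P j))\<^sup>2)) n"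
    unfolding hat_def fourth_majorant_def by (simp add: sum.distrib sum_distrib_left add_divide_distrib algebra_simps)
  also have "norm \<dots> \<le> 17 * norm (hat M (\<lambda>j. of_real (norm (major_model P j) ^ 4)) n) + 4 * B\<^sup>2 * real (cdiff P n)"
    unfolding hat_norm_cubesum_squared[OF parameter_bounds(1)] by (rule order_trans[OF norm_triangle_ineq]) (simp add: norm_mult norm_power)
  also have "norm (hat M (\<lambda>j. of_real (norm (major_model P j) ^ 4)) n) \<le> model4_bound"
    by (rule order_trans[OF norm_hat_le]) (use mean_vstar4 in \<open>simp add: norm_power\<close>)
  also have "4 * B\<^sup>2 * real (cdiff P n) \<le> 4 * B\<^sup>2 * D + (if int M dvd n then 4 * B\<^sup>2 * real (cdiff P n) else 0)"
    using cdiff_le[OF tm, of n] parameter_bounds by (auto intro!: mult_left_mono)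
  finally show ?thesis by simp
qed

text \<open>One of the three factors is replaced by its majorant \<open>fourth_majorant\<close>, whose Fourier coefficients are small
  away from \<open>0\<close>; the other two are then estimated in mean square.\<close>

lemma triple_correlation_le:
  "(\<Sum>i<M. \<Sum>j<M. fourth_powers P i * fourth_powers P j * fourth_powers P ((2 * M - i - j) mod M)) / (real M)\<^sup>2 \<le> triple_bound"
proof -
  let ?U = "\<lambda>j. complex_of_real (fourth_powers P j)" and ?Y = "\<lambda>j. complex_of_real (fourth_majorant P D j)"
  define p where "p = real P"
  have p: "p \<ge> 1" using parameter_bounds by (simp add: p_def)
  have "(\<Sum>i<M. \<Sum>j<M. fourth_powers P i * fourth_powers P j * fourth_powers P ((2 * M - i - j) mod M)) / (real M)\<^sup>2
     \<le> (\<Sum>i<M. \<Sum>j<M. fourth_powers P i * fourth_powers P j * fourth_majorant P D ((2 * M - i - j) mod M)) / (real M)\<^sup>2"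
    using parameter_bounds by (intro divide_right_mono sum_mono mult_left_mono fourth_powers_le_fourth_majorant[OF tm] mult_nonneg_nonneg fourth_powers_nonneg) auto
  also have "\<dots> = norm ((\<Sum>i<M. \<Sum>j<M. ?U i * ?U j * ?Y ((2 * M - i - j) mod M)) / (of_nat M)\<^sup>2)"
  proof -
    have "0 \<le> (\<Sum>i<M. \<Sum>j<M. fourth_powers P i * fourth_powers P j * fourth_majorant P D ((2 * M - i - j) mod M))"
      by (intro sum_nonneg mult_nonneg_nonneg fourth_powers_nonneg) (simp add: fourth_majorant_def)
    moreover have "(\<Sum>i<M. \<Sum>j<M. ?U i * ?U j * ?Y ((2 * M - i - j) mod M)) = of_real (\<Sum>i<M. \<Sum>j<M. fourth_powers P i * fourth_powers P j * fourth_majorant P D ((2 * M - i - j) mod M))"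
      by simp
    ultimately show ?thesis by (simp only: norm_divide norm_power norm_of_nat norm_of_real abs_of_nonneg)
  qed
  also have "\<dots> = norm (\<Sum>n<M. hat M ?U (int n) * hat M ?U (int n) * hat M ?Y (int n))"
    by (subst hat_triple[OF parameter_bounds(3)]) simp
  also have "\<dots> \<le> (\<Sum>n<M. (norm (hat M ?U (int n)))\<^sup>2 * norm (hat M ?Y (int n)))"
    by (rule sum_norm_le) (simp add: norm_mult power2_eq_square)
  also have "\<dots> \<le> (\<Sum>n<M. (norm (hat M ?U (int n)))\<^sup>2 * (17 * model4_bound + 4 * B\<^sup>2 * D) + (if n = 0 then (norm (hat M ?U 0))\<^sup>2 * (4 * B\<^sup>2 * p) else 0))"
  proof (rule sum_mono)
    fix n assume n: "n \<in> {..<M}"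
    have dv: "int M dvd int n \<longleftrightarrow> n = 0" using n by (auto dest: nat_dvd_not_less)
    have "(norm (hat M ?U (int n)))\<^sup>2 * norm (hat M ?Y (int n)) \<le> (norm (hat M ?U (int n)))\<^sup>2 * ((17 * model4_bound + 4 * B\<^sup>2 * D) + (if n = 0 then 4 * B\<^sup>2 * p else 0))"
    proof (intro mult_left_mono order_trans[OF norm_hat_fourth_majorant_le] add_left_mono)
      show "(if int M dvd int n then 4 * B\<^sup>2 * real (cdiff P (int n)) else 0) \<le> (if n = 0 then 4 * B\<^sup>2 * p else 0)"
        unfolding dv using cdiff_0_le[of P] by (auto simp: p_def intro!: mult_left_mono)
    qed simp
    then show "(norm (hat M ?U (int n)))\<^sup>2 * norm (hat M ?Y (int n)) \<le> (norm (hat M ?U (int n)))\<^sup>2 * (17 * model4_bound + 4 * B\<^sup>2 * D) + (if n = 0 then (norm (hat M ?U 0))\<^sup>2 * (4 * B\<^sup>2 * p) else 0)"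
      by (cases "n = 0") (simp_all add: distrib_left)
  qed
  also have "\<dots> = (\<Sum>n<M. (norm (hat M ?U (int n)))\<^sup>2) * (17 * model4_bound + 4 * B\<^sup>2 * D) + (norm (hat M ?U 0))\<^sup>2 * (4 * B\<^sup>2 * p)"
    using parameter_bounds by (simp add: sum.distrib sum_distrib_right)
  also have "(\<Sum>n<M. (norm (hat M ?U (int n)))\<^sup>2) = (\<Sum>j<M. (fourth_powers P j)\<^sup>2) / real M"
    by (subst hat_parseval[OF parameter_bounds(3)]) simp
  finally have main: "(\<Sum>i<M. \<Sum>j<M. fourth_powers P i * fourth_powers P j * fourth_powers P ((2 * M - i - j) mod M)) / (real M)\<^sup>2
    \<le> (\<Sum>j<M. (fourth_powers P j)\<^sup>2) / real M * (17 * model4_bound + 4 * B\<^sup>2 * D) + (norm (hat M ?U 0))\<^sup>2 * (4 * B\<^sup>2 * p)" .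
  \<comment> \<open>At 0 the contribution is P^4 * P powr (3/2) * P, the same power P powr (13/2) as
    P^5 * P powr (3/2) from the other coefficients.\<close>
  have "(norm (hat M ?U 0))\<^sup>2 \<le> (8 * X * D * p\<^sup>2)\<^sup>2"
  proof (rule power_mono)
    show "norm (hat M ?U 0) \<le> 8 * X * D * p\<^sup>2"
      unfolding p_def by (rule order_trans[OF norm_hat_le]) (use mean_fourth_powers fourth_powers_nonneg in simp)
  qed simp
  then have 1: "(norm (hat M ?U 0))\<^sup>2 * (4 * B\<^sup>2 * p) \<le> (8 * X * D * p\<^sup>2)\<^sup>2 * (4 * B\<^sup>2 * p)"
    using p by (intro mult_right_mono) auto
  have 2: "(\<Sum>j<M. (fourth_powers P j)\<^sup>2) / real M * (17 * model4_bound + 4 * B\<^sup>2 * D) \<le> square_bound * (17 * model4_bound + 4 * B\<^sup>2 * D)"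
    using mean_fourth_powers_squared parameter_bounds by (intro mult_right_mono) (auto simp: model4_bound_def)
  have "17 * model4_bound + 4 * B\<^sup>2 * D \<le> 8000000 * (X * D ^ 5 * p powr (3/2))"
  proof -
    have d: "1 \<le> D ^ 5" using parameter_bounds by (intro one_le_power)
    have "X * 1 * p powr (3/2) \<le> X * D ^ 5 * p powr (3/2)" using d parameter_bounds by (intro mult_right_mono mult_left_mono) auto
    moreover have "1 * (D ^ 5 * p powr (3/2)) \<le> X * (D ^ 5 * p powr (3/2))" using parameter_bounds by (intro mult_right_mono) auto
    moreover have "17 * model4_bound = 102 * (X * 1 * p powr (3/2))" by (simp add: model4_bound_def p_def)
    moreover have "4 * B\<^sup>2 * D = 7840000 * (1 * (D ^ 5 * p powr (3/2)))" unfolding B_squared by (simp add: p_def eval_nat_numeral mult_ac)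
    moreover have "0 \<le> X * D ^ 5 * p powr (3/2)" using parameter_bounds by simp
    ultimately show ?thesis by (simp only: mult.assoc)
  qed
  then have "square_bound * (17 * model4_bound + 4 * B\<^sup>2 * D) \<le> square_bound * (8000000 * (X * D ^ 5 * p powr (3/2)))"
    using parameter_bounds by (intro mult_left_mono) (auto simp: square_bound_def)
  then have "(\<Sum>i<M. \<Sum>j<M. fourth_powers P i * fourth_powers P j * fourth_powers P ((2 * M - i - j) mod M)) / (real M)\<^sup>2
    \<le> square_bound * (8000000 * (X * D ^ 5 * p powr (3/2))) + (8 * X * D * p\<^sup>2)\<^sup>2 * (4 * B\<^sup>2 * p)"
    using main 1 2 by linarith
  also have "square_bound * (8000000 * (X * D ^ 5 * p powr (3/2))) + (8 * X * D * p\<^sup>2)\<^sup>2 * (4 * B\<^sup>2 * p)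
     = 128000000000 * (X\<^sup>2 * D ^ 7 * (p ^ 5 * p powr (3/2))) + 501760000 * (X\<^sup>2 * D ^ 6 * (p ^ 5 * p powr (3/2)))"
    unfolding B_squared square_bound_def by (simp add: p_def power_mult_distrib eval_nat_numeral mult_ac)
  also have "p ^ 5 * p powr (3/2) = p powr (13/2)"
  proof -
    have "p ^ 5 = p powr 5" using p by simp
    then show ?thesis by (simp only: powr_add[symmetric]) simp
  qed
  also have "128000000000 * (X\<^sup>2 * D ^ 7 * p powr (13/2)) + 501760000 * (X\<^sup>2 * D ^ 6 * p powr (13/2)) \<le> triple_bound"
  proof -
    have "D ^ 6 \<le> D ^ 7" using parameter_bounds by (intro power_increasing) auto
    then have "X\<^sup>2 * D ^ 6 * p powr (13/2) \<le> X\<^sup>2 * D ^ 7 * p powr (13/2)" by (intro mult_right_mono mult_left_mono) auto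
    moreover have "0 \<le> X\<^sup>2 * D ^ 7 * p powr (13/2)" using parameter_bounds by simp
    moreover have "triple_bound = 200000000000 * (X\<^sup>2 * D ^ 7 * p powr (13/2))" by (simp add: triple_bound_def p_def)
    ultimately show ?thesis by linarith
  qed
  finally show ?thesis .
qed

section \<open>Representation numbers as Fourier coefficients\<close>

definition r4 :: "nat \<Rightarrow> nat" where
  "r4 m = card {xs \<in> tuples 4 {1..P}. (\<Sum>x\<leftarrow>xs. x ^ 3) = m}"

definition r5 :: "nat \<Rightarrow> nat" where
  "r5 m = card {xs \<in> tuples 5 {1..P}. (\<Sum>x\<leftarrow>xs. x ^ 3) = m}"

lemma sum_cubes_bound: "xs \<in> tuples s {1..P} \<Longrightarrow> (\<Sum>x\<leftarrow>xs. x ^ 3) \<le> s * P ^ 3"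
proof -
  assume "xs \<in> tuples s {1..P}"
  then have "length xs = s" "\<forall>x\<in>set xs. x \<le> P" by (auto simp: tuples_def)
  then show ?thesis
  proof (induction xs arbitrary: s)
    case (Cons x xs)
    then have "x ^ 3 \<le> P ^ 3" and "(\<Sum>x\<leftarrow>xs. x ^ 3) \<le> length xs * P ^ 3" by (simp_all add: power_mono)
    then have "x ^ 3 + (\<Sum>x\<leftarrow>xs. x ^ 3) \<le> P ^ 3 + length xs * P ^ 3" by (rule add_mono)
    moreover have "s * P ^ 3 = P ^ 3 + length xs * P ^ 3" using Cons.prems(1) by auto
    ultimately show ?case by simp
  qed simp
qed

text \<open>A sum of at most five cubes up to P^3 is below the modulus, so counting modulo M is
  exact counting.\<close>

lemma hat_cubesum_power_eq:
  assumes "s \<le> 5" "n < M"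
  shows "hat M (\<lambda>j. cubesum P j ^ s) (int n) = of_nat (card {xs \<in> tuples s {1..P}. (\<Sum>x\<leftarrow>xs. x ^ 3) = n})"
proof -
  have "int M dvd int (\<Sum>x\<leftarrow>xs. x ^ 3) - int n \<longleftrightarrow> (\<Sum>x\<leftarrow>xs. x ^ 3) = n" if "xs \<in> tuples s {1..P}" for xs
  proof
    have "(\<Sum>x\<leftarrow>xs. x ^ 3) \<le> s * P ^ 3" by (rule sum_cubes_bound[OF that])
    also have "\<dots> < M" using assms parameter_bounds(1) by (simp add: cmod3_def)
    finally have lt: "(\<Sum>x\<leftarrow>xs. x ^ 3) < M" .
    assume "int M dvd int (\<Sum>x\<leftarrow>xs. x ^ 3) - int n"
    then have "int (\<Sum>x\<leftarrow>xs. x ^ 3) = int n"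
      by (rule eq_if_congruent_small) (use lt assms in linarith)
    then show "(\<Sum>x\<leftarrow>xs. x ^ 3) = n" by (simp only: of_nat_eq_iff)
  qed simp
  then have "{xs \<in> tuples s {1..P}. int M dvd int (\<Sum>x\<leftarrow>xs. x ^ 3) - int n} = {xs \<in> tuples s {1..P}. (\<Sum>x\<leftarrow>xs. x ^ 3) = n}"
    by blast
  then show ?thesis unfolding hat_cubesum_power[OF parameter_bounds(1)] by simp
qed

text \<open>Used twice: with f^4 and K = 1 for the representations by four cubes, and with f^5 - V^5
  and K = 5 B for the remainders.\<close>

lemma sum_hat_cube_le:
  assumes F: "\<And>j. j < M \<Longrightarrow> norm (F j) \<le> K * fourth_powers P j" and K: "K \<ge> 0"
  shows "norm (\<Sum>n<M. hat M F (int n) ^ 3) \<le> K ^ 3 * triple_bound"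
proof -
  let ?S = "\<Sum>i<M. \<Sum>j<M. F i * F j * F ((2 * M - i - j) mod M)"
  let ?T = "\<Sum>i<M. \<Sum>j<M. fourth_powers P i * fourth_powers P j * fourth_powers P ((2 * M - i - j) mod M)"
  have eq: "(\<Sum>n<M. hat M F (int n) ^ 3) = ?S / (of_nat M)\<^sup>2"
    by (subst hat_triple[OF parameter_bounds(3), symmetric]) (simp add: power3_eq_cube)
  have "norm ?S \<le> (\<Sum>i<M. \<Sum>j<M. K ^ 3 * (fourth_powers P i * fourth_powers P j * fourth_powers P ((2 * M - i - j) mod M)))"
  proof (intro sum_norm_le)
    fix i j assume ij: "i \<in> {..<M}" "j \<in> {..<M}"
    have "norm (F i * F j * F ((2 * M - i - j) mod M)) \<le> (K * fourth_powers P i) * (K * fourth_powers P j) * (K * fourth_powers P ((2 * M - i - j) mod M))"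
      unfolding norm_mult using ij parameter_bounds(3) K by (intro mult_mono F mult_nonneg_nonneg fourth_powers_nonneg) auto
    then show "norm (F i * F j * F ((2 * M - i - j) mod M)) \<le> K ^ 3 * (fourth_powers P i * fourth_powers P j * fourth_powers P ((2 * M - i - j) mod M))"
      by (simp add: power3_eq_cube mult_ac)
  qed
  then have S: "norm ?S \<le> K ^ 3 * ?T" by (simp only: sum_distrib_left)
  have "norm (\<Sum>n<M. hat M F (int n) ^ 3) = norm ?S / (real M)\<^sup>2"
    unfolding eq norm_divide norm_power norm_of_nat ..
  moreover have "norm ?S / (real M)\<^sup>2 \<le> K ^ 3 * ?T / (real M)\<^sup>2" by (intro divide_right_mono S) simp
  moreover have "K ^ 3 * (?T / (real M)\<^sup>2) \<le> K ^ 3 * triple_bound" using K by (intro mult_left_mono triple_correlation_le) auto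
  ultimately show ?thesis by simp
qed

lemma sum_r4_cube_le: "(\<Sum>m<M. real (r4 m) ^ 3) \<le> triple_bound"
proof -
  have "norm (\<Sum>n<M. hat M (\<lambda>j. cubesum P j ^ 4) (int n) ^ 3) \<le> 1 ^ 3 * triple_bound"
    by (rule sum_hat_cube_le) (auto simp: fourth_powers_def norm_power)
  moreover have "(\<Sum>n<M. hat M (\<lambda>j. cubesum P j ^ 4) (int n) ^ 3) = of_real (\<Sum>m<M. real (r4 m) ^ 3)"
    by (simp add: hat_cubesum_power_eq r4_def)
  moreover have "0 \<le> (\<Sum>m<M. real (r4 m) ^ 3)" by (intro sum_nonneg) simp
  ultimately show ?thesis by (simp only: norm_of_real abs_of_nonneg) simp
qed

definition \<rho> :: "nat \<Rightarrow> complex" where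
  "\<rho> n = hat M (fifth_diff P) (int n)"

definition model5_bound :: real where "model5_bound = 36 * X * (real P)\<^sup>2"

lemma \<rho>_eq: "n < M \<Longrightarrow> \<rho> n = of_nat (r5 n) - hat M (\<lambda>j. major_model P j ^ 5) (int n)"
  using hat_cubesum_power_eq[of 5 n] unfolding \<rho>_def fifth_diff_def r5_def[symmetric]
  by (simp add: hat_def sum_subtractf left_diff_distrib diff_divide_distrib)

lemma norm_V5_le: "norm (hat M (\<lambda>j. major_model P j ^ 5) n) \<le> model5_bound"
proof -
  have "norm (hat M (\<lambda>j. major_model P j ^ 5) n) \<le> 36 * C * (real P)\<^sup>2" by (rule norm_hat_major_model_fifth_le[OF gm parameter_bounds(1)])
  also have "\<dots> \<le> model5_bound" unfolding model5_bound_def using X by (intro mult_right_mono) auto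
  finally show ?thesis .
qed

end

text \<open>Here \<open>Re z \<ge> - Y\<close> and \<open>|Im z| \<le> Y\<close>, so that \<open>Re z\<close> is within \<open>3 Y\<close> of \<open>norm z\<close>.\<close>

lemma norm_cube_le_Re_cube:
  fixes z v :: complex
  assumes "z + v = of_real R" "R \<ge> 0" "norm v \<le> Y"
  shows "norm z ^ 3 \<le> Re (z ^ 3) + 7 * Y * (norm z)\<^sup>2"
proof -
  define a b where "a = Re z" and "b = Im z"
  have Y: "Y \<ge> 0" using assms(3) norm_ge_zero order_trans by blast
  have "Re z + Re v = R" "Im z + Im v = 0" using assms(1) by (auto simp: complex_eq_iff)
  moreover have "\<bar>Re v\<bar> \<le> Y" "\<bar>Im v\<bar> \<le> Y" using assms(3) abs_Re_le_cmod abs_Im_le_cmod order_trans by blast+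
  ultimately have ab: "a \<ge> - Y" "\<bar>b\<bar> \<le> Y" using assms(2) by (auto simp: a_def b_def)
  have n: "norm z \<le> \<bar>a\<bar> + \<bar>b\<bar>" "\<bar>a\<bar> \<le> norm z" "\<bar>b\<bar> \<le> norm z" "(norm z)\<^sup>2 = a\<^sup>2 + b\<^sup>2"
    by (auto simp: a_def b_def cmod_le abs_Re_le_cmod abs_Im_le_cmod cmod_power2)
  have "Re (z ^ 3) = a * (a\<^sup>2 - 3 * b\<^sup>2)"
    by (simp add: a_def b_def power3_eq_cube power2_eq_square algebra_simps)
  also have "\<dots> = a * (norm z)\<^sup>2 - 4 * (a * b\<^sup>2)" unfolding n(4) by (simp add: algebra_simps)
  finally have Re: "Re (z ^ 3) = a * (norm z)\<^sup>2 - 4 * (a * b\<^sup>2)" .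
  have "norm z - 3 * Y \<le> a" using n(1) ab by linarith
  then have "(norm z - 3 * Y) * (norm z)\<^sup>2 \<le> a * (norm z)\<^sup>2" by (intro mult_right_mono) auto
  then have 1: "norm z ^ 3 - 3 * Y * (norm z)\<^sup>2 \<le> a * (norm z)\<^sup>2" by (simp add: left_diff_distrib power2_eq_square power3_eq_cube)
  have "a * b\<^sup>2 \<le> \<bar>a\<bar> * (\<bar>b\<bar> * \<bar>b\<bar>)" by (simp add: power2_eq_square mult_right_mono)
  also have "\<dots> \<le> norm z * (Y * norm z)" using n ab by (intro mult_mono mult_nonneg_nonneg) auto
  finally have 2: "a * b\<^sup>2 \<le> Y * (norm z)\<^sup>2" by (simp add: power2_eq_square mult_ac)
  show ?thesis using Re 1 2 by linarith
qed

context five_cubes_setup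
begin

text \<open>The main part is B^3 P powr (13/2), with exponent 9/4 + 13/2 = 35/4. Passing from real
  parts to norms costs P^2 times the second moment B^2 P^5, with the smaller exponent 17/2.\<close>

lemma third_moment_\<rho>: "(\<Sum>n<M. norm (\<rho> n) ^ 3) \<le> 10 ^ 24 * X\<^sup>2 * D ^ 13 * real P powr (35/4)"
proof -
  define p where "p = real P"
  have p: "p \<ge> 1" using parameter_bounds by (simp add: p_def)
  have "(\<Sum>n<M. norm (\<rho> n) ^ 3) \<le> (\<Sum>n<M. Re (\<rho> n ^ 3) + 7 * model5_bound * (norm (\<rho> n))\<^sup>2)"
  proof (rule sum_mono)
    fix n assume "n \<in> {..<M}"
    then show "norm (\<rho> n) ^ 3 \<le> Re (\<rho> n ^ 3) + 7 * model5_bound * (norm (\<rho> n))\<^sup>2"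
      by (intro norm_cube_le_Re_cube[OF _ _ norm_V5_le[of "int n"], of _ "real (r5 n)"]) (auto simp: \<rho>_eq)
  qed
  also have "\<dots> = Re (\<Sum>n<M. \<rho> n ^ 3) + 7 * model5_bound * (\<Sum>n<M. (norm (\<rho> n))\<^sup>2)"
    by (simp add: sum.distrib sum_distrib_left Re_sum)
  also have "Re (\<Sum>n<M. \<rho> n ^ 3) \<le> (5 * B) ^ 3 * triple_bound"
  proof (rule order_trans[OF complex_Re_le_cmod])
    show "norm (\<Sum>n<M. \<rho> n ^ 3) \<le> (5 * B) ^ 3 * triple_bound"
      unfolding \<rho>_def by (rule sum_hat_cube_le) (use norm_fifth_diff_le[OF tm] parameter_bounds in auto)
  qed
  also have "(\<Sum>n<M. (norm (\<rho> n))\<^sup>2) \<le> (5 * B)\<^sup>2 * square_bound"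
  proof -
    have "(\<Sum>n<M. (norm (\<rho> n))\<^sup>2) = (\<Sum>j<M. (norm (fifth_diff P j))\<^sup>2) / real M"
      unfolding \<rho>_def by (rule hat_parseval[OF parameter_bounds(3)])
    also have "\<dots> \<le> (\<Sum>j<M. (5 * B)\<^sup>2 * (fourth_powers P j)\<^sup>2) / real M"
      unfolding power_mult_distrib[symmetric] using norm_fifth_diff_le[OF tm] by (intro divide_right_mono sum_mono power_mono) auto
    also have "\<dots> = (5 * B)\<^sup>2 * ((\<Sum>j<M. (fourth_powers P j)\<^sup>2) / real M)" by (simp add: sum_distrib_left)
    also have "\<dots> \<le> (5 * B)\<^sup>2 * square_bound" by (intro mult_left_mono mean_fourth_powers_squared) auto
    finally show ?thesis .
  qed
  finally have "(\<Sum>n<M. norm (\<rho> n) ^ 3) \<le> (5 * B) ^ 3 * triple_bound + 7 * model5_bound * ((5 * B)\<^sup>2 * square_bound)"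
    using parameter_bounds by (simp add: model5_bound_def mult_left_mono)
  also have "(5 * B) ^ 3 * triple_bound = 68600000000000000000000 * (X\<^sup>2 * D ^ 13 * p powr (35/4))"
  proof -
    have "(p powr (3/4)) ^ 3 * p powr (13/2) = p powr (35/4)"
    proof -
      have "(p powr (3/4)) ^ 3 = p powr (9/4)" using p by (simp add: powr_power)
      then show ?thesis by (simp only: powr_add[symmetric]) simp
    qed
    moreover have "(5 * (1400 * d\<^sup>2 * a)) ^ 3 * (2 * 10 ^ 11 * y * d ^ 7 * b) = 68600000000000000000000 * (y * d ^ 13 * (a ^ 3 * b))" for a b d y :: real
    proof -
      have "(d\<^sup>2) ^ 3 * d ^ 7 = d ^ 13" by (simp flip: power_mult power_add)
      moreover have "(5 * (1400 * d\<^sup>2 * a)) ^ 3 * (2 * 10 ^ 11 * y * d ^ 7 * b) = 68600000000000000000000 * (y * ((d\<^sup>2) ^ 3 * d ^ 7) * (a ^ 3 * b))"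
        unfolding power_mult_distrib by simp
      ultimately show ?thesis by simp
    qed
    ultimately show ?thesis unfolding approx_bound_def triple_bound_def p_def by (simp only:)
  qed
  also have "7 * model5_bound * ((5 * B)\<^sup>2 * square_bound) \<le> 200000000000000 * (X\<^sup>2 * D ^ 13 * p powr (35/4))"
  proof -
    have "7 * model5_bound * ((5 * B)\<^sup>2 * square_bound) = 197568000000000 * (X\<^sup>2 * D ^ 6 * (p ^ 7 * p powr (3/2)))"
      unfolding power_mult_distrib B_squared model5_bound_def square_bound_def p_def by (simp add: eval_nat_numeral mult_ac)
    also have "p ^ 7 * p powr (3/2) = p powr (17/2)"
    proof -
      have "p ^ 7 = p powr 7" using p by simp
      then show ?thesis by (simp only: powr_add[symmetric]) simp
    qed
    also have "197568000000000 * (X\<^sup>2 * D ^ 6 * p powr (17/2)) \<le> 200000000000000 * (X\<^sup>2 * D ^ 13 * p powr (35/4))"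
      using parameter_bounds p by (intro mult_mono mult_nonneg_nonneg power_increasing powr_mono) auto
    finally show ?thesis .
  qed
  also have "68600000000000000000000 * (X\<^sup>2 * D ^ 13 * p powr (35/4)) + 200000000000000 * (X\<^sup>2 * D ^ 13 * p powr (35/4))
     \<le> 10 ^ 24 * (X\<^sup>2 * D ^ 13 * p powr (35/4))"
  proof -
    have "0 \<le> X\<^sup>2 * D ^ 13 * p powr (35/4)" using parameter_bounds by simp
    then show ?thesis by simp
  qed
  finally show ?thesis by (simp add: p_def mult.assoc)
qed

lemma waring_count_eq_r5:
  assumes "n \<le> P ^ 3"
  shows "waring_count 5 3 n = r5 n"
proof -
  have "x \<le> P" if "x \<in> set xs" "(\<Sum>x\<leftarrow>xs. x ^ 3) = n" for x and xs :: "nat list"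
  proof -
    have "x ^ 3 \<in> set (map (\<lambda>x. x ^ 3) xs)" using that(1) by simp
    then have "x ^ 3 \<le> (\<Sum>x\<leftarrow>xs. x ^ 3)" by (intro member_le_sum_list) auto
    then have "x ^ 3 \<le> P ^ 3" using that(2) assms by linarith
    then show "x \<le> P" by (simp only: power_mono_iff zero_le zero_less_numeral)
  qed
  then have "{xs :: nat list. length xs = 5 \<and> (\<forall>x\<in>set xs. x > 0) \<and> (\<Sum>x\<leftarrow>xs. x ^ 3) = n} = {xs \<in> tuples 5 {1..P}. (\<Sum>x\<leftarrow>xs. x ^ 3) = n}"
    by (fastforce simp: tuples_def Suc_le_eq)
  then show ?thesis by (simp add: waring_count_def r5_def)
qed

definition main_const :: real where "main_const = X * (252 + 3 / Gamma (5/3))"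

lemma main_const_pos: "main_const > 0"
proof -
  have "Gamma (5/3 :: real) > 0" by (rule Gamma_real_pos) simp
  then show ?thesis using parameter_bounds by (simp add: main_const_def add_pos_pos)
qed

lemma five_cubes_error_le:
  assumes "n \<in> {1..P ^ 3}"
  shows "five_cubes_error n \<le> norm (\<rho> n) + main_const * real P powr (7/4)"
proof -
  have nM: "n < M" using assms by (simp add: cmod3_def)
  have G5: "Gamma (5/3 :: real) > 0" by (rule Gamma_real_pos) simp
  define v m where "v = hat M (\<lambda>j. major_model P j ^ 5) (int n)"
    and "m = of_real (Gamma (4/3) ^ 5 / Gamma (5/3)) * singular_series 5 3 n * of_real (real n powr (2/3))"
  have "five_cubes_error n = norm (\<rho> n + (v - m))"
    using waring_count_eq_r5[of n] assms \<rho>_eq[OF nM] by (simp add: five_cubes_error_def v_def m_def)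
  also have "\<dots> \<le> norm (\<rho> n) + norm (v - m)" by (rule norm_triangle_ineq)
  also have "norm (v - m) \<le> C * (252 + 3 / Gamma (5/3)) * real P powr (7/4)"
    unfolding v_def m_def using assms by (intro main_term[OF gm parameter_bounds(1)]) auto
  also have "\<dots> \<le> main_const * real P powr (7/4)"
    unfolding main_const_def using X G5 by (intro mult_right_mono) auto
  finally show ?thesis by simp
qed

text \<open>The error P powr (7/4) of the main term contributes P^3 * P powr (21/4) = P powr (33/4),
  below P powr (35/4).\<close>

lemma third_moment:
  "(\<Sum>n=1..P ^ 3. five_cubes_error n ^ 3) \<le> (4 * 10 ^ 24 * X\<^sup>2 + 4 * main_const ^ 3) * D ^ 13 * real P powr (35/4)"
proof -
  define p where "p = real P"
  have p: "p \<ge> 1" using parameter_bounds by (simp add: p_def)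
  have cub: "(a + b) ^ 3 \<le> 4 * a ^ 3 + 4 * b ^ 3" if "a \<ge> 0" "b \<ge> 0" for a b :: real
  proof -
    have "4 * a ^ 3 + 4 * b ^ 3 - (a + b) ^ 3 = 3 * ((a + b) * (a - b)\<^sup>2)"
      by (simp add: power2_eq_square power3_eq_cube algebra_simps)
    moreover have "0 \<le> (a + b) * (a - b)\<^sup>2" using that by simp
    ultimately show ?thesis by linarith
  qed
  have main_const: "0 \<le> main_const * p powr (7/4)" using main_const_pos by simp
  have "(\<Sum>n=1..P ^ 3. five_cubes_error n ^ 3) \<le> (\<Sum>n=1..P ^ 3. 4 * norm (\<rho> n) ^ 3 + 4 * (main_const * p powr (7/4)) ^ 3)"
  proof (rule sum_mono)
    fix n assume n: "n \<in> {1..P ^ 3}"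
    have "five_cubes_error n ^ 3 \<le> (norm (\<rho> n) + main_const * p powr (7/4)) ^ 3"
      using five_cubes_error_le[OF n] by (intro power_mono) (auto simp: p_def five_cubes_error_def)
    also have "\<dots> \<le> 4 * norm (\<rho> n) ^ 3 + 4 * (main_const * p powr (7/4)) ^ 3" using main_const by (intro cub) auto
    finally show "five_cubes_error n ^ 3 \<le> 4 * norm (\<rho> n) ^ 3 + 4 * (main_const * p powr (7/4)) ^ 3" .
  qed
  also have "\<dots> = 4 * (\<Sum>n=1..P ^ 3. norm (\<rho> n) ^ 3) + 4 * main_const ^ 3 * (p ^ 3 * (p powr (7/4)) ^ 3)"
    by (simp add: sum.distrib sum_distrib_left power_mult_distrib p_def)
  also have "(\<Sum>n=1..P ^ 3. norm (\<rho> n) ^ 3) \<le> (\<Sum>n<M. norm (\<rho> n) ^ 3)"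
    using parameter_bounds(1) by (intro sum_mono2) (auto simp: cmod3_def)
  also have "\<dots> \<le> 10 ^ 24 * X\<^sup>2 * D ^ 13 * p powr (35/4)" unfolding p_def by (rule third_moment_\<rho>)
  also have "p ^ 3 * (p powr (7/4)) ^ 3 \<le> D ^ 13 * p powr (35/4)"
  proof -
    have "p ^ 3 = p powr 3" "(p powr (7/4)) ^ 3 = p powr (21/4)" using p by (simp_all add: powr_power)
    then have "p ^ 3 * (p powr (7/4)) ^ 3 = p powr (33/4)" by (simp only: powr_add[symmetric]) simp
    also have "\<dots> \<le> 1 * p powr (35/4)" using p by (simp add: powr_mono)
    also have "\<dots> \<le> D ^ 13 * p powr (35/4)" using parameter_bounds by (intro mult_right_mono one_le_power) auto
    finally show ?thesis .
  qed
  finally show ?thesis using main_const_pos by (simp add: p_def algebra_simps)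
qed

end

section \<open>Large values\<close>

text \<open>Remove an element of least value: its rank is the size of the set, and other ranks can
  only drop. Summing over ranks replaces a dyadic decomposition by size, and ties only increase the
  ranks.\<close>

lemma sum_inverse_rank_le:
  fixes v :: "'a \<Rightarrow> 'b::linorder"
  assumes "finite S"
  shows "(\<Sum>n\<in>S. 1 / real (card {m \<in> S. v n \<le> v m})) \<le> (\<Sum>k=1..card S. 1 / real k)"
  using assms
proof (induction "card S" arbitrary: S)
  case 0
  then show ?case by simp
next
  case (Suc z)
  have "S \<noteq> {}" using Suc.hyps(2) by auto
  then have "Min (v ` S) \<in> v ` S" using Suc.prems by (intro Min_in) auto
  then obtain s where s: "s \<in> S" "v s = Min (v ` S)" by (metis imageE)
  have min: "v s \<le> v m" if "m \<in> S" for m using s that Suc.prems by simp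
  have c: "card (S - {s}) = z" using Suc s by simp
  have le: "1 / real (card {m \<in> S. v n \<le> v m}) \<le> 1 / real (card {m \<in> S - {s}. v n \<le> v m})" if "n \<in> S - {s}" for n
  proof -
    have "card {m \<in> S - {s}. v n \<le> v m} > 0" using that Suc.prems by (auto simp: card_gt_0_iff)
    moreover have "card {m \<in> S - {s}. v n \<le> v m} \<le> card {m \<in> S. v n \<le> v m}"
      using Suc.prems by (intro card_mono) auto
    ultimately show ?thesis by (intro divide_left_mono) auto
  qed
  have "{m \<in> S. v s \<le> v m} = S" using min by auto
  then have "(\<Sum>n\<in>S. 1 / real (card {m \<in> S. v n \<le> v m})) = 1 / real (Suc z) + (\<Sum>n\<in>S - {s}. 1 / real (card {m \<in> S. v n \<le> v m}))"
    using s Suc by (subst sum.remove[of _ s]) auto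
  also have "\<dots> \<le> 1 / real (Suc z) + (\<Sum>n\<in>S - {s}. 1 / real (card {m \<in> S - {s}. v n \<le> v m}))"
    by (intro add_left_mono sum_mono le)
  also have "\<dots> \<le> 1 / real (Suc z) + (\<Sum>k=1..z. 1 / real k)"
    using Suc.hyps(1)[of "S - {s}"] c Suc.prems by simp
  also have "\<dots> = (\<Sum>k=1..card S. 1 / real k)" using Suc.hyps(2)[symmetric] by simp
  finally show ?case .
qed

context five_cubes_setup
begin

text \<open>The tuples are sorted by their first entry.\<close>

lemma r5_le: "r5 n \<le> (\<Sum>x=1..P. if x ^ 3 \<le> n then r4 (n - x ^ 3) else 0)"
proof -
  have "{xs \<in> tuples 5 {1..P}. (\<Sum>x\<leftarrow>xs. x ^ 3) = n}
     \<subseteq> (\<Union>x\<in>{x \<in> {1..P}. x ^ 3 \<le> n}. (#) x ` {xs \<in> tuples 4 {1..P}. (\<Sum>x\<leftarrow>xs. x ^ 3) = n - x ^ 3})"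
  proof
    fix xs assume "xs \<in> {xs \<in> tuples 5 {1..P}. (\<Sum>x\<leftarrow>xs. x ^ 3) = n}"
    then have xs: "length xs = 5" "set xs \<subseteq> {1..P}" "(\<Sum>x\<leftarrow>xs. x ^ 3) = n" by (auto simp: tuples_def)
    then obtain y ys where y: "xs = y # ys" by (cases xs) auto
    have "ys \<in> {xs \<in> tuples 4 {1..P}. (\<Sum>x\<leftarrow>xs. x ^ 3) = n - y ^ 3}" "y \<in> {x \<in> {1..P}. x ^ 3 \<le> n}"
      using xs by (auto simp: y tuples_def)
    then show "xs \<in> (\<Union>x\<in>{x \<in> {1..P}. x ^ 3 \<le> n}. (#) x ` {xs \<in> tuples 4 {1..P}. (\<Sum>x\<leftarrow>xs. x ^ 3) = n - x ^ 3})"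
      unfolding y by blast
  qed
  then have "r5 n \<le> card (\<Union>x\<in>{x \<in> {1..P}. x ^ 3 \<le> n}. (#) x ` {xs \<in> tuples 4 {1..P}. (\<Sum>x\<leftarrow>xs. x ^ 3) = n - x ^ 3})"
    unfolding r5_def by (intro card_mono) auto
  also have "\<dots> \<le> (\<Sum>x\<in>{x \<in> {1..P}. x ^ 3 \<le> n}. card ((#) x ` {xs \<in> tuples 4 {1..P}. (\<Sum>x\<leftarrow>xs. x ^ 3) = n - x ^ 3}))"
    by (rule card_UN_le) simp
  also have "\<dots> = (\<Sum>x\<in>{x \<in> {1..P}. x ^ 3 \<le> n}. r4 (n - x ^ 3))"
    unfolding r4_def by (intro sum.cong refl card_image) (auto intro: inj_onI)
  also have "\<dots> = (\<Sum>x=1..P. if x ^ 3 \<le> n then r4 (n - x ^ 3) else 0)"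
    by (simp add: sum.inter_filter[symmetric])
  finally show ?thesis .
qed

text \<open>The sum counts m, x, y with n = m + x^3 and n' = m + y^3 both in Z. The data n, n', x, y
  determine m and satisfy n - n' = x^3 - y^3, with few solutions (x, y) unless n = n'.\<close>

lemma sum_shift_count_squared_le:
  assumes Z: "Z \<subseteq> {1..P ^ 3}"
  shows "(\<Sum>m<M. (real (card {x \<in> {1..P}. m + x ^ 3 \<in> Z}))\<^sup>2) \<le> real P * real (card Z) + D * (real (card Z))\<^sup>2"
proof -
  have fin: "finite Z" using Z finite_subset by blast
  have "(\<Sum>m<M. (card {x \<in> {1..P}. m + x ^ 3 \<in> Z})\<^sup>2)
     = card (SIGMA m:{..<M}. {x \<in> {1..P}. m + x ^ 3 \<in> Z} \<times> {x \<in> {1..P}. m + x ^ 3 \<in> Z})"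
    by (simp add: power2_eq_square card_cartesian_product)
  also have "\<dots> \<le> card (SIGMA nn:Z \<times> Z. {t \<in> {1..P} \<times> {1..P}. int (cmod3 P) dvd (int (fst t) ^ 3 - int (snd t) ^ 3) - (int (fst nn) - int (snd nn))})"
    by (rule card_inj_on_le[of "\<lambda>(m, x, y). ((m + x ^ 3, m + y ^ 3), (x, y))"]) (auto intro!: inj_onI simp: fin)
  also have "\<dots> = (\<Sum>nn\<in>Z \<times> Z. cdiff P (int (fst nn) - int (snd nn)))"
    by (simp add: cdiff_def fin)
  finally have "(\<Sum>m<M. (card {x \<in> {1..P}. m + x ^ 3 \<in> Z})\<^sup>2) \<le> (\<Sum>nn\<in>Z \<times> Z. cdiff P (int (fst nn) - int (snd nn)))" .
  then have "real (\<Sum>m<M. (card {x \<in> {1..P}. m + x ^ 3 \<in> Z})\<^sup>2) \<le> real (\<Sum>nn\<in>Z \<times> Z. cdiff P (int (fst nn) - int (snd nn)))"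
    by (rule of_nat_mono)
  then have "(\<Sum>m<M. (real (card {x \<in> {1..P}. m + x ^ 3 \<in> Z}))\<^sup>2) \<le> (\<Sum>nn\<in>Z \<times> Z. real (cdiff P (int (fst nn) - int (snd nn))))"
    by (simp only: of_nat_sum of_nat_power)
  also have "\<dots> \<le> (\<Sum>nn\<in>Z \<times> Z. (if fst nn = snd nn then real P else 0) + D)"
  proof (rule sum_mono)
    fix nn assume nn: "nn \<in> Z \<times> Z"
    show "real (cdiff P (int (fst nn) - int (snd nn))) \<le> (if fst nn = snd nn then real P else 0) + D"
    proof (cases "fst nn = snd nn")
      case True
      have "real (cdiff P 0) \<le> real P" by (intro of_nat_mono cdiff_0_le)
      then show ?thesis using True parameter_bounds by simp
    next
      case False
      have "n < M" if "n \<in> Z" for n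
      proof -
        have "n \<le> P ^ 3" "1 \<le> P ^ 3" using that Z parameter_bounds(1) by auto
        then show ?thesis by (simp add: cmod3_def)
      qed
      then have "fst nn < M" "snd nn < M" using nn by (auto simp: mem_Times_iff)
      then have lt: "int (fst nn) < int M" "int (snd nn) < int M" by (simp_all only: of_nat_less_iff)
      have "\<not> int M dvd int (fst nn) - int (snd nn)"
      proof
        assume "int M dvd int (fst nn) - int (snd nn)"
        then have "int (fst nn) = int (snd nn)" by (rule eq_if_congruent_small) (use lt in linarith)
        then show False using False by simp
      qed
      then show ?thesis using cdiff_le[OF tm] False by simp
    qed
  qed
  also have "\<dots> = real P * real (card Z) + D * (real (card Z))\<^sup>2"
  proof -
    have "(\<Sum>nn\<in>Z \<times> Z. if fst nn = snd nn then real P else 0) = (\<Sum>a\<in>Z. \<Sum>b\<in>Z. if a = b then real P else 0)"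
      by (simp add: sum.cartesian_product split_def)
    also have "\<dots> = real P * real (card Z)" by (simp add: fin)
    finally show ?thesis by (simp add: sum.distrib card_cartesian_product power2_eq_square)
  qed
  finally show ?thesis .
qed

text \<open>Double counting over pairs (n, x) with n in the level set. Values of \<open>r4\<close>
  up to T/(2P) account for at most T/2 of each \<open>r5 n\<close> and are dropped. By Cauchy's
  inequality what is left is bounded by the second moment of the large \<open>r4\<close>, at most
  2P/T times the third moment, times the second moment of the shift counts.\<close>

lemma level_set_card_le:
  assumes T: "T > 0" "16 * real P * triple_bound * D \<le> T ^ 3"
  shows "T ^ 3 * real (card {n \<in> {1..P ^ 3}. T \<le> real (r5 n)}) \<le> 16 * (real P)\<^sup>2 * triple_bound"
proof -
  define Z where "Z = {n \<in> {1..P ^ 3}. T \<le> real (r5 n)}"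
  define z where "z = real (card Z)"
  define p where "p = real P"
  have p: "p \<ge> 1" using parameter_bounds by (simp add: p_def)
  have triple_bound: "triple_bound \<ge> 0" using parameter_bounds by (simp add: triple_bound_def)
  define b where "b m = (if real (r4 m) > T / (2 * p) then real (r4 m) else 0)" for m
  define c where "c m = real (card {x \<in> {1..P}. m + x ^ 3 \<in> Z})" for m
  have b0: "b m \<ge> 0" for m by (simp add: b_def)
  have Zn: "T / 2 \<le> (\<Sum>x=1..P. if x ^ 3 \<le> n then b (n - x ^ 3) else 0)" if "n \<in> Z" for n
  proof -
    have "T \<le> real (r5 n)" using that by (simp add: Z_def)
    also have "\<dots> \<le> real (\<Sum>x=1..P. if x ^ 3 \<le> n then r4 (n - x ^ 3) else 0)" by (intro of_nat_mono r5_le)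
    also have "\<dots> = (\<Sum>x=1..P. if x ^ 3 \<le> n then real (r4 (n - x ^ 3)) else 0)" by (simp add: if_distrib cong: if_cong)
    also have "\<dots> \<le> (\<Sum>x=1..P. (if x ^ 3 \<le> n then b (n - x ^ 3) else 0) + T / (2 * p))"
      using T p by (intro sum_mono) (auto simp: b_def)
    also have "\<dots> = (\<Sum>x=1..P. if x ^ 3 \<le> n then b (n - x ^ 3) else 0) + T / 2"
      using p by (simp add: sum.distrib p_def)
    finally show ?thesis by simp
  qed
  have "z * (T / 2) = (\<Sum>n\<in>Z. T / 2)" by (simp add: z_def)
  also have "\<dots> \<le> (\<Sum>n\<in>Z. \<Sum>x=1..P. if x ^ 3 \<le> n then b (n - x ^ 3) else 0)" by (intro sum_mono Zn)
  also have "\<dots> = (\<Sum>x=1..P. \<Sum>n\<in>Z. if x ^ 3 \<le> n then b (n - x ^ 3) else 0)" by (rule sum.swap)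
  also have "\<dots> = (\<Sum>x=1..P. \<Sum>m<M. if m + x ^ 3 \<in> Z then b m else 0)"
  proof (rule sum.cong[OF refl])
    fix x
    have "(\<Sum>n\<in>Z. if x ^ 3 \<le> n then b (n - x ^ 3) else 0) = (\<Sum>n | n \<in> Z \<and> x ^ 3 \<le> n. b (n - x ^ 3))"
      by (rule sum.inter_filter[symmetric]) (simp add: Z_def)
    also have "\<dots> = (\<Sum>m | m \<in> {..<M} \<and> m + x ^ 3 \<in> Z. b m)"
      by (rule sum.reindex_bij_witness[of _ "\<lambda>m. m + x ^ 3" "\<lambda>n. n - x ^ 3"]) (use parameter_bounds(1) in \<open>auto simp: Z_def cmod3_def\<close>)
    also have "\<dots> = (\<Sum>m<M. if m + x ^ 3 \<in> Z then b m else 0)" by (rule sum.inter_filter) simp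
    finally show "(\<Sum>n\<in>Z. if x ^ 3 \<le> n then b (n - x ^ 3) else 0) = (\<Sum>m<M. if m + x ^ 3 \<in> Z then b m else 0)" .
  qed
  also have "\<dots> = (\<Sum>m<M. \<Sum>x=1..P. if m + x ^ 3 \<in> Z then b m else 0)" by (rule sum.swap)
  also have "\<dots> = (\<Sum>m<M. b m * c m)"
    by (intro sum.cong refl) (simp add: c_def mult.commute flip: sum.inter_filter)
  finally have lower: "z * (T / 2) \<le> (\<Sum>m<M. b m * c m)" .
  have "(z * (T / 2))\<^sup>2 \<le> (\<Sum>m<M. b m * c m)\<^sup>2"
    using lower T by (intro power_mono) (auto simp: z_def)
  also have "\<dots> \<le> (\<Sum>m<M. (b m)\<^sup>2) * (\<Sum>m<M. (c m)\<^sup>2)" by (rule Cauchy_Schwarz_ineq_sum)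
  also have "\<dots> \<le> (2 * p * triple_bound / T) * (p * z + D * z\<^sup>2)"
  proof (rule mult_mono)
    have "(\<Sum>m<M. T / (2 * p) * (b m)\<^sup>2) \<le> (\<Sum>m<M. real (r4 m) ^ 3)"
    proof (rule sum_mono)
      fix m
      have "T / (2 * p) * (b m)\<^sup>2 \<le> real (r4 m) * (b m)\<^sup>2"
        by (cases "T / (2 * p) < real (r4 m)") (auto intro: mult_right_mono simp: b_def simp del: times_divide_eq_left)
      also have "\<dots> \<le> real (r4 m) * (real (r4 m))\<^sup>2" by (intro mult_left_mono power_mono) (auto simp: b_def)
      finally show "T / (2 * p) * (b m)\<^sup>2 \<le> real (r4 m) ^ 3" by (simp add: power2_eq_square power3_eq_cube)
    qed
    then have "T / (2 * p) * (\<Sum>m<M. (b m)\<^sup>2) \<le> triple_bound" using sum_r4_cube_le by (simp add: sum_distrib_left)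
    then show "(\<Sum>m<M. (b m)\<^sup>2) \<le> 2 * p * triple_bound / T" using T p by (simp add: field_simps)
    show "(\<Sum>m<M. (c m)\<^sup>2) \<le> p * z + D * z\<^sup>2"
      unfolding c_def p_def z_def by (rule sum_shift_count_squared_le) (auto simp: Z_def)
  qed (use T p triple_bound in \<open>auto intro: sum_nonneg\<close>)
  finally have "(z * (T / 2))\<^sup>2 * T \<le> (2 * p * triple_bound / T) * (p * z + D * z\<^sup>2) * T"
    using T by (intro mult_right_mono) auto
  then have "T ^ 3 * z\<^sup>2 \<le> 8 * p\<^sup>2 * triple_bound * z + 8 * p * triple_bound * D * z\<^sup>2"
  proof -
    have "(2 * p * triple_bound / T) * (p * z + D * z\<^sup>2) * T = 2 * p * triple_bound * (p * z + D * z\<^sup>2)" using T by simp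
    moreover have "2 * p * triple_bound * (p * z + D * z\<^sup>2) = (8 * p\<^sup>2 * triple_bound * z + 8 * p * triple_bound * D * z\<^sup>2) / 4"
      by (simp add: power2_eq_square algebra_simps)
    moreover have "(z * (T / 2))\<^sup>2 * T = T ^ 3 * z\<^sup>2 / 4" by (simp add: power2_eq_square power3_eq_cube)
    ultimately have "T ^ 3 * z\<^sup>2 / 4 \<le> (8 * p\<^sup>2 * triple_bound * z + 8 * p * triple_bound * D * z\<^sup>2) / 4"
      using \<open>(z * (T / 2))\<^sup>2 * T \<le> _\<close> by (simp only:)
    then show ?thesis by simp
  qed
  \<comment> \<open>The lower bound on T makes the off-diagonal part at most half of the left
    side.\<close>
  moreover have "16 * p * triple_bound * D * z\<^sup>2 \<le> T ^ 3 * z\<^sup>2" unfolding p_def by (intro mult_right_mono T) simp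
  ultimately have *: "(T ^ 3 * z) * z \<le> (16 * p\<^sup>2 * triple_bound) * z" by (simp add: power2_eq_square mult_ac)
  have "T ^ 3 * z \<le> 16 * p\<^sup>2 * triple_bound"
  proof (cases "z = 0")
    case True
    then show ?thesis using triple_bound p by simp
  next
    case False
    then have "z > 0" by (simp add: z_def)
    then show ?thesis using * by simp
  qed
  then show ?thesis by (simp add: z_def Z_def p_def)
qed

definition level_const :: real where "level_const = 16 * (real P)\<^sup>2 * triple_bound"

text \<open>The level set bound at height v = \<open>r5 n\<close> says that the rank k of n
  satisfies v^3 k <= \<open>level_const\<close>. Hence v powr h is at most
  \<open>level_const\<close> powr (h/3) divided by k, because h >= 3, and the sum over ranks is
  harmonic.\<close>

lemma sum_large_r5_le:
  assumes T: "T > 0" "16 * real P * triple_bound * D \<le> T ^ 3" and h: "h \<ge> 3"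
  shows "(\<Sum>n | n \<in> {1..P ^ 3} \<and> T \<le> real (r5 n). real (r5 n) powr h) \<le> level_const powr (h / 3) * (1 + 3 * ln (real P))"
proof -
  define Z where "Z = {n \<in> {1..P ^ 3}. T \<le> real (r5 n)}"
  have fin: "finite Z" by (simp add: Z_def)
  have A0: "level_const \<ge> 0" using parameter_bounds by (simp add: level_const_def triple_bound_def)
  have "(\<Sum>n\<in>Z. real (r5 n) powr h) \<le> (\<Sum>n\<in>Z. level_const powr (h / 3) * (1 / real (card {m \<in> Z. r5 n \<le> r5 m})))"
  proof (rule sum_mono)
    fix n assume n: "n \<in> Z"
    define v where "v = real (r5 n)"
    define k where "k = real (card {m \<in> Z. r5 n \<le> r5 m})"
    have v: "T \<le> v" "v > 0" using n T by (auto simp: Z_def v_def)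
    have "card {m \<in> Z. r5 n \<le> r5 m} > 0" using n fin by (auto simp: card_gt_0_iff)
    then have k: "k \<ge> 1" by (simp add: k_def)
    have "{m \<in> Z. r5 n \<le> r5 m} = {m \<in> {1..P ^ 3}. v \<le> real (r5 m)}"
      using v by (auto simp: Z_def v_def)
    moreover have "T ^ 3 \<le> v ^ 3" using v T by (intro power_mono) auto
    ultimately have "v ^ 3 * k \<le> level_const"
      using level_set_card_le[of v] v T(2) by (simp add: level_const_def k_def)
    then have "v ^ 3 \<le> level_const / k" using k by (simp add: pos_le_divide_eq)
    then have "(v ^ 3) powr (h / 3) \<le> (level_const / k) powr (h / 3)" using v h by (intro powr_mono2) auto
    moreover have "(v ^ 3) powr (h / 3) = v powr h"
    proof -
      have "v ^ 3 = v powr 3" using v by simp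
      then show ?thesis by (simp only: powr_powr) simp
    qed
    moreover have "(level_const / k) powr (h / 3) = level_const powr (h / 3) * (1 / k powr (h / 3))" using A0 k by (simp add: powr_divide)
    moreover have "1 / k powr (h / 3) \<le> 1 / k"
    proof -
      have "k powr 1 \<le> k powr (h / 3)" using k h by (intro powr_mono) auto
      then show ?thesis using k by (intro divide_left_mono) auto
    qed
    then have "level_const powr (h / 3) * (1 / k powr (h / 3)) \<le> level_const powr (h / 3) * (1 / k)" by (intro mult_left_mono) auto
    ultimately show "real (r5 n) powr h \<le> level_const powr (h / 3) * (1 / real (card {m \<in> Z. r5 n \<le> r5 m}))"
      unfolding v_def k_def by linarith
  qed
  also have "\<dots> = level_const powr (h / 3) * (\<Sum>n\<in>Z. 1 / real (card {m \<in> Z. r5 n \<le> r5 m}))" by (simp only: sum_distrib_left)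
  also have "\<dots> \<le> level_const powr (h / 3) * (1 + 3 * ln (real P))"
  proof (rule mult_left_mono)
    have "card Z \<le> card {1..P ^ 3}" unfolding Z_def by (intro card_mono) auto
    then have "(\<Sum>k=1..card Z. 1 / real k) \<le> (\<Sum>k=1..P ^ 3. 1 / real k)" by (intro sum_mono2) auto
    also have "\<dots> \<le> 1 + ln (real (P ^ 3))" using parameter_bounds by (intro sum_inverse_le_ln) auto
    also have "\<dots> = 1 + 3 * ln (real P)" using parameter_bounds by (simp add: ln_realpow)
    finally show "(\<Sum>n\<in>Z. 1 / real (card {m \<in> Z. r5 n \<le> r5 m})) \<le> 1 + 3 * ln (real P)"
      using sum_inverse_rank_le[OF fin, of r5] by linarith
  qed simp
  finally show ?thesis by (simp add: Z_def)
qed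

section \<open>Moments of order above three\<close>

definition Km :: real where "Km = Gamma (4/3) ^ 5 / Gamma (5/3) * C"

definition Kt :: real where "Kt = 20000 * X + Km"

text \<open>The exponent 5/2 is the least for which the level set bound is available, since its
  condition asks for T^3 of size P * P powr (13/2). The constant works because 20000^3 exceeds 16 *
  2 * 10^11; adding \<open>Km\<close> lets \<open>T0\<close> dominate the main term as well.\<close>

definition T0 :: real where "T0 = Kt * D ^ 3 * real P powr (5/2)"

lemma Km_nonneg: "0 \<le> Km"
proof -
  have "Gamma (5/3 :: real) > 0" "Gamma (4/3 :: real) > 0" by (auto intro: Gamma_real_pos)
  then show ?thesis using parameter_bounds by (simp add: Km_def)
qed

lemma five_cubes_error_le_r5:
  assumes n: "n \<in> {1..P ^ 3}"
  shows "five_cubes_error n \<le> real (r5 n) + T0"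
proof -
  have G: "Gamma (5/3 :: real) > 0" "Gamma (4/3 :: real) > 0" by (auto intro: Gamma_real_pos)
  define m where "m = of_real (Gamma (4/3) ^ 5 / Gamma (5/3)) * singular_series 5 3 n * of_real (real n powr (2/3))"
  have "five_cubes_error n = norm (of_nat (r5 n) - m)"
    using waring_count_eq_r5[of n] n by (simp add: five_cubes_error_def m_def)
  also have "\<dots> \<le> real (r5 n) + norm m" by (rule order_trans[OF norm_triangle_ineq4]) simp
  also have "norm m = Gamma (4/3) ^ 5 / Gamma (5/3) * norm (singular_series 5 3 n) * real n powr (2/3)"
    using G by (simp add: m_def norm_mult norm_divide norm_power)
  also have "\<dots> \<le> Gamma (4/3) ^ 5 / Gamma (5/3) * C * (real P powr (5/2))"
  proof (intro mult_mono mult_left_mono singular_series_bounds(1)[OF gm parameter_bounds(1)])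
    have "real n \<le> real (P ^ 3)" using n by (intro of_nat_mono) simp
    then have "real n powr (2/3) \<le> real (P ^ 3) powr (2/3)" by (intro powr_mono2) auto
    also have "real (P ^ 3) = real P powr 3" using parameter_bounds by simp
    also have "(real P powr 3) powr (2/3) = real P powr 2" by (simp only: powr_powr) simp
    also have "\<dots> \<le> real P powr (5/2)" using parameter_bounds by (intro powr_mono) auto
    finally show "real n powr (2/3) \<le> real P powr (5/2)" .
  qed (use G parameter_bounds in auto)
  also have "\<dots> = Km * 1 * real P powr (5/2)" by (simp add: Km_def)
  also have "\<dots> \<le> T0"
    unfolding T0_def Kt_def using parameter_bounds Km_nonneg by (intro mult_right_mono mult_mono one_le_power) auto
  finally show ?thesis by simp
qed

lemma T0: "T0 > 0" "16 * real P * triple_bound * D \<le> T0 ^ 3"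
proof -
  show "T0 > 0" using parameter_bounds Km_nonneg by (simp add: T0_def Kt_def)
  define p where "p = real P"
  have p: "p \<ge> 1" using parameter_bounds by (simp add: p_def)
  have pp: "p * p powr (13/2) = p powr (15/2)"
  proof -
    have "p = p powr 1" using p by simp
    then have "p * p powr (13/2) = p powr 1 * p powr (13/2)" by simp
    then show ?thesis by (simp only: powr_add[symmetric]) simp
  qed
  have "16 * p * triple_bound * D = 3200000000000 * X\<^sup>2 * D ^ 8 * (p * p powr (13/2))"
    by (simp add: triple_bound_def p_def eval_nat_numeral mult_ac)
  also have "\<dots> \<le> Kt ^ 3 * D ^ 9 * p powr (15/2)"
  proof (unfold pp, intro mult_right_mono mult_mono power_increasing)
    have "3200000000000 * X\<^sup>2 \<le> 8000000000000 * (X * X\<^sup>2)"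
      using parameter_bounds mult_right_mono[of 1 X "X\<^sup>2"] by simp
    also have "\<dots> = (20000 * X) ^ 3" by (simp add: power_mult_distrib power2_eq_square power3_eq_cube)
    also have "\<dots> \<le> Kt ^ 3" using parameter_bounds Km_nonneg by (intro power_mono) (auto simp: Kt_def)
    finally show "3200000000000 * X\<^sup>2 \<le> Kt ^ 3" .
  qed (use parameter_bounds Km_nonneg in \<open>auto simp: Kt_def\<close>)
  also have "\<dots> = T0 ^ 3"
  proof -
    have "(p powr (5/2)) ^ 3 = p powr (15/2)" using p by (simp add: powr_power)
    moreover have "(D ^ 3) ^ 3 = D ^ 9" by (simp flip: power_mult)
    ultimately show ?thesis by (simp add: T0_def p_def power_mult_distrib)
  qed
  finally show "16 * real P * triple_bound * D \<le> T0 ^ 3" by (simp add: p_def)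
qed

lemma five_cubes_error_nonneg: "0 \<le> five_cubes_error n"
  by (simp add: five_cubes_error_def)

text \<open>Split at twice \<open>T0\<close>. Below, h - 3 powers are bounded trivially and the
  third moment takes the rest. Above, the error is at most twice \<open>r5 n\<close>, since the main
  term is at most \<open>T0\<close>, and then \<open>r5 n\<close> itself exceeds
  \<open>T0\<close>.\<close>

lemma higher_moment:
  assumes h: "h \<ge> 3"
  shows "(\<Sum>n=1..P ^ 3. five_cubes_error n powr h)
    \<le> (2 * T0) powr (h - 3) * ((4 * 10 ^ 24 * X\<^sup>2 + 4 * main_const ^ 3) * D ^ 13 * real P powr (35/4))
      + 2 powr h * (level_const powr (h / 3) * (1 + 3 * ln (real P)))"
proof -
  let ?E = five_cubes_error
  have "(\<Sum>n=1..P ^ 3. ?E n powr h)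
      \<le> (\<Sum>n=1..P ^ 3. (2 * T0) powr (h - 3) * ?E n ^ 3 + 2 powr h * (if T0 \<le> real (r5 n) then real (r5 n) powr h else 0))"
  proof (rule sum_mono)
    fix n assume n: "n \<in> {1..P ^ 3}"
    define E where "E = ?E n"
    have E: "E \<ge> 0" "E \<le> real (r5 n) + T0" using five_cubes_error_le_r5[OF n] five_cubes_error_nonneg by (auto simp: E_def)
    show "?E n powr h \<le> (2 * T0) powr (h - 3) * ?E n ^ 3 + 2 powr h * (if T0 \<le> real (r5 n) then real (r5 n) powr h else 0)"
    proof (cases "E \<le> 2 * T0")
      case True
      have "E powr h = E powr (h - 3) * E ^ 3"
      proof (cases "E = 0")
        case False
        then have "E ^ 3 = E powr 3" using E by simp
        then show ?thesis by (simp only: powr_add[symmetric]) simp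
      qed (use h in auto)
      also have "\<dots> \<le> (2 * T0) powr (h - 3) * E ^ 3" using True E h by (intro mult_right_mono powr_mono2) auto
      finally show ?thesis by (simp add: E_def add_increasing2)
    next
      case False
      then have r: "E \<le> 2 * real (r5 n)" "T0 \<le> real (r5 n)" using E by linarith+
      have "E powr h \<le> (2 * real (r5 n)) powr h" using r E h by (intro powr_mono2) auto
      also have "\<dots> = 2 powr h * real (r5 n) powr h" by (simp add: powr_mult)
      finally show ?thesis using r E by (simp add: E_def add_increasing)
    qed
  qed
  also have "\<dots> = (2 * T0) powr (h - 3) * (\<Sum>n=1..P ^ 3. ?E n ^ 3)
      + 2 powr h * (\<Sum>n | n \<in> {1..P ^ 3} \<and> T0 \<le> real (r5 n). real (r5 n) powr h)"
    by (simp only: sum.distrib sum_distrib_left[symmetric] sum.inter_filter[OF finite_atLeastAtMost])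
  also have "\<dots> \<le> (2 * T0) powr (h - 3) * ((4 * 10 ^ 24 * X\<^sup>2 + 4 * main_const ^ 3) * D ^ 13 * real P powr (35/4))
      + 2 powr h * (level_const powr (h / 3) * (1 + 3 * ln (real P)))"
    by (intro add_mono mult_left_mono third_moment sum_large_r5_le T0 h) auto
  finally show ?thesis .
qed

end

section \<open>Conclusion\<close>

lemma cube_cover:
  assumes "N \<ge> 1"
  obtains P where "P \<ge> 1" "N \<le> P ^ 3" "real P \<le> 2 * real N powr (1/3)"
proof
  define P where "P = nat \<lceil>real N powr (1/3)\<rceil>"
  have g: "real N powr (1/3) \<ge> 1" using assms by (simp add: ge_one_powr_ge_zero)
  then show "nat \<lceil>real N powr (1/3)\<rceil> \<ge> 1" by linarith
  have "real N powr (1/3) \<le> real P" by (simp add: P_def real_nat_ceiling_ge)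
  then have "(real N powr (1/3)) ^ 3 \<le> real P ^ 3" by (intro power_mono) auto
  then have "real N \<le> real (P ^ 3)" by simp
  then show "N \<le> nat \<lceil>real N powr (1/3)\<rceil> ^ 3" unfolding P_def of_nat_le_iff .
  have "real (nat \<lceil>real N powr (1/3)\<rceil>) \<le> real N powr (1/3) + 1"
    using g of_int_ceiling_le_add_one[of "real N powr (1/3)"] by (simp add: of_nat_nat)
  then show "real (nat \<lceil>real N powr (1/3)\<rceil>) \<le> 2 * real N powr (1/3)" using g by linarith
qed

lemma powr_cube_cover_le:
  assumes "real P \<le> 2 * real N powr (1/3)" "a \<ge> 0"
  shows "real P powr a \<le> 2 powr a * real N powr (a / 3)"
proof -
  have "real P powr a \<le> (2 * real N powr (1/3)) powr a" using assms by (intro powr_mono2) auto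
  also have "\<dots> = 2 powr a * (real N powr (1/3)) powr a" by (simp add: powr_mult)
  also have "(real N powr (1/3)) powr a = real N powr (a / 3)" by (simp only: powr_powr) simp
  finally show ?thesis .
qed

lemma third_moment_bound:
  assumes "\<epsilon> > 0"
  shows "\<exists>K\<ge>0. \<forall>N\<ge>1. (\<Sum>n=1..N. five_cubes_error n ^ 3) \<le> K * real N powr (35/12 + \<epsilon>)"
proof -
  \<comment> \<open>The bound contains D^13 and P is of order N powr (1/3), so the loss N powr (13
    \<eta>/3) is exactly N powr \<epsilon>.\<close>
  define \<eta> where "\<eta> = 3 * \<epsilon> / 13"
  have \<eta>: "\<eta> > 0" using assms by (simp add: \<eta>_def)
  obtain \<kappa> C where gm: "gauss_majorant \<kappa> C" using gauss_sum_majorant by blast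
  obtain C1 where C1: "C1 \<ge> 1" "\<And>P. P \<ge> 1 \<Longrightarrow> tame P (C1 * real P powr \<eta>)" using tame_exists[OF \<eta>] by blast
  define K0 where "K0 = 4 * 10 ^ 24 * (C + 1)\<^sup>2 + 4 * ((C + 1) * (252 + 3 / Gamma (5/3))) ^ 3"
  have C: "0 \<le> C" by (rule gauss_majorantD(4)[OF gm])
  have K0: "K0 \<ge> 0"
  proof -
    have "Gamma (5/3 :: real) > 0" by (rule Gamma_real_pos) simp
    then show ?thesis using C by (simp add: K0_def)
  qed
  define a where "a = 35/4 + 13 * \<eta>"
  have "(\<Sum>n=1..N. five_cubes_error n ^ 3) \<le> K0 * C1 ^ 13 * 2 powr a * real N powr (35/12 + \<epsilon>)" if N: "N \<ge> 1" for N
  proof -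
    obtain P where P: "P \<ge> 1" "N \<le> P ^ 3" "real P \<le> 2 * real N powr (1/3)" using cube_cover[OF N] .
    interpret five_cubes_setup P "C1 * real P powr \<eta>" \<kappa> C "C + 1"
      by unfold_locales (use C1 P gm in auto)
    have "(\<Sum>n=1..N. five_cubes_error n ^ 3) \<le> (\<Sum>n=1..P ^ 3. five_cubes_error n ^ 3)"
      using P by (intro sum_mono2) (auto intro: five_cubes_error_nonneg)
    also have "\<dots> \<le> K0 * (C1 * real P powr \<eta>) ^ 13 * real P powr (35/4)"
      using third_moment by (simp add: K0_def main_const_def)
    also have "\<dots> = K0 * C1 ^ 13 * ((real P powr \<eta>) ^ 13 * real P powr (35/4))" by (simp add: power_mult_distrib)
    also have "(real P powr \<eta>) ^ 13 * real P powr (35/4) = real P powr a"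
    proof -
      have "(real P powr \<eta>) ^ 13 = real P powr (13 * \<eta>)" using P(1) by (simp add: powr_power)
      then show ?thesis by (simp only: powr_add[symmetric] a_def) (simp add: add.commute)
    qed
    also have "K0 * C1 ^ 13 * real P powr a \<le> K0 * C1 ^ 13 * (2 powr a * real N powr (a / 3))"
      using P(3) \<eta> K0 C1(1) by (intro mult_left_mono powr_cube_cover_le) (auto simp: a_def)
    also have "a / 3 = 35/12 + \<epsilon>" by (simp add: a_def \<eta>_def)
    finally show ?thesis by (simp add: mult.assoc)
  qed
  moreover have "K0 * C1 ^ 13 * 2 powr a \<ge> 0" using K0 C1(1) by simp
  ultimately show ?thesis by blast
qed

text \<open>For \<open>h \<le> 3\<close> the values below \<open>N powr (23/36)\<close> contribute trivially, and the larger ones are absorbed by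
  the third moment.\<close>

lemma low_moment_bound:
  assumes h: "0 < h" "h \<le> 3"
  shows "\<exists>K\<ge>0. \<forall>N\<ge>1. (\<Sum>n=1..N. five_cubes_error n powr h) \<le> K * real N powr (2 * h / 3 + 1 - h / 72)"
proof -
  obtain K where K: "K \<ge> 0" "\<And>N. N \<ge> 1 \<Longrightarrow> (\<Sum>n=1..N. five_cubes_error n ^ 3) \<le> K * real N powr (35/12 + h / 72)"
    using third_moment_bound[of "h / 72"] h by auto
  have "(\<Sum>n=1..N. five_cubes_error n powr h) \<le> (1 + K) * real N powr (2 * h / 3 + 1 - h / 72)" if N: "N \<ge> 1" for N
  proof -
    \<comment> \<open>The exponent 23/36 solves 1 + 3 x = 35/12, which balances the two
      contributions; it is 2/3 - 1/36. Half of the resulting gain h/36 is spent on the loss h/72 in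
      the third moment.\<close>
    define l where "l = real N powr (23/36)"
    have l: "l > 0" using N by (simp add: l_def)
    have "(\<Sum>n=1..N. five_cubes_error n powr h) \<le> (\<Sum>n=1..N. l powr h + l powr (h - 3) * five_cubes_error n ^ 3)"
    proof (rule sum_mono)
      fix n
      define E where "E = five_cubes_error n"
      have E: "E \<ge> 0" by (simp add: E_def five_cubes_error_def)
      show "five_cubes_error n powr h \<le> l powr h + l powr (h - 3) * five_cubes_error n ^ 3"
      proof (cases "E \<le> l")
        case True
        then have "E powr h \<le> l powr h" using E h by (intro powr_mono2) auto
        then show ?thesis using E by (simp add: E_def add_increasing2)
      next
        case False
        then have "E ^ 3 = E powr 3" using l by simp
        then have "E powr h = E powr (h - 3) * E ^ 3" by (simp only: powr_add[symmetric]) simp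
        also have "\<dots> \<le> l powr (h - 3) * E ^ 3" using False l h E by (intro mult_right_mono powr_mono2') auto
        finally show ?thesis by (simp add: E_def add_increasing)
      qed
    qed
    also have "\<dots> = real N * l powr h + l powr (h - 3) * (\<Sum>n=1..N. five_cubes_error n ^ 3)"
      by (simp add: sum.distrib sum_distrib_left)
    also have "\<dots> \<le> real N * l powr h + l powr (h - 3) * (K * real N powr (35/12 + h / 72))"
      by (intro add_left_mono mult_left_mono K N) auto
    also have "\<dots> = real N powr (1 + 23/36 * h) + K * real N powr (23/36 * (h - 3) + (35/12 + h / 72))"
    proof -
      have "real N = real N powr 1" using N by simp
      then have "real N * l powr h = real N powr 1 * real N powr (23/36 * h)" unfolding l_def by (simp only: powr_powr)
      moreover have "l powr (h - 3) = real N powr (23/36 * (h - 3))" unfolding l_def by (simp only: powr_powr)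
      ultimately show ?thesis by (simp only: powr_add mult.left_commute)
    qed
    also have "\<dots> \<le> real N powr (2 * h / 3 + 1 - h / 72) + K * real N powr (2 * h / 3 + 1 - h / 72)"
      using N K(1) h by (intro add_mono mult_left_mono powr_mono) (auto simp: field_simps)
    finally show ?thesis by (simp add: distrib_right)
  qed
  then show ?thesis using K(1) by (intro exI[of _ "1 + K"]) auto
qed

text \<open>For h < 7/2 the term with the third moment has exponent 5h/2 + 5/4, below 2h + 3, and
  the term with large values has 17h/6, also below. The slack 7/4 - h/2 of the first pays for all
  powers of P\<eta>.\<close>

lemma high_moment_bound:
  assumes h: "3 < h" "h < 7/2"
  shows "\<exists>\<delta>>0. \<exists>K\<ge>0. \<forall>N\<ge>1. (\<Sum>n=1..N. five_cubes_error n powr h) \<le> K * real N powr (2 * h / 3 + 1 - \<delta>)"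
proof -
  \<comment> \<open>The first term needs 3 \<eta> h + 4 \<eta> + 3 \<delta> <= 7/4 - h/2. With
    \<delta> = 5 \<eta> and h < 7/2 the left side is below 29.5 \<eta>, hence the 30.\<close>
  define \<eta> where "\<eta> = (7/4 - h / 2) / 30"
  define \<delta> where "\<delta> = 5 * \<eta>"
  define b where "b = 2 * h + 3 - 3 * \<delta>"
  have \<eta>: "\<eta> > 0" using h by (simp add: \<eta>_def)
  obtain \<kappa> C where gm: "gauss_majorant \<kappa> C" using gauss_sum_majorant by blast
  obtain C1 where C1: "C1 \<ge> 1" "\<And>P. P \<ge> 1 \<Longrightarrow> tame P (C1 * real P powr \<eta>)" using tame_exists[OF \<eta>] by blast
  define X where "X = C + 1"
  have C: "0 \<le> C" by (rule gauss_majorantD(4)[OF gm])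
  have X: "X \<ge> 1" using C by (simp add: X_def)
  have G: "Gamma (5/3 :: real) > 0" "Gamma (4/3 :: real) > 0" by (auto intro: Gamma_real_pos)
  define K0 where "K0 = 4 * 10 ^ 24 * X\<^sup>2 + 4 * (X * (252 + 3 / Gamma (5/3))) ^ 3"
  define Kt where "Kt = 20000 * X + Gamma (4/3) ^ 5 / Gamma (5/3) * C"
  have K0: "K0 \<ge> 0" using X G by (simp add: K0_def)
  have Kt: "Kt \<ge> 0" using X G C by (simp add: Kt_def)
  define K1 where "K1 = (2 * Kt * C1 ^ 3) powr (h - 3) * K0 * C1 ^ 13"
  define K2 where "K2 = 2 powr h * (3200000000000 * X\<^sup>2 * C1 ^ 7) powr (h / 3) * (1 + 3 / \<eta>)"
  have K12: "K1 \<ge> 0" "K2 \<ge> 0" using K0 C1(1) \<eta> by (auto simp: K1_def K2_def)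
  have "(\<Sum>n=1..N. five_cubes_error n powr h) \<le> (K1 + K2) * 2 powr b * real N powr (2 * h / 3 + 1 - \<delta>)" if N: "N \<ge> 1" for N
  proof -
    obtain P where P: "P \<ge> 1" "N \<le> P ^ 3" "real P \<le> 2 * real N powr (1/3)" using cube_cover[OF N] .
    define p where "p = real P"
    have p: "p \<ge> 1" using P by (simp add: p_def)
    interpret S: five_cubes_setup P "C1 * real P powr \<eta>" \<kappa> C X
      by unfold_locales (use C1 P gm X_def in auto)
    have pw: "(p powr c) ^ k = p powr (c * real k)" for c k
      using p by (simp add: powr_power mult.commute)
    have first: "(2 * S.T0) powr (h - 3) * ((4 * 10 ^ 24 * X\<^sup>2 + 4 * S.main_const ^ 3) * (C1 * real P powr \<eta>) ^ 13 * real P powr (35/4)) \<le> K1 * p powr b"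
    proof -
      have "2 * S.T0 = (2 * Kt * C1 ^ 3) * p powr (\<eta> * 3 + 5/2)"
        unfolding S.T0_def S.Kt_def S.Km_def Kt_def
        unfolding p_def[symmetric] power_mult_distrib pw powr_add by simp
      then have "(2 * S.T0) powr (h - 3) = (2 * Kt * C1 ^ 3) powr (h - 3) * p powr ((\<eta> * 3 + 5/2) * (h - 3))"
        by (simp only: powr_mult powr_powr)
      moreover have "K * (C1 * real P powr \<eta>) ^ 13 * real P powr (35/4) = K * (C1 ^ 13 * p powr (\<eta> * 13 + 35/4))" for K
        unfolding p_def[symmetric] power_mult_distrib pw powr_add by simp
      ultimately have "(2 * S.T0) powr (h - 3) * ((4 * 10 ^ 24 * X\<^sup>2 + 4 * S.main_const ^ 3) * (C1 * real P powr \<eta>) ^ 13 * real P powr (35/4))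
        = (2 * Kt * C1 ^ 3) powr (h - 3) * p powr ((\<eta> * 3 + 5/2) * (h - 3)) * (K0 * (C1 ^ 13 * p powr (\<eta> * 13 + 35/4)))"
        unfolding S.main_const_def K0_def by (simp only:)
      also have "\<dots> = K1 * p powr ((\<eta> * 3 + 5/2) * (h - 3) + (\<eta> * 13 + 35/4))"
        unfolding K1_def by (simp only: powr_add mult_ac)
      also have "\<dots> \<le> K1 * p powr b"
      proof (intro mult_left_mono powr_mono K12(1) p)
        have "\<eta> * h \<le> \<eta> * (7/2)" using h \<eta> by (intro mult_left_mono) auto
        moreover have "30 * \<eta> = 7/4 - h / 2" by (simp add: \<eta>_def)
        moreover have "(\<eta> * 3 + 5/2) * (h - 3) + (\<eta> * 13 + 35/4) = 3 * (\<eta> * h) + 4 * \<eta> + 5/2 * h + 5/4"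
          by (simp add: field_simps)
        ultimately show "(\<eta> * 3 + 5/2) * (h - 3) + (\<eta> * 13 + 35/4) \<le> b"
          using \<eta> unfolding b_def \<delta>_def by linarith
      qed
      finally show ?thesis .
    qed
    have second: "2 powr h * (S.level_const powr (h / 3) * (1 + 3 * ln (real P))) \<le> K2 * p powr b"
    proof -
      have "S.level_const = (3200000000000 * X\<^sup>2 * C1 ^ 7) * (p powr 2 * p powr (\<eta> * 7) * p powr (13/2))"
        unfolding S.level_const_def S.triple_bound_def
        unfolding p_def[symmetric] power_mult_distrib pw using p by simp
      then have A: "S.level_const powr (h / 3) = (3200000000000 * X\<^sup>2 * C1 ^ 7) powr (h / 3) * p powr ((2 + \<eta> * 7 + 13/2) * (h / 3))"
        by (simp only: powr_add[symmetric] powr_mult powr_powr)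
      have "ln p \<le> p powr \<eta> / \<eta>" using p \<eta> by (intro ln_powr_bound)
      moreover have "1 \<le> p powr \<eta>" using p \<eta> by (simp add: ge_one_powr_ge_zero)
      ultimately have l: "1 + 3 * ln p \<le> (1 + 3 / \<eta>) * p powr \<eta>" by (simp add: algebra_simps)
      have "2 powr h * (S.level_const powr (h / 3) * (1 + 3 * ln (real P))) \<le> 2 powr h * (S.level_const powr (h / 3) * ((1 + 3 / \<eta>) * p powr \<eta>))"
        using l by (intro mult_left_mono) (auto simp: p_def)
      also have "\<dots> = K2 * p powr ((2 + \<eta> * 7 + 13/2) * (h / 3) + \<eta>)"
        unfolding A K2_def powr_add[of p _ \<eta>] by (simp only: mult_ac)
      also have "\<dots> \<le> K2 * p powr b"
      proof (intro mult_left_mono powr_mono K12(2) p)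
        have "\<eta> * h \<le> \<eta> * (7/2)" using h \<eta> by (intro mult_left_mono) auto
        moreover have "30 * \<eta> = 7/4 - h / 2" by (simp add: \<eta>_def)
        moreover have "(2 + \<eta> * 7 + 13/2) * (h / 3) + \<eta> = 17/6 * h + 7/3 * (\<eta> * h) + \<eta>"
          by (simp add: algebra_simps)
        ultimately show "(2 + \<eta> * 7 + 13/2) * (h / 3) + \<eta> \<le> b"
          using \<eta> h unfolding b_def \<delta>_def by linarith
      qed
      finally show ?thesis .
    qed
    have "(\<Sum>n=1..N. five_cubes_error n powr h) \<le> (\<Sum>n=1..P ^ 3. five_cubes_error n powr h)"
      using P by (intro sum_mono2) auto
    also have "\<dots> \<le> K1 * p powr b + K2 * p powr b"
      using S.higher_moment[of h] first second h by linarith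
    also have "\<dots> = (K1 + K2) * p powr b" by (simp add: distrib_right)
    also have "\<dots> \<le> (K1 + K2) * (2 powr b * real N powr (b / 3))"
      unfolding p_def using P(3) K12 h \<eta> by (intro mult_left_mono powr_cube_cover_le) (auto simp: b_def \<delta>_def \<eta>_def)
    also have "b / 3 = 2 * h / 3 + 1 - \<delta>" by (simp add: b_def)
    finally show ?thesis by (simp add: mult.assoc)
  qed
  moreover have "\<delta> > 0" using \<eta> by (simp add: \<delta>_def)
  moreover have "(K1 + K2) * 2 powr b \<ge> 0" using K12 by simp
  ultimately show ?thesis by blast
qed

lemma bigoI_powr:
  fixes f :: "nat \<Rightarrow> real"
  assumes "\<And>N. f N \<ge> 0" "\<And>N. N \<ge> 1 \<Longrightarrow> f N \<le> K * real N powr a"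
  shows "f \<in> O(\<lambda>N. real N powr a)"
proof (rule bigoI[of _ K])
  show "\<forall>\<^sub>F N in sequentially. norm (f N) \<le> K * norm (real N powr a)"
    using eventually_ge_at_top[of 1] by eventually_elim (use assms in simp)
qed

theorem theorem1p7:
  "(\<forall>h::real. 0 < h \<and> h < 7/2 \<longrightarrow>
      (\<exists>\<delta>::real. \<delta> > 0 \<and>
        (\<lambda>N::nat. \<Sum>n=1..N. five_cubes_error n powr h)
          \<in> O(\<lambda>N. real N powr (2 * h / 3 + 1 - \<delta>))))
   \<and> (\<forall>\<epsilon>::real. \<epsilon> > 0 \<longrightarrow>
        (\<lambda>N::nat. \<Sum>n=1..N. five_cubes_error n ^ 3)
          \<in> O(\<lambda>N. real N powr (35/12 + \<epsilon>)))"
proof (intro conjI allI impI)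
  fix h :: real assume h: "0 < h \<and> h < 7/2"
  have "\<exists>\<delta>>0. \<exists>K\<ge>0. \<forall>N\<ge>1. (\<Sum>n=1..N. five_cubes_error n powr h) \<le> K * real N powr (2 * h / 3 + 1 - \<delta>)"
  proof (cases "h \<le> 3")
    case True
    then show ?thesis using low_moment_bound[of h] h by (intro exI[of _ "h / 72"]) auto
  qed (use high_moment_bound h in auto)
  then obtain \<delta> K where d: "\<delta> > 0" "\<And>N. N \<ge> 1 \<Longrightarrow> (\<Sum>n=1..N. five_cubes_error n powr h) \<le> K * real N powr (2 * h / 3 + 1 - \<delta>)"
    by blast
  have "(\<lambda>N::nat. \<Sum>n=1..N. five_cubes_error n powr h) \<in> O(\<lambda>N. real N powr (2 * h / 3 + 1 - \<delta>))"
    by (rule bigoI_powr[OF _ d(2)]) (auto intro: sum_nonneg)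
  then show "\<exists>\<delta>>0. (\<lambda>N::nat. \<Sum>n=1..N. five_cubes_error n powr h) \<in> O(\<lambda>N. real N powr (2 * h / 3 + 1 - \<delta>))"
    using d(1) by blast
next
  fix \<epsilon> :: real assume "\<epsilon> > 0"
  then obtain K where K: "\<And>N. N \<ge> 1 \<Longrightarrow> (\<Sum>n=1..N. five_cubes_error n ^ 3) \<le> K * real N powr (35/12 + \<epsilon>)"
    using third_moment_bound by blast
  show "(\<lambda>N::nat. \<Sum>n=1..N. five_cubes_error n ^ 3) \<in> O(\<lambda>N. real N powr (35/12 + \<epsilon>))"
    by (rule bigoI_powr[OF _ K]) (auto intro!: sum_nonneg simp: five_cubes_error_def)
qed

end
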